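(* Let $r\ge4$. The subset $\bigcup_{\phi\in\mathrm{Out}(\mathbb F_r)}\mathcal X^1(\mathcal R_r,\mathrm{id})\cdot\phi$ of $(\mathcal X^1(\mathbb F_r),d_{\mathfrak h})$ has bounded diameter. Moreover, the (isometric) action of $\mathrm{Out}(\mathbb F_r)$ on the metric completion of $(\mathcal X^1(\mathbb F_r),d_{\mathfrak h})$ has a fixed point.
   Context: Graphs are finite connected graphs in Serre's sense: a vertex set $V$, a set $E$ of oriented edges, maps $o,\tau\colon E\to V$ and a fixed-point-free involution $e\mapsto\bar e$ with $o(\bar e)=\tau(e)$; $E_+\subset E$ contains exactly one edge from each pair $\{e,\bar e\}$. A length function on $G$ is a map $\ell\colon E_+\to\mathbb{R}_{>0}$, extended to $E$ by $\ell(\bar e)=\ell(e)$ and to edge paths additively; $\mathcal M(G)=\mathbb{R}_{>0}^{|E_+|}$. A based circuit is a reduced edge path $(e_1,\dots,e_n)$ (i.e. $\tau(e_i)=o(e_{i+1})$, $e_{i+1}\ne\bar e_i$) with $\tau(e_n)=o(e_1)$, $e_n\ne\bar e_1$. The entropy is $\mathfrak h_G(\ell)=\lim_{t\to\infty}\frac1t\log\#\{\gamma \text{ based circuit}:\ell(\gamma)\le t\}$, $\mathcal M^1(G)=\{\mathfrak h_G=1\}$, with entropy norm $\|(\ell,v)\|_{\mathfrak h,G}^2=\langle v,\operatorname{Hess}\mathfrak h_G(\ell)v\rangle$ on tangent vectors $v$ ($\langle v,\nabla \mathfrak h_G(\ell)\rangle=0$). Outer space: $\mathcal R_r$ is the rose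 with $r$ petals, $\mathbb F_r\cong\pi_1(\mathcal R_r)$ fixed. A marked metric graph $(G,\rho,\ell)$ has $G$ finite connected with no vertices of valence 1 or 2, $\rho\colon\mathcal R_r\to G$ a homotopy equivalence, $\ell\in\mathcal M(G)$; equivalence is via graph isomorphisms $\alpha$ with $\ell_1=\ell_2\circ\alpha$ and $\alpha\circ\rho_1\simeq\rho_2$. $\mathcal X^1(\mathbb F_r)$ is the set of classes with $\mathfrak h_G(\ell)=1$; $\mathcal X^1(G,\rho)$ the classes with underlying marked graph $(G,\rho)$ (up to homotopy of $\rho$), identified with $\mathcal M^1(G)$. $\mathrm{Out}(\mathbb F_r)$ acts on the right by $[(G,\rho,\ell)]\cdot\phi=[(G,\rho\circ g_\phi,\ell)]$ where $g_\phi\colon\mathcal R_r\to\mathcal R_r$ realizes $\phi$; $\mathcal X^1(\mathcal R_r,\mathrm{id})$ is the set of unit entropy length functions on the rose with the identity marking. $d_{\mathfrak h}$ is the path metric on $\mathcal X^1(\mathbb F_r)$ (with the standard weak topology of outer space) obtained as the infimum over continuous paths that are piecewise smooth paths inside cells $\mathcal X^1(G_k,\rho_k)$ of the sum of entropy lengths of the pieces; it is $\mathrm{Out}(\mathbb F_r)$-invariant, so the action extends isometrically to the completion. *)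

theory Defs
  imports "HOL-Analysis.Analysis"
begin

text \<open>A graph in Serre's sense with vertex set {0..<nv} and oriented edge set
{0..<2*ne}; the involution is e <-> bar e pairing 2i with 2i+1, and E_+ is the set of
even edges, indexed by i < ne (edge 2i).  org is the origin map; the terminus is
org of the reversed edge.  base is the image of the vertex of the rose, mark i the
edge path image of the i-th petal (the marking rho, up to homotopy), and len i the
length of the i-th edge of E_+.\<close>

record mgraph =
  nv :: nat
  ne :: nat
  org :: "nat \<Rightarrow> nat"
  base :: nat
  mark :: "nat \<Rightarrow> nat list"
  len :: "nat \<Rightarrow> real"

definition bar :: "nat \<Rightarrow> nat" where
  "bar e = (if even e then Suc e else e - 1)"

definition edges :: "('a) mgraph_scheme \<Rightarrow> nat set" where
  "edges G = {..< 2 * ne G}"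

definition ter :: "('a) mgraph_scheme \<Rightarrow> nat \<Rightarrow> nat" where
  "ter G e = org G (bar e)"

fun chain :: "('a) mgraph_scheme \<Rightarrow> nat list \<Rightarrow> bool" where
  "chain G (e # f # es) = (ter G e = org G f \<and> chain G (f # es))"
| "chain G _ = True"

definition is_path :: "('a) mgraph_scheme \<Rightarrow> nat \<Rightarrow> nat list \<Rightarrow> nat \<Rightarrow> bool" where
  "is_path G u p v \<longleftrightarrow> set p \<subseteq> edges G \<and> u < nv G \<and> v < nv G \<and>
     (if p = [] then u = v else org G (hd p) = u \<and> ter G (last p) = v \<and> chain G p)"

fun reduced_by :: "('b \<Rightarrow> 'b) \<Rightarrow> 'b list \<Rightarrow> bool" where
  "reduced_by iv (a # b # xs) = (b \<noteq> iv a \<and> reduced_by iv (b # xs))"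
| "reduced_by iv _ = True"

definition freered :: "('b \<Rightarrow> 'b) \<Rightarrow> 'b list \<Rightarrow> 'b list" where
  "freered iv xs = foldr (\<lambda>a acc. case acc of [] \<Rightarrow> [a]
       | b # bs \<Rightarrow> (if b = iv a then bs else a # acc)) xs []"

definition rev_path :: "nat list \<Rightarrow> nat list" where
  "rev_path p = rev (map bar p)"

definition based_circuit :: "('a) mgraph_scheme \<Rightarrow> nat list \<Rightarrow> bool" where
  "based_circuit G \<gamma> \<longleftrightarrow> \<gamma> \<noteq> [] \<and> is_path G (org G (hd \<gamma>)) \<gamma> (org G (hd \<gamma>))
     \<and> reduced_by bar \<gamma> \<and> last \<gamma> \<noteq> bar (hd \<gamma>)"

definition plen :: "(nat \<Rightarrow> real) \<Rightarrow> nat list \<Rightarrow> real" where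
  "plen l \<gamma> = sum_list (map (\<lambda>e. l (e div 2)) \<gamma>)"

definition entropy :: "('a) mgraph_scheme \<Rightarrow> (nat \<Rightarrow> real) \<Rightarrow> real" where
  "entropy G l = Lim at_top
     (\<lambda>t::real. ln (real (card {\<gamma>. based_circuit G \<gamma> \<and> plen l \<gamma> \<le> t})) / t)"

definition hess_form :: "('a) mgraph_scheme \<Rightarrow> (nat \<Rightarrow> real) \<Rightarrow> (nat \<Rightarrow> real) \<Rightarrow> real" where
  "hess_form G l v = deriv (deriv (\<lambda>u. entropy G (\<lambda>i. l i + u * v i))) 0"

definition valence :: "('a) mgraph_scheme \<Rightarrow> nat \<Rightarrow> nat" where
  "valence G v = card {e \<in> edges G. org G e = v}"

definition graph_ok :: "('a) mgraph_scheme \<Rightarrow> bool" where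
  "graph_ok G \<longleftrightarrow> 1 \<le> nv G \<and> (\<forall>e\<in>edges G. org G e < nv G)
     \<and> (\<forall>u<nv G. \<forall>v<nv G. \<exists>p. is_path G u p v)
     \<and> (\<forall>v<nv G. valence G v \<noteq> 1 \<and> valence G v \<noteq> 2)"

text \<open>Letters (i, True) = a_i and (i, False) = a_i^{-1}.\<close>
definition winv :: "nat \<times> bool \<Rightarrow> nat \<times> bool" where
  "winv x = (fst x, \<not> snd x)"

definition words :: "nat \<Rightarrow> (nat \<times> bool) list set" where
  "words r = {w. reduced_by winv w \<and> (\<forall>x\<in>set w. fst x < r)}"

definition lift :: "(nat \<Rightarrow> nat list) \<Rightarrow> (nat \<times> bool) list \<Rightarrow> nat list" where
  "lift \<rho> w = freered bar (concat (map (\<lambda>x. if snd x then \<rho> (fst x) else rev_path (\<rho> (fst x))) w))"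

text \<open>rho is a homotopy equivalence: it induces an isomorphism F_r -> pi_1(G, base).\<close>
definition marking_ok :: "nat \<Rightarrow> ('a) mgraph_scheme \<Rightarrow> bool" where
  "marking_ok r G \<longleftrightarrow> base G < nv G \<and> (\<forall>i<r. is_path G (base G) (mark G i) (base G))
     \<and> bij_betw (lift (mark G)) (words r) {p. is_path G (base G) p (base G) \<and> reduced_by bar p}"

definition point :: "nat \<Rightarrow> mgraph \<Rightarrow> bool" where
  "point r x \<longleftrightarrow> graph_ok x \<and> marking_ok r x \<and> (\<forall>i<ne x. 0 < len x i) \<and> entropy x (len x) = 1"

text \<open>collapse_rep r G l x: the marked graph G with nonnegative lengths l, whose
zero-length edges form a forest, represents (after collapsing that forest, and up to
equivalence of marked metric graphs) the point x.  When l is positive this is exactly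
equivalence of marked metric graphs (graph isomorphism preserving lengths and
markings up to homotopy).\<close>
definition collapse_rep :: "nat \<Rightarrow> ('a) mgraph_scheme \<Rightarrow> (nat \<Rightarrow> real) \<Rightarrow> mgraph \<Rightarrow> bool" where
  "collapse_rep r G l x \<longleftrightarrow> point r x \<and> (\<forall>i<ne G. 0 \<le> l i) \<and>
    (\<exists>\<beta>V \<beta>E p.
      \<beta>V ` {..<nv G} = {..<nv x} \<and>
      bij_betw \<beta>E {e\<in>edges G. 0 < l (e div 2)} (edges x) \<and>
      (\<forall>e\<in>edges G. 0 < l (e div 2) \<longrightarrow> \<beta>E (bar e) = bar (\<beta>E e)
          \<and> org x (\<beta>E e) = \<beta>V (org G e) \<and> len x (\<beta>E e div 2) = l (e div 2)) \<and>
      (\<forall>e\<in>edges G. l (e div 2) = 0 \<longrightarrow> \<beta>V (org G e) = \<beta>V (ter G e)) \<and>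
      (\<forall>u<nv G. \<forall>v<nv G. \<beta>V u = \<beta>V v \<longrightarrow>
          (\<exists>q. is_path G u q v \<and> (\<forall>e\<in>set q. l (e div 2) = 0))) \<and>
      (\<forall>q u. is_path G u q u \<and> reduced_by bar q \<and> q \<noteq> [] \<longrightarrow> (\<exists>e\<in>set q. 0 < l (e div 2))) \<and>
      is_path x (\<beta>V (base G)) p (base x) \<and>
      (\<forall>i<r. freered bar (rev_path p @ map \<beta>E (filter (\<lambda>e. 0 < l (e div 2)) (mark G i)) @ p)
              = freered bar (mark x i)))"

type_synonym path_data =
  "nat \<times> (nat \<Rightarrow> real) \<times> (nat \<Rightarrow> mgraph) \<times> (nat \<Rightarrow> real \<Rightarrow> nat \<Rightarrow> real) \<times> (nat \<Rightarrow> real \<Rightarrow> nat \<Rightarrow> real)"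

text \<open>A path (n, t, Gs, c, dc) from x to y: the parameter interval [0,1] is split by
0 = t 0 < ... < t n = 1; on [t k, t (k+1)] the path lies in the closure of the cell of
the marked graph Gs k, with coordinates c k s (continuous on the closed interval,
C^1 with derivative dc k s and of unit entropy in the open cell on the open interval);
endpoints are points of outer space obtained by collapsing zero-length forests, and
consecutive pieces meet at the same point of X^1(F_r).\<close>
definition adm_path :: "nat \<Rightarrow> mgraph \<Rightarrow> mgraph \<Rightarrow> path_data \<Rightarrow> bool" where
  "adm_path r x y P \<longleftrightarrow> (case P of (n, t, Gs, c, dc) \<Rightarrow>
     1 \<le> n \<and> t 0 = 0 \<and> t n = 1 \<and> (\<forall>k<n. t k < t (Suc k)) \<and>
     (\<forall>k<n. graph_ok (Gs k) \<and> marking_ok r (Gs k) \<and>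
        (\<forall>s\<in>{t k<..<t (Suc k)}. (\<forall>i<ne (Gs k). 0 < c k s i) \<and> entropy (Gs k) (c k s) = 1) \<and>
        (\<forall>i<ne (Gs k). continuous_on {t k..t (Suc k)} (\<lambda>s. c k s i) \<and>
           (\<forall>s\<in>{t k<..<t (Suc k)}. ((\<lambda>s. c k s i) has_real_derivative dc k s i) (at s)) \<and>
           continuous_on {t k<..<t (Suc k)} (\<lambda>s. dc k s i))) \<and>
     collapse_rep r (Gs 0) (c 0 0) x \<and>
     collapse_rep r (Gs (n - 1)) (c (n - 1) 1) y \<and>
     (\<forall>k. 0 < k \<and> k < n \<longrightarrow> (\<exists>z. collapse_rep r (Gs (k - 1)) (c (k - 1) (t k)) z
                                   \<and> collapse_rep r (Gs k) (c k (t k)) z)))"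

definition path_length :: "path_data \<Rightarrow> ennreal" where
  "path_length P = (case P of (n, t, Gs, c, dc) \<Rightarrow>
     (\<Sum>k<n. \<integral>\<^sup>+ s. indicator {t k<..<t (Suc k)} s *
        ennreal (sqrt (hess_form (Gs k) (c k s) (dc k s))) \<partial>lborel))"

definition dh :: "nat \<Rightarrow> mgraph \<Rightarrow> mgraph \<Rightarrow> ennreal" where
  "dh r x y = (INF P \<in> {P. adm_path r x y P}. path_length P)"

definition is_aut :: "nat \<Rightarrow> (nat \<Rightarrow> (nat \<times> bool) list) \<Rightarrow> bool" where
  "is_aut r \<sigma> \<longleftrightarrow> (\<forall>i<r. \<sigma> i \<in> words r) \<and>
     bij_betw (\<lambda>w. freered winv (concat (map (\<lambda>x. if snd x then \<sigma> (fst x)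
                                               else rev (map winv (\<sigma> (fst x)))) w)))
              (words r) (words r)"

definition act :: "mgraph \<Rightarrow> (nat \<Rightarrow> (nat \<times> bool) list) \<Rightarrow> mgraph" where
  "act x \<sigma> = x\<lparr>mark := (\<lambda>i. lift (mark x) (\<sigma> i))\<rparr>"

definition rose :: "nat \<Rightarrow> (nat \<Rightarrow> real) \<Rightarrow> mgraph" where
  "rose r l = \<lparr>nv = 1, ne = r, org = (\<lambda>_. 0), base = 0, mark = (\<lambda>i. [2 * i]), len = l\<rparr>"

end

theory Submission
  imports Defs
begin

text \<open>The fixed point is a limit of barbell graphs. Write \<open>y = 2 / (1 + exp \<ell>)\<close> for the weight of a petal of
  length \<open>\<ell>\<close>; a rose has unit entropy iff its weights sum to 1. In a barbell with petals \<open>i < 2\<close> on one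
  side and \<open>i \<ge> 2\<close> on the other, the side weights \<open>a\<close>, \<open>b\<close> range over \<open>a + b > 1\<close> once the length of the bar is
  solved from the entropy condition, and the Hessian of the entropy carries the factor \<open>1 - b\<close>. Hence any
  rose can push its lighter side up to weight \<open>b = 1 - \<eta>\<close> at bounded cost, after which the other side moves
  to weight \<open>1 - \<eta>\<close> at a cost that vanishes with \<open>\<eta>\<close>. All roses with identity marking are therefore within
  bounded distance of the limit point of these balanced barbells (\<open>r \<ge> 4\<close> leaves at least two petals
  on each side).

  That limit point is invariant under the Nielsen generators of \<open>Out(F\<^sub>r)\<close>. Inversions only relabel. For
  \<open>a\<^sub>i \<mapsto> a\<^sub>j\<inverse> a\<^sub>i\<close>, pass to the roses near the limit point on which petal \<open>i\<close> has weight of order \<open>\<eta>\<close>, and slide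
  the end of petal \<open>i\<close> along petal \<open>j\<close> through a theta graph: since petal \<open>i\<close> is so long, the squared cost
  is of order \<open>\<eta> ln\<^sup>2 \<eta>\<close>.\<close>

section \<open>Free reduction\<close>

text \<open>Entropy is only given as a limit of circuit counts, so even its differentiability must
  be extracted. A positive eigenvector of the non-backtracking transfer operator certifies its
  value, the eigenvector condition becomes an explicit equation in the scaled lengths, and entropy
  is the implicit function of that equation. On tangent vectors its first derivative vanishes, so
  the Hessian is a quotient of a second by a first derivative. The weight
  \<open>2 / (1 + exp \<ell>)\<close> is what the two orientations of a petal contribute to the
  equation. The factor \<open>1 - b\<close> appears because a side of weight \<open>b\<close> adds a
  term of order \<open>1 / (1 - b)\<close> to the denominator, provided none of its petals is short.
  Two petals per side guarantee this: a single petal of weight near 1 would have length near 0.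
  Speeds blow up at the ends of the segments, so all bounds are made against one fixed integrable
  weight; and since only upper bounds for the distance matter, straight segments in well chosen
  coordinates suffice. Generation by the Nielsen moves is proved by reducing tuples of
  words.\<close>

locale invol =
  fixes iv :: "'b \<Rightarrow> 'b"
  assumes iv_iv [simp]: "iv (iv a) = a"
begin

abbreviation fr :: "'b list \<Rightarrow> 'b list" where "fr \<equiv> freered iv"

definition winverse :: "'b list \<Rightarrow> 'b list" where "winverse xs = rev (map iv xs)"

lemma fr_Nil [simp]: "fr [] = []" by (simp add: freered_def)

lemma fr_Cons: "fr (a # xs) = (case fr xs of [] \<Rightarrow> [a] | b # bs \<Rightarrow> if b = iv a then bs else a # fr xs)"
  by (simp add: freered_def split: list.split)

lemma reduced_by_tl: "reduced_by iv (a # xs) \<Longrightarrow> reduced_by iv xs"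
  by (cases xs) auto

lemma reduced_fr: "reduced_by iv (fr xs)"
  by (induction xs) (auto simp: fr_Cons split: list.split dest: reduced_by_tl)

lemma fr_reduced: "reduced_by iv xs \<Longrightarrow> fr xs = xs"
proof (induction xs)
  case (Cons a xs)
  then show ?case by (cases xs) (auto simp: fr_Cons dest: reduced_by_tl)
qed simp

lemma fr_fr [simp]: "fr (fr xs) = fr xs"
  by (rule fr_reduced[OF reduced_fr])

lemma fr_Cons_fr: "fr (a # fr xs) = fr (a # xs)"
  unfolding fr_Cons[of a] fr_fr ..

lemma fr_cancel: "fr (a # iv a # xs) = fr xs"
proof (cases "fr xs")
  case Nil then show ?thesis by (simp add: fr_Cons)
next
  case (Cons b bs)
  show ?thesis
  proof (cases "b = a")
    case True
    have "reduced_by iv (a # bs)" using reduced_fr[of xs] Cons True by simp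
    then show ?thesis using Cons True by (cases bs) (auto simp: fr_Cons)
  next
    case False
    then show ?thesis using Cons by (simp add: fr_Cons)
  qed
qed

lemma fr_append_fr_right [simp]: "fr (xs @ fr ys) = fr (xs @ ys)"
proof (induction xs)
  case (Cons a xs)
  then show ?case by (metis append_Cons fr_Cons_fr)
qed simp

lemma fr_append_fr_left [simp]: "fr (fr xs @ ys) = fr (xs @ ys)"
proof (induction xs)
  case (Cons a xs)
  have *: "fr (a # xs @ ys) = fr (a # fr xs @ ys)"
    using Cons by (metis fr_Cons_fr)
  show ?case
  proof (cases "fr xs")
    case Nil
    then show ?thesis using * by (simp add: fr_Cons)
  next
    case (Cons b bs)
    then show ?thesis using * fr_cancel[of a "bs @ ys"] by (auto simp: fr_Cons[of a xs])
  qed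
qed simp

lemma fr_append_cong:
  "fr xs = fr xs' \<Longrightarrow> fr ys = fr ys' \<Longrightarrow> fr (xs @ ys) = fr (xs' @ ys')"
  by (metis fr_append_fr_left fr_append_fr_right)

lemma winverse_simps [simp]:
  "winverse [] = []" "winverse (xs @ ys) = winverse ys @ winverse xs"
  "winverse (a # xs) = winverse xs @ [iv a]" "winverse (winverse xs) = xs"
  "length (winverse xs) = length xs" "(winverse xs = []) = (xs = [])"
  by (auto simp: winverse_def rev_map[symmetric] o_def)

lemma fr_winverse_right: "fr (xs @ winverse xs @ ys) = fr ys"
proof (induction xs arbitrary: ys)
  case (Cons a xs)
  have "fr ((a # xs) @ winverse (a # xs) @ ys) = fr (a # fr (xs @ winverse xs @ iv a # ys))"
    by (simp add: fr_Cons_fr)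
  also have "\<dots> = fr ys" by (simp only: Cons fr_Cons_fr fr_cancel)
  finally show ?case .
qed simp

lemma fr_winverse_left: "fr (winverse xs @ xs @ ys) = fr ys"
  using fr_winverse_right[of "winverse xs" ys] by simp

lemma fr_winverse_right0 [simp]: "fr (xs @ winverse xs) = []"
  using fr_winverse_right[of xs "[]"] by simp

lemma fr_winverse_left0 [simp]: "fr (winverse xs @ xs) = []"
  using fr_winverse_left[of xs "[]"] by simp

lemma fr_winverse_cong: "fr xs = fr ys \<Longrightarrow> fr (winverse xs) = fr (winverse ys)"
proof -
  assume h: "fr xs = fr ys"
  have "fr (winverse xs) = fr (winverse xs @ (ys @ winverse ys))"
    using fr_append_cong[OF refl, of "[]" "ys @ winverse ys" "winverse xs"] by simp
  also have "\<dots> = fr (winverse xs @ (xs @ winverse ys))"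
    by (rule fr_append_cong[OF refl fr_append_cong[OF h[symmetric] refl]])
  also have "\<dots> = fr (winverse ys)" by (rule fr_winverse_left)
  finally show ?thesis .
qed

lemma reduced_by_append:
  "reduced_by iv (xs @ ys) \<longleftrightarrow> reduced_by iv xs \<and> reduced_by iv ys \<and>
     (xs \<noteq> [] \<longrightarrow> ys \<noteq> [] \<longrightarrow> hd ys \<noteq> iv (last xs))"
proof (induction xs)
  case (Cons a xs)
  then show ?case by (cases xs; cases ys) auto
qed simp

lemma reduced_winverse: "reduced_by iv xs \<Longrightarrow> reduced_by iv (winverse xs)"
proof (induction xs)
  case (Cons a xs)
  then show ?case
    by (cases xs) (auto simp: reduced_by_append dest: reduced_by_tl)
qed simp

lemma fr_winverse: "fr (winverse xs) = winverse (fr xs)"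
  using fr_winverse_cong[of "fr xs" xs] fr_reduced[OF reduced_winverse[OF reduced_fr[of xs]]] by simp

lemma set_fr: "set (fr xs) \<subseteq> set xs"
  by (induction xs) (auto simp: fr_Cons split: list.splits if_splits)

end

lemma bar_bar [simp]: "bar (bar e) = e" by (auto simp: bar_def)
lemma bar_div2 [simp]: "bar e div 2 = e div 2" by (auto simp: bar_def elim: oddE)
lemma bar_neq [simp]: "bar e \<noteq> e" "e \<noteq> bar e"
  by (auto simp: bar_def) (metis even_Suc n_not_Suc_n odd_Suc_minus_one)+
lemma bar_double [simp]: "bar (2 * i) = Suc (2 * i)" "bar (Suc (2 * i)) = 2 * i"
  by (auto simp: bar_def)

lemma winv_winv [simp]: "winv (winv x) = x" by (simp add: winv_def)
lemma winv_neq [simp]: "winv x \<noteq> x" "x \<noteq> winv x" by (auto simp: winv_def prod_eq_iff)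
lemma winv_Pair [simp]: "winv (i, b) = (i, \<not> b)" by (simp add: winv_def)
lemma fst_winv [simp]: "fst (winv x) = fst x" by (simp add: winv_def)

interpretation B: invol bar by standard simp
interpretation W: invol winv by standard simp

lemma rev_path_eq: "rev_path = B.winverse" by (simp add: rev_path_def B.winverse_def fun_eq_iff)

text \<open>A substitution of letters descends to reduced words once opposite letters receive words
  that cancel. The two alphabets may differ, so the same argument serves automorphisms, markings,
  edge labels and collapses. The hypothesis is limited to letters of \<open>xs\<close> because
  labels and collapse maps respect reversal only on the edges of the graph.\<close>

lemma (in invol) hom_freered:
  fixes iv' :: "'c \<Rightarrow> 'c"
  assumes "\<And>b. iv' (iv' b) = b"
    and "\<And>a. a \<in> set xs \<Longrightarrow> freered iv' (f a @ f (iv a)) = []"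
  shows "freered iv' (concat (map f (fr xs))) = freered iv' (concat (map f xs))"
  using assms(2)
proof (induction xs)
  case (Cons a xs)
  interpret V: invol iv' by standard (rule assms)
  have IH: "V.fr (concat (map f (fr xs))) = V.fr (concat (map f xs))" using Cons by simp
  have *: "V.fr (f a @ concat (map f (fr xs))) = V.fr (concat (map f (a # xs)))"
    using V.fr_append_cong[OF refl IH, of "f a"] by simp
  show ?case
  proof (cases "fr xs")
    case Nil
    then show ?thesis using * by (simp add: fr_Cons)
  next
    case (Cons b bs)
    have "V.fr ((f a @ f (iv a)) @ concat (map f bs)) = V.fr (concat (map f bs))"
      using Cons.prems[of a] by (metis V.fr_append_fr_left append_Nil list.set_intros(1))
    then show ?thesis using * Cons by (auto simp: fr_Cons)
  qed
qed simp

section \<open>Automorphisms of free groups\<close>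

definition sgn_word :: "(nat \<Rightarrow> (nat \<times> bool) list) \<Rightarrow> nat \<times> bool \<Rightarrow> (nat \<times> bool) list" where
  "sgn_word \<sigma> x = (if snd x then \<sigma> (fst x) else W.winverse (\<sigma> (fst x)))"

text \<open>The endomorphism of the free group with \<open>\<sigma> i\<close> as image of the
  generator \<open>i\<close>, acting on reduced words.\<close>

definition ext :: "(nat \<Rightarrow> (nat \<times> bool) list) \<Rightarrow> (nat \<times> bool) list \<Rightarrow> (nat \<times> bool) list" where
  "ext \<sigma> w = W.fr (concat (map (sgn_word \<sigma>) w))"

lemma sgn_word_winv: "sgn_word \<sigma> (winv x) = W.winverse (sgn_word \<sigma> x)"
  by (auto simp: sgn_word_def winv_def)

lemma concat_sgn_word_winverse:
  "concat (map (sgn_word \<sigma>) (W.winverse w)) = W.winverse (concat (map (sgn_word \<sigma>) w))"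
  by (induction w) (auto simp: sgn_word_winv)

lemma ext_fr: "ext \<sigma> (W.fr w) = ext \<sigma> w"
  unfolding ext_def by (rule W.hom_freered) (auto simp: sgn_word_winv)

lemma ext_Nil [simp]: "ext \<sigma> [] = []" by (simp add: ext_def)

lemma ext_Cons: "ext \<sigma> (x # w) = W.fr (sgn_word \<sigma> x @ ext \<sigma> w)"
  by (simp add: ext_def)

lemma ext_append: "ext \<sigma> (v @ w) = W.fr (ext \<sigma> v @ ext \<sigma> w)"
  by (simp add: ext_def)

lemma ext_winverse: "ext \<sigma> (W.winverse w) = W.winverse (ext \<sigma> w)"
  by (simp add: ext_def concat_sgn_word_winverse W.fr_winverse)

lemma sgn_word_comp: "sgn_word (\<lambda>i. ext \<sigma> (\<tau> i)) x = ext \<sigma> (sgn_word \<tau> x)"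
  by (simp add: sgn_word_def ext_winverse)

lemma ext_comp: "ext (\<lambda>i. ext \<sigma> (\<tau> i)) w = ext \<sigma> (ext \<tau> w)"
proof -
  have "ext (\<lambda>i. ext \<sigma> (\<tau> i)) w = ext \<sigma> (concat (map (sgn_word \<tau>) w))"
    by (induction w) (simp_all add: ext_Cons sgn_word_comp ext_append)
  then show ?thesis by (simp add: ext_fr ext_def[of \<tau>])
qed

lemma ext_cong:
  assumes "\<And>x. x \<in> set w \<Longrightarrow> \<sigma> (fst x) = \<tau> (fst x)"
  shows "ext \<sigma> w = ext \<tau> w"
proof -
  have "map (sgn_word \<sigma>) w = map (sgn_word \<tau>) w"
    using assms by (simp add: sgn_word_def)
  then show ?thesis unfolding ext_def by (rule arg_cong)
qed

lemma ext_letters: "ext (\<lambda>k. [(k, True)]) w = W.fr w"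
proof -
  have "concat (map (sgn_word (\<lambda>k. [(k, True)])) w) = w"
    by (induction w) (auto simp: sgn_word_def)
  then show ?thesis by (simp add: ext_def)
qed

lemma words_iff: "w \<in> words r \<longleftrightarrow> W.fr w = w \<and> (\<forall>x\<in>set w. fst x < r)"
  unfolding words_def using W.fr_reduced[of w] W.reduced_fr[of w] by auto

lemma words_reducedD: "w \<in> words r \<Longrightarrow> reduced_by winv w" by (simp add: words_def)

lemma words_fr [simp]: "w \<in> words r \<Longrightarrow> W.fr w = w" by (simp add: words_iff)

lemma fst_winverse: "x \<in> set (W.winverse w) \<Longrightarrow> \<exists>y\<in>set w. fst x = fst y"
  by (force simp: W.winverse_def)

lemma words_winverse: "w \<in> words r \<Longrightarrow> W.winverse w \<in> words r"
  unfolding words_def using fst_winverse W.reduced_winverse by fastforce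

lemma words_fr_append: "v \<in> words r \<Longrightarrow> w \<in> words r \<Longrightarrow> W.fr (v @ w) \<in> words r"
  using W.set_fr[of "v @ w"] unfolding words_iff by auto

lemma words_tl: "x # w \<in> words r \<Longrightarrow> fst x < r \<and> w \<in> words r"
  unfolding words_def by (auto dest: W.reduced_by_tl)

lemma sgn_word_words: "(\<forall>i<r. \<sigma> i \<in> words r) \<Longrightarrow> fst x < r \<Longrightarrow> sgn_word \<sigma> x \<in> words r"
  by (auto simp: sgn_word_def words_winverse)

lemma ext_words:
  assumes "\<forall>i<r. \<sigma> i \<in> words r" "w \<in> words r"
  shows "ext \<sigma> w \<in> words r"
  using assms(2)
proof (induction w)
  case (Cons x w)
  then show ?case using words_tl[of x w r] sgn_word_words[OF assms(1), of x]
    by (simp add: ext_Cons words_fr_append)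
qed (simp add: words_def)

lemma letter_words [simp]: "[(k, b)] \<in> words r \<longleftrightarrow> k < r" by (simp add: words_def)

lemma is_aut_iff: "is_aut r \<sigma> \<longleftrightarrow> (\<forall>i<r. \<sigma> i \<in> words r) \<and> bij_betw (ext \<sigma>) (words r) (words r)"
proof -
  have "ext \<sigma> = (\<lambda>w. freered winv (concat (map (\<lambda>x. if snd x then \<sigma> (fst x)
                 else rev (map winv (\<sigma> (fst x)))) w)))"
    by (simp add: ext_def fun_eq_iff sgn_word_def[abs_def] W.winverse_def cong: if_cong)
  then show ?thesis by (simp add: is_aut_def)
qed

lemma is_aut_comp:
  assumes "is_aut r \<sigma>" "is_aut r \<tau>" shows "is_aut r (\<lambda>i. ext \<sigma> (\<tau> i))"
proof -
  have "ext (\<lambda>i. ext \<sigma> (\<tau> i)) = ext \<sigma> \<circ> ext \<tau>" by (simp add: fun_eq_iff ext_comp)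
  then show ?thesis using assms unfolding is_aut_iff
    by (auto intro: bij_betw_trans ext_words)
qed

text \<open>Both composites fix the generators and hence all reduced words, so
  \<open>ext \<tau>\<close> is an inverse bijection.\<close>

lemma is_autI:
  assumes "\<forall>i<r. \<sigma> i \<in> words r" "\<forall>i<r. \<tau> i \<in> words r"
    and "\<forall>k<r. ext \<sigma> (\<tau> k) = [(k, True)]" "\<forall>k<r. ext \<tau> (\<sigma> k) = [(k, True)]"
  shows "is_aut r \<sigma>"
proof -
  have id: "ext \<alpha> (ext \<beta> w) = w" if "\<forall>k<r. ext \<alpha> (\<beta> k) = [(k, True)]" "w \<in> words r" for \<alpha> \<beta> w
  proof -
    have "ext \<alpha> (ext \<beta> w) = ext (\<lambda>k. [(k, True)]) w"
      unfolding ext_comp[symmetric] using that by (intro ext_cong) (auto simp: words_def)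
    then show ?thesis using that by (simp add: ext_letters)
  qed
  show ?thesis unfolding is_aut_iff
    using assms by (intro conjI bij_betw_byWitness[where f' = "ext \<tau>"]) (auto simp: id ext_words)
qed

section \<open>Elementary Nielsen automorphisms and the tuples they generate\<close>

definition transv :: "nat \<Rightarrow> nat \<Rightarrow> nat \<Rightarrow> (nat \<times> bool) list" where
  "transv i j k = (if k = i then [(j, False), (i, True)] else [(k, True)])"

definition flip :: "nat \<Rightarrow> nat \<Rightarrow> (nat \<times> bool) list" where
  "flip i k = [(k, k \<noteq> i)]"

lemma is_aut_transv:
  assumes "i < r" "j < r" "i \<noteq> j" shows "is_aut r (transv i j)"
  by (rule is_autI[where \<tau> = "\<lambda>k. if k = i then [(j, True), (i, True)] else [(k, True)]"])
    (use assms in \<open>auto simp: transv_def words_def ext_def sgn_word_def W.fr_Cons\<close>)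

lemma is_aut_flip: "i < r \<Longrightarrow> is_aut r (flip i)"
  by (rule is_autI[where \<tau> = "flip i"]) (auto simp: flip_def ext_def sgn_word_def W.fr_Cons)

text \<open>Tuples are built by composing with one more generator on the inner side. Since
  \<open>act\<close> is a right action, this is the order in which the new generator acts last on a
  marked graph. Only the first \<open>r\<close> entries are prescribed, because only these determine
  the automorphism.\<close>

inductive niel :: "nat \<Rightarrow> (nat \<Rightarrow> (nat \<times> bool) list) \<Rightarrow> bool" for r where
  niel_id: "\<forall>k<r. u k = [(k, True)] \<Longrightarrow> niel r u"
| niel_transv: "niel r u \<Longrightarrow> i < r \<Longrightarrow> j < r \<Longrightarrow> i \<noteq> j \<Longrightarrow>
    \<forall>k<r. u' k = ext u (transv i j k) \<Longrightarrow> niel r u'"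
| niel_flip: "niel r u \<Longrightarrow> i < r \<Longrightarrow> \<forall>k<r. u' k = ext u (flip i k) \<Longrightarrow> niel r u'"

definition wtuple :: "nat \<Rightarrow> (nat \<Rightarrow> (nat \<times> bool) list) \<Rightarrow> bool" where
  "wtuple r u \<longleftrightarrow> (\<forall>k<r. u k \<in> words r)"

lemma wtuple_words: "wtuple r u \<Longrightarrow> k < r \<Longrightarrow> u k \<in> words r"
  by (simp add: wtuple_def)

lemma wtuple_fr: "wtuple r u \<Longrightarrow> k < r \<Longrightarrow> W.fr (u k) = u k"
  by (simp add: wtuple_def words_iff)

lemma wtuple_sgn_word: "wtuple r u \<Longrightarrow> fst x < r \<Longrightarrow> sgn_word u x \<in> words r"
  by (simp add: wtuple_def sgn_word_words)

lemma wtuple_upd: "wtuple r u \<Longrightarrow> w \<in> words r \<Longrightarrow> wtuple r (u(i := w))"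
  by (simp add: wtuple_def)

lemmas wtuple_intros = wtuple_upd words_winverse words_fr_append wtuple_words

lemma ext_transv: "wtuple r u \<Longrightarrow> i < r \<Longrightarrow> j < r \<Longrightarrow> k < r \<Longrightarrow>
    ext u (transv i j k) = (u(i := W.fr (W.winverse (u j) @ u i))) k"
  by (simp add: transv_def ext_def sgn_word_def wtuple_fr)

lemma ext_flip: "wtuple r u \<Longrightarrow> i < r \<Longrightarrow> k < r \<Longrightarrow> ext u (flip i k) = (u(i := W.winverse (u i))) k"
  by (auto simp: flip_def ext_def sgn_word_def wtuple_fr W.fr_winverse)

lemma niel_cong: "niel r u \<Longrightarrow> \<forall>k<r. u' k = u k \<Longrightarrow> niel r u'"
  by (erule niel.cases) (auto intro: niel.intros)

lemma niel_inv: assumes "niel r u" "wtuple r u" "i < r" shows "niel r (u(i := W.winverse (u i)))"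
  using niel_flip[OF assms(1,3), of "u(i := W.winverse (u i))"] ext_flip[OF assms(2,3)] by simp

lemma niel_inv_iff: assumes "wtuple r u" "i < r" shows "niel r (u(i := W.winverse (u i))) \<longleftrightarrow> niel r u"
proof
  assume h: "niel r (u(i := W.winverse (u i)))"
  have "wtuple r (u(i := W.winverse (u i)))" using assms by (intro wtuple_intros)
  from niel_inv[OF h this assms(2)]
  show "niel r u" by (rule niel_cong) simp
qed (use assms niel_inv in blast)

lemma niel_left: assumes "niel r u" "wtuple r u" "i < r" "j < r" "i \<noteq> j"
  shows "niel r (u(i := W.fr (W.winverse (u j) @ u i)))"
  using niel_transv[OF assms(1,3-5), of "u(i := W.fr (W.winverse (u j) @ u i))"]
    ext_transv[OF assms(2-4)] by simp

lemma niel_left': assumes "niel r u" "wtuple r u" "i < r" "j < r" "i \<noteq> j"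
  shows "niel r (u(i := W.fr (u j @ u i)))"
proof -
  let ?v = "u(j := W.winverse (u j))"
  have v: "wtuple r ?v" using assms by (intro wtuple_intros)
  let ?w = "?v(i := W.fr (W.winverse (?v j) @ ?v i))"
  have w: "wtuple r ?w" by (intro wtuple_intros v assms)
  have "niel r (?w(j := W.winverse (?w j)))"
    by (intro niel_inv niel_left assms v w)
  moreover have "?w(j := W.winverse (?w j)) = u(i := W.fr (u j @ u i))"
    using assms(5) by (auto simp: fun_eq_iff)
  ultimately show ?thesis by simp
qed

text \<open>Stated as equivalences because the reduction below travels backwards: the moved tuple is
  shown to be generated first, and the original one is recovered from it.\<close>

lemma niel_left_iff: assumes "wtuple r u" "i < r" "j < r" "i \<noteq> j"
  shows "niel r (u(i := W.fr (u j @ u i))) \<longleftrightarrow> niel r u"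
    and "niel r (u(i := W.fr (W.winverse (u j) @ u i))) \<longleftrightarrow> niel r u"
proof -
  have w: "wtuple r (u(i := W.fr (u j @ u i)))" "wtuple r (u(i := W.fr (W.winverse (u j) @ u i)))"
    using assms by (simp_all add: wtuple_intros)
  have 1: "W.fr (W.winverse (u j) @ u j @ u i) = u i" "W.fr (u j @ W.winverse (u j) @ u i) = u i"
    using assms by (simp_all add: W.fr_winverse_left W.fr_winverse_right wtuple_fr)
  show "niel r (u(i := W.fr (u j @ u i))) \<longleftrightarrow> niel r u"
    using niel_left[OF _ w(1) assms(2-)] niel_left'[OF _ assms] 1 assms(4) by auto
  show "niel r (u(i := W.fr (W.winverse (u j) @ u i))) \<longleftrightarrow> niel r u"
    using niel_left'[OF _ w(2) assms(2-)] niel_left[OF _ assms] 1 assms(4) by auto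
qed

lemma niel_right_iff: assumes "wtuple r u" "i < r" "j < r" "i \<noteq> j"
  shows "niel r (u(i := W.fr (u i @ u j))) \<longleftrightarrow> niel r u"
    and "niel r (u(i := W.fr (u i @ W.winverse (u j)))) \<longleftrightarrow> niel r u"
proof -
  let ?v = "u(i := W.winverse (u i))"
  have v: "wtuple r ?v" using assms by (intro wtuple_intros)
  note n = niel_left_iff[OF v assms(2-4)] niel_inv_iff[OF assms(1,2)]
  have w: "wtuple r (?v(i := W.fr (?v j @ ?v i)))" "wtuple r (?v(i := W.fr (W.winverse (?v j) @ ?v i)))"
    using assms by (simp_all add: wtuple_intros)
  note m = niel_inv_iff[OF w(1) assms(2)] niel_inv_iff[OF w(2) assms(2)]
  show "niel r (u(i := W.fr (u i @ u j))) \<longleftrightarrow> niel r u"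
    "niel r (u(i := W.fr (u i @ W.winverse (u j)))) \<longleftrightarrow> niel r u"
    using n m assms(4) by (simp_all add: W.fr_winverse[symmetric])
qed

text \<open>One form for all four one-sided multiplications: with signed letters, right
  multiplication of the inverse of an entry is left multiplication of the entry. The reduction
  theory can then speak about products \<open>x y\<close> only.\<close>

lemma niel_mult_iff:
  assumes "wtuple r u" "fst x < r" "fst y < r" "fst x \<noteq> fst y"
  shows "niel r (u(fst x := if snd x then W.fr (sgn_word u x @ sgn_word u y)
     else W.winverse (W.fr (sgn_word u x @ sgn_word u y)))) \<longleftrightarrow> niel r u"
  using niel_left_iff[OF assms] niel_right_iff[OF assms]
  by (simp add: sgn_word_def W.fr_winverse[symmetric])

text \<open>The classical product of three multiplications and an inversion: the pair (a, b) passes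
  through (b a, b), (b a, a^-1) and (b, a^-1) to (b, a).\<close>

lemma niel_swap_iff:
  assumes "wtuple r u" "i < r" "j < r" "i \<noteq> j"
  shows "niel r (u(i := u j, j := u i)) \<longleftrightarrow> niel r u"
proof -
  define u1 where "u1 = u(i := W.fr (u j @ u i))"
  define u2 where "u2 = u1(j := W.fr (W.winverse (u1 i) @ u1 j))"
  have w1: "wtuple r u1" using assms by (simp add: u1_def wtuple_intros)
  have w2: "wtuple r u2" using assms w1 by (simp add: u2_def wtuple_intros)
  have n: "niel r u1 = niel r u" "niel r u2 = niel r u1"
    unfolding u2_def using assms w1 by (auto simp: niel_left_iff) (simp_all add: u1_def niel_left_iff)
  have uj: "u2 j = W.winverse (u i)"
  proof -
    have "u2 j = W.fr (W.winverse (W.fr (u j @ u i)) @ u j)"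
      using assms by (simp add: u2_def u1_def)
    also have "\<dots> = W.fr (W.winverse (u i) @ W.winverse (u j) @ u j)"
      by (simp add: W.fr_winverse[symmetric])
    also have "\<dots> = W.fr (W.winverse (u i))"
      using W.fr_append_cong[OF refl, of "W.winverse (u j) @ u j" "[]" "W.winverse (u i)"] by simp
    finally show ?thesis using assms by (simp add: W.fr_winverse wtuple_fr)
  qed
  have ui: "u2 i = W.fr (u j @ u i)" using assms by (simp add: u2_def u1_def)
  define u3 where "u3 = u2(i := W.fr (u2 i @ u2 j))"
  have n3: "niel r u3 = niel r u2"
    using niel_mult_iff[OF w2, of "(i, True)" "(j, True)"] assms by (simp add: u3_def sgn_word_def)
  have "W.fr (u j @ u i @ W.winverse (u i)) = W.fr (u j)"
    using W.fr_append_cong[OF refl, of "u i @ W.winverse (u i)" "[]" "u j"] by simp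
  then have u3i: "u3 i = u j" using assms by (simp add: u3_def ui uj wtuple_fr)
  have w3: "wtuple r u3" using w2 assms by (simp add: u3_def wtuple_intros)
  have "niel r (u3(j := W.winverse (u3 j))) = niel r u3" by (rule niel_inv_iff[OF w3 assms(3)])
  moreover have "u3(j := W.winverse (u3 j)) = u(i := u j, j := u i)"
  proof
    fix k show "(u3(j := W.winverse (u3 j))) k = (u(i := u j, j := u i)) k"
      using assms(4) u3i uj by (cases "k = i"; cases "k = j") (auto simp: u3_def u2_def u1_def)
  qed
  ultimately show ?thesis using n n3 by simp
qed

section \<open>Cancellation between reduced words and Nielsen reduced tuples\<close>

lemma (in invol) cancel_ex:
  assumes "reduced_by iv p" "reduced_by iv q"
  shows "\<exists>p' c q'. p = p' @ c \<and> q = winverse c @ q' \<and> reduced_by iv (p' @ q')"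
  using assms
proof (induction p arbitrary: q rule: rev_induct)
  case (snoc a p)
  show ?case
  proof (cases "\<exists>q''. q = iv a # q''")
    case True
    then obtain q'' where q: "q = iv a # q''" by blast
    have "reduced_by iv p" "reduced_by iv q''"
      using snoc.prems q reduced_by_append[of p "[a]"] reduced_by_tl[of "iv a" q''] by auto
    from snoc.IH[OF this] obtain p' c q' where "p = p' @ c" "q'' = winverse c @ q'" "reduced_by iv (p' @ q')"
      by blast
    then show ?thesis using q by (intro exI[of _ p'] exI[of _ "c @ [a]"] exI[of _ q']) simp
  next
    case False
    then have "reduced_by iv ((p @ [a]) @ q)"
      using snoc.prems by (subst reduced_by_append) (cases q, auto)
    then show ?thesis by (intro exI[of _ "p @ [a]"] exI[of _ "[]"] exI[of _ q]) simp
  qed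
qed (rule exI[of _ "[]"], rule exI[of _ "[]"], simp)

text \<open>The last letter is the inverse of the first, so outer layers can be peeled off. What
  remains in the middle is one letter equal to its own inverse or an adjacent cancelling pair, and
  both are excluded.\<close>

lemma (in invol) winverse_fixed:
  assumes "\<And>a. iv a \<noteq> a"
  shows "reduced_by iv d \<Longrightarrow> winverse d = d \<Longrightarrow> d = []"
proof (induction "length d" arbitrary: d rule: less_induct)
  case less
  show ?case
  proof (rule ccontr)
    assume "d \<noteq> []"
    then obtain a d' where d: "d = a # d'" by (cases d) auto
    show False
    proof (cases d' rule: rev_cases)
      case Nil then show False using less.prems d assms by simp
    next
      case (snoc m b)
      then have *: "winverse m = m" "iv b = a" using less.prems(2) d by auto
      have "reduced_by iv m" using less.prems(1) d snoc by (metis reduced_by_append reduced_by_tl)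
      then have "m = []" using less.hyps[of m] * d snoc by simp
      then show False using less.prems(1) d snoc *(2) by auto
    qed
  qed
qed

text \<open>If the square of a reduced word cancelled more than half of it, the cancelled suffix and
  its inverse prefix would overlap in a word equal to its own inverse.\<close>

lemma (in invol) self_cancel:
  assumes "\<And>a. iv a \<noteq> a" "reduced_by iv (p @ c)" "p @ c = winverse c @ q"
  shows "2 * length c \<le> length (p @ c)"
proof (rule ccontr)
  assume "\<not> ?thesis"
  then have lt: "length p < length c" by simp
  from assms(3) obtain d where "p = winverse c @ d \<or> p @ d = winverse c \<and> c = d @ q"
    unfolding append_eq_append_conv2 by blast
  with lt have d: "winverse c = p @ d" "c = d @ q" by auto
  have "length p = length q" using arg_cong[OF assms(3), of length] by simp
  moreover have "winverse q @ winverse d = p @ d" using d by (metis winverse_simps(2))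
  ultimately have "winverse d = d" by simp
  moreover have "reduced_by iv d" using assms(2) d by (simp add: reduced_by_append)
  ultimately have "d = []" using winverse_fixed assms(1) by blast
  then show False using d lt by (metis append_Nil2 less_irrefl winverse_simps(5))
qed

text \<open>Base-\<open>B\<close> digits with the first letter lowest. Besides separating words of
  equal length, the code of a concatenation is additive in its tail, which turns the exchange of a
  segment into an exact difference of weights.\<close>

fun wcode :: "nat \<Rightarrow> (nat \<times> bool) list \<Rightarrow> nat" where
  "wcode B [] = 0"
| "wcode B (x # w) = 2 * fst x + of_bool (snd x) + B * wcode B w"

lemma wcode_append: "wcode B (v @ w) = wcode B v + B ^ length v * wcode B w"
  by (induction v) (simp_all add: algebra_simps)

lemma wcode_inj:
  assumes "length v = length w" "\<forall>x\<in>set v. fst x < r" "\<forall>x\<in>set w. fst x < r"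
    "wcode (2 * r) v = wcode (2 * r) w"
  shows "v = w"
  using assms
proof (induction v w rule: list_induct2)
  case (Cons x v y w)
  let ?c = "\<lambda>x::nat \<times> bool. 2 * fst x + of_bool (snd x) :: nat"
  have lt: "?c x < 2 * r" "?c y < 2 * r" using Cons.prems by (auto simp: of_bool_def)
  have e: "?c x + 2 * r * wcode (2 * r) v = ?c y + 2 * r * wcode (2 * r) w"
    using Cons.prems by (simp add: mult.assoc)
  have 1: "?c x = ?c y" using arg_cong[OF e, of "\<lambda>n. n mod (2 * r)"] lt by simp
  then have "fst x = fst y \<and> snd x = snd y" by (auto simp: of_bool_def split: if_splits) presburger+
  moreover have "wcode (2 * r) v = wcode (2 * r) w" using e 1 lt by simp
  ultimately show ?case using Cons by (simp add: prod_eq_iff)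
qed simp

text \<open>The Nielsen moves that preserve the total length are made to decrease this weight.\<close>
definition half_weight :: "nat \<Rightarrow> (nat \<times> bool) list \<Rightarrow> nat" where
  "half_weight r w = wcode (2 * r) (take ((length w + 1) div 2) w)
     + wcode (2 * r) (take ((length w + 1) div 2) (W.winverse w))"

lemma half_weight_winverse [simp]: "half_weight r (W.winverse w) = half_weight r w"
  by (simp add: half_weight_def)

text \<open>The half rounded up has at least \<open>length c\<close> and at most
  \<open>length p\<close> letters. So the leading half of the word lies inside \<open>p\<close>,
  while the leading half of its inverse begins with the exchanged segment and continues inside the
  inverse of \<open>p\<close>. Only the codes of \<open>c\<close> and \<open>d\<close>
  differ.\<close>

lemma half_weight_tail:
  assumes "length c = length d" "length c \<le> length p"
  shows "half_weight r (p @ W.winverse c) + wcode (2 * r) d = half_weight r (p @ W.winverse d) + wcode (2 * r) c"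
proof -
  define n where "n = (length p + length c + 1) div 2"
  have n: "n \<le> length p" "length c \<le> n" using assms(2) by (auto simp: n_def)
  show ?thesis using assms n
    by (simp add: half_weight_def n_def[symmetric] n_def[symmetric, simplified] wcode_append take_append)
qed

text \<open>Local minimality under the moves, with length compared first and
  \<open>half_weight\<close> second. The tie-break is what yields Nielsen's condition that a factor
  is never consumed completely by its two neighbours.\<close>

definition nreduced :: "nat \<Rightarrow> (nat \<Rightarrow> (nat \<times> bool) list) \<Rightarrow> bool" where
  "nreduced r u \<longleftrightarrow> (\<forall>x y. fst x < r \<longrightarrow> fst y < r \<longrightarrow> fst x \<noteq> fst y \<longrightarrow>
     (let w = W.fr (sgn_word u x @ sgn_word u y) in
       length (sgn_word u x) < length w \<or>
       length (sgn_word u x) = length w \<and> half_weight r (sgn_word u x) \<le> half_weight r w))"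

lemma fr_cancelled: "reduced_by winv (p @ q) \<Longrightarrow> W.fr ((p @ c) @ (W.winverse c @ q)) = p @ q"
proof -
  assume "reduced_by winv (p @ q)"
  moreover have "W.fr (p @ (c @ W.winverse c @ q)) = W.fr (p @ q)"
    by (rule W.fr_append_cong) (simp_all add: W.fr_winverse_right)
  ultimately show ?thesis by (simp add: W.fr_reduced)
qed

text \<open>For distinct indices the product \<open>x y\<close> is compared with \<open>x\<close>
  and, through inverses, with \<open>y\<close>. For equal indices \<open>y\<close> is
  \<open>x\<close> itself, where minimality says nothing and self-cancellation takes over.\<close>

lemma nreduced_half:
  assumes n: "nreduced r u" and x: "fst x < r" and y: "fst y < r"
    and "y \<noteq> winv x" "sgn_word u x = p @ c" "sgn_word u y = W.winverse c @ q"
    and red: "reduced_by winv (p @ q)" "reduced_by winv (sgn_word u x)"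
  shows "2 * length c \<le> length (sgn_word u x) \<and> 2 * length c \<le> length (sgn_word u y)"
proof (cases "fst x = fst y")
  case True
  then have "y = x" using assms(4) by (auto simp: winv_def prod_eq_iff)
  then show ?thesis using W.self_cancel[of p c q] assms by simp
next
  case False
  have "length (sgn_word u x) \<le> length (p @ q)"
    using n[unfolded nreduced_def, rule_format, OF x y False] fr_cancelled[OF red(1), of c] assms(5,6)
    by (auto simp: Let_def)
  moreover have "length (sgn_word u y) \<le> length (p @ q)"
  proof -
    have "W.fr (sgn_word u (winv y) @ sgn_word u (winv x)) = W.winverse (p @ q)"
      using arg_cong[OF fr_cancelled[OF red(1), of c], of W.winverse] assms(5,6)
      by (simp add: sgn_word_winv W.fr_winverse[symmetric])
    moreover have "length (sgn_word u (winv y)) = length (sgn_word u y)" by (simp add: sgn_word_winv)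
    moreover have "length (sgn_word u (winv y)) \<le> length (W.fr (sgn_word u (winv y) @ sgn_word u (winv x)))"
      using n[unfolded nreduced_def, rule_format, of "winv y" "winv x"] x y False by (auto simp: Let_def)
    ultimately show ?thesis by simp
  qed
  ultimately show ?thesis using assms(5,6) by simp
qed

text \<open>Here the product keeps the length of \<open>x\<close> and exchanges its tail
  \<open>P^-1\<close> for \<open>Q^-1\<close>, so minimality of the weight compares the two
  codes.\<close>

lemma nreduced_code:
  assumes n: "nreduced r u" and x: "fst x < r" and y: "fst y < r" and xy: "fst x \<noteq> fst y"
    and "sgn_word u x = p @ W.winverse P" "sgn_word u y = P @ W.winverse Q"
    and red: "reduced_by winv (p @ W.winverse Q)" and l: "length P = length Q" "length P \<le> length p"
  shows "wcode (2 * r) P \<le> wcode (2 * r) Q"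
proof -
  have "W.fr (sgn_word u x @ sgn_word u y) = p @ W.winverse Q"
    using fr_cancelled[OF red, of "W.winverse P"] assms(5,6) by simp
  then have "half_weight r (p @ W.winverse P) \<le> half_weight r (p @ W.winverse Q)"
    using n[unfolded nreduced_def, rule_format, OF x y xy] assms(5) l by (simp add: Let_def)
  then show ?thesis using half_weight_tail[OF l, of r] by linarith
qed

text \<open>If the neighbours consumed \<open>y\<close> completely, each would take exactly half,
  \<open>y = P Q^-1\<close>. The tie-break, applied to \<open>x y\<close> and to the inverse of
  \<open>y z\<close>, then orders the codes of \<open>P\<close> and \<open>Q\<close> both ways, so
  \<open>P = Q\<close> and \<open>y\<close> is trivial.\<close>

lemma nreduced_core:
  assumes n: "nreduced r u" and w: "wtuple r u" and ne: "\<forall>k<r. u k \<noteq> []"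
    and lt: "fst x < r" "fst y < r" "fst z < r" and "y \<noteq> winv x" "z \<noteq> winv y"
    and 1: "sgn_word u x = p1 @ c1" "sgn_word u y = W.winverse c1 @ q1" "reduced_by winv (p1 @ q1)"
    and 2: "sgn_word u y = p2 @ c2" "sgn_word u z = W.winverse c2 @ q2" "reduced_by winv (p2 @ q2)"
  shows "length c1 + length c2 < length (sgn_word u y)"
proof (rule ccontr)
  assume nlt: "\<not> ?thesis"
  have sw: "sgn_word u x \<in> words r" "sgn_word u y \<in> words r" "sgn_word u z \<in> words r"
    by (intro wtuple_sgn_word[OF w] lt)+
  note red = sw[THEN words_reducedD]
  have h: "2 * length c1 \<le> length (sgn_word u x)" "2 * length c1 \<le> length (sgn_word u y)"
     "2 * length c2 \<le> length (sgn_word u y)" "2 * length c2 \<le> length (sgn_word u z)"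
    using nreduced_half[OF n lt(1,2) assms(7) 1 red(1)] nreduced_half[OF n lt(2,3) assms(8) 2 red(2)] by auto
  have yne: "sgn_word u y \<noteq> []" using ne lt by (auto simp: sgn_word_def)
  define P where "P = W.winverse c1"
  define Q where "Q = W.winverse c2"
  have len: "length c1 = length c2" "length (sgn_word u y) = 2 * length c1" using nlt h by linarith+
  have lp: "length p2 = length c1" "length q1 = length c1"
    using len arg_cong[OF 1(2), of length] arg_cong[OF 2(1), of length] by simp_all
  have "W.winverse c1 @ q1 = p2 @ c2" using 1(2) 2(1) by simp
  then have "p2 = P" "q1 = c2" using lp by (simp_all add: P_def)
  then have y: "sgn_word u y = P @ W.winverse Q" using 2 by (simp add: Q_def)
  have PQ: "length P = length Q" using len by (simp add: P_def Q_def)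
  have neq: "P \<noteq> Q"
  proof
    assume "P = Q"
    then have "W.fr (sgn_word u y) = []" using y by simp
    then show False using yne words_fr[OF sw(2)] by simp
  qed
  have xy: "fst x \<noteq> fst y"
  proof
    assume "fst x = fst y"
    then have "x = y" using assms(7) by (auto simp: winv_def prod_eq_iff)
    then have "p1 @ W.winverse P = P @ W.winverse Q" using 1(1) y by (simp add: P_def)
    then have "W.winverse P = W.winverse Q" using PQ by simp
    then show False using neq by (metis W.winverse_simps(4))
  qed
  have zy: "fst z \<noteq> fst y"
  proof
    assume "fst z = fst y"
    then have "z = y" using assms(8) by (auto simp: winv_def prod_eq_iff)
    then have "Q @ q2 = P @ W.winverse Q" using 2(2) y by (simp add: Q_def)
    then show False using neq PQ by simp
  qed
  have "wcode (2 * r) P \<le> wcode (2 * r) Q"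
  proof (rule nreduced_code[OF n lt(1,2) xy _ y _ PQ])
    show "sgn_word u x = p1 @ W.winverse P" using 1 by (simp add: P_def)
    show "reduced_by winv (p1 @ W.winverse Q)" using 1(3) \<open>q1 = c2\<close> by (simp add: Q_def)
    show "length P \<le> length p1" using h(1) 1(1) by (simp add: P_def)
  qed
  moreover have "wcode (2 * r) Q \<le> wcode (2 * r) P"
  proof (rule nreduced_code[OF n, of "winv z" "winv y" "W.winverse q2"])
    show "sgn_word u (winv z) = W.winverse q2 @ W.winverse Q" using 2 by (simp add: sgn_word_winv Q_def)
    show "sgn_word u (winv y) = Q @ W.winverse P" using y by (simp add: sgn_word_winv)
    show "reduced_by winv (W.winverse q2 @ W.winverse P)"
      using W.reduced_winverse[OF 2(3)] \<open>p2 = P\<close> by simp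
    show "length Q \<le> length (W.winverse q2)" using h(4) 2(2) by (simp add: Q_def)
  qed (simp_all add: lt zy PQ)
  ultimately have e: "wcode (2 * r) P = wcode (2 * r) Q" by simp
  have "\<forall>x\<in>set P. fst x < r" "\<forall>x\<in>set Q. fst x < r"
    using sw(2,3) unfolding 1(2) 2(2) words_iff P_def Q_def by simp_all
  from wcode_inj[OF PQ this e] neq show False by simp
qed

text \<open>The part of the first factor that survives its right neighbour survives in the whole
  image, and each further factor leaves at least one letter. Hence words of two or more letters have
  images of two or more letters.\<close>

lemma nreduced_ext:
  assumes n: "nreduced r u" and w: "wtuple r u" and ne: "\<forall>k<r. u k \<noteq> []"
  shows "x # v \<in> words r \<Longrightarrow>
    (v = [] \<longrightarrow> ext u (x # v) = sgn_word u x) \<and>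
    (\<forall>y v' p c q. v = y # v' \<longrightarrow> sgn_word u x = p @ c \<longrightarrow> sgn_word u y = W.winverse c @ q \<longrightarrow>
       reduced_by winv (p @ q) \<longrightarrow> (\<exists>t. ext u (x # v) = p @ t \<and> length v \<le> length t))"
proof (induction v arbitrary: x)
  case Nil
  then have "sgn_word u x \<in> words r" by (intro wtuple_sgn_word[OF w]) (simp add: words_def)
  then show ?case by (simp add: ext_Cons)
next
  case (Cons y v)
  have yv: "y # v \<in> words r" and lt: "fst x < r" "fst y < r" and xy: "y \<noteq> winv x"
    using Cons.prems by (auto simp: words_def dest: W.reduced_by_tl)
  have sw: "sgn_word u x \<in> words r" "sgn_word u y \<in> words r"
    by (intro wtuple_sgn_word[OF w] lt)+
  have main: "\<exists>t. ext u (x # y # v) = p @ t \<and> length (y # v) \<le> length t"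
    if 1: "sgn_word u x = p @ c" "sgn_word u y = W.winverse c @ q" "reduced_by winv (p @ q)" for p c q
  proof -
    \<comment> \<open>\<open>q'\<close> is the part of the second factor touched by neither
      neighbour. It is nonempty by the halving bound at the end of the word and by
      \<open>nreduced_core\<close> elsewhere.\<close>
    have "\<exists>q' t. ext u (y # v) = W.winverse c @ q' @ t \<and> q' \<noteq> [] \<and> (\<exists>q''. q = q' @ q'') \<and> length v \<le> length t"
    proof (cases v)
      case Nil
      have "2 * length c \<le> length (sgn_word u y)"
        using nreduced_half[OF n lt xy 1] sw words_reducedD by blast
      moreover have "sgn_word u y \<noteq> []" using ne lt by (auto simp: sgn_word_def)
      ultimately have "q \<noteq> []" using 1(2) by auto
      then show ?thesis using Cons.IH[OF yv] Nil 1(2) by (intro exI[of _ q] exI[of _ "[]"]) auto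
    next
      case (Cons z v')
      have ltz: "fst z < r" and yz: "z \<noteq> winv y" using yv Cons by (auto simp: words_def)
      have swz: "sgn_word u z \<in> words r" by (rule wtuple_sgn_word[OF w ltz])
      obtain p2 c2 q2 where 2: "sgn_word u y = p2 @ c2" "sgn_word u z = W.winverse c2 @ q2" "reduced_by winv (p2 @ q2)"
        using W.cancel_ex[OF words_reducedD[OF sw(2)] words_reducedD[OF swz]] by blast
      have l: "length c + length c2 < length (sgn_word u y)"
        by (rule nreduced_core[OF n w ne lt ltz xy yz 1 2])
      obtain t where t: "ext u (y # v) = p2 @ t" "length v \<le> length t"
        using Cons.IH[OF yv, THEN conjunct2, rule_format, OF Cons 2] by blast
      have lp: "length c < length p2" using l 2(1) by simp
      have "W.winverse c @ q = p2 @ c2" using 1(2) 2(1) by simp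
      then obtain q' where "p2 = W.winverse c @ q' \<and> q = q' @ c2 \<or> W.winverse c = p2 @ q'"
        unfolding append_eq_append_conv2 by auto
      moreover have "W.winverse c \<noteq> p2 @ q'"
      proof
        assume "W.winverse c = p2 @ q'"
        from arg_cong[OF this, of length] show False using lp by simp
      qed
      ultimately have q': "p2 = W.winverse c @ q'" "q = q' @ c2" by auto
      have "q' \<noteq> []" using q'(1) lp by auto
      then show ?thesis using t q' by auto
    qed
    then obtain q' t q'' where t: "ext u (y # v) = W.winverse c @ q' @ t" "q' \<noteq> []" "q = q' @ q''" "length v \<le> length t"
      by blast
    have "reduced_by winv (ext u (y # v))" unfolding ext_def by (rule W.reduced_fr)
    then have "reduced_by winv (q' @ t)" using t(1) by (simp add: W.reduced_by_append)
    then have "reduced_by winv (p @ q' @ t)" using 1(3) t(2,3) by (auto simp: W.reduced_by_append)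
    then have "ext u (x # y # v) = p @ (q' @ t)"
      using fr_cancelled[of p "q' @ t" c] 1(1) t(1) by (simp add: ext_Cons[of u x])
    moreover have "length (y # v) \<le> length (q' @ t)" using t(2,4) by (cases q') auto
    ultimately show ?thesis by blast
  qed
  show ?case using main by simp
qed

lemma is_aut_cong: "is_aut r \<sigma> \<Longrightarrow> \<forall>k<r. \<tau> k = \<sigma> k \<Longrightarrow> is_aut r \<tau>"
proof -
  assume h: "is_aut r \<sigma>" "\<forall>k<r. \<tau> k = \<sigma> k"
  have "ext \<tau> w = ext \<sigma> w" if "w \<in> words r" for w
    using that h(2) by (intro ext_cong) (auto simp: words_def)
  then show ?thesis using h unfolding is_aut_iff by (metis (no_types, lifting) bij_betw_cong)
qed

text \<open>Multiplying an entry is precomposition with an elementary automorphism, and the one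
  built from the inverse letter undoes it.\<close>

lemma is_aut_mult:
  assumes u: "is_aut r u" and "fst x < r" "fst y < r" "fst x \<noteq> fst y"
  shows "is_aut r (u(fst x := if snd x then W.fr (sgn_word u x @ sgn_word u y)
     else W.winverse (W.fr (sgn_word u x @ sgn_word u y))))"
proof -
  define m where "m y = (\<lambda>k. if k = fst x then (if snd x then [x, y] else [winv y, winv x]) else [(k, True)])" for y
  have "is_aut r (m y)"
    by (rule is_autI[where \<tau> = "m (winv y)"]; cases x; cases y; cases "snd x"; cases "snd y")
      (use assms in \<open>auto simp: m_def words_def ext_def sgn_word_def W.fr_Cons\<close>)
  from is_aut_comp[OF u this] have "is_aut r (\<lambda>i. ext u (m y i))" .
  then show ?thesis
  proof (rule is_aut_cong, intro allI impI)
    fix k assume k: "k < r"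
    have "wtuple r u" using u by (simp add: wtuple_def is_aut_iff)
    note f = wtuple_fr[OF this]
    show "(u(fst x := if snd x then W.fr (sgn_word u x @ sgn_word u y)
     else W.winverse (W.fr (sgn_word u x @ sgn_word u y)))) k = ext u (m y k)"
    proof (cases "k = fst x")
      case True
      then show ?thesis using W.fr_winverse[symmetric, of "sgn_word u x @ sgn_word u y"]
        by (simp add: m_def ext_def sgn_word_winv)
    next
      case False
      then show ?thesis using f[OF k] by (simp add: m_def ext_def sgn_word_def)
    qed
  qed
qed

lemma niel_flips:
  assumes "wtuple r u" "finite F" "F \<subseteq> {..<r}"
  shows "niel r (\<lambda>k. if k \<in> F then W.winverse (u k) else u k) \<longleftrightarrow> niel r u"
  using assms(2,3)
proof (induction F rule: finite_induct)
  case (insert a F)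
  let ?v = "\<lambda>k. if k \<in> F then W.winverse (u k) else u k"
  have "wtuple r ?v" using assms(1) by (simp add: wtuple_def words_winverse)
  from niel_inv_iff[OF this, of a]
  have "niel r (?v(a := W.winverse (?v a))) = niel r ?v" using insert by simp
  moreover have "(?v(a := W.winverse (?v a))) = (\<lambda>k. if k \<in> insert a F then W.winverse (u k) else u k)"
    using insert by (auto simp: fun_eq_iff)
  ultimately show ?case using insert by simp
qed simp

lemma niel_perm:
  assumes "\<pi> permutes {..<r}" shows "niel r (\<lambda>k. [(\<pi> k, True)])"
  using assms
proof (induction rule: permutes_rev_induct[OF finite_lessThan[of r], consumes 1, case_names id swap])
  case id show ?case by (intro niel_id) simp
next
  case (swap a b p)
  show ?case
  proof (cases "a = b")
    case True then show ?thesis using swap by simp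
  next
    case False
    let ?u = "\<lambda>k. [(p k, True)]"
    have "wtuple r ?u" using swap by (auto simp: wtuple_def permutes_in_image[of p "{..<r}", simplified])
    from niel_swap_iff[OF this, of a b] have "niel r (?u(a := ?u b, b := ?u a))" using swap False by simp
    moreover have "(?u(a := ?u b, b := ?u a)) = (\<lambda>k. [((p \<circ> Transposition.transpose a b) k, True)])"
      using False by (auto simp: fun_eq_iff Transposition.transpose_def)
    ultimately show ?thesis by simp
  qed
qed

text \<open>Induction on the total length, ties broken by the total half-weight. A tuple that is not
  Nielsen reduced admits a decreasing move. A reduced one must hit every generator, by
  \<open>nreduced_ext\<close> only with one-letter words, and is therefore a signed permutation of
  the generators.\<close>

theorem niel_of_aut: "is_aut r u \<Longrightarrow> niel r u"
proof (induction u rule: wf_induct_rule[OF wf_measures[of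
    "[\<lambda>u. \<Sum>k<r. length (u k), \<lambda>u. \<Sum>k<r. half_weight r (u k)]"]])
  case (1 u)
  have w: "wtuple r u" using 1 by (simp add: wtuple_def is_aut_iff)
  have bij: "bij_betw (ext u) (words r) (words r)" using 1 by (simp add: is_aut_iff)
  show ?case
  proof (cases "nreduced r u")
    case False
    then obtain x y where lt: "fst x < r" "fst y < r" "fst x \<noteq> fst y" and
      n: "\<not> (length (sgn_word u x) < length (W.fr (sgn_word u x @ sgn_word u y)) \<or>
       length (sgn_word u x) = length (W.fr (sgn_word u x @ sgn_word u y)) \<and>
       half_weight r (sgn_word u x) \<le> half_weight r (W.fr (sgn_word u x @ sgn_word u y)))"
      unfolding nreduced_def Let_def by blast
    define z where "z = (if snd x then W.fr (sgn_word u x @ sgn_word u y)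
     else W.winverse (W.fr (sgn_word u x @ sgn_word u y)))"
    have s: "(\<Sum>k<r. f ((u(fst x := z)) k)) = f z + (\<Sum>k\<in>{..<r} - {fst x}. f (u k))"
      "(\<Sum>k<r. f (u k)) = f (u (fst x)) + (\<Sum>k\<in>{..<r} - {fst x}. f (u k))" for f :: "_ \<Rightarrow> nat"
      using lt(1) by (simp_all add: sum.remove[of "{..<r}" "fst x"])
    have "length z < length (u (fst x)) \<or> length z = length (u (fst x)) \<and> half_weight r z < half_weight r (u (fst x))"
      using n by (auto simp: z_def sgn_word_def split: if_splits)
    then have "(u(fst x := z), u) \<in> measures [\<lambda>u. \<Sum>k<r. length (u k), \<lambda>u. \<Sum>k<r. half_weight r (u k)]"
      unfolding in_measures s[of length] s[of "half_weight r"] by auto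
    moreover have "is_aut r (u(fst x := z))" unfolding z_def by (rule is_aut_mult[OF 1(2) lt])
    ultimately have "niel r (u(fst x := z))" by (rule 1(1))
    then show ?thesis unfolding z_def niel_mult_iff[OF w lt] .
  next
    case True
    have ne: "\<forall>k<r. u k \<noteq> []"
    proof (intro allI impI notI)
      fix k assume k: "k < r" "u k = []"
      then have "ext u [(k, True)] = ext u []" by (simp add: ext_def sgn_word_def)
      moreover have "[(k, True)] \<in> words r" "[] \<in> words r" using k by (auto simp: words_def)
      ultimately show False using bij by (metis bij_betw_def inj_onD list.distinct(1))
    qed
    have "\<exists>x. fst x < r \<and> sgn_word u x = [(i, True)]" if i: "i < r" for i
    proof -
      have "[(i, True)] \<in> ext u ` words r" using bij i by (simp add: bij_betw_def)
      then obtain v where v: "v \<in> words r" "ext u v = [(i, True)]" by fastforce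
      then obtain x v' where xv: "v = x # v'" by (cases v) auto
      note e = nreduced_ext[OF True w ne, of x v'] v xv
      have fx: "fst x < r" using v xv by (auto simp: words_def)
      show ?thesis
      proof (cases v')
        case Nil then have "sgn_word u x = [(i, True)]" using e by auto
        then show ?thesis using fx by blast
      next
        case (Cons y v'')
        have fy: "fst y < r" and xy: "y \<noteq> winv x" using v xv Cons by (auto simp: words_def)
        have sw: "sgn_word u x \<in> words r" "sgn_word u y \<in> words r"
          by (intro wtuple_sgn_word[OF w] fx fy)+
        obtain p c q where 1: "sgn_word u x = p @ c" "sgn_word u y = W.winverse c @ q" "reduced_by winv (p @ q)"
          using W.cancel_ex[OF words_reducedD[OF sw(1)] words_reducedD[OF sw(2)]] by blast
        have "2 * length c \<le> length (sgn_word u x)"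
          using nreduced_half[OF True fx fy xy 1] sw words_reducedD by blast
        moreover have "sgn_word u x \<noteq> []" using ne fx by (auto simp: sgn_word_def)
        ultimately have "p \<noteq> []" using 1(1) by auto
        moreover obtain t where "ext u v = p @ t" "length v' \<le> length t"
          using e(1)[THEN conjunct2, rule_format, OF _ Cons 1] v xv by auto
        ultimately have "length (ext u v) \<ge> 2" using Cons by (cases p) auto
        then show ?thesis using v(2) by simp
      qed
    qed
    \<comment> \<open>\<open>g i\<close> is the signed letter whose image is the generator
      \<open>i\<close>. Finiteness turns the injection of indices into a permutation; the signs are
      corrected afterwards by inversions.\<close>
    then obtain g where g: "\<And>i. i < r \<Longrightarrow> fst (g i) < r \<and> sgn_word u (g i) = [(i, True)]" by metis
    then have ug: "u (fst (g i)) = [(i, snd (g i))]" if "i < r" for i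
      using that[THEN g] by (auto simp: sgn_word_def W.winverse_def split: if_splits)
    define \<gamma> where "\<gamma> i = (if i < r then fst (g i) else i)" for i
    have "inj_on \<gamma> {..<r}"
      by (rule inj_onI) (metis \<gamma>_def fst_conv lessThan_iff list.inject ug)
    moreover have "\<gamma> ` {..<r} \<subseteq> {..<r}" using g by (auto simp: \<gamma>_def)
    ultimately have "bij_betw \<gamma> {..<r} {..<r}"
      by (simp add: bij_betw_def endo_inj_surj)
    then have perm: "\<gamma> permutes {..<r}" by (rule bij_imp_permutes) (simp add: \<gamma>_def)
    define \<pi> where "\<pi> = inv \<gamma>"
    have "\<pi> permutes {..<r}" unfolding \<pi>_def by (rule permutes_inv[OF perm])
    from niel_perm[OF this] have "niel r (\<lambda>k. [(\<pi> k, True)])" .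
    moreover have "wtuple r (\<lambda>k. [(\<pi> k, True)])"
      using permutes_in_image[OF \<open>\<pi> permutes {..<r}\<close>] by (auto simp: wtuple_def)
    define F where "F = {k. k < r \<and> \<not> snd (g (\<pi> k))}"
    have "niel r (\<lambda>k. if k \<in> F then W.winverse [(\<pi> k, True)] else [(\<pi> k, True)])"
      using niel_flips[OF \<open>wtuple r (\<lambda>k. [(\<pi> k, True)])\<close>, of F] \<open>niel r (\<lambda>k. [(\<pi> k, True)])\<close>
      by (auto simp: F_def)
    then show ?thesis
    proof (rule niel_cong, intro allI impI)
      fix k assume k: "k < r"
      have pk: "\<pi> k < r" using permutes_in_image[OF \<open>\<pi> permutes {..<r}\<close>, of k] k by simp
      have "\<gamma> (\<pi> k) = k" unfolding \<pi>_def using perm by (simp add: permutes_inverses)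
      then have "fst (g (\<pi> k)) = k" using pk by (simp add: \<gamma>_def)
      then have "u k = [(\<pi> k, snd (g (\<pi> k)))]" using ug[OF pk] by simp
      then show "u k = (if k \<in> F then W.winverse [(\<pi> k, True)] else [(\<pi> k, True)])"
        using k by (simp add: F_def)
    qed
  qed
qed

section \<open>Edge paths, markings and the action\<close>

definition gwf :: "'a mgraph_scheme \<Rightarrow> bool" where
  "gwf G \<longleftrightarrow> (\<forall>e\<in>edges G. org G e < nv G)"

lemma bar_edges [simp]: "bar e \<in> edges G \<longleftrightarrow> e \<in> edges G"
proof -
  have "e' < 2 * n \<longleftrightarrow> e' div 2 < n" for e' n :: nat by auto
  then show ?thesis by (simp add: edges_def)
qed

lemma is_path_Nil [simp]: "is_path G u [] v \<longleftrightarrow> u = v \<and> u < nv G"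
  by (auto simp: is_path_def)

lemma is_path_Cons:
  assumes "gwf G"
  shows "is_path G u (e # p) v \<longleftrightarrow> e \<in> edges G \<and> org G e = u \<and> is_path G (ter G e) p v"
  using assms by (cases p) (auto simp: is_path_def gwf_def ter_def)

lemma is_path_append:
  assumes "gwf G"
  shows "is_path G u (p @ q) v \<longleftrightarrow> (\<exists>w. is_path G u p w \<and> is_path G w q v)"
proof (induction p arbitrary: u)
  case Nil
  have "is_path G u q v \<Longrightarrow> u < nv G" by (simp add: is_path_def)
  then show ?case by auto
qed (auto simp: is_path_Cons[OF assms])

lemma is_path_rev:
  assumes "gwf G"
  shows "is_path G u p v \<Longrightarrow> is_path G v (rev_path p) u"
proof (induction p arbitrary: u)
  case (Cons e p)
  have "u < nv G" using Cons.prems by (simp add: is_path_def)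
  moreover have "is_path G v (rev_path p) (ter G e)" "e \<in> edges G" "org G e = u"
    using Cons by (auto simp: is_path_Cons[OF assms])
  moreover have "ter G (bar e) = org G e" by (simp add: ter_def)
  ultimately show ?case
    by (auto simp: rev_path_eq is_path_append[OF assms] is_path_Cons[OF assms] ter_def)
qed (simp add: rev_path_eq)

lemma is_path_fr:
  assumes "gwf G"
  shows "is_path G u p v \<Longrightarrow> is_path G u (B.fr p) v"
proof (induction p arbitrary: u)
  case (Cons e p)
  then have *: "e \<in> edges G" "org G e = u" "is_path G (ter G e) (B.fr p) v"
    by (auto simp: is_path_Cons[OF assms])
  then show ?case
    by (cases "B.fr p") (auto simp: B.fr_Cons is_path_Cons[OF assms] ter_def)
qed simp

lemma is_path_edges: "is_path G u p v \<Longrightarrow> set p \<subseteq> edges G"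
  by (simp add: is_path_def)

definition sgn_path :: "(nat \<Rightarrow> nat list) \<Rightarrow> nat \<times> bool \<Rightarrow> nat list" where
  "sgn_path \<rho> x = (if snd x then \<rho> (fst x) else rev_path (\<rho> (fst x)))"

lemma lift_alt: "lift \<rho> w = B.fr (concat (map (sgn_path \<rho>) w))"
  by (simp add: lift_def sgn_path_def[abs_def])

lemma sgn_path_winv: "sgn_path \<rho> (winv x) = B.winverse (sgn_path \<rho> x)"
  by (auto simp: sgn_path_def winv_def rev_path_eq)

lemma concat_sgn_path_winverse:
  "concat (map (sgn_path \<rho>) (W.winverse w)) = B.winverse (concat (map (sgn_path \<rho>) w))"
  by (induction w) (auto simp: sgn_path_winv)

lemma lift_fr: "lift \<rho> (W.fr w) = lift \<rho> w"
  unfolding lift_alt by (rule W.hom_freered) (auto simp: sgn_path_winv)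

lemma lift_append: "lift \<rho> (v @ w) = B.fr (lift \<rho> v @ lift \<rho> w)"
  by (simp add: lift_alt)

lemma lift_Cons: "lift \<rho> (x # w) = B.fr (sgn_path \<rho> x @ lift \<rho> w)"
  by (simp add: lift_alt)

lemma lift_winverse: "lift \<rho> (W.winverse w) = B.winverse (lift \<rho> w)"
  by (simp add: lift_alt concat_sgn_path_winverse B.fr_winverse)

lemma lift_lift: "lift (\<lambda>i. lift \<rho> (\<sigma> i)) w = lift \<rho> (ext \<sigma> w)"
proof -
  have s: "sgn_path (\<lambda>i. lift \<rho> (\<sigma> i)) x = lift \<rho> (sgn_word \<sigma> x)" for x
    by (simp add: sgn_path_def sgn_word_def lift_winverse rev_path_eq)
  have "lift (\<lambda>i. lift \<rho> (\<sigma> i)) w = lift \<rho> (concat (map (sgn_word \<sigma>) w))"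
    by (induction w) (simp_all add: lift_Cons s lift_append, simp add: lift_alt)
  then show ?thesis by (simp add: lift_fr ext_def)
qed

lemma act_act: "act (act x \<sigma>) \<tau> = act x (\<lambda>i. ext \<sigma> (\<tau> i))"
  by (simp add: act_def lift_lift)

lemma is_path_sgn_path:
  assumes "gwf G" "\<forall>i<r. is_path G b (\<rho> i) b" "fst x < r"
  shows "is_path G b (sgn_path \<rho> x) b"
  using assms is_path_rev[OF assms(1)] by (simp add: sgn_path_def)

lemma is_path_concat:
  assumes "gwf G" "b < nv G" "\<forall>i<r. is_path G b (\<rho> i) b" "\<forall>x\<in>set w. fst x < r"
  shows "is_path G b (concat (map (sgn_path \<rho>) w)) b"
  using assms(4)
proof (induction w)
  case (Cons x w)
  then show ?case using is_path_sgn_path[OF assms(1,3), of x] by (auto simp: is_path_append[OF assms(1)])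
qed (simp add: assms)

lemma is_path_lift:
  assumes "gwf G" "b < nv G" "\<forall>i<r. is_path G b (\<rho> i) b" "\<forall>x\<in>set w. fst x < r"
  shows "is_path G b (lift \<rho> w) b"
  unfolding lift_alt by (rule is_path_fr[OF assms(1) is_path_concat[OF assms]])

text \<open>A marking is certified by labels of the edges in the free group together with paths \<open>T v\<close> from
  the base point: the labels induce the inverse of the marking.\<close>
lemma marking_okI:
  fixes G :: "'a mgraph_scheme"
  assumes wf: "gwf G" and b: "base G < nv G" and m: "\<forall>i<r. is_path G (base G) (mark G i) (base G)"
    and inv: "\<And>e. e \<in> edges G \<Longrightarrow> lb (bar e) = W.winverse (lb e)"
    and lt: "\<And>e x. e \<in> edges G \<Longrightarrow> x \<in> set (lb e) \<Longrightarrow> fst x < r"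
    and lab: "\<And>i. i < r \<Longrightarrow> W.fr (concat (map lb (mark G i))) = [(i, True)]"
    and T: "T (base G) = []"
    and tree: "\<And>e. e \<in> edges G \<Longrightarrow> lift (mark G) (lb e) = B.fr (T (org G e) @ e # rev_path (T (ter G e)))"
  shows "marking_ok r G"
proof -
  define \<Lambda> where "\<Lambda> p = W.fr (concat (map lb p))" for p
  have \<Lambda>_fr: "\<Lambda> (B.fr p) = \<Lambda> p" if "set p \<subseteq> edges G" for p
    unfolding \<Lambda>_def by (rule B.hom_freered) (use that inv in \<open>auto simp: subset_iff\<close>)
  have rev: "concat (map lb (B.winverse p)) = W.winverse (concat (map lb p))" if "set p \<subseteq> edges G" for p
    using that by (induction p) (auto simp: inv)
  have lab': "\<Lambda> (sgn_path (mark G) x) = [x]" if "fst x < r" for x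
  proof -
    have "set (mark G (fst x)) \<subseteq> edges G" using m that is_path_edges by blast
    then show ?thesis using lab[OF that]
      by (cases x) (auto simp: sgn_path_def \<Lambda>_def rev_path_eq rev W.fr_winverse)
  qed
  have 1: "\<Lambda> (lift (mark G) w) = w" if "w \<in> words r" for w
  proof -
    have w: "\<forall>x\<in>set w. fst x < r" using that by (simp add: words_def)
    have "\<Lambda> (concat (map (sgn_path (mark G)) w)) = W.fr w" using w
    proof (induction w)
      case (Cons x w)
      have "\<Lambda> (concat (map (sgn_path (mark G)) (x # w))) = W.fr (\<Lambda> (sgn_path (mark G) x) @ \<Lambda> (concat (map (sgn_path (mark G)) w)))"
        by (simp add: \<Lambda>_def)
      also have "\<dots> = W.fr ([x] @ W.fr w)" using Cons lab' by simp
      also have "\<dots> = W.fr (x # w)" by (subst W.fr_append_fr_right) simp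
      finally show ?case .
    qed (simp add: \<Lambda>_def)
    moreover have "set (concat (map (sgn_path (mark G)) w)) \<subseteq> edges G"
      using is_path_edges[OF is_path_concat[OF wf b m w]] .
    ultimately show ?thesis using that \<Lambda>_fr by (simp add: lift_alt)
  qed
  \<comment> \<open>Telescoping: the return path after each edge cancels the approach to the next
    one.\<close>
  have tel: "lift (mark G) (concat (map lb p)) = B.fr (T u @ p @ rev_path (T v))" if "is_path G u p v" for u p v
    using that
  proof (induction p arbitrary: u)
    case (Cons e p)
    then have e: "e \<in> edges G" "org G e = u" "is_path G (ter G e) p v" by (auto simp: is_path_Cons[OF wf])
    have "lift (mark G) (concat (map lb (e # p))) =
        B.fr ((T u @ [e] @ rev_path (T (ter G e))) @ (T (ter G e) @ p @ rev_path (T v)))"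
      using Cons.IH[OF e(3)] tree[OF e(1)] e(2) by (simp add: lift_append)
    also have "\<dots> = B.fr ((T u @ [e]) @ (B.winverse (T (ter G e)) @ T (ter G e) @ (p @ rev_path (T v))))"
      by (simp add: rev_path_eq)
    also have "\<dots> = B.fr ((T u @ [e]) @ (p @ rev_path (T v)))"
      by (rule B.fr_append_cong[OF refl B.fr_winverse_left])
    finally show ?case by simp
  qed (simp add: lift_alt rev_path_eq)
  have 2: "lift (mark G) (\<Lambda> p) = p" if "is_path G (base G) p (base G)" "reduced_by bar p" for p
    using tel[OF that(1)] B.fr_reduced[OF that(2)] T by (simp add: \<Lambda>_def lift_fr rev_path_eq)
  have "bij_betw (lift (mark G)) (words r) {p. is_path G (base G) p (base G) \<and> reduced_by bar p}"
  proof (rule bij_betw_byWitness[where f' = \<Lambda>])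
    show "lift (mark G) ` words r \<subseteq> {p. is_path G (base G) p (base G) \<and> reduced_by bar p}"
    proof clarify
      fix w assume "w \<in> words r"
      then have "\<forall>x\<in>set w. fst x < r" by (simp add: words_def)
      from is_path_lift[OF wf b m this]
      show "is_path G (base G) (lift (mark G) w) (base G) \<and> reduced_by bar (lift (mark G) w)"
        by (simp add: lift_alt B.reduced_fr)
    qed
    show "\<Lambda> ` {p. is_path G (base G) p (base G) \<and> reduced_by bar p} \<subseteq> words r"
    proof clarify
      fix p assume "is_path G (base G) p (base G)"
      then have "set p \<subseteq> edges G" by (rule is_path_edges)
      then have "\<forall>x\<in>set (concat (map lb p)). fst x < r" using lt by auto
      then have "\<forall>x\<in>set (\<Lambda> p). fst x < r"
        using W.set_fr[of "concat (map lb p)"] unfolding \<Lambda>_def by blast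
      then show "\<Lambda> p \<in> words r" by (simp add: \<Lambda>_def words_iff)
    qed
  qed (use 1 2 in auto)
  then show ?thesis using b m by (simp add: marking_ok_def)
qed

section \<open>Invariance under changes of marking and lengths, and the action on points\<close>

lemma chain_upd [simp]: "chain (G\<lparr>mark := m\<rparr>) p = chain G p" "chain (G\<lparr>len := l\<rparr>) p = chain G p"
  by (induction p rule: induct_list012) (auto simp: ter_def)

lemma edges_upd [simp]: "edges (G\<lparr>mark := m\<rparr>) = edges G" "edges (G\<lparr>len := l\<rparr>) = edges G"
  by (simp_all add: edges_def)

lemma ter_upd [simp]: "ter (G\<lparr>mark := m\<rparr>) e = ter G e" "ter (G\<lparr>len := l\<rparr>) e = ter G e"
  by (simp_all add: ter_def)

lemma is_path_upd [simp]: "is_path (G\<lparr>mark := m\<rparr>) u p v = is_path G u p v"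
   "is_path (G\<lparr>len := l\<rparr>) u p v = is_path G u p v"
  by (simp_all add: is_path_def)

lemma based_circuit_upd [simp]: "based_circuit (G\<lparr>mark := m\<rparr>) p = based_circuit G p"
  "based_circuit (G\<lparr>len := l\<rparr>) p = based_circuit G p"
  by (simp_all add: based_circuit_def)

lemma entropy_upd [simp]: "entropy (G\<lparr>mark := m\<rparr>) l' = entropy G l'" "entropy (G\<lparr>len := l\<rparr>) l' = entropy G l'"
  by (simp_all add: entropy_def)

lemma hess_form_upd [simp]: "hess_form (G\<lparr>mark := m\<rparr>) l' v = hess_form G l' v"
  "hess_form (G\<lparr>len := l\<rparr>) l' v = hess_form G l' v"
  by (simp_all add: hess_form_def)

lemma graph_ok_upd [simp]: "graph_ok (G\<lparr>mark := m\<rparr>) = graph_ok G" "graph_ok (G\<lparr>len := l\<rparr>) = graph_ok G"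
  by (simp_all add: graph_ok_def valence_def)

lemma marking_ok_len [simp]: "marking_ok r (G\<lparr>len := l\<rparr>) = marking_ok r G"
  by (simp add: marking_ok_def)

lemma graph_ok_gwf: "graph_ok G \<Longrightarrow> gwf G" by (simp add: graph_ok_def gwf_def)

lemma act_sel [simp]: "nv (act x \<sigma>) = nv x" "ne (act x \<sigma>) = ne x" "org (act x \<sigma>) = org x"
  "base (act x \<sigma>) = base x" "len (act x \<sigma>) = len x" "mark (act x \<sigma>) i = lift (mark x) (\<sigma> i)"
  "edges (act x \<sigma>) = edges x" "ter (act x \<sigma>) = ter x" "is_path (act x \<sigma>) = is_path x"
  "graph_ok (act x \<sigma>) = graph_ok x" "entropy (act x \<sigma>) l = entropy x l"
  "hess_form (act x \<sigma>) l v = hess_form x l v"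
  by (simp_all add: act_def fun_eq_iff)

lemma marking_ok_act:
  assumes "gwf x" "marking_ok r x" "is_aut r \<sigma>" shows "marking_ok r (act x \<sigma>)"
proof -
  have s: "\<forall>i<r. \<forall>y\<in>set (\<sigma> i). fst y < r" using assms(3) by (auto simp: is_aut_iff words_def)
  have "bij_betw (lift (mark x) \<circ> ext \<sigma>) (words r) {p. is_path x (base x) p (base x) \<and> reduced_by bar p}"
    using assms by (intro bij_betw_trans[of _ _ "words r"]) (auto simp: is_aut_iff marking_ok_def)
  moreover have "lift (mark x) \<circ> ext \<sigma> = lift (mark (act x \<sigma>))"
    by (simp add: fun_eq_iff act_def lift_lift)
  moreover have "is_path x (base x) (lift (mark x) (\<sigma> i)) (base x)" if "i < r" for i
    by (rule is_path_lift[OF assms(1), of _ r]) (use assms s that in \<open>auto simp: marking_ok_def\<close>)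
  ultimately show ?thesis using assms(2) by (simp add: marking_ok_def)
qed

lemma point_act: "point r x \<Longrightarrow> is_aut r \<sigma> \<Longrightarrow> point r (act x \<sigma>)"
  using marking_ok_act graph_ok_gwf by (auto simp: point_def)

text \<open>The edge map of the collapse, with zero edges sent to the empty path, is a homomorphism
  up to free reduction, and so is conjugation by \<open>p\<close>. The relation between the two
  markings thus passes from generators to all words, in particular to the words
  \<open>\<sigma> i\<close>, with the same vertex and edge maps.\<close>

lemma collapse_rep_act:
  assumes rep: "collapse_rep r G l x" and G: "gwf G" "marking_ok r G" and \<sigma>: "is_aut r \<sigma>"
  shows "collapse_rep r (act G \<sigma>) l (act x \<sigma>)"
proof -
  from rep obtain \<beta>V \<beta>E p where
    pt: "point r x" "\<forall>i<ne G. 0 \<le> l i" and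
    R1: "\<beta>V ` {..<nv G} = {..<nv x}" "bij_betw \<beta>E {e\<in>edges G. 0 < l (e div 2)} (edges x)" and
    R2: "\<forall>e\<in>edges G. 0 < l (e div 2) \<longrightarrow> \<beta>E (bar e) = bar (\<beta>E e)
          \<and> org x (\<beta>E e) = \<beta>V (org G e) \<and> len x (\<beta>E e div 2) = l (e div 2)" and
    R3: "\<forall>e\<in>edges G. l (e div 2) = 0 \<longrightarrow> \<beta>V (org G e) = \<beta>V (ter G e)"
       "\<forall>u<nv G. \<forall>v<nv G. \<beta>V u = \<beta>V v \<longrightarrow> (\<exists>q. is_path G u q v \<and> (\<forall>e\<in>set q. l (e div 2) = 0))"
       "\<forall>q u. is_path G u q u \<and> reduced_by bar q \<and> q \<noteq> [] \<longrightarrow> (\<exists>e\<in>set q. 0 < l (e div 2))"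
       "is_path x (\<beta>V (base G)) p (base x)" and
    R4: "\<forall>i<r. freered bar (rev_path p @ map \<beta>E (filter (\<lambda>e. 0 < l (e div 2)) (mark G i)) @ p)
              = freered bar (mark x i)"
    unfolding collapse_rep_def by blast
  define f where "f e = (if 0 < l (e div 2) then [\<beta>E e] else [])" for e
  have f: "map \<beta>E (filter (\<lambda>e. 0 < l (e div 2)) q) = concat (map f q)" for q
    by (induction q) (auto simp: f_def)
  have f_bar: "f (bar e) = B.winverse (f e)" if "e \<in> edges G" for e
    using that R2 by (auto simp: f_def)
  have f_rev: "concat (map f (B.winverse q)) = B.winverse (concat (map f q))" if "set q \<subseteq> edges G" for q
    using that by (induction q) (auto simp: f_bar)
  have f_fr: "B.fr (concat (map f (B.fr q))) = B.fr (concat (map f q))" if "set q \<subseteq> edges G" for q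
    by (rule B.hom_freered) (use that in \<open>auto simp: f_bar subset_iff\<close>)
  have mG: "\<forall>i<r. is_path G (base G) (mark G i) (base G)" and b: "base G < nv G" using G by (auto simp: marking_ok_def)
  have letter: "B.fr (B.winverse p @ concat (map f (sgn_path (mark G) y)) @ p) = B.fr (sgn_path (mark x) y)"
    if y: "fst y < r" for y
  proof -
    have h: "B.fr (B.winverse p @ concat (map f (mark G (fst y))) @ p) = B.fr (mark x (fst y))"
      using R4 y by (simp add: f rev_path_eq)
    have e: "set (mark G (fst y)) \<subseteq> edges G" using mG y is_path_edges by blast
    show ?thesis
      using h B.fr_winverse_cong[OF h] by (simp add: sgn_path_def rev_path_eq f_rev[OF e])
  qed
  have conj: "B.fr (B.winverse p @ concat (map f (concat (map (sgn_path (mark G)) w))) @ p)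
      = B.fr (concat (map (sgn_path (mark x)) w))" if "\<forall>y\<in>set w. fst y < r" for w
    using that
  proof (induction w)
    case (Cons y w)
    let ?F = "\<lambda>w. concat (map f (concat (map (sgn_path (mark G)) w)))"
    \<comment> \<open>Inserting \<open>p p^-1\<close> between consecutive factors makes the
      conjugation multiplicative.\<close>
    have "B.fr (p @ B.winverse p @ ?F w @ p) = B.fr (?F w @ p)" by (rule B.fr_winverse_right)
    then have "B.fr ((B.winverse p @ concat (map f (sgn_path (mark G) y))) @ (?F w @ p)) =
        B.fr ((B.winverse p @ concat (map f (sgn_path (mark G) y))) @ (p @ B.winverse p @ ?F w @ p))"
      by (intro B.fr_append_cong[OF refl]) simp
    also have "\<dots> = B.fr ((B.winverse p @ concat (map f (sgn_path (mark G) y)) @ p) @ (B.winverse p @ ?F w @ p))"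
      by simp
    also have "\<dots> = B.fr (sgn_path (mark x) y @ concat (map (sgn_path (mark x)) w))"
      using Cons letter by (intro B.fr_append_cong) auto
    finally show ?case by simp
  qed simp
  have new: "\<forall>i<r. freered bar (rev_path p @ map \<beta>E (filter (\<lambda>e. 0 < l (e div 2)) (mark (act G \<sigma>) i)) @ p)
              = freered bar (mark (act x \<sigma>) i)"
  proof (intro allI impI)
    fix i assume i: "i < r"
    have s: "\<forall>y\<in>set (\<sigma> i). fst y < r" using \<sigma> i by (auto simp: is_aut_iff words_def)
    let ?c = "concat (map (sgn_path (mark G)) (\<sigma> i))"
    have "set ?c \<subseteq> edges G" by (rule is_path_edges[OF is_path_concat[OF G(1) b mG s]])
    then have "B.fr (B.winverse p @ (concat (map f (B.fr ?c)) @ p)) = B.fr (B.winverse p @ (concat (map f ?c) @ p))"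
      by (intro B.fr_append_cong f_fr refl)
    then show "freered bar (rev_path p @ map \<beta>E (filter (\<lambda>e. 0 < l (e div 2)) (mark (act G \<sigma>) i)) @ p)
              = freered bar (mark (act x \<sigma>) i)"
      using conj[OF s] by (simp add: f rev_path_eq lift_alt)
  qed
  show ?thesis unfolding collapse_rep_def
    using point_act[OF pt(1) \<sigma>] pt(2) R1 R2 R3 new
    by (intro conjI exI[of _ \<beta>V] exI[of _ \<beta>E] exI[of _ p]) auto
qed

text \<open>Automorphisms that agree on the first \<open>r\<close> generators act with results that
  differ as records; this allows such records to be exchanged.\<close>

lemma collapse_rep_cong:
  assumes "collapse_rep r G l x" "point r x'" "nv x' = nv x" "ne x' = ne x" "org x' = org x"
    "base x' = base x" "len x' = len x" "\<forall>i<r. freered bar (mark x' i) = freered bar (mark x i)"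
  shows "collapse_rep r G l x'"
proof -
  define m where "m = mark x'"
  have x': "x' = x\<lparr>mark := m\<rparr>" using assms by (simp add: m_def)
  have 1: "edges x' = edges x" "is_path x' = is_path x"
    by (simp_all add: x' fun_eq_iff)
  show ?thesis using assms(1) unfolding collapse_rep_def 1 assms(3-7)
    using assms(2,8) by auto
qed

section \<open>Concatenating paths inside cells\<close>

text \<open>An integrable majorant for the speed of the paths below near the ends of a cell.\<close>
definition weight :: "real \<Rightarrow> real" where "weight s = (s * (1 - s)) powr (- 3 / 4)"

definition weight_integral :: real where
  "weight_integral = enn2real (\<integral>\<^sup>+ s. indicator {0<..<1} s * ennreal (weight s) \<partial>lborel)"

lemma weight_measurable [measurable]: "weight \<in> borel_measurable borel"
  unfolding weight_def by measurable

lemma weight_nonneg [simp]: "0 \<le> weight s" by (simp add: weight_def)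

lemma nn_integral_powr_unit: "(\<integral>\<^sup>+ s. indicator {0..1} s * ennreal (s powr (- 3 / 4)) \<partial>lborel) = ennreal 4"
proof -
  have "((\<lambda>x. x powr (- 3 / 4)) has_integral (1 powr (- 3 / 4 + 1) / (- 3 / 4 + 1))) {0..1::real}"
    by (rule has_integral_powr_from_0) auto
  then have "((\<lambda>x. x powr (- 3 / 4)) has_integral 4) {0..1::real}" by simp
  from nn_integral_has_integral_lebesgue'[OF _ this] show ?thesis
    by (simp add: mult.commute)
qed

text \<open>One of \<open>s\<close> and \<open>1 - s\<close> is at least 1/2, which separates the
  singularities at the two ends.\<close>

lemma weight_bound: "0 < s \<Longrightarrow> s < 1 \<Longrightarrow> weight s \<le> 2 powr (3/4) * (s powr (- 3 / 4) + (1 - s) powr (- 3 / 4))"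
proof -
  assume s: "0 < s" "s < 1"
  have half: "y powr (- 3 / 4) \<le> 2 powr (3/4)" if "1 / 2 \<le> y" for y :: real
  proof -
    have "y powr (- 3 / 4) \<le> (1 / 2) powr (- 3 / 4)" using that by (intro powr_mono2') auto
    also have "\<dots> = 2 powr (3/4)" by (simp add: powr_divide powr_minus field_simps)
    finally show ?thesis .
  qed
  have "weight s = s powr (- 3 / 4) * (1 - s) powr (- 3 / 4)"
    unfolding weight_def using s by (subst powr_mult) auto
  also have "\<dots> \<le> 2 powr (3/4) * (s powr (- 3 / 4) + (1 - s) powr (- 3 / 4))"
  proof (cases "1 / 2 \<le> s")
    case True
    have "s powr (- 3 / 4) * (1 - s) powr (- 3 / 4) \<le> 2 powr (3/4) * (1 - s) powr (- 3 / 4)"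
      using half[OF True] by (intro mult_right_mono) auto
    also have "\<dots> \<le> 2 powr (3/4) * (s powr (- 3 / 4) + (1 - s) powr (- 3 / 4))"
      by (intro mult_left_mono) auto
    finally show ?thesis .
  next
    case False
    have "s powr (- 3 / 4) * (1 - s) powr (- 3 / 4) \<le> s powr (- 3 / 4) * 2 powr (3/4)"
      using half[of "1 - s"] False by (intro mult_left_mono) auto
    also have "\<dots> = 2 powr (3/4) * s powr (- 3 / 4)" by simp
    also have "\<dots> \<le> 2 powr (3/4) * (s powr (- 3 / 4) + (1 - s) powr (- 3 / 4))"
      by (intro mult_left_mono) auto
    finally show ?thesis .
  qed
  finally show ?thesis .
qed

lemma weight_integral: "(\<integral>\<^sup>+ s. indicator {0<..<1} s * ennreal (weight s) \<partial>lborel) = ennreal weight_integral"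
proof -
  let ?p = "\<lambda>s::real. indicator {0..1} s * ennreal (s powr (- 3 / 4))"
  let ?C = "ennreal (2 powr (3/4))"
  have refl: "(\<integral>\<^sup>+ s. ?p (1 - s) \<partial>lborel) = ennreal 4"
    using nn_integral_real_affine[of ?p "- 1" 1] nn_integral_powr_unit by simp
  have "(\<integral>\<^sup>+ s. indicator {0<..<1} s * ennreal (weight s) \<partial>lborel) \<le> (\<integral>\<^sup>+ s. ?C * (?p s + ?p (1 - s)) \<partial>lborel)"
  proof (rule nn_integral_mono)
    fix s :: real
    show "indicator {0<..<1} s * ennreal (weight s) \<le> ?C * (?p s + ?p (1 - s))"
      using weight_bound[of s]
      by (cases "0 < s \<and> s < 1") (auto simp: ennreal_mult[symmetric] ennreal_plus[symmetric] simp del: ennreal_plus)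
  qed
  also have "\<dots> = ?C * (\<integral>\<^sup>+ s. ?p s + ?p (1 - s) \<partial>lborel)"
    by (rule nn_integral_cmult) measurable
  also have "(\<integral>\<^sup>+ s. ?p s + ?p (1 - s) \<partial>lborel) = (\<integral>\<^sup>+ s. ?p s \<partial>lborel) + (\<integral>\<^sup>+ s. ?p (1 - s) \<partial>lborel)"
    by (rule nn_integral_add) measurable
  also have "\<dots> = ennreal 4 + ennreal 4" by (simp only: nn_integral_powr_unit refl)
  finally have "(\<integral>\<^sup>+ s. indicator {0<..<1} s * ennreal (weight s) \<partial>lborel) \<noteq> top"
    by (rule neq_top_trans[rotated]) (simp add: ennreal_mult_eq_top_iff)
  then show ?thesis unfolding weight_integral_def by (simp add: less_top)
qed

lemma weight_integral_nonneg [simp]: "0 \<le> weight_integral" by (simp add: weight_integral_def)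

text \<open>One piece of a path, with a Hessian bound for all multiples of the velocity: this makes the
  bound survive reversal and affine reparametrisation.\<close>
definition cell_path :: "nat \<Rightarrow> mgraph \<Rightarrow> (real \<Rightarrow> nat \<Rightarrow> real) \<Rightarrow> (real \<Rightarrow> nat \<Rightarrow> real) \<Rightarrow> mgraph \<Rightarrow> mgraph \<Rightarrow> real \<Rightarrow> bool" where
  "cell_path r G c dc x y K \<longleftrightarrow> 0 \<le> K \<and> graph_ok G \<and> marking_ok r G \<and>
     (\<forall>s\<in>{0<..<1}. (\<forall>i<ne G. 0 < c s i) \<and> entropy G (c s) = 1) \<and>
     (\<forall>i<ne G. continuous_on {0..1} (\<lambda>s. c s i) \<and>
        (\<forall>s\<in>{0<..<1}. ((\<lambda>s. c s i) has_real_derivative dc s i) (at s)) \<and>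
        continuous_on {0<..<1} (\<lambda>s. dc s i)) \<and>
     collapse_rep r G (c 0) x \<and> collapse_rep r G (c 1) y \<and>
     (\<forall>s\<in>{0<..<1}. \<forall>k. hess_form G (c s) (\<lambda>i. k * dc s i) \<le> k\<^sup>2 * (K * (weight s)\<^sup>2))"

definition cell_seg :: "nat \<Rightarrow> mgraph \<Rightarrow> mgraph \<Rightarrow> real \<Rightarrow> bool" where
  "cell_seg r x y K \<longleftrightarrow> (\<exists>G c dc. cell_path r G c dc x y K)"

lemma cell_path_rev:
  assumes "cell_path r G c dc x y K"
  shows "cell_path r G (\<lambda>s. c (1 - s)) (\<lambda>s i. - dc (1 - s) i) y x K"
proof -
  note P = assms[unfolded cell_path_def]
  have D: "continuous_on {0..1} (\<lambda>s. c (1 - s) i)"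
    "\<forall>s\<in>{0<..<1}. ((\<lambda>s. c (1 - s) i) has_real_derivative - dc (1 - s) i) (at s)"
    "continuous_on {0<..<1} (\<lambda>s. - dc (1 - s) i)" if i: "i < ne G" for i
  proof -
    have *: "continuous_on {0..1} (\<lambda>s. c s i)" "continuous_on {0<..<1} (\<lambda>s. dc s i)" using P i by auto
    show "continuous_on {0..1} (\<lambda>s. c (1 - s) i)"
      by (rule continuous_on_compose2[OF *(1)]) (auto intro!: continuous_intros)
    show "continuous_on {0<..<1} (\<lambda>s. - dc (1 - s) i)"
      by (intro continuous_on_minus continuous_on_compose2[OF *(2)]) (auto intro!: continuous_intros)
    show "\<forall>s\<in>{0<..<1}. ((\<lambda>s. c (1 - s) i) has_real_derivative - dc (1 - s) i) (at s)"
    proof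
      fix s :: real assume "s \<in> {0<..<1}"
      then have "((\<lambda>s. c s i) has_real_derivative dc (1 - s) i) (at (1 - s))" using P i by auto
      moreover have "((\<lambda>s. 1 - s) has_real_derivative - 1) (at s)" by (auto intro!: derivative_eq_intros)
      ultimately show "((\<lambda>s. c (1 - s) i) has_real_derivative - dc (1 - s) i) (at s)"
        using DERIV_chain2[of "\<lambda>s. c s i" "dc (1 - s) i" "\<lambda>s. 1 - s" s "- 1"] by simp
    qed
  qed
  have H: "hess_form G (c (1 - s)) (\<lambda>i. k * - dc (1 - s) i) \<le> k\<^sup>2 * (K * (weight s)\<^sup>2)" if "s \<in> {0<..<1}" for s k
  proof -
    have "\<forall>s\<in>{0<..<1}. \<forall>k. hess_form G (c s) (\<lambda>i. k * dc s i) \<le> k\<^sup>2 * (K * (weight s)\<^sup>2)"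
      using P by blast
    from this[rule_format, of "1 - s" "- k"] that
    have "hess_form G (c (1 - s)) (\<lambda>i. - k * dc (1 - s) i) \<le> (- k)\<^sup>2 * (K * (weight (1 - s))\<^sup>2)"
      by simp
    then show ?thesis by (simp add: weight_def mult.commute)
  qed
  show ?thesis unfolding cell_path_def using P D H by simp
qed

lemma seg_sym: "cell_seg r x y K \<Longrightarrow> cell_seg r y x K"
  unfolding cell_seg_def using cell_path_rev by blast

lemma seg_act: assumes "cell_seg r x y K" "is_aut r \<sigma>" shows "cell_seg r (act x \<sigma>) (act y \<sigma>) K"
proof -
  from assms(1) obtain G c dc where P: "cell_path r G c dc x y K" unfolding cell_seg_def by blast
  then have g: "gwf G" and m: "marking_ok r G" by (auto simp: cell_path_def graph_ok_gwf)
  have "cell_path r (act G \<sigma>) c dc (act x \<sigma>) (act y \<sigma>) K"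
    using P collapse_rep_act[OF _ g m assms(2)] marking_ok_act[OF g m assms(2)]
    unfolding cell_path_def by simp
  then show ?thesis unfolding cell_seg_def by blast
qed

text \<open>Distance bounds in units of \<open>weight_integral\<close>. Keeping chains of cells
  abstract postpones the joint parametrisation over the unit interval to \<open>conn_dh\<close> and
  makes symmetry and invariance plain inductions.\<close>

inductive conn :: "nat \<Rightarrow> mgraph \<Rightarrow> mgraph \<Rightarrow> real \<Rightarrow> bool" for r where
  conn_seg: "cell_seg r x y K \<Longrightarrow> conn r x y (sqrt K)"
| conn_trans: "conn r x y C \<Longrightarrow> conn r y z D \<Longrightarrow> conn r x z (C + D)"

lemma conn_sym: "conn r x y D \<Longrightarrow> conn r y x D"
proof (induction rule: conn.induct)
  case (conn_trans x y C z D)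
  then show ?case using conn.conn_trans[of r z y D x C] by (simp add: add.commute)
qed (auto intro: conn_seg seg_sym)

lemma conn_act: "conn r x y D \<Longrightarrow> is_aut r \<sigma> \<Longrightarrow> conn r (act x \<sigma>) (act y \<sigma>) D"
  by (induction rule: conn.induct) (auto intro: conn.intros seg_act)

lemma conn_chain: "conn r x y D \<Longrightarrow> \<exists>n z K. 1 \<le> n \<and> z 0 = x \<and> z n = y \<and>
    (\<forall>k<n. cell_seg r (z k) (z (Suc k)) (K k)) \<and> D = (\<Sum>k<n. sqrt (K k))"
proof (induction rule: conn.induct)
  case (conn_seg x y K)
  then show ?case
    by (intro exI[of _ 1] exI[of _ "\<lambda>k. if k = 0 then x else y"] exI[of _ "\<lambda>_. K"]) simp
next
  case (conn_trans x y C w D)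
  then obtain n z K m z' K' where
    a: "1 \<le> n" "z 0 = x" "z n = y" "\<forall>k<n. cell_seg r (z k) (z (Suc k)) (K k)" "C = (\<Sum>k<n. sqrt (K k))" and
    b: "1 \<le> m" "z' 0 = y" "z' m = w" "\<forall>k<m. cell_seg r (z' k) (z' (Suc k)) (K' k)" "D = (\<Sum>k<m. sqrt (K' k))"
    by metis
  let ?z = "\<lambda>k. if k \<le> n then z k else z' (k - n)"
  let ?K = "\<lambda>k. if k < n then K k else K' (k - n)"
  have "cell_seg r (?z k) (?z (Suc k)) (?K k)" if "k < n + m" for k
  proof -
    consider "k < n" | "k = n" | "n < k" by linarith
    then show ?thesis
    proof cases
      case 3
      then have "cell_seg r (z' (k - n)) (z' (Suc (k - n))) (K' (k - n))" using b that by auto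
      then show ?thesis using 3 by (simp add: Suc_diff_le)
    qed (use a b that in auto)
  qed
  moreover have "(\<Sum>k<n + m. sqrt (?K k)) = C + D"
  proof -
    have "{..<n + m} = {..<n} \<union> {n..<n + m}" by auto
    then have "(\<Sum>k<n + m. sqrt (?K k)) = (\<Sum>k<n. sqrt (?K k)) + (\<Sum>k=n..<n + m. sqrt (?K k))"
      by (simp add: sum.union_disjoint ivl_disj_int)
    also have "(\<Sum>k=n..<n + m. sqrt (?K k)) = (\<Sum>k<m. sqrt (K' k))"
      by (rule sum.reindex_bij_witness[of _ "\<lambda>k. k + n" "\<lambda>k. k - n"]) auto
    finally show ?thesis using a b by simp
  qed
  ultimately show ?case using a b
    by (intro exI[of _ "n + m"] exI[of _ ?z] exI[of _ ?K]) auto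
qed

text \<open>Squeezing a piece into an interval of length \<open>1 / n\<close> multiplies its speed
  by \<open>n\<close> and leaves the integral unchanged. No sign of \<open>h\<close> is assumed:
  \<open>sqrt\<close> is monotone on all reals and \<open>ennreal\<close> truncates negative
  values.\<close>

lemma nn_integral_piece:
  fixes n :: nat and k :: nat
  assumes n: "1 \<le> n" and K: "0 \<le> K" and h: "\<And>s. 0 < s \<Longrightarrow> s < 1 \<Longrightarrow> h s \<le> (real n)\<^sup>2 * (K * (weight s)\<^sup>2)"
  shows "(\<integral>\<^sup>+ s. indicator {real k / n<..<real (Suc k) / n} s * ennreal (sqrt (h (n * s - k))) \<partial>lborel)
     \<le> ennreal (sqrt K * weight_integral)"
proof -
  let ?f = "\<lambda>s. ennreal (sqrt K) * (indicator {0<..<1} s * ennreal (weight s))"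
  have "(\<integral>\<^sup>+ s. indicator {real k / n<..<real (Suc k) / n} s * ennreal (sqrt (h (n * s - k))) \<partial>lborel)
     \<le> (\<integral>\<^sup>+ s. ennreal n * ?f (- real k + n * s) \<partial>lborel)"
  proof (rule nn_integral_mono)
    fix s :: real
    show "indicator {real k / n<..<real (Suc k) / n} s * ennreal (sqrt (h (n * s - k))) \<le> ennreal n * ?f (- real k + n * s)"
    proof (cases "s \<in> {real k / n<..<real (Suc k) / n}")
      case True
      then have s: "0 < n * s - k" "n * s - k < 1" using n by (auto simp: field_simps)
      have "sqrt (h (n * s - k)) \<le> sqrt ((real n)\<^sup>2 * (K * (weight (n * s - k))\<^sup>2))" using h[OF s] by simp
      also have "\<dots> = n * (sqrt K * weight (n * s - k))" by (simp add: real_sqrt_mult)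
      finally have "ennreal (sqrt (h (n * s - k))) \<le> ennreal n * (ennreal (sqrt K) * ennreal (weight (n * s - k)))"
        using K by (simp add: ennreal_mult[symmetric] ennreal_leI)
      then show ?thesis using True s by (simp add: add.commute)
    qed simp
  qed
  also have "\<dots> = (\<integral>\<^sup>+ s. ?f s \<partial>lborel)"
    using nn_integral_real_affine[of ?f "real n" "- real k"] n
    by (subst nn_integral_cmult) (auto simp: mult.commute)
  also have "\<dots> = ennreal (sqrt K * weight_integral)"
    using K by (subst nn_integral_cmult) (auto simp: weight_integral ennreal_mult)
  finally show ?thesis .
qed

lemma conn_dh: assumes "conn r x y D" shows "dh r x y \<le> ennreal (D * weight_integral)"
proof -
  from conn_chain[OF assms] obtain n z K where n: "1 \<le> n" and z: "z 0 = x" "z n = y"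
    and s: "\<forall>k<n. cell_seg r (z k) (z (Suc k)) (K k)" and D: "D = (\<Sum>k<n. sqrt (K k))" by blast
  from s have "\<forall>k. \<exists>G c dc. k < n \<longrightarrow> cell_path r G c dc (z k) (z (Suc k)) (K k)"
    unfolding cell_seg_def by blast
  then obtain G c dc where P: "\<And>k. k < n \<Longrightarrow> cell_path r (G k) (c k) (dc k) (z k) (z (Suc k)) (K k)"
    by metis
  note P' = P[unfolded cell_path_def]
  have
    K: "\<And>k. k < n \<Longrightarrow> 0 \<le> K k" and
    G: "\<And>k. k < n \<Longrightarrow> graph_ok (G k) \<and> marking_ok r (G k)" and
    c: "\<And>k s. k < n \<Longrightarrow> s \<in> {0<..<1::real} \<Longrightarrow> (\<forall>i<ne (G k). 0 < c k s i) \<and> entropy (G k) (c k s) = 1" and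
    d: "\<And>k i. k < n \<Longrightarrow> i < ne (G k) \<Longrightarrow> continuous_on {0..1} (\<lambda>s. c k s i) \<and>
        (\<forall>s\<in>{0<..<1}. ((\<lambda>s. c k s i) has_real_derivative dc k s i) (at s)) \<and>
        continuous_on {0<..<1} (\<lambda>s. dc k s i)" and
    e: "\<And>k. k < n \<Longrightarrow> collapse_rep r (G k) (c k 0) (z k) \<and> collapse_rep r (G k) (c k 1) (z (Suc k))" and
    h: "\<And>k s m. k < n \<Longrightarrow> s \<in> {0<..<1} \<Longrightarrow> hess_form (G k) (c k s) (\<lambda>i. m * dc k s i) \<le> m\<^sup>2 * (K k * (weight s)\<^sup>2)"
    using P' by blast+
  \<comment> \<open>All pieces get intervals of equal length, and piece \<open>k\<close> runs in its
    local time \<open>n * s - k\<close>.\<close>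
  define t where "t k = real k / n" for k :: nat
  define c' where "c' k s = c k (real n * s - real k)" for k :: nat and s :: real
  define dc' where "dc' k s i = real n * dc k (real n * s - real k) i" for k :: nat and s :: real and i
  have io: "real n * s - real k \<in> {0<..<1}" if "s \<in> {t k<..<t (Suc k)}" for s :: real and k :: nat
    using that n by (auto simp: t_def field_simps)
  have ic: "real n * s - real k \<in> {0..1}" if "s \<in> {t k..t (Suc k)}" for s :: real and k :: nat
    using that n by (auto simp: t_def field_simps)
  have te: "real n * t k - real k = 0" "real n * t (Suc k) - real k = 1" for k using n by (auto simp: t_def field_simps)
  have adm: "adm_path r x y (n, t, G, c', dc')"
    unfolding adm_path_def prod.case
  proof (intro conjI allI impI ballI)
    show "t 0 = 0" "t n = 1" using n by (auto simp: t_def)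
    show "t k < t (Suc k)" for k using n by (simp add: t_def divide_strict_right_mono)
    fix k assume k: "k < n"
    show "graph_ok (G k)" "marking_ok r (G k)" using G k by auto
    {
      fix s assume s: "s \<in> {t k<..<t (Suc k)}"
      show "entropy (G k) (c' k s) = 1" using c[OF k io[OF s]] by (simp add: c'_def)
      fix i assume i: "i < ne (G k)"
      show "0 < c' k s i" using c[OF k io[OF s]] i by (simp add: c'_def)
    }
    fix i assume i: "i < ne (G k)"
    note dd = d[OF k i]
    show "continuous_on {t k..t (Suc k)} (\<lambda>s. c' k s i)" unfolding c'_def
      by (rule continuous_on_compose2[OF dd[THEN conjunct1]]) (use ic in \<open>auto intro!: continuous_intros\<close>)
    show "continuous_on {t k<..<t (Suc k)} (\<lambda>s. dc' k s i)" unfolding dc'_def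
      by (intro continuous_on_mult_left continuous_on_compose2[OF dd[THEN conjunct2, THEN conjunct2]])
        (use io in \<open>auto intro!: continuous_intros\<close>)
    fix s assume s: "s \<in> {t k<..<t (Suc k)}"
    have "((\<lambda>s. c k s i) has_real_derivative dc k (real n * s - real k) i) (at (real n * s - real k))"
      using dd io[OF s] by blast
    moreover have "((\<lambda>s. real n * s - real k) has_real_derivative real n) (at s)"
      by (auto intro!: derivative_eq_intros)
    ultimately show "((\<lambda>s. c' k s i) has_real_derivative dc' k s i) (at s)"
      unfolding c'_def dc'_def
      using DERIV_chain2[of "\<lambda>s. c k s i" "dc k (real n * s - real k) i" "\<lambda>s. real n * s - real k" s "real n"]
      by (simp add: mult.commute)
  next
    show "1 \<le> n" by fact
    show "collapse_rep r (G 0) (c' 0 0) x" using e[of 0] n z by (simp add: c'_def)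
    show "collapse_rep r (G (n - 1)) (c' (n - 1) 1) y" using e[of "n - 1"] n z by (simp add: c'_def of_nat_diff)
    fix k assume k: "0 < k \<and> k < n"
    have "real n * t k - real (k - 1) = 1" using te(2)[of "k - 1"] k by simp
    moreover have "k - 1 < n" using k by linarith
    ultimately show "\<exists>z. collapse_rep r (G (k - 1)) (c' (k - 1) (t k)) z \<and> collapse_rep r (G k) (c' k (t k)) z"
      using e[of "k - 1"] e[of k] k te(1)[of k] by (intro exI[of _ "z k"]) (simp add: c'_def)
  qed
  have "path_length (n, t, G, c', dc') \<le> (\<Sum>k<n. ennreal (sqrt (K k) * weight_integral))"
    unfolding path_length_def prod.case
  proof (rule sum_mono)
    fix k assume "k \<in> {..<n}"
    then have k: "k < n" by simp
    show "(\<integral>\<^sup>+ s. indicator {t k<..<t (Suc k)} s * ennreal (sqrt (hess_form (G k) (c' k s) (dc' k s))) \<partial>lborel)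
        \<le> ennreal (sqrt (K k) * weight_integral)"
      unfolding t_def c'_def dc'_def
      using nn_integral_piece[OF n K[OF k], of "\<lambda>s. hess_form (G k) (c k s) (\<lambda>i. n * dc k s i)" k] h[OF k] by simp
  qed
  also have "\<dots> = ennreal (D * weight_integral)"
    using K by (subst sum_ennreal) (auto simp: D sum_distrib_right)
  finally show ?thesis unfolding dh_def using adm by (auto intro: INF_lower2)
qed

section \<open>Entropy from a positive eigenvector\<close>

definition succs :: "'a mgraph_scheme \<Rightarrow> nat \<Rightarrow> nat set" where
  "succs G e = {f \<in> edges G. org G f = ter G e \<and> f \<noteq> bar e}"

fun nb :: "'a mgraph_scheme \<Rightarrow> nat \<Rightarrow> nat list \<Rightarrow> bool" where
  "nb G e [] = True"
| "nb G e (f # p) = (f \<in> succs G e \<and> nb G f p)"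

lemma finite_edges [simp]: "finite (edges G)" by (simp add: edges_def)

lemma finite_succs [simp]: "finite (succs G e)"
  by (rule finite_subset[of _ "edges G"]) (auto simp: succs_def)

lemma nb_append: "nb G e (p @ q) \<longleftrightarrow> nb G e p \<and> nb G (last (e # p)) q"
  by (induction p arbitrary: e) auto

lemma nb_edges: "nb G e p \<Longrightarrow> set p \<subseteq> edges G"
  by (induction p arbitrary: e) (auto simp: succs_def)

lemma nb_path:
  assumes "gwf G"
  shows "e \<in> edges G \<Longrightarrow> nb G e p \<Longrightarrow> is_path G (org G e) (e # p) (ter G (last (e # p))) \<and> reduced_by bar (e # p)"
proof (induction p arbitrary: e)
  case Nil
  then have "ter G e < nv G" using assms by (simp add: gwf_def ter_def)
  then show ?case using Nil by (simp add: is_path_Cons[OF assms])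
next
  case (Cons f p)
  then have f: "f \<in> edges G" "org G f = ter G e" "f \<noteq> bar e" "nb G f p" by (auto simp: succs_def)
  show ?case using Cons.IH[OF f(1,4)] f Cons.prems by (simp add: is_path_Cons[OF assms])
qed

lemma path_nb:
  assumes "gwf G"
  shows "is_path G u (e # p) v \<Longrightarrow> reduced_by bar (e # p) \<Longrightarrow> nb G e p"
  by (induction p arbitrary: u e) (auto simp: is_path_Cons[OF assms] succs_def)

lemma plen_simps [simp]: "plen l [] = 0" "plen l (e # p) = l (e div 2) + plen l p"
  "plen l (p @ q) = plen l p + plen l q"
  by (simp_all add: plen_def)

text \<open>Continuations of \<open>e\<close>, cut at the edge during which the length first exceeds
  \<open>t\<close>. They form a complete antichain in the tree of non-backtracking paths, so a
  quantity conserved at every branching keeps its total over them.\<close>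

definition crossing :: "'a mgraph_scheme \<Rightarrow> (nat \<Rightarrow> real) \<Rightarrow> nat \<Rightarrow> real \<Rightarrow> nat list set" where
  "crossing G l e t = {p. p \<noteq> [] \<and> nb G e p \<and> plen l (butlast p) \<le> t \<and> t < plen l p}"

locale metric_graph =
  fixes G :: "'a mgraph_scheme" and l :: "nat \<Rightarrow> real" and lmin lmax :: real
  assumes wf: "gwf G"
    and lmin: "0 < lmin" "\<And>e. e \<in> edges G \<Longrightarrow> lmin \<le> l (e div 2)"
    and lmax: "\<And>e. e \<in> edges G \<Longrightarrow> l (e div 2) \<le> lmax"
begin

lemma plen_nonneg: "set p \<subseteq> edges G \<Longrightarrow> 0 \<le> plen l p"
  using lmin by (induction p) (force intro: order_trans add_nonneg_nonneg)+

lemma crossing_rec: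
  assumes "0 \<le> t"
  shows "crossing G l e t =
    (\<Union>f\<in>succs G e. if t < l (f div 2) then {[f]} else (#) f ` crossing G l f (t - l (f div 2)))"
proof (intro set_eqI iffI)
  fix p assume "p \<in> crossing G l e t"
  then obtain f q where p: "p = f # q" "f \<in> succs G e" "nb G f q" "plen l (butlast p) \<le> t" "t < plen l p"
    by (cases p) (auto simp: crossing_def)
  have fE: "f \<in> edges G" using p by (simp add: succs_def)
  show "p \<in> (\<Union>f\<in>succs G e. if t < l (f div 2) then {[f]} else (#) f ` crossing G l f (t - l (f div 2)))"
  proof (cases "q = []")
    case True then show ?thesis using p by auto
  next
    case False
    have "set (butlast q) \<subseteq> edges G" using nb_edges[OF p(3)] in_set_butlastD by fastforce
    then have "0 \<le> plen l (butlast q)" by (rule plen_nonneg)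
    then have "l (f div 2) \<le> t" using p False by simp
    moreover have "q \<in> crossing G l f (t - l (f div 2))" using p False by (simp add: crossing_def)
    ultimately show ?thesis using p by (intro UN_I[of f]) auto
  qed
next
  fix p assume "p \<in> (\<Union>f\<in>succs G e. if t < l (f div 2) then {[f]} else (#) f ` crossing G l f (t - l (f div 2)))"
  then obtain f where f: "f \<in> succs G e" "p \<in> (if t < l (f div 2) then {[f]} else (#) f ` crossing G l f (t - l (f div 2)))"
    by blast
  then show "p \<in> crossing G l e t" using assms by (auto simp: crossing_def split: if_splits)
qed

text \<open>The eigenvector equation is iterated along the cut. Every edge uses up at least
  \<open>lmin\<close>, so \<open>N\<close> rounds are enough once
  \<open>t < N * lmin\<close>.\<close>

lemma crossing_sum:
  assumes \<phi>: "\<And>e. e \<in> edges G \<Longrightarrow> \<phi> e = (\<Sum>f\<in>succs G e. exp (- h * l (f div 2)) * \<phi> f)"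
  shows "e \<in> edges G \<Longrightarrow> 0 \<le> t \<Longrightarrow> t < real N * lmin \<Longrightarrow>
    finite (crossing G l e t) \<and> (\<Sum>p\<in>crossing G l e t. exp (- h * plen l p) * \<phi> (last p)) = \<phi> e"
proof (induction N arbitrary: e t)
  case (Suc N)
  let ?D = "\<lambda>f. if t < l (f div 2) then {[f]} else (#) f ` crossing G l f (t - l (f div 2))"
  have D: "finite (?D f) \<and> (\<Sum>p\<in>?D f. exp (- h * plen l p) * \<phi> (last p)) = exp (- h * l (f div 2)) * \<phi> f"
    if f: "f \<in> succs G e" for f
  proof (cases "t < l (f div 2)")
    case False
    have fE: "f \<in> edges G" using f by (simp add: succs_def)
    have IH: "finite (crossing G l f (t - l (f div 2)))"
      "(\<Sum>p\<in>crossing G l f (t - l (f div 2)). exp (- h * plen l p) * \<phi> (last p)) = \<phi> f"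
      using Suc.IH[OF fE, of "t - l (f div 2)"] False Suc.prems lmin(2)[OF fE] by (auto simp: algebra_simps)
    have "(\<Sum>p\<in>(#) f ` crossing G l f (t - l (f div 2)). exp (- h * plen l p) * \<phi> (last p))
      = (\<Sum>p\<in>crossing G l f (t - l (f div 2)). exp (- h * plen l (f # p)) * \<phi> (last (f # p)))"
      by (subst sum.reindex) auto
    also have "\<dots> = (\<Sum>p\<in>crossing G l f (t - l (f div 2)). exp (- h * l (f div 2)) * (exp (- h * plen l p) * \<phi> (last p)))"
      by (rule sum.cong) (auto simp: crossing_def algebra_simps exp_diff exp_minus exp_add field_simps)
    also have "\<dots> = exp (- h * l (f div 2)) * \<phi> f" by (subst sum_distrib_left[symmetric]) (simp only: IH(2))
    finally show ?thesis using False IH by simp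
  qed simp
  have "(\<Sum>p\<in>(\<Union>f\<in>succs G e. ?D f). exp (- h * plen l p) * \<phi> (last p))
      = (\<Sum>f\<in>succs G e. \<Sum>p\<in>?D f. exp (- h * plen l p) * \<phi> (last p))"
  proof (rule sum.UNION_disjoint)
    show "\<forall>i\<in>succs G e. \<forall>j\<in>succs G e. i \<noteq> j \<longrightarrow> ?D i \<inter> ?D j = {}" by (auto split: if_splits)
  qed (use D in auto)
  also have "\<dots> = (\<Sum>f\<in>succs G e. exp (- h * l (f div 2)) * \<phi> f)" using D by (intro sum.cong) auto
  also have "\<dots> = \<phi> e" using \<phi>[OF Suc.prems(1)] by simp
  finally have S: "(\<Sum>p\<in>crossing G l e t. exp (- h * plen l p) * \<phi> (last p)) = \<phi> e"
    using crossing_rec[OF Suc.prems(2), of e] by simp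
  have "finite (\<Union>f\<in>succs G e. ?D f)" using D by (intro finite_UN_I) auto
  then show ?case using S crossing_rec[OF Suc.prems(2), of e] by simp
qed simp

text \<open>A cut path overshoots \<open>t\<close> by at most its last edge, so all terms of the
  conserved sum are comparable to \<open>exp (- h * t)\<close>. The sum itself lies between
  \<open>m\<close> and \<open>M\<close>, and this counts the cut.\<close>

lemma crossing_card:
  assumes h: "0 < h"
    and \<phi>: "\<And>e. e \<in> edges G \<Longrightarrow> \<phi> e = (\<Sum>f\<in>succs G e. exp (- h * l (f div 2)) * \<phi> f)"
    and m: "0 < m" "\<And>e. e \<in> edges G \<Longrightarrow> m \<le> \<phi> e \<and> \<phi> e \<le> M"
    and e: "e \<in> edges G" and t: "0 \<le> t"
  shows "finite (crossing G l e t)"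
    "real (card (crossing G l e t)) \<le> M / m * exp (h * lmax) * exp (h * t)"
    "m / M * exp (h * t) \<le> real (card (crossing G l e t))"
proof -
  obtain N :: nat where "t / lmin < N" using reals_Archimedean2 by blast
  then have "t < real N * lmin" using lmin(1) by (simp add: field_simps)
  note S = crossing_sum[OF \<phi> e t this]
  show fin: "finite (crossing G l e t)" using S by blast
  have M: "0 < M" using m(1) m(2)[OF e] by linarith
  have b: "t < plen l p \<and> plen l p \<le> t + lmax \<and> last p \<in> edges G" if "p \<in> crossing G l e t" for p
  proof -
    have p: "p \<noteq> []" "nb G e p" "plen l (butlast p) \<le> t" "t < plen l p" using that by (auto simp: crossing_def)
    then have "last p \<in> edges G" using nb_edges[OF p(2)] last_in_set by blast
    moreover have "plen l p = plen l (butlast p) + l (last p div 2)"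
      using plen_simps(3)[of l "butlast p" "[last p]"] p(1) by simp
    ultimately show ?thesis using p lmax[of "last p"] by auto
  qed
  have "real (card (crossing G l e t)) * (exp (- h * (t + lmax)) * m)
      \<le> (\<Sum>p\<in>crossing G l e t. exp (- h * plen l p) * \<phi> (last p))"
    unfolding sum_constant[symmetric]
  proof (rule sum_mono)
    fix p assume "p \<in> crossing G l e t"
    note b = b[OF this]
    show "exp (- h * (t + lmax)) * m \<le> exp (- h * plen l p) * \<phi> (last p)"
      using b m h by (intro mult_mono) (auto intro: mult_left_mono)
  qed
  then have "real (card (crossing G l e t)) * (exp (- h * (t + lmax)) * m) \<le> M" using S m(2)[OF e] by linarith
  then have "real (card (crossing G l e t)) * exp (- h * (t + lmax)) * m * exp (h * (t + lmax)) \<le> M * exp (h * (t + lmax))"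
    by (intro mult_right_mono) (auto simp: mult.assoc)
  moreover have "exp (- h * (t + lmax)) * exp (h * (t + lmax)) = 1" by (simp add: exp_add[symmetric])
  ultimately have "real (card (crossing G l e t)) * m \<le> M * exp (h * (t + lmax))"
    by (metis (no_types, opaque_lifting) mult.assoc mult.commute mult.right_neutral)
  then show "real (card (crossing G l e t)) \<le> M / m * exp (h * lmax) * exp (h * t)"
    using m(1) by (simp add: field_simps exp_add)
  have "(\<Sum>p\<in>crossing G l e t. exp (- h * plen l p) * \<phi> (last p)) \<le> real (card (crossing G l e t)) * (exp (- h * t) * M)"
    unfolding sum_constant[symmetric]
  proof (rule sum_mono)
    fix p assume "p \<in> crossing G l e t"
    note b = b[OF this]
    have "0 \<le> \<phi> (last p)" using b m(1) m(2)[of "last p"] by linarith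
    then show "exp (- h * plen l p) * \<phi> (last p) \<le> exp (- h * t) * M"
      using b m h by (intro mult_mono) auto
  qed
  then have "m \<le> real (card (crossing G l e t)) * (exp (- h * t) * M)" using S m(2)[OF e] by linarith
  then have "m * exp (h * t) \<le> real (card (crossing G l e t)) * (exp (- h * t) * M) * exp (h * t)"
    by (intro mult_right_mono) auto
  also have "\<dots> = real (card (crossing G l e t)) * M" by (simp add: exp_minus field_simps)
  finally show "m / M * exp (h * t) \<le> real (card (crossing G l e t))" using M by (simp add: field_simps)
qed

text \<open>The last edge is at least one mesh \<open>lmin\<close> long, so some multiple of
  \<open>lmin\<close> falls within it and the path belongs to the cut at that level. Counting all
  paths up to length \<open>t\<close> therefore costs only a factor linear in
  \<open>t\<close>.\<close>

lemma nb_grid: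
  assumes "nb G e p" "p \<noteq> []" "plen l p \<le> t"
  shows "\<exists>k\<le>nat \<lfloor>t / lmin\<rfloor>. p \<in> crossing G l e (real k * lmin)"
proof -
  have E: "set (butlast p) \<subseteq> edges G" "last p \<in> edges G"
    using nb_edges[OF assms(1)] assms(2) in_set_butlastD last_in_set by fastforce+
  have pl: "plen l p = plen l (butlast p) + l (last p div 2)"
    using plen_simps(3)[of l "butlast p" "[last p]"] assms(2) by simp
  define k where "k = nat \<lceil>plen l (butlast p) / lmin\<rceil>"
  have "0 \<le> plen l (butlast p) / lmin" using plen_nonneg[OF E(1)] lmin(1) by simp
  then have k: "plen l (butlast p) / lmin \<le> real k" "real k < plen l (butlast p) / lmin + 1"
    unfolding k_def by linarith+
  have k1: "plen l (butlast p) \<le> real k * lmin" "real k * lmin < plen l p"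
  proof -
    show "plen l (butlast p) \<le> real k * lmin" using k(1) lmin(1) by (simp add: field_simps)
    have "real k * lmin < plen l (butlast p) + lmin" using k(2) lmin(1) by (simp add: field_simps)
    then show "real k * lmin < plen l p" using pl lmin(2)[OF E(2)] by linarith
  qed
  have "real k \<le> t / lmin" using k1 assms(3) lmin(1) by (simp add: field_simps)
  then have "k \<le> nat \<lfloor>t / lmin\<rfloor>" by linarith
  then show ?thesis using k1 assms by (auto simp: crossing_def)
qed

lemma circuits_upper:
  assumes h: "0 < h"
    and \<phi>: "\<And>e. e \<in> edges G \<Longrightarrow> \<phi> e = (\<Sum>f\<in>succs G e. exp (- h * l (f div 2)) * \<phi> f)"
    and m: "0 < m" "\<And>e. e \<in> edges G \<Longrightarrow> m \<le> \<phi> e \<and> \<phi> e \<le> M" and t: "1 \<le> t" and "0 \<le> M"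
  shows "finite {\<gamma>. based_circuit G \<gamma> \<and> plen l \<gamma> \<le> t} \<and>
    real (card {\<gamma>. based_circuit G \<gamma> \<and> plen l \<gamma> \<le> t})
     \<le> real (card (edges G)) * (1 + (1 / lmin + 1) * (M / m * exp (h * lmax))) * t * exp (h * t)"
proof -
  define A where "A = M / m * exp (h * lmax)"
  define n where "n = nat \<lfloor>t / lmin\<rfloor>"
  have A: "0 \<le> A" using m(1) assms(6) by (simp add: A_def)
  \<comment> \<open>A circuit is its first edge followed by a path in one of the cuts; circuits of a
    single edge are added separately.\<close>
  let ?U = "\<lambda>e. insert [e] (\<Union>k\<le>n. (#) e ` crossing G l e (real k * lmin))"
  let ?C = "{\<gamma>. based_circuit G \<gamma> \<and> plen l \<gamma> \<le> t}"
  have sub: "?C \<subseteq> (\<Union>e\<in>edges G. ?U e)"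
  proof
    fix \<gamma> assume g: "\<gamma> \<in> ?C"
    then obtain e p where ep: "\<gamma> = e # p" by (cases \<gamma>) (auto simp: based_circuit_def)
    have pa: "is_path G (org G e) (e # p) (org G e)" "reduced_by bar (e # p)" and pt: "plen l (e # p) \<le> t"
      using g ep by (auto simp: based_circuit_def)
    have e: "e \<in> edges G" using pa by (simp add: is_path_Cons[OF wf])
    have nbp: "nb G e p" by (rule path_nb[OF wf pa])
    show "\<gamma> \<in> (\<Union>e\<in>edges G. ?U e)"
    proof (cases "p = []")
      case True then show ?thesis using e ep by auto
    next
      case False
      have "plen l p \<le> t" using pt lmin(1) lmin(2)[OF e] by simp
      from nb_grid[OF nbp False this] show ?thesis using e ep by (auto simp: n_def)
    qed
  qed
  have fc: "finite (crossing G l e (real k * lmin))" if "e \<in> edges G" for e k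
    using crossing_card(1)[OF h \<phi> m that] lmin(1) by simp
  have finU: "finite (?U e)" if "e \<in> edges G" for e using fc[OF that] by auto
  have cU: "real (card (?U e)) \<le> (1 + (1 / lmin + 1) * A) * t * exp (h * t)" if e: "e \<in> edges G" for e
  proof -
    have "real (card (?U e)) \<le> 1 + real (card (\<Union>k\<le>n. (#) e ` crossing G l e (real k * lmin)))"
      using card_insert_le_m1[of 1] finU[OF e] by (simp add: card_insert_if)
    also have "real (card (\<Union>k\<le>n. (#) e ` crossing G l e (real k * lmin))) \<le> (\<Sum>k\<le>n. real (card ((#) e ` crossing G l e (real k * lmin))))"
      using card_UN_le[of "{..n}" "\<lambda>k. (#) e ` crossing G l e (real k * lmin)"] by (simp flip: of_nat_sum)
    also have "\<dots> \<le> (\<Sum>k\<le>n. A * exp (h * t))"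
    proof (rule sum_mono)
      fix k assume "k \<in> {..n}"
      moreover have "real n \<le> t / lmin" unfolding n_def using t lmin(1) by simp
      ultimately have "real k \<le> t / lmin" by simp
      then have kt: "real k * lmin \<le> t" using lmin(1) by (simp add: field_simps)
      have "real (card ((#) e ` crossing G l e (real k * lmin))) \<le> real (card (crossing G l e (real k * lmin)))"
        using card_image_le[OF fc[OF e]] by simp
      also have "\<dots> \<le> A * exp (h * (real k * lmin))"
        unfolding A_def using crossing_card(2)[OF h \<phi> m e, of "real k * lmin"] lmin(1) by simp
      also have "\<dots> \<le> A * exp (h * t)" using kt h A by (intro mult_left_mono) auto
      finally show "real (card ((#) e ` crossing G l e (real k * lmin))) \<le> A * exp (h * t)" .
    qed
    also have "\<dots> = (real n + 1) * (A * exp (h * t))" by simp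
    also have "\<dots> \<le> ((1 / lmin + 1) * t) * (A * exp (h * t))"
    proof (rule mult_right_mono)
      have "real n \<le> t / lmin" unfolding n_def using t lmin(1) by simp
      then show "real n + 1 \<le> (1 / lmin + 1) * t" using t by (simp add: algebra_simps)
    qed (use A in auto)
    also have "1 + ((1 / lmin + 1) * t) * (A * exp (h * t)) \<le> (1 + (1 / lmin + 1) * A) * t * exp (h * t)"
    proof -
      have "1 * 1 \<le> t * exp (h * t)" using t h by (intro mult_mono) auto
      then show ?thesis by (simp add: algebra_simps)
    qed
    finally show ?thesis by simp
  qed
  have fin: "finite (\<Union>e\<in>edges G. ?U e)" using finU by auto
  have "real (card ?C) \<le> real (card (\<Union>e\<in>edges G. ?U e))" using card_mono[OF fin sub] by simp
  also have "\<dots> \<le> (\<Sum>e\<in>edges G. real (card (?U e)))"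
    using card_UN_le[of "edges G" ?U] by (simp flip: of_nat_sum)
  also have "\<dots> \<le> (\<Sum>e\<in>edges G. (1 + (1 / lmin + 1) * A) * t * exp (h * t))"
    by (rule sum_mono) (rule cU)
  also have "\<dots> = real (card (edges G)) * (1 + (1 / lmin + 1) * A) * t * exp (h * t)" by (simp add: mult.assoc)
  finally show ?thesis using finite_subset[OF sub fin] by (simp add: A_def)
qed

text \<open>Each cut path is closed up by a fixed return to \<open>e\<close>. Its first edge is a
  successor of \<open>e\<close>, so closing with \<open>e\<close> creates no backtracking, and the
  map is injective because no cut path is a proper prefix of another.\<close>

lemma circuits_lower:
  assumes e: "e \<in> edges G" and q: "\<And>f. f \<in> edges G \<Longrightarrow> nb G f (q f @ [e]) \<and> plen l (q f) \<le> K"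
    and fin: "finite {\<gamma>. based_circuit G \<gamma> \<and> plen l \<gamma> \<le> t + (2 * lmax + K)}" and t: "0 \<le> t"
  shows "card (crossing G l e t) \<le> card {\<gamma>. based_circuit G \<gamma> \<and> plen l \<gamma> \<le> t + (2 * lmax + K)}"
proof (rule card_inj_on_le[OF _ _ fin])
  let ?g = "\<lambda>p. p @ q (last p) @ [e]"
  have pre: False if "p \<in> crossing G l e t" "p' \<in> crossing G l e t" "p' = p @ w" "w \<noteq> []" for p p' w
  proof -
    have "butlast p' = p @ butlast w" using that by (simp add: butlast_append)
    moreover have "set (butlast w) \<subseteq> edges G" using that nb_edges[of G e p'] in_set_butlastD
      by (fastforce simp: crossing_def)
    ultimately show False using that plen_nonneg[of "butlast w"] by (auto simp: crossing_def)
  qed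
  show "inj_on ?g (crossing G l e t)"
  proof (rule inj_onI)
    fix p p' assume p: "p \<in> crossing G l e t" "p' \<in> crossing G l e t" "?g p = ?g p'"
    from p(3) obtain w where "p = p' @ w \<or> p' = p @ w" by (auto simp: append_eq_append_conv2)
    then show "p = p'" using pre[OF p(1,2), of w] pre[OF p(2,1), of w] by (cases "w = []") auto
  qed
  show "?g ` crossing G l e t \<subseteq> {\<gamma>. based_circuit G \<gamma> \<and> plen l \<gamma> \<le> t + (2 * lmax + K)}"
  proof clarify
    fix p assume "p \<in> crossing G l e t"
    then obtain f p' where p: "p = f # p'" "f \<in> succs G e" "nb G f p'" "plen l (butlast p) \<le> t" "p \<noteq> []"
      by (cases p) (auto simp: crossing_def)
    have f: "f \<in> edges G" "org G f = ter G e" "f \<noteq> bar e" using p by (auto simp: succs_def)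
    have lp: "last p \<in> edges G" using p f nb_edges[OF p(3)] by (cases p') auto
    have "nb G f (p' @ q (last p) @ [e])" using p q[OF lp] by (simp add: nb_append[of G f p'])
    from nb_path[OF wf f(1) this] have "is_path G (org G f) (?g p) (ter G e)" "reduced_by bar (?g p)"
      using p by simp_all
    moreover have "last (?g p) \<noteq> bar (hd (?g p))" using p f by (auto simp: p)
    moreover have "hd (?g p) = f" using p by simp
    ultimately have "based_circuit G (?g p)" using f by (simp add: based_circuit_def)
    moreover have "plen l p = plen l (butlast p) + l (last p div 2)"
      using plen_simps(3)[of l "butlast p" "[last p]"] p(5) by simp
    ultimately show "based_circuit G (?g p) \<and> plen l (?g p) \<le> t + (2 * lmax + K)"
      using p(4) lmax[OF lp] lmax[OF e] q[OF lp] by simp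
  qed
qed

end

text \<open>After taking logarithms and dividing by \<open>t\<close>, the factor \<open>t\<close> of
  the upper bound and the shift \<open>M\<close> of the lower bound both disappear in the
  limit.\<close>

lemma entropy_limit:
  fixes N :: "real \<Rightarrow> nat"
  assumes a: "0 < a" "0 < b" and up: "\<And>t. 1 \<le> t \<Longrightarrow> real (N t) \<le> b * t * exp (h * t)"
    and lo: "\<And>t. 0 \<le> t \<Longrightarrow> a * exp (h * t) \<le> real (N (t + M))"
  shows "((\<lambda>t. ln (real (N t)) / t) \<longlongrightarrow> h) at_top"
proof (rule tendsto_sandwich)
  have inv: "((\<lambda>t::real. c / t) \<longlongrightarrow> 0) at_top" for c
    by (intro tendsto_divide_0[OF tendsto_const] filterlim_at_top_imp_at_infinity filterlim_ident)
  have "((\<lambda>t. (ln a - h * M) / t + h) \<longlongrightarrow> 0 + h) at_top" by (intro tendsto_intros inv)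
  then show "((\<lambda>t. (ln a - h * M) / t + h) \<longlongrightarrow> h) at_top" by simp
  have "((\<lambda>t. ln b / t + ln t / t + h) \<longlongrightarrow> 0 + 0 + h) at_top"
    by (intro tendsto_intros inv ln_x_over_x_tendsto_0)
  then show "((\<lambda>t. ln b / t + ln t / t + h) \<longlongrightarrow> h) at_top" by simp
  have lo': "a * exp (h * (t - M)) \<le> real (N t)" if "M \<le> t" for t
    using lo[of "t - M"] that by simp
  show "\<forall>\<^sub>F t in at_top. (ln a - h * M) / t + h \<le> ln (real (N t)) / t"
    using eventually_ge_at_top[of "max M 1"]
  proof eventually_elim
    case (elim t)
    have pos: "0 < a * exp (h * (t - M))" using a by simp
    have "ln (a * exp (h * (t - M))) \<le> ln (real (N t))"
      using lo'[of t] elim pos by (subst ln_le_cancel_iff) linarith+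
    moreover have "ln (a * exp (h * (t - M))) = ln a + h * (t - M)" using a by (simp add: ln_mult)
    ultimately have "(ln a + h * (t - M)) / t \<le> ln (real (N t)) / t" using elim by (simp add: divide_right_mono)
    moreover have "(ln a + h * (t - M)) / t = (ln a - h * M) / t + h" using elim by (simp add: field_simps)
    ultimately show ?case by simp
  qed
  show "\<forall>\<^sub>F t in at_top. ln (real (N t)) / t \<le> ln b / t + ln t / t + h"
    using eventually_ge_at_top[of "max M 1"]
  proof eventually_elim
    case (elim t)
    have "0 < a * exp (h * (t - M))" using a by simp
    then have "0 < real (N t)" using lo'[of t] elim by linarith
    then have "ln (real (N t)) \<le> ln (b * t * exp (h * t))"
      using up[of t] elim by (subst ln_le_cancel_iff) auto
    also have "\<dots> = ln b + ln t + h * t" using a elim by (simp add: ln_mult)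
    finally have "ln (real (N t)) / t \<le> (ln b + ln t + h * t) / t" using elim by (simp add: divide_right_mono)
    then show ?case using elim by (simp add: add_divide_distrib)
  qed
qed

text \<open>Perron-Frobenius in the form of a certificate: a positive solution of the eigenvector
  equation with exponent \<open>h\<close> pins the growth of circuits to \<open>exp (h * t)\<close>
  up to a linear factor. Irreducibility enters as one edge \<open>hub\<close> that can be reached
  from every edge.\<close>

lemma entropy_eigenvector:
  assumes wf: "gwf G" and l: "\<And>i. i < ne G \<Longrightarrow> 0 < l i" and h: "0 < h"
    and pos: "\<And>e. e \<in> edges G \<Longrightarrow> 0 < \<phi> e"
    and \<phi>: "\<And>e. e \<in> edges G \<Longrightarrow> \<phi> e = (\<Sum>f\<in>succs G e. exp (- h * l (f div 2)) * \<phi> f)"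
    and hub: "hub \<in> edges G" "\<And>e. e \<in> edges G \<Longrightarrow> \<exists>q. nb G e (q @ [hub])"
  shows "entropy G l = h"
proof -
  let ?L = "(\<lambda>e. l (e div 2)) ` edges G" and ?F = "\<phi> ` edges G"
  have ne: "edges G \<noteq> {}" using hub by auto
  have fin: "finite ?L" "?L \<noteq> {}" "finite ?F" "?F \<noteq> {}" using ne by auto
  have lpos: "0 < l (e div 2)" if "e \<in> edges G" for e using that l by (auto simp: edges_def)
  interpret metric_graph G l "Min ?L" "Max ?L"
    by unfold_locales (use fin lpos wf in \<open>auto simp: Min_gr_iff\<close>)
  define m M where "m = Min ?F" and "M = Max ?F"
  have m: "0 < m" "\<And>e. e \<in> edges G \<Longrightarrow> m \<le> \<phi> e \<and> \<phi> e \<le> M"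
    using fin pos by (auto simp: m_def M_def Min_gr_iff)
  have M: "0 < M" using m hub(1) by (meson less_le_trans)
  from hub(2) obtain q where q: "\<And>e. e \<in> edges G \<Longrightarrow> nb G e (q e @ [hub])" by metis
  define K where "K = Max ((\<lambda>e. plen l (q e)) ` edges G)"
  have qK: "nb G f (q f @ [hub]) \<and> plen l (q f) \<le> K" if "f \<in> edges G" for f
    using that q by (auto simp: K_def)
  let ?N = "\<lambda>t. card {\<gamma>. based_circuit G \<gamma> \<and> plen l \<gamma> \<le> t}"
  have K: "0 \<le> K"
  proof -
    have "set (q hub) \<subseteq> edges G" using nb_edges[OF q[OF hub(1)]] by simp
    then show ?thesis using qK[OF hub(1)] plen_nonneg[of "q hub"] by linarith
  qed
  have lm: "0 < Max ?L" using fin lpos ne by (simp add: Max_gr_iff) (use hub in blast)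
  have up: "finite {\<gamma>. based_circuit G \<gamma> \<and> plen l \<gamma> \<le> t} \<and> real (?N t)
      \<le> real (card (edges G)) * (1 + (1 / Min ?L + 1) * (M / m * exp (h * Max ?L))) * t * exp (h * t)"
    if "1 \<le> t" for t
    by (rule circuits_upper[of h \<phi> m M t]) (use h \<phi> m that M in auto)
  have finN: "finite {\<gamma>. based_circuit G \<gamma> \<and> plen l \<gamma> \<le> t}" for t
  proof -
    have "finite {\<gamma>. based_circuit G \<gamma> \<and> plen l \<gamma> \<le> max 1 t}" using up[of "max 1 t"] by simp
    then show ?thesis by (rule finite_subset[rotated]) auto
  qed
  have "((\<lambda>t. ln (real (?N t)) / t) \<longlongrightarrow> h) at_top"
  proof (rule entropy_limit)
    show "0 < m / M" using m M by simp
    show "0 < real (card (edges G)) * (1 + (1 / Min ?L + 1) * (M / m * exp (h * Max ?L)))"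
      using ne m M lmin(1) by (intro mult_pos_pos add_pos_pos) (auto simp: card_gt_0_iff)
    show "real (?N t) \<le> real (card (edges G)) * (1 + (1 / Min ?L + 1) * (M / m * exp (h * Max ?L))) * t * exp (h * t)"
      if "1 \<le> t" for t using up[OF that] by simp
    show "m / M * exp (h * t) \<le> real (?N (t + (2 * Max ?L + K)))" if "0 \<le> t" for t
    proof -
      have "m / M * exp (h * t) \<le> real (card (crossing G l hub t))"
        by (rule crossing_card(3)[of h \<phi> m M]) (use h \<phi> m hub that in auto)
      also have "\<dots> \<le> real (?N (t + (2 * Max ?L + K)))"
        using circuits_lower[OF hub(1) qK finN that] by simp
      finally show ?thesis .
    qed
  qed
  then show ?thesis unfolding entropy_def by (intro tendsto_Lim) auto
qed

text \<open>Reduction from edges to vertices. Let \<open>P v\<close> be the sum of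
  \<open>x f * \<phi> f\<close> over the edges leaving \<open>v\<close>; then
  \<open>\<phi> e = P (ter e) - x e * \<phi> (bar e)\<close>. Solving this together with the same
  equation for \<open>bar e\<close> gives the fraction used below. Assumption \<open>pos\<close> is
  positivity of the eigenvector, and \<open>eq\<close> is the consistency of
  \<open>P\<close>.\<close>

lemma entropy_vertex:
  fixes P :: "nat \<Rightarrow> real"
  defines "x \<equiv> \<lambda>h (l :: nat \<Rightarrow> real) e. exp (- h * l (e div 2))"
  assumes wf: "gwf G" and l: "\<And>i. i < ne G \<Longrightarrow> 0 < l i" and h: "0 < h"
    and pos: "\<And>e. e \<in> edges G \<Longrightarrow> x h l e * P (org G e) < P (ter G e)"
    and eq: "\<And>v. v < nv G \<Longrightarrow>
       (\<Sum>f\<in>{f\<in>edges G. org G f = v}. x h l f * (P (ter G f) - x h l f * P v) / (1 - (x h l f)\<^sup>2)) = P v"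
    and hub: "hub \<in> edges G" "\<And>e. e \<in> edges G \<Longrightarrow> \<exists>q. nb G e (q @ [hub])"
  shows "entropy G l = h"
proof (rule entropy_eigenvector[OF wf l h _ _ hub])
  define \<phi> where "\<phi> e = (P (ter G e) - x h l e * P (org G e)) / (1 - (x h l e)\<^sup>2)" for e
  have x1: "0 < 1 - (x h l e)\<^sup>2" if "e \<in> edges G" for e
  proof -
    have "0 < l (e div 2)" using that l by (auto simp: edges_def)
    then have "x h l e < 1" "0 < x h l e" using h by (auto simp: x_def)
    then show ?thesis by (simp add: power_less_one_iff)
  qed
  show "0 < \<phi> e" if "e \<in> edges G" for e using x1[OF that] pos[OF that] by (simp add: \<phi>_def)
  show "\<phi> e = (\<Sum>f\<in>succs G e. exp (- h * l (f div 2)) * \<phi> f)" if e: "e \<in> edges G" for e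
  proof -
    let ?S = "{f\<in>edges G. org G f = ter G e}"
    have be: "bar e \<in> ?S" using e by (simp add: ter_def)
    have S: "succs G e = ?S - {bar e}" by (auto simp: succs_def)
    have v: "ter G e < nv G" using e wf by (simp add: gwf_def ter_def)
    have "(\<Sum>f\<in>?S. x h l f * \<phi> f)
        = (\<Sum>f\<in>?S. x h l f * (P (ter G f) - x h l f * P (ter G e)) / (1 - (x h l f)\<^sup>2))"
      by (rule sum.cong) (auto simp: \<phi>_def)
    then have "(\<Sum>f\<in>?S. x h l f * \<phi> f) = P (ter G e)" using eq[OF v] by simp
    then have "(\<Sum>f\<in>succs G e. x h l f * \<phi> f) = P (ter G e) - x h l (bar e) * \<phi> (bar e)"
      unfolding S using sum.remove[of ?S "bar e" "\<lambda>f. x h l f * \<phi> f"] be by simp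
    moreover have "x h l (bar e) = x h l e" by (simp add: x_def)
    moreover have "ter G (bar e) = org G e" "org G (bar e) = ter G e" by (simp_all add: ter_def)
    ultimately have "(\<Sum>f\<in>succs G e. x h l f * \<phi> f)
        = P (ter G e) - x h l e * ((P (org G e) - x h l e * P (ter G e)) / (1 - (x h l e)\<^sup>2))"
      by (simp add: \<phi>_def)
    also have "\<dots> = \<phi> e" using x1[OF e] by (simp add: \<phi>_def field_simps power2_eq_square)
    finally show ?thesis by (simp add: x_def)
  qed
qed

section \<open>The Hessian of the entropy by implicit differentiation\<close>

lemma isCont_nhds: "isCont f a \<Longrightarrow> f a = b \<Longrightarrow> filterlim f (nhds b) (nhds a)"
  by (auto simp: continuous_at tendsto_at_iff_tendsto_nhds)

text \<open>About \<open>E\<close> it is only known that it equals every root, so its continuity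
  comes from a sign change: \<open>\<Phi>\<close> decreases in \<open>h\<close>, its signs at
  \<open>h0 - e\<close> and \<open>h0 + e\<close> persist for nearby \<open>u\<close>, and the root
  in between has to be \<open>E u\<close>.\<close>

lemma implicit_continuous:
  fixes \<Phi> :: "real \<Rightarrow> real \<Rightarrow> real"
  assumes S: "open S" "(h0, u0) \<in> S"
    and d: "\<And>h u. (h, u) \<in> S \<Longrightarrow>
      ((\<lambda>p. \<Phi> (fst p) (snd p)) has_derivative (\<lambda>q. Ph h u * fst q + Pu h u * snd q)) (at (h, u))"
    and neg: "\<And>h u. (h, u) \<in> S \<Longrightarrow> Ph h u < 0"
    and z: "\<Phi> h0 u0 = 0" and E: "\<And>h u. (h, u) \<in> S \<Longrightarrow> \<Phi> h u = 0 \<Longrightarrow> E u = h" and \<epsilon>: "0 < \<epsilon>"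
  shows "\<forall>\<^sub>F u in nhds u0. \<bar>E u - h0\<bar> < \<epsilon> \<and> (E u, u) \<in> S \<and> \<Phi> (E u) u = 0"
proof -
  obtain A B where AB: "open A" "open B" "h0 \<in> A" "u0 \<in> B" "A \<times> B \<subseteq> S"
    using S by (metis open_prod_elim mem_Times_iff fst_conv snd_conv)
  obtain \<delta> where \<delta>: "0 < \<delta>" "ball h0 \<delta> \<subseteq> A" using AB openE by blast
  define e where "e = min (\<epsilon> / 2) (\<delta> / 2)"
  have e: "0 < e" "e < \<epsilon>" "{h0 - e..h0 + e} \<subseteq> A"
    using \<epsilon> \<delta> by (auto simp: e_def subset_iff dist_real_def min_def)
  have inS: "(h, u) \<in> S" if "h \<in> {h0 - e..h0 + e}" "u \<in> B" for h u using that e AB by auto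
  have dh: "((\<lambda>h. \<Phi> h u) has_real_derivative Ph h u) (at h)" if "(h, u) \<in> S" for h u
  proof -
    have "((\<lambda>h. (h, u)) has_derivative (\<lambda>x. (x, 0))) (at h)" by (auto intro!: derivative_eq_intros)
    from has_derivative_compose[OF this d[OF that]] show ?thesis
      by (simp add: has_field_derivative_def)
  qed
  have "\<Phi> h0 u0 < \<Phi> (h0 - e) u0"
    by (rule DERIV_neg_imp_decreasing[of "h0 - e" h0 "\<lambda>h. \<Phi> h u0"])
      (use e inS AB in \<open>auto intro!: exI[of _ "Ph _ u0"] dh neg\<close>)
  moreover have "\<Phi> (h0 + e) u0 < \<Phi> h0 u0"
    by (rule DERIV_neg_imp_decreasing[of h0 "h0 + e" "\<lambda>h. \<Phi> h u0"])
      (use e inS AB in \<open>auto intro!: exI[of _ "Ph _ u0"] dh neg\<close>)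
  ultimately have sg: "0 < \<Phi> (h0 - e) u0" "\<Phi> (h0 + e) u0 < 0" using z by auto
  have cu: "isCont (\<lambda>u. \<Phi> h u) u0" if "h \<in> {h0 - e..h0 + e}" for h
  proof -
    have "((\<lambda>u. (h, u)) has_derivative (\<lambda>x. (0, x))) (at u0)" by (auto intro!: derivative_eq_intros)
    from has_derivative_compose[OF this d[OF inS[OF that AB(4)]]] show ?thesis
      by (auto dest: has_derivative_continuous)
  qed
  have "\<forall>\<^sub>F u in nhds u0. 0 < \<Phi> (h0 - e) u"
    using cu[of "h0 - e"] sg(1) e(1)
    by (intro order_tendstoD(1)[of _ "\<Phi> (h0 - e) u0"]) (auto simp: continuous_within tendsto_at_iff_tendsto_nhds)
  moreover have "\<forall>\<^sub>F u in nhds u0. \<Phi> (h0 + e) u < 0"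
    using cu[of "h0 + e"] sg(2) e(1)
    by (intro order_tendstoD(2)[of _ "\<Phi> (h0 + e) u0"]) (auto simp: continuous_within tendsto_at_iff_tendsto_nhds)
  moreover have "\<forall>\<^sub>F u in nhds u0. u \<in> B" using AB by (simp add: eventually_nhds_in_open)
  ultimately show ?thesis
  proof eventually_elim
    case (elim u)
    have "\<exists>h. h0 - e \<le> h \<and> h \<le> h0 + e \<and> \<Phi> h u = 0"
    proof (rule IVT2)
      show "\<forall>x. h0 - e \<le> x \<and> x \<le> h0 + e \<longrightarrow> isCont (\<lambda>h. \<Phi> h u) x"
        using dh inS elim(3) DERIV_isCont by (metis atLeastAtMost_iff)
    qed (use elim e in auto)
    then obtain h where h: "h0 - e \<le> h" "h \<le> h0 + e" "\<Phi> h u = 0" by blast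
    have "(h, u) \<in> S" using h elim inS by auto
    moreover from E[OF this h(3)] have "E u = h" .
    ultimately show ?case using h e by auto
  qed
qed

text \<open>The linearisation of \<open>\<Phi>\<close> has a remainder controlled by both
  increments. A first pass gives a Lipschitz bound for \<open>E\<close>, which removes the increment
  of \<open>E\<close> from the remainder in a second pass.\<close>

lemma implicit_derivative:
  fixes \<Phi> :: "real \<Rightarrow> real \<Rightarrow> real"
  assumes S: "open S" "(h0, u0) \<in> S"
    and d: "\<And>h u. (h, u) \<in> S \<Longrightarrow>
      ((\<lambda>p. \<Phi> (fst p) (snd p)) has_derivative (\<lambda>q. Ph h u * fst q + Pu h u * snd q)) (at (h, u))"
    and neg: "\<And>h u. (h, u) \<in> S \<Longrightarrow> Ph h u < 0"
    and z: "\<Phi> h0 u0 = 0" and E: "\<And>h u. (h, u) \<in> S \<Longrightarrow> \<Phi> h u = 0 \<Longrightarrow> E u = h"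
  shows "(E has_real_derivative - Pu h0 u0 / Ph h0 u0) (at u0)"
proof -
  have ev: "\<forall>\<^sub>F u in nhds u0. \<bar>E u - h0\<bar> < \<epsilon> \<and> (E u, u) \<in> S \<and> \<Phi> (E u) u = 0" if "0 < \<epsilon>" for \<epsilon>
    by (rule implicit_continuous[OF S d neg z E that])
  have E0: "E u0 = h0" using E[OF S(2) z] .
  define a b where "a = Ph h0 u0" and "b = Pu h0 u0"
  have a: "a < 0" using neg[OF S(2)] by (simp add: a_def)
  have rem: "\<forall>\<^sub>F u in nhds u0. \<bar>a * (E u - h0) + b * (u - u0)\<bar> \<le> c * (\<bar>E u - h0\<bar> + \<bar>u - u0\<bar>)" if c: "0 < c" for c
  proof -
    from has_derivative_within_alt[THEN iffD1, OF d[OF S(2)], THEN conjunct2, rule_format, OF c]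
    obtain \<delta> where \<delta>: "0 < \<delta>" "\<And>p. norm (p - (h0, u0)) < \<delta> \<Longrightarrow>
      \<bar>\<Phi> (fst p) (snd p) - \<Phi> h0 u0 - (a * fst (p - (h0, u0)) + b * snd (p - (h0, u0)))\<bar> \<le> c * norm (p - (h0, u0))"
      by (auto simp: a_def b_def)
    have "\<forall>\<^sub>F u in nhds u0. dist u u0 < \<delta> / 2"
      unfolding eventually_nhds_metric using \<delta>(1) by (intro exI[of _ "\<delta> / 2"]) auto
    moreover have "\<forall>\<^sub>F u in nhds u0. \<bar>E u - h0\<bar> < \<delta> / 2 \<and> (E u, u) \<in> S \<and> \<Phi> (E u) u = 0"
      using \<delta>(1) by (intro ev) simp_all
    ultimately show ?thesis
    proof eventually_elim
      case (elim u)
      have n: "norm ((E u, u) - (h0, u0)) \<le> \<bar>E u - h0\<bar> + \<bar>u - u0\<bar>"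
        using norm_Pair_le[of "E u - h0" "u - u0"] by simp
      then have "norm ((E u, u) - (h0, u0)) < \<delta>" using elim by (simp add: dist_real_def)
      from \<delta>(2)[OF this] have "\<bar>a * (E u - h0) + b * (u - u0)\<bar> \<le> c * norm ((E u, u) - (h0, u0))"
        using elim z by simp
      also have "\<dots> \<le> c * (\<bar>E u - h0\<bar> + \<bar>u - u0\<bar>)" using n c by (intro mult_left_mono) auto
      finally show ?case .
    qed
  qed
  define L where "L = 2 * (\<bar>a\<bar> + \<bar>b\<bar>) / \<bar>a\<bar>"
  have L: "0 \<le> L" by (simp add: L_def)
  have "\<exists>d>0. \<forall>u. norm (u - u0) < d \<longrightarrow> norm (E u - E u0 - (- b / a) * (u - u0)) \<le> e * norm (u - u0)" if e: "0 < e" for e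
  proof -
    \<comment> \<open>The first entry lets half of \<open>\<bar>a\<bar> * \<bar>x\<bar>\<close> be
      absorbed on the left, which yields the Lipschitz constant \<open>L\<close>; the second brings
      the remainder below \<open>e\<close>.\<close>
    define c where "c = min (\<bar>a\<bar> / 2) (e * \<bar>a\<bar> / (L + 1))"
    have c: "0 < c" "c \<le> \<bar>a\<bar> / 2" "c * (L + 1) \<le> e * \<bar>a\<bar>"
    proof -
      have "0 < e * \<bar>a\<bar> / (L + 1)" using a e L by (intro divide_pos_pos mult_pos_pos) auto
      then show "0 < c" "c \<le> \<bar>a\<bar> / 2" using a by (auto simp: c_def)
      have "c \<le> e * \<bar>a\<bar> / (L + 1)" by (simp add: c_def)
      then show "c * (L + 1) \<le> e * \<bar>a\<bar>" using L by (simp add: pos_le_divide_eq)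
    qed
    from rem[OF c(1)] obtain d where d: "0 < d" "\<And>u. dist u u0 < d \<Longrightarrow>
        \<bar>a * (E u - h0) + b * (u - u0)\<bar> \<le> c * (\<bar>E u - h0\<bar> + \<bar>u - u0\<bar>)"
      unfolding eventually_nhds_metric by blast
    have "norm (E u - E u0 - (- b / a) * (u - u0)) \<le> e * norm (u - u0)" if u: "norm (u - u0) < d" for u
    proof -
      define x y where "x = E u - h0" and "y = u - u0"
      have r: "\<bar>a * x + b * y\<bar> \<le> c * (\<bar>x\<bar> + \<bar>y\<bar>)" using d(2)[of u] u by (simp add: x_def y_def dist_norm)
      have "\<bar>a\<bar> * \<bar>x\<bar> \<le> \<bar>a * x + b * y\<bar> + \<bar>b\<bar> * \<bar>y\<bar>"
        using abs_triangle_ineq4[of "a * x + b * y" "b * y"] by (simp add: abs_mult)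
      also have "\<dots> \<le> c * \<bar>x\<bar> + c * \<bar>y\<bar> + \<bar>b\<bar> * \<bar>y\<bar>" using r by (simp add: algebra_simps)
      also have "\<dots> \<le> \<bar>a\<bar> / 2 * \<bar>x\<bar> + \<bar>a\<bar> * \<bar>y\<bar> + \<bar>b\<bar> * \<bar>y\<bar>"
        using mult_right_mono[OF c(2), of "\<bar>x\<bar>"] mult_right_mono[of c "\<bar>a\<bar>" "\<bar>y\<bar>"] c(1,2) by linarith
      finally have "\<bar>a\<bar> * \<bar>x\<bar> \<le> 2 * (\<bar>a\<bar> + \<bar>b\<bar>) * \<bar>y\<bar>" by (simp add: algebra_simps)
      then have xL: "\<bar>x\<bar> \<le> L * \<bar>y\<bar>" using a by (simp add: L_def field_simps)
      have "\<bar>a\<bar> * \<bar>x - (- b / a) * y\<bar> = \<bar>a * x + b * y\<bar>"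
        using a by (simp add: abs_mult[symmetric] field_simps)
      also have "\<dots> \<le> c * (L * \<bar>y\<bar> + \<bar>y\<bar>)" using r mult_left_mono[of "\<bar>x\<bar> + \<bar>y\<bar>" "L * \<bar>y\<bar> + \<bar>y\<bar>" c] xL c(1) by linarith
      also have "\<dots> = (c * (L + 1)) * \<bar>y\<bar>" by (simp add: algebra_simps)
      also have "\<dots> \<le> (e * \<bar>a\<bar>) * \<bar>y\<bar>" using c(3) by (intro mult_right_mono) auto
      finally have "\<bar>a\<bar> * \<bar>x - (- b / a) * y\<bar> \<le> \<bar>a\<bar> * (e * \<bar>y\<bar>)" by (simp add: mult_ac)
      then have "\<bar>x - (- b / a) * y\<bar> \<le> e * \<bar>y\<bar>" using a by simp
      then show ?thesis by (simp add: x_def y_def E0)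
    qed
    then show ?thesis using d(1) by blast
  qed
  then show ?thesis unfolding has_field_derivative_def has_derivative_at_alt a_def[symmetric] b_def[symmetric]
    by (intro conjI bounded_linear_mult_right) blast
qed

text \<open>Since \<open>Pu\<close> vanishes at the base point, the curve \<open>(E u, u)\<close>
  starts in the direction (0, 1). The derivatives involving \<open>h\<close> therefore drop out, and
  \<open>Pu\<close> changes along the curve as it does along the line \<open>h = 1\<close>.\<close>

lemma implicit_second_derivative:
  fixes \<Phi> Ph Pu :: "real \<Rightarrow> real \<Rightarrow> real"
  assumes ev: "\<forall>\<^sub>F p in nhds (1, 0).
      ((\<lambda>p. \<Phi> (fst p) (snd p)) has_derivative (\<lambda>q. Ph (fst p) (snd p) * fst q + Pu (fst p) (snd p) * snd q)) (at p)
      \<and> (\<Phi> (fst p) (snd p) = 0 \<longrightarrow> E (snd p) = fst p)"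
    and z: "\<Phi> 1 0 = 0" and neg: "Ph 1 0 < 0" and Pu0: "Pu 1 0 = 0"
    and dPh: "(\<lambda>p. Ph (fst p) (snd p)) differentiable (at (1, 0))"
    and dPu: "(\<lambda>p. Pu (fst p) (snd p)) differentiable (at (1, 0))"
    and B: "((\<lambda>u. Pu 1 u) has_real_derivative B) (at 0)"
  shows "deriv (deriv E) 0 = - B / Ph 1 0"
proof -
  have "isCont (\<lambda>p. Ph (fst p) (snd p)) (1, 0)"
    using dPh differentiable_imp_continuous_within by blast
  then have "\<forall>\<^sub>F p in nhds (1, 0). Ph (fst p) (snd p) < 0"
    using neg by (intro order_tendstoD(2)[of _ "Ph 1 0"] isCont_nhds) auto
  from eventually_conj[OF ev this] obtain S where S: "open S" "(1, 0) \<in> S" and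
    P: "\<And>p. p \<in> S \<Longrightarrow> ((\<lambda>p. \<Phi> (fst p) (snd p)) has_derivative
           (\<lambda>q. Ph (fst p) (snd p) * fst q + Pu (fst p) (snd p) * snd q)) (at p)
      \<and> (\<Phi> (fst p) (snd p) = 0 \<longrightarrow> E (snd p) = fst p) \<and> Ph (fst p) (snd p) < 0"
    unfolding eventually_nhds by blast
  have d: "\<And>h u. (h, u) \<in> S \<Longrightarrow>
      ((\<lambda>p. \<Phi> (fst p) (snd p)) has_derivative (\<lambda>q. Ph h u * fst q + Pu h u * snd q)) (at (h, u))"
    and n: "\<And>h u. (h, u) \<in> S \<Longrightarrow> Ph h u < 0" and E: "\<And>h u. (h, u) \<in> S \<Longrightarrow> \<Phi> h u = 0 \<Longrightarrow> E u = h"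
    using P by fastforce+
  have E0: "E 0 = 1" using E[OF S(2) z] .
  have "\<forall>\<^sub>F u in nhds 0. (E u, u) \<in> S \<and> \<Phi> (E u) u = 0"
  proof -
    have "\<forall>\<^sub>F u in nhds 0. \<bar>E u - 1\<bar> < 1 \<and> (E u, u) \<in> S \<and> \<Phi> (E u) u = 0"
      by (rule implicit_continuous[OF S d n z E zero_less_one])
    then show ?thesis by eventually_elim auto
  qed
  then have eq: "\<forall>\<^sub>F u in nhds 0. deriv E u = - Pu (E u) u / Ph (E u) u"
  proof eventually_elim
    case (elim u)
    have "(E has_real_derivative - Pu (E u) u / Ph (E u) u) (at u)"
      by (rule implicit_derivative[OF S(1) _ d n _ E]) (use elim in auto)
    then show ?case by (rule DERIV_imp_deriv)
  qed
  have "(E has_real_derivative - Pu 1 0 / Ph 1 0) (at 0)" by (rule implicit_derivative[OF S d n z E])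
  then have "(E has_real_derivative 0) (at 0)" using Pu0 by simp
  then have "(E has_derivative (\<lambda>x. 0)) (at 0)"
    unfolding has_field_derivative_def by (rule has_derivative_eq_rhs) auto
  then have curve: "((\<lambda>u. (E u, u)) has_derivative (\<lambda>x. (0, x))) (at 0)"
    by (auto intro!: derivative_eq_intros)
  have line: "((\<lambda>u::real. (1::real, u)) has_derivative (\<lambda>x. (0, x))) (at 0)"
    by (auto intro!: derivative_eq_intros)
  obtain D where D: "((\<lambda>p. Pu (fst p) (snd p)) has_derivative D) (at (1, 0))" using dPu by (auto simp: differentiable_def)
  obtain D' where D': "((\<lambda>p. Ph (fst p) (snd p)) has_derivative D') (at (1, 0))" using dPh by (auto simp: differentiable_def)
  have "((\<lambda>u. Pu 1 u) has_derivative (\<lambda>x. D (0, x))) (at 0)" using has_derivative_compose[OF line D] by simp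
  then have "(\<lambda>x. D (0, x)) = (\<lambda>x. B * x)"
    using B has_derivative_unique unfolding has_field_derivative_def by blast
  then have 1: "((\<lambda>u. Pu (E u) u) has_real_derivative B) (at 0)"
    using has_derivative_compose[OF curve, of "\<lambda>p. Pu (fst p) (snd p)" D] D E0 by (simp add: has_field_derivative_def)
  have "((\<lambda>u. Ph (E u) u) has_derivative (\<lambda>x. D' (0, x))) (at 0)"
    using has_derivative_compose[OF curve, of "\<lambda>p. Ph (fst p) (snd p)" D'] D' E0 by simp
  then have "(\<lambda>u. Ph (E u) u) differentiable (at 0)" unfolding differentiable_def by blast
  then obtain C where 2: "((\<lambda>u. Ph (E u) u) has_real_derivative C) (at 0)"
    by (auto simp: real_differentiable_def)
  have "((\<lambda>u. - Pu (E u) u / Ph (E u) u) has_real_derivative - B / Ph 1 0) (at 0)"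
    by (rule derivative_eq_intros 1 2 refl | use neg E0 Pu0 in \<open>simp add: field_simps\<close>)+
  then have "deriv (\<lambda>u. - Pu (E u) u / Ph (E u) u) 0 = - B / Ph 1 0" by (rule DERIV_imp_deriv)
  then show ?thesis using deriv_cong_ev[OF eq refl] by simp
qed

lemma differentiable_comp_real:
  fixes g :: "'a::real_normed_vector \<Rightarrow> real"
  assumes "(f has_real_derivative D) (at (g p))" "g differentiable (at p)"
  shows "(\<lambda>p. f (g p)) differentiable (at p)"
proof -
  obtain g' where "(g has_derivative g') (at p)" using assms(2) by (auto simp: differentiable_def)
  from DERIV_compose_FDERIV[OF assms(1) this] show ?thesis unfolding differentiable_def by blast
qed

text \<open>All unit-entropy conditions below have the shape
  \<open>\<Sum>k. \<kappa> k (\<Sum>i\<in>I k. f k (h * l i)) = 0\<close> in terms of the scaled lengths \<open>h * l i\<close>.\<close>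
lemma hess_form_implicit:
  fixes K :: "'k set" and I :: "'k \<Rightarrow> nat set" and l v :: "nat \<Rightarrow> real" and f :: "'k \<Rightarrow> real \<Rightarrow> real"
  defines "S \<equiv> \<lambda>k. \<Sum>i\<in>I k. f k (l i)"
  assumes fin: "finite K" "\<And>k. k \<in> K \<Longrightarrow> finite (I k)"
    and U: "\<And>k. k \<in> K \<Longrightarrow> open (U k) \<and> S k \<in> U k"
    and l: "\<And>k i. k \<in> K \<Longrightarrow> i \<in> I k \<Longrightarrow> 0 < l i"
    and f: "\<And>k x. k \<in> K \<Longrightarrow> 0 < x \<Longrightarrow> (f k has_real_derivative f' k x) (at x)"
      "\<And>k x. k \<in> K \<Longrightarrow> 0 < x \<Longrightarrow> (f' k has_real_derivative f'' k x) (at x)"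
    and g: "\<And>k x. k \<in> K \<Longrightarrow> x \<in> U k \<Longrightarrow> (g k has_real_derivative g' k x) (at x)"
      "\<And>k x. k \<in> K \<Longrightarrow> x \<in> U k \<Longrightarrow> (g' k has_real_derivative g'' k x) (at x)"
    and z: "(\<Sum>k\<in>K. g k (S k)) = 0"
    and ent: "\<And>h m. 0 < h \<Longrightarrow> (\<And>k i. k \<in> K \<Longrightarrow> i \<in> I k \<Longrightarrow> 0 < m i) \<Longrightarrow>
       (\<And>k. k \<in> K \<Longrightarrow> (\<Sum>i\<in>I k. f k (h * m i)) \<in> U k) \<Longrightarrow>
       (\<Sum>k\<in>K. g k (\<Sum>i\<in>I k. f k (h * m i))) = 0 \<Longrightarrow> entropy G m = h"
    and neg: "(\<Sum>k\<in>K. g' k (S k) * (\<Sum>i\<in>I k. f' k (l i) * l i)) < 0"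
    and tan: "(\<Sum>k\<in>K. g' k (S k) * (\<Sum>i\<in>I k. f' k (l i) * v i)) = 0"
  shows "hess_form G l v =
     - (\<Sum>k\<in>K. g'' k (S k) * (\<Sum>i\<in>I k. f' k (l i) * v i)\<^sup>2 + g' k (S k) * (\<Sum>i\<in>I k. f'' k (l i) * (v i)\<^sup>2))
       / (\<Sum>k\<in>K. g' k (S k) * (\<Sum>i\<in>I k. f' k (l i) * l i))"
proof -
  \<comment> \<open>The scaled length: scaling by \<open>h\<close> and moving along \<open>v\<close>
    become the two variables of one equation.\<close>
  define T where "T i h u = h * (l i + u * v i)" for i and h u :: real
  define s where "s k h u = (\<Sum>i\<in>I k. f k (T i h u))" for k h u
  define \<Phi> where "\<Phi> h u = (\<Sum>k\<in>K. g k (s k h u))" for h u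
  define Ph where "Ph h u = (\<Sum>k\<in>K. g' k (s k h u) * (\<Sum>i\<in>I k. f' k (T i h u) * (l i + u * v i)))" for h u
  define Pu where "Pu h u = (\<Sum>k\<in>K. g' k (s k h u) * (\<Sum>i\<in>I k. f' k (T i h u) * (h * v i)))" for h u
  have T0: "T i 1 0 = l i" for i by (simp add: T_def)
  have s0: "s k 1 0 = S k" for k by (simp add: s_def S_def T0)
  have dT: "((\<lambda>p. T i (fst p) (snd p)) has_derivative
      (\<lambda>q. fst q * (l i + snd p * v i) + fst p * (snd q * v i))) (at p)" for i p
    unfolding T_def by (auto intro!: derivative_eq_intros simp: algebra_simps)
  have dT': "(\<lambda>p. T i (fst p) (snd p)) differentiable (at p)" for i p
    using dT unfolding differentiable_def by blast
  have evT: "\<forall>\<^sub>F p in nhds (1, 0). \<forall>k\<in>K. \<forall>i\<in>I k. 0 < T i (fst p) (snd p)"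
  proof (intro eventually_ball_finite fin ballI)
    fix k i assume ki: "k \<in> K" "i \<in> I k"
    have "isCont (\<lambda>p. T i (fst p) (snd p)) (1, 0)" by (rule has_derivative_continuous[OF dT])
    then show "\<forall>\<^sub>F p in nhds (1, 0). 0 < T i (fst p) (snd p)"
      using l[OF ki] by (intro order_tendstoD(1)[of _ "T i 1 0"] isCont_nhds) (auto simp: T0)
  qed
  have ds: "((\<lambda>p. s k (fst p) (snd p)) has_derivative
      (\<lambda>q. (\<Sum>i\<in>I k. f' k (T i (fst p) (snd p)) * (l i + snd p * v i)) * fst q
         + (\<Sum>i\<in>I k. f' k (T i (fst p) (snd p)) * (fst p * v i)) * snd q)) (at p)"
    if k: "k \<in> K" and p: "\<And>i. i \<in> I k \<Longrightarrow> 0 < T i (fst p) (snd p)" for k p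
  proof -
    have "((\<lambda>p. s k (fst p) (snd p)) has_derivative
      (\<lambda>q. \<Sum>i\<in>I k. (fst q * (l i + snd p * v i) + fst p * (snd q * v i)) * f' k (T i (fst p) (snd p)))) (at p)"
      unfolding s_def by (intro has_derivative_sum DERIV_compose_FDERIV[OF f(1)[OF k p] dT])
    then show ?thesis
      by (rule has_derivative_eq_rhs) (simp add: fun_eq_iff sum_distrib_right sum_distrib_left sum.distrib algebra_simps)
  qed
  have evU: "\<forall>\<^sub>F p in nhds (1, 0). \<forall>k\<in>K. s k (fst p) (snd p) \<in> U k"
  proof (intro eventually_ball_finite fin ballI)
    fix k assume k: "k \<in> K"
    have "isCont (\<lambda>p. s k (fst p) (snd p)) (1, 0)"
      by (rule has_derivative_continuous[OF ds[OF k]]) (simp add: T0 l[OF k])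
    then show "\<forall>\<^sub>F p in nhds (1, 0). s k (fst p) (snd p) \<in> U k"
      using U[OF k] by (intro topological_tendstoD[of _ "s k 1 0"] isCont_nhds) (auto simp: s0)
  qed
  have evh: "\<forall>\<^sub>F p in nhds (1 :: real, 0 :: real). 0 < fst p"
    by (intro order_tendstoD(1)[of _ "1"] isCont_nhds) auto
  have dT0: "(\<lambda>p. f' k (T i (fst p) (snd p))) differentiable (at (1, 0))" if "k \<in> K" "i \<in> I k" for k i
    by (rule differentiable_comp_real[OF f(2)[OF that(1)] dT']) (simp add: T0 l[OF that])
  have ds0: "(\<lambda>p. s k (fst p) (snd p)) differentiable (at (1, 0))" if "k \<in> K" for k
    using ds[OF that, of "(1, 0)"] l[OF that] unfolding differentiable_def T0 by (auto simp: T0)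
  have dg0: "(\<lambda>p. g' k (s k (fst p) (snd p))) differentiable (at (1, 0))" if "k \<in> K" for k
    by (rule differentiable_comp_real[OF g(2)[OF that] ds0[OF that]]) (simp add: s0 U[OF that])
  have lin: "(\<lambda>p. fst p * c) differentiable (at x)" "(\<lambda>p. c + snd p * d) differentiable (at x)"
    for c d :: real and x :: "real \<times> real"
    unfolding differentiable_def by (rule exI, (rule derivative_eq_intros refl)+)+
  have "deriv (deriv (\<lambda>u. entropy G (\<lambda>i. l i + u * v i))) 0
      = - (\<Sum>k\<in>K. g'' k (S k) * (\<Sum>i\<in>I k. f' k (l i) * v i)\<^sup>2 + g' k (S k) * (\<Sum>i\<in>I k. f'' k (l i) * (v i)\<^sup>2)) / Ph 1 0"
  proof (rule implicit_second_derivative)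
    show "\<forall>\<^sub>F p in nhds (1, 0).
      ((\<lambda>p. \<Phi> (fst p) (snd p)) has_derivative (\<lambda>q. Ph (fst p) (snd p) * fst q + Pu (fst p) (snd p) * snd q)) (at p)
      \<and> (\<Phi> (fst p) (snd p) = 0 \<longrightarrow> entropy G (\<lambda>i. l i + snd p * v i) = fst p)"
      using evT evU evh
    proof eventually_elim
      case (elim p)
      have "((\<lambda>p. \<Phi> (fst p) (snd p)) has_derivative
       (\<lambda>q. \<Sum>k\<in>K. ((\<Sum>i\<in>I k. f' k (T i (fst p) (snd p)) * (l i + snd p * v i)) * fst q
         + (\<Sum>i\<in>I k. f' k (T i (fst p) (snd p)) * (fst p * v i)) * snd q) * g' k (s k (fst p) (snd p)))) (at p)"
        unfolding \<Phi>_def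
        by (intro has_derivative_sum DERIV_compose_FDERIV[OF g(1)] ds) (use elim in auto)
      then have "((\<lambda>p. \<Phi> (fst p) (snd p)) has_derivative (\<lambda>q. Ph (fst p) (snd p) * fst q + Pu (fst p) (snd p) * snd q)) (at p)"
        by (rule has_derivative_eq_rhs)
          (simp add: fun_eq_iff Ph_def Pu_def sum_distrib_right[of _ K] sum_distrib_left[of _ _ K] sum.distrib algebra_simps)
      moreover have "\<Phi> (fst p) (snd p) = 0 \<longrightarrow> entropy G (\<lambda>i. l i + snd p * v i) = fst p"
      proof
        assume "\<Phi> (fst p) (snd p) = 0"
        then show "entropy G (\<lambda>i. l i + snd p * v i) = fst p"
          using elim by (intro ent) (auto simp: \<Phi>_def s_def T_def zero_less_mult_iff dest!: bspec)
      qed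
      ultimately show ?case by blast
    qed
    show "\<Phi> 1 0 = 0" using z by (simp add: \<Phi>_def s0)
    show "Ph 1 0 < 0" using neg by (simp add: Ph_def s0 T0)
    show "Pu 1 0 = 0" using tan by (simp add: Pu_def s0 T0)
    show "(\<lambda>p. Ph (fst p) (snd p)) differentiable (at (1, 0))"
      unfolding Ph_def by (intro differentiable_sum ballI differentiable_mult dg0 dT0 lin fin)
    show "(\<lambda>p. Pu (fst p) (snd p)) differentiable (at (1, 0))"
      unfolding Pu_def by (intro differentiable_sum ballI differentiable_mult dg0 dT0 lin fin)
    have T1: "((\<lambda>u. T i 1 u) has_real_derivative v i) (at 0)" for i
      unfolding T_def by (auto intro!: derivative_eq_intros)
    have F1: "((\<lambda>u. F (T i 1 u)) has_real_derivative F' (l i) * v i) (at 0)"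
      if "(F has_real_derivative F' (l i)) (at (l i))" for F F' i
      using DERIV_chain2[of F "F' (l i)" "\<lambda>u. T i 1 u" 0 "v i"] that T1 by (simp add: T0)
    have s1: "((\<lambda>u. s k 1 u) has_real_derivative (\<Sum>i\<in>I k. f' k (l i) * v i)) (at 0)" if k: "k \<in> K" for k
      unfolding s_def by (intro DERIV_sum F1 f(1)[OF k] l[OF k])
    have g1: "((\<lambda>u. g' k (s k 1 u)) has_real_derivative g'' k (S k) * (\<Sum>i\<in>I k. f' k (l i) * v i)) (at 0)" if k: "k \<in> K" for k
      using DERIV_chain2[of "g' k" "g'' k (S k)" "\<lambda>u. s k 1 u" 0] g(2)[OF k, of "S k"] U[OF k] s1[OF k] by (simp add: s0)
    have h1: "((\<lambda>u. \<Sum>i\<in>I k. f' k (T i 1 u) * (1 * v i)) has_real_derivative (\<Sum>i\<in>I k. f'' k (l i) * (v i)\<^sup>2)) (at 0)"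
      if k: "k \<in> K" for k
    proof -
      have "((\<lambda>u. \<Sum>i\<in>I k. f' k (T i 1 u) * (1 * v i)) has_real_derivative (\<Sum>i\<in>I k. f'' k (l i) * v i * (1 * v i))) (at 0)"
        by (intro DERIV_sum DERIV_cmult_right F1 f(2)[OF k] l[OF k])
      then show ?thesis by (simp add: power2_eq_square mult.assoc)
    qed
    show "((\<lambda>u. Pu 1 u) has_real_derivative (\<Sum>k\<in>K. g'' k (S k) * (\<Sum>i\<in>I k. f' k (l i) * v i)\<^sup>2
        + g' k (S k) * (\<Sum>i\<in>I k. f'' k (l i) * (v i)\<^sup>2))) (at 0)"
      unfolding Pu_def
    proof (intro DERIV_sum)
      fix k assume k: "k \<in> K"
      show "((\<lambda>u. g' k (s k 1 u) * (\<Sum>i\<in>I k. f' k (T i 1 u) * (1 * v i))) has_real_derivative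
        g'' k (S k) * (\<Sum>i\<in>I k. f' k (l i) * v i)\<^sup>2 + g' k (S k) * (\<Sum>i\<in>I k. f'' k (l i) * (v i)\<^sup>2)) (at 0)"
        using DERIV_mult[OF g1[OF k] h1[OF k]] by (simp add: s0 T0 power2_eq_square algebra_simps)
    qed
  qed
  then show ?thesis by (simp add: hess_form_def Ph_def s0 T0)
qed

section \<open>Roses and barbells\<close>

text \<open>In the coordinate \<open>2 / (1 + exp \<ell>)\<close> the unit entropy roses form an open simplex.\<close>
definition yv :: "real \<Rightarrow> real" where "yv x = 2 / (1 + exp x)"

definition ylen :: "real \<Rightarrow> real" where "ylen y = ln (2 / y - 1)"

lemma yv_half: "1 - yv x / 2 = exp x / (1 + exp x)"
proof -
  have "1 + exp x \<noteq> 0" using exp_gt_zero[of x] by linarith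
  then show ?thesis unfolding yv_def by (simp add: divide_simps)
qed

text \<open>A logistic equation, so all derivatives of the weights are polynomials in the
  weights.\<close>

lemma yv_deriv: "(yv has_real_derivative - (yv x * (1 - yv x / 2))) (at x)"
proof -
  have "1 + exp x \<noteq> 0" using exp_gt_zero[of x] by linarith
  then have "(yv has_real_derivative - (2 * exp x) / (1 + exp x)\<^sup>2) (at x)"
    unfolding yv_def by (auto intro!: derivative_eq_intros simp: power2_eq_square)
  moreover have "- (2 * exp x) / (1 + exp x)\<^sup>2 = - (yv x * (1 - yv x / 2))"
    unfolding yv_half by (simp add: yv_def power2_eq_square)
  ultimately show ?thesis by simp
qed

lemma yv_deriv2: "((\<lambda>x. - (yv x * (1 - yv x / 2))) has_real_derivative yv x * (1 - yv x / 2) * (1 - yv x)) (at x)"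
proof -
  have "((\<lambda>y. - (y * (1 - y / 2))) has_real_derivative y - 1) (at y)" for y :: real
    by (auto intro!: derivative_eq_intros simp: field_simps)
  from DERIV_chain2[OF this yv_deriv]
  have "((\<lambda>x. - (yv x * (1 - yv x / 2))) has_real_derivative (yv x - 1) * - (yv x * (1 - yv x / 2))) (at x)" .
  moreover have "(yv x - 1) * - (yv x * (1 - yv x / 2)) = yv x * (1 - yv x / 2) * (1 - yv x)" by algebra
  ultimately show ?thesis by simp
qed

lemma yv_pos [simp]: "0 < yv x" by (simp add: yv_def add_pos_pos)

lemma yv_less1: "0 < x \<Longrightarrow> yv x < 1" by (simp add: yv_def field_simps add_pos_pos)

lemma yv_ylen: "0 < y \<Longrightarrow> y < 2 \<Longrightarrow> yv (ylen y) = y"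
  by (simp add: yv_def ylen_def field_simps)

lemma ylen_yv: "ylen (yv x) = x"
proof -
  have "2 / yv x - 1 = exp x" by (simp add: yv_def add_divide_distrib)
  then show ?thesis by (simp add: ylen_def)
qed

lemma ylen_pos: "0 < y \<Longrightarrow> y < 1 \<Longrightarrow> 0 < ylen y"
  by (simp add: ylen_def field_simps)

lemma ylen_deriv: "0 < y \<Longrightarrow> y < 2 \<Longrightarrow> (ylen has_real_derivative - 1 / (y * (1 - y / 2))) (at y)"
  unfolding ylen_def by (auto intro!: derivative_eq_intros simp: field_simps power2_eq_square)

lemma even_bar [simp]: "even (bar e) \<longleftrightarrow> odd e" by (auto simp: bar_def)

lemma sum_double: "(\<Sum>f<2 * n. g f) = (\<Sum>i<n. g (2 * i) + g (Suc (2 * i)))" for g :: "nat \<Rightarrow> real"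
  by (induction n) (simp_all add: add.assoc)

lemma sum_edges:
  fixes g :: "nat \<Rightarrow> real"
  shows "(\<Sum>f\<in>{f\<in>edges G. org G f = v}. g f) =
    (\<Sum>i<ne G. (if org G (2 * i) = v then g (2 * i) else 0) + (if org G (Suc (2 * i)) = v then g (Suc (2 * i)) else 0))"
proof -
  have "(\<Sum>f\<in>{f\<in>edges G. org G f = v}. g f) = (\<Sum>f<2 * ne G. if org G f = v then g f else 0)"
    unfolding edges_def by (rule sum.inter_filter) simp
  then show ?thesis unfolding sum_double .
qed

lemma valence_ge3:
  assumes "{a, b, c} \<subseteq> {e \<in> edges G. org G e = v}" "a \<noteq> b" "a \<noteq> c" "b \<noteq> c"
  shows "valence G v \<noteq> 1 \<and> valence G v \<noteq> 2"
proof -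
  have "card {a, b, c} \<le> valence G v" unfolding valence_def
    by (rule card_mono[OF _ assms(1)]) (simp add: edges_def)
  then show ?thesis using assms(2-) by simp
qed

text \<open>The term of \<open>entropy_vertex\<close> for one orientation of a loop. With both
  orientations a petal of length \<open>t\<close> contributes \<open>P * yv (h * t)\<close>, which
  is the origin of the coordinate \<open>yv\<close>.\<close>

lemma loop_term:
  assumes "0 < h * t"
  shows "exp (- h * t) * (P - exp (- h * t) * P) / (1 - (exp (- h * t))\<^sup>2) = P * (yv (h * t) / 2)"
proof -
  define x where "x = exp (- h * t)"
  have x: "0 < x" "x < 1" "yv (h * t) = 2 * x / (1 + x)"
    using assms by (auto simp: x_def yv_def exp_minus field_simps)
  have "1 - x\<^sup>2 = (1 - x) * (1 + x)" by (simp add: power2_eq_square algebra_simps)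
  then have "x * (P - x * P) / (1 - x\<^sup>2) = (x * P) * (1 - x) / ((1 + x) * (1 - x))"
    by (simp add: algebra_simps)
  also have "\<dots> = P * (x / (1 + x))" using x by simp
  also have "x / (1 + x) = yv (h * t) / 2" unfolding x(3) using x(1) by (simp add: field_simps)
  finally show ?thesis unfolding x_def[symmetric] .
qed

section \<open>Roses\<close>

lemma rose_sel [simp]: "nv (rose r l) = 1" "ne (rose r l) = r" "org (rose r l) = (\<lambda>_. 0)"
  "base (rose r l) = 0" "mark (rose r l) i = [2 * i]" "len (rose r l) = l"
  by (simp_all add: rose_def)

lemma rose_edges: "edges (rose r l) = {..<2 * r}" by (simp add: edges_def)

lemma rose_gwf: "gwf (rose r l)" by (simp add: gwf_def)

lemma rose_entropy:
  assumes r: "2 \<le> r" and l: "\<And>i. i < r \<Longrightarrow> 0 < l i" and h: "0 < h" and s: "(\<Sum>i<r. yv (h * l i)) = 1"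
  shows "entropy (rose r l') l = h"
proof (rule entropy_vertex[where P = "\<lambda>_. 1" and hub = 0])
  show "gwf (rose r l')" by (rule rose_gwf)
  show "0 < l i" if "i < ne (rose r l')" for i using that l by simp
  show "exp (- h * l (e div 2)) * 1 < (1::real)" if "e \<in> edges (rose r l')" for e
    using that l[of "e div 2"] h by (auto simp: rose_edges)
  show "(\<Sum>f | f \<in> edges (rose r l') \<and> org (rose r l') f = v.
       exp (- h * l (f div 2)) * (1 - exp (- h * l (f div 2)) * 1) / (1 - (exp (- h * l (f div 2)))\<^sup>2)) = 1"
    if "v < nv (rose r l')" for v
  proof -
    define F where "F f = exp (- h * l (f div 2)) * (1 - exp (- h * l (f div 2)) * 1) / (1 - (exp (- h * l (f div 2)))\<^sup>2)" for f
    have F: "F f = yv (h * l (f div 2)) / 2" if "f div 2 < r" for f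
      using loop_term[of h "l (f div 2)" 1] l[OF that] h by (simp add: F_def)
    have "(\<Sum>f | f \<in> edges (rose r l') \<and> org (rose r l') f = v. F f)
      = (\<Sum>i<r. yv (h * l i) / 2 + yv (h * l i) / 2)"
      unfolding sum_edges using that by (intro sum.cong) (auto simp: F)
    then show ?thesis using s by (simp add: F_def)
  qed
  show "0 \<in> edges (rose r l')" using r by (simp add: rose_edges)
  fix e assume e: "e \<in> edges (rose r l')"
  show "\<exists>q. nb (rose r l') e (q @ [0])"
  proof (cases "e = 1")
    case True
    \<comment> \<open>Edge 0 is the reverse of edge 1, so the return goes around another petal
      first.\<close>
    have "nb (rose r l') e ([2] @ [0])" using True r by (simp add: succs_def rose_edges ter_def bar_def)
    then show ?thesis by blast
  next
    case False
    then have "bar e \<noteq> 0" by (auto simp: bar_def elim!: oddE)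
    then have "nb (rose r l') e ([] @ [0])" using r by (simp add: succs_def rose_edges ter_def)
    then show ?thesis by blast
  qed
qed (fact h)

lemma rose_graph_ok: assumes "2 \<le> r" shows "graph_ok (rose r l)"
proof -
  have "valence (rose r l) 0 \<noteq> 1 \<and> valence (rose r l) 0 \<noteq> 2"
    by (rule valence_ge3[of 0 1 2]) (use assms in \<open>auto simp: rose_edges\<close>)
  moreover have "is_path (rose r l) 0 [] 0" by simp
  ultimately show ?thesis unfolding graph_ok_def by (auto intro!: exI[of _ "[]"])
qed

lemma rose_marking_ok: "marking_ok r (rose r l)"
proof (rule marking_okI[where lb = "\<lambda>e. [(e div 2, even e)]" and T = "\<lambda>_. []"])
  show "\<forall>i<r. is_path (rose r l) (base (rose r l)) (mark (rose r l) i) (base (rose r l))"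
    by (auto simp: is_path_def rose_edges ter_def)
  show "[(bar e div 2, even (bar e))] = W.winverse [(e div 2, even e)]" for e
    by simp
  show "lift (mark (rose r l)) [(e div 2, even e)] =
     B.fr ([] @ e # rev_path [])" for e
    by (cases "even e") (auto simp: lift_alt sgn_path_def rev_path_eq elim!: oddE)
qed (auto simp: rose_gwf rose_edges rev_path_eq B.fr_Cons W.fr_Cons)

lemma rose_point:
  assumes "2 \<le> r" "\<And>i. i < r \<Longrightarrow> 0 < l i" "(\<Sum>i<r. yv (l i)) = 1"
  shows "point r (rose r l)"
  using rose_entropy[of r l 1 l] assms rose_graph_ok rose_marking_ok by (simp add: point_def)

text \<open>The converse of \<open>rose_entropy\<close>, without a second count: the weights sum to
  \<open>r\<close> at scale 0 and to less than 1 at a large scale, so the sum is 1 at some scale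
  \<open>h\<close> in between. Then \<open>h\<close> is the entropy, hence 1.\<close>

lemma rose_pointD:
  assumes r: "2 \<le> r" and p: "point r (rose r l)"
  shows "(\<forall>i<r. 0 < l i) \<and> (\<Sum>i<r. yv (l i)) = 1"
proof
  show l: "\<forall>i<r. 0 < l i" using p by (simp add: point_def)
  let ?F = "\<lambda>h. \<Sum>i<r. yv (h * l i)"
  have cont: "isCont ?F h" for h
    using yv_deriv by (intro isCont_sum isCont_o2[OF _ DERIV_isCont[OF yv_deriv]] continuous_intros) 
  have lim: "((\<lambda>h. yv (h * c)) \<longlongrightarrow> 0) at_top" if "0 < c" for c
  proof -
    have "filterlim (\<lambda>h. h * c) at_top at_top" using that
      by (rule filterlim_at_top_mult_tendsto_pos[OF tendsto_const _ filterlim_ident])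
    then have "filterlim (\<lambda>h. 1 + exp (h * c)) at_top at_top"
      by (intro filterlim_tendsto_add_at_top[OF tendsto_const] filterlim_compose[OF exp_at_top])
    then show ?thesis unfolding yv_def
      by (intro tendsto_divide_0[OF tendsto_const] filterlim_at_top_imp_at_infinity)
  qed
  have "(?F \<longlongrightarrow> (\<Sum>i<r. 0)) at_top" using l by (intro tendsto_sum lim) auto
  then have "\<forall>\<^sub>F h in at_top. ?F h < 1" by (intro order_tendstoD) auto
  then obtain H where H: "\<And>h. H \<le> h \<Longrightarrow> ?F h < 1" by (auto simp: eventually_at_top_linorder)
  have F0: "?F 0 = r" by (simp add: yv_def)
  have "\<exists>h. 0 \<le> h \<and> h \<le> max H 0 \<and> ?F h = 1"
    by (rule IVT2) (use cont F0 r H[of "max H 0"] in auto)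
  then obtain h where h: "0 \<le> h" "?F h = 1" by blast
  have "h \<noteq> 0" using F0 h r by auto
  then have "0 < h" using h by simp
  from rose_entropy[OF r _ this h(2), of l] l have "entropy (rose r l) l = h" by auto
  then show "(\<Sum>i<r. yv (l i)) = 1" using p h by (simp add: point_def)
qed

section \<open>Barbells and their entropy\<close>

definition barbell :: "nat \<Rightarrow> (nat \<Rightarrow> real) \<Rightarrow> mgraph" where
  "barbell r l = \<lparr>nv = 2, ne = Suc r,
     org = (\<lambda>e. if e = 2 * r then 0 else if e = Suc (2 * r) then 1 else if e < 4 then 0 else 1),
     base = 0, mark = (\<lambda>i. if i < 2 then [2 * i] else [2 * r, 2 * i, Suc (2 * r)]), len = l\<rparr>"

definition petals :: "nat \<Rightarrow> bool \<Rightarrow> nat set" where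
  "petals r b = (if b then {..<2} else {2..<r})"

lemma petals_finite [simp]: "finite (petals r b)" by (simp add: petals_def)

lemma petals_nonempty: "4 \<le> r \<Longrightarrow> petals r b \<noteq> {}"
  by (auto simp: petals_def lessThan_empty_iff)

lemma barbell_sel [simp]: "nv (barbell r l) = 2" "ne (barbell r l) = Suc r"
  "org (barbell r l) e = (if e = 2 * r then 0 else if e = Suc (2 * r) then 1 else if e < 4 then 0 else 1)"
  "base (barbell r l) = 0" "mark (barbell r l) i = (if i < 2 then [2 * i] else [2 * r, 2 * i, Suc (2 * r)])"
  "len (barbell r l) = l"
  by (simp_all add: barbell_def)

lemma barbell_edges: "edges (barbell r l) = {..<2 * r + 2}" by (auto simp: edges_def)

lemma barbell_gwf: "gwf (barbell r l)" by (auto simp: gwf_def)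

lemma bar_less4: "bar e < 4 \<longleftrightarrow> e < 4"
proof -
  have "e' < 4 \<longleftrightarrow> e' div 2 < 2" for e' :: nat by auto
  then show ?thesis by simp
qed

lemma bar_eq_simps [simp]: "bar e = 2 * i \<longleftrightarrow> e = Suc (2 * i)" "bar e = Suc (2 * i) \<longleftrightarrow> e = 2 * i"
  by (metis bar_bar bar_double)+

lemma barbell_ter [simp]: "ter (barbell r l) e = (if e = Suc (2 * r) then 0 else if e = 2 * r then 1 else if e < 4 then 0 else 1)"
  by (simp add: ter_def bar_less4)

lemma barbell_graph_ok: assumes r: "4 \<le> r" shows "graph_ok (barbell r l)"
proof -
  have "valence (barbell r l) 0 \<noteq> 1 \<and> valence (barbell r l) 0 \<noteq> 2"
    by (rule valence_ge3[of 0 1 2]) (use r in \<open>auto simp: barbell_edges\<close>)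
  moreover have "valence (barbell r l) 1 \<noteq> 1 \<and> valence (barbell r l) 1 \<noteq> 2"
    by (rule valence_ge3[of 4 5 6]) (use r in \<open>auto simp: barbell_edges\<close>)
  moreover have "is_path (barbell r l) 0 [2 * r] 1" "is_path (barbell r l) 1 [Suc (2 * r)] 0"
    "is_path (barbell r l) 0 [] 0" "is_path (barbell r l) 1 [] 1"
    by (auto simp: is_path_Cons[OF barbell_gwf] barbell_edges)
  ultimately show ?thesis unfolding graph_ok_def
    using barbell_gwf[of r l]
    by (auto simp: gwf_def less_2_cases_iff simp del: barbell_sel(3) intro: exI[of _ "[]"])
qed

text \<open>The bar is a maximal tree: petals carry their own letters as labels, the bar the empty
  word, and a far petal is marked by its conjugate along the bar. Collapsing the bar thus leaves the
  identity marking.\<close>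

lemma barbell_marking_ok: assumes r: "4 \<le> r" shows "marking_ok r (barbell r l)"
proof (rule marking_okI[where lb = "\<lambda>e. if e div 2 < r then [(e div 2, even e)] else []"
      and T = "\<lambda>v. if v = 0 then [] else [2 * r]"])
  show "\<forall>i<r. is_path (barbell r l) (base (barbell r l)) (mark (barbell r l) i) (base (barbell r l))"
    by (auto simp: is_path_Cons[OF barbell_gwf] barbell_edges)
  show "(if bar e div 2 < r then [(bar e div 2, even (bar e))] else []) =
     W.winverse (if e div 2 < r then [(e div 2, even e)] else [])" for e
    by simp
  show "lift (mark (barbell r l)) (if e div 2 < r then [(e div 2, even e)] else []) =
     B.fr ((if org (barbell r l) e = 0 then [] else [2 * r]) @
        e # rev_path (if ter (barbell r l) e = 0 then [] else [2 * r]))"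
    if "e \<in> edges (barbell r l)" for e
  proof -
    define i where "i = e div 2"
    have i: "e = 2 * i \<or> e = Suc (2 * i)" unfolding i_def by presburger
    have "i \<le> r" using that i by (auto simp: barbell_edges)
    show ?thesis
    proof (cases "i = r")
      case True
      have "B.fr [2 * r, Suc (2 * r)] = []" using B.fr_cancel[of "2 * r" "[]"] by simp
      then show ?thesis using i True by (elim disjE) (simp_all add: lift_alt rev_path_eq)
    next
      case False
      then have "i < r" using \<open>i \<le> r\<close> by simp
      from i show ?thesis
      proof
        assume e: "e = 2 * i"
        show ?thesis using \<open>i < r\<close> unfolding e
          by (cases "i < 2") (simp_all add: lift_alt sgn_path_def rev_path_eq)
      next
        assume e: "e = Suc (2 * i)"
        have "Suc (2 * i) \<noteq> 2 * r" by presburger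
        then show ?thesis using \<open>i < r\<close> unfolding e
          by (cases "i < 2") (simp_all add: lift_alt sgn_path_def rev_path_eq)
      qed
    qed
  qed
qed (use r in \<open>auto simp: barbell_gwf W.fr_Cons barbell_edges split: if_splits\<close>)

text \<open>With \<open>z = exp (- h * l r)\<close> the two vertex equations are linear in the
  potential. Their determinant vanishes exactly under \<open>eq\<close>, and then
  \<open>b * z\<close> and \<open>1 - a\<close> solve them. The eigenvector is positive along the
  bar because \<open>a + b > 1\<close>, which follows from \<open>eq\<close> and
  \<open>z < 1\<close>.\<close>

lemma barbell_entropy:
  assumes r: "4 \<le> r" and l: "\<And>i. i \<le> r \<Longrightarrow> 0 < l i" and h: "0 < h"
    and ab: "a = (\<Sum>i\<in>petals r True. yv (h * l i))" "b = (\<Sum>i\<in>petals r False. yv (h * l i))" "a < 1" "b < 1"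
    and eq: "(1 - a) * (1 - b) = a * b * exp (- 2 * h * l r)"
  shows "entropy (barbell r l') l = h"
proof (rule entropy_vertex[where P = "\<lambda>v. if v = 0 then b * exp (- h * l r) else 1 - a" and hub = "2 * r"])
  define z where "z = exp (- h * l r)"
  have z: "0 < z" "z < 1" "exp (- 2 * h * l r) = z\<^sup>2"
    using l[of r] h by (auto simp: z_def power2_eq_square exp_add[symmetric])
  have a0: "0 < a" "0 < b" unfolding ab using petals_nonempty[OF r] by (auto intro!: sum_pos)
  have e: "(1 - a) * (1 - b) = a * b * z\<^sup>2" using eq z by simp
  have "z\<^sup>2 < 1" using z by (simp add: power_less_one_iff)
  then have "a * b * z\<^sup>2 < a * b * 1" using a0 by (intro mult_strict_left_mono) auto
  then have s: "1 < a + b" using e by (simp add: algebra_simps)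
  show "gwf (barbell r l')" by (rule barbell_gwf)
  show "0 < l i" if "i < ne (barbell r l')" for i using that l by simp
  show "2 * r \<in> edges (barbell r l')" by (simp add: barbell_edges)
  have z0: "b * z * z < 1 - a"
  proof -
    have "a * (b * z * z) = (1 - a) * (1 - b)" using e by (simp add: power2_eq_square)
    also have "\<dots> < (1 - a) * a" using s ab by (intro mult_strict_left_mono) auto
    finally show ?thesis using a0 by (simp add: mult.commute)
  qed
  have z1: "(1 - a) * z < b * z" using s z by simp
  define P where "P v = (if v = 0 then b * exp (- h * l r) else 1 - a)" for v :: nat
  have P: "P 0 = b * z" "P (Suc 0) = 1 - a" by (simp_all add: P_def z_def)
  have Ppos: "0 < P v" for v using a0 ab z by (simp add: P_def)
  have "exp (- h * l (e div 2)) * P (org (barbell r l') e) < P (ter (barbell r l') e)"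
    if e: "e \<in> edges (barbell r l')" for e
  proof -
    have "e < 2 * r + 2" using e by (simp add: barbell_edges)
    then consider "e = 2 * r" | "e = Suc (2 * r)" | "e < 2 * r" by linarith
    then show ?thesis
    proof cases
      case 1
      then have "exp (- h * l (e div 2)) = z" by (simp add: z_def)
      then show ?thesis using 1 z0 by (simp add: P mult_ac)
    next
      case 2
      then have "exp (- h * l (e div 2)) = z" by (simp add: z_def)
      then show ?thesis using 2 z1 by (simp add: P mult_ac)
    next
      case 3
      then have "exp (- h * l (e div 2)) < 1" using l[of "e div 2"] h by auto
      moreover have "org (barbell r l') e = ter (barbell r l') e" using 3 by simp
      ultimately show ?thesis using Ppos[of "ter (barbell r l') e"] by simp
    qed
  qed
  then show "exp (- h * l (e div 2)) * (if org (barbell r l') e = 0 then b * exp (- h * l r) else 1 - a)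
      < (if ter (barbell r l') e = 0 then b * exp (- h * l r) else 1 - a)" if "e \<in> edges (barbell r l')" for e
    using that unfolding P_def by blast
  show "(\<Sum>f | f \<in> edges (barbell r l') \<and> org (barbell r l') f = v.
       exp (- h * l (f div 2)) * ((if ter (barbell r l') f = 0 then b * exp (- h * l r) else 1 - a)
          - exp (- h * l (f div 2)) * (if v = 0 then b * exp (- h * l r) else 1 - a)) /
       (1 - (exp (- h * l (f div 2)))\<^sup>2)) = (if v = 0 then b * exp (- h * l r) else 1 - a)"
    if v: "v < nv (barbell r l')" for v
  proof -
    define F where "F f = exp (- h * l (f div 2)) * (P (ter (barbell r l') f)
          - exp (- h * l (f div 2)) * P v) / (1 - (exp (- h * l (f div 2)))\<^sup>2)" for f
    have F: "F f = P v * yv (h * l (f div 2)) / 2" if "f div 2 < r" "ter (barbell r l') f = v" for f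
      using loop_term[of h "l (f div 2)" "P v"] l[of "f div 2"] h that by (simp add: F_def)
    have z2: "1 - z\<^sup>2 \<noteq> 0" using \<open>z\<^sup>2 < 1\<close> by simp
    let ?s = "\<lambda>b. \<Sum>i\<in>petals r b. yv (h * l i)"
    let ?t = "\<lambda>i. (if org (barbell r l') (2 * i) = v then F (2 * i) else 0) +
        (if org (barbell r l') (Suc (2 * i)) = v then F (Suc (2 * i)) else 0)"
    have pet: "(\<Sum>i<r. ?t i) = P v * ?s (v = 0)"
    proof -
      have "(\<Sum>i<r. ?t i) = (\<Sum>i\<in>petals r (v = 0). P v * yv (h * l i))"
        using v r by (intro sum.mono_neutral_cong_right) (auto simp: petals_def F)
      then show ?thesis by (simp add: sum_distrib_left)
    qed
    have sum: "(\<Sum>f | f \<in> edges (barbell r l') \<and> org (barbell r l') f = v. F f) = P v * ?s (v = 0) + ?t r"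
      unfolding sum_edges using pet by simp
    have zr: "exp (- (h * l r)) = z" by (simp add: z_def)
    define w where "w = ?t r"
    have w0: "w = z * (1 - a - z * (b * z)) / (1 - z\<^sup>2)" if "v = 0"
      unfolding w_def using that by (simp add: F_def P zr)
    have w1: "w = z * (b * z - z * (1 - a)) / (1 - z\<^sup>2)" if "v = 1"
      unfolding w_def using that by (simp add: F_def P zr)
    have "v = 0 \<or> v = 1" using v by (simp add: less_2_cases_iff)
    then have "P v * ?s (v = 0) + w = P v"
    proof
      assume v0: "v = 0"
      have "1 - a - z * (b * z) - b * (1 - a) * (1 - z\<^sup>2) = (1 - a) * (1 - b) - a * b * z\<^sup>2"
        by (simp add: algebra_simps power2_eq_square)
      then have "1 - a - z * (b * z) = b * (1 - a) * (1 - z\<^sup>2)" using e by linarith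
      then have "w = z * (b * (1 - a))" using z2 w0[OF v0] by simp
      moreover have "P v * ?s (v = 0) = b * z * a" using v0 by (simp add: P ab(1))
      moreover have "b * z * a + z * (b * (1 - a)) = b * z" by (simp add: algebra_simps)
      moreover have "P v = b * z" using v0 P by simp
      ultimately show ?thesis by linarith
    next
      assume v1: "v = 1"
      have "z * (b * z - z * (1 - a)) - (1 - a) * (1 - b) * (1 - z\<^sup>2) = a * b * z\<^sup>2 - (1 - a) * (1 - b)"
        by (simp add: algebra_simps power2_eq_square)
      then have "z * (b * z - z * (1 - a)) = (1 - a) * (1 - b) * (1 - z\<^sup>2)" using e by linarith
      then have "w = (1 - a) * (1 - b)" using z2 w1[OF v1] by simp
      moreover have "P v * ?s (v = 0) = (1 - a) * b" using v1 by (simp add: P ab(2))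
      moreover have "(1 - a) * b + (1 - a) * (1 - b) = 1 - a" by (simp add: algebra_simps)
      moreover have "P v = 1 - a" using v1 P by simp
      ultimately show ?thesis by linarith
    qed
    then have "(\<Sum>f | f \<in> edges (barbell r l') \<and> org (barbell r l') f = v. F f) = P v" using sum w_def by simp
    then show ?thesis unfolding F_def P_def .
  qed
  fix e assume e: "e \<in> edges (barbell r l')"
  have S: "f \<in> succs (barbell r l') d \<longleftrightarrow> f < 2 * r + 2 \<and> org (barbell r l') f = ter (barbell r l') d \<and> f \<noteq> bar d" for d f
    by (simp add: succs_def barbell_edges)
  have s0: "0 \<in> succs (barbell r l') (Suc (2 * r))" using r by (simp add: S)
  have s1: "2 * r \<in> succs (barbell r l') f" if "f < 4" for f 
  proof -
    have "bar f < 4" using that by (simp add: bar_less4)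
    then have "2 * r \<noteq> bar f" using r by linarith
    then show ?thesis using that r by (simp add: S)
  qed
  have s2: "Suc (2 * r) \<in> succs (barbell r l') f" if "4 \<le> f" "f < 2 * r" for f
  proof -
    have "Suc (2 * r) \<noteq> bar f" using that by (metis bar_eq_simps(2) less_irrefl)
    then show ?thesis using that r by (simp add: S)
  qed
  have s3: "4 \<in> succs (barbell r l') (2 * r)" using r by (simp add: S)
  have "e < 2 * r + 2" using e by (simp add: barbell_edges)
  then consider "e < 4" | "e = Suc (2 * r)" | "e = 2 * r" | "4 \<le> e" "e < 2 * r" by linarith
  then show "\<exists>q. nb (barbell r l') e (q @ [2 * r])"
  proof cases
    case 1
    have "nb (barbell r l') e ([] @ [2 * r])" using s1[OF 1] by simp
    then show ?thesis by blast
  next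
    case 2
    have "nb (barbell r l') e ([0] @ [2 * r])" using s0 s1[of 0] 2 by simp
    then show ?thesis by blast
  next
    case 3
    have "nb (barbell r l') e ([4, Suc (2 * r), 0] @ [2 * r])"
      using s0 s1[of 0] s2[of 4] s3 3 r by simp
    then show ?thesis by blast
  next
    case 4
    have "nb (barbell r l') e ([Suc (2 * r), 0] @ [2 * r])" using s0 s1[of 0] s2[OF 4] by simp
    then show ?thesis by blast
  qed
qed (fact h)

section \<open>The separated entropy equation of the barbell and its Hessian\<close>

definition logit :: "real \<Rightarrow> real" where "logit a = ln a - ln (1 - a)"

lemma logit_deriv: "0 < a \<Longrightarrow> a < 1 \<Longrightarrow> (logit has_real_derivative 1 / (a * (1 - a))) (at a)"
  unfolding logit_def by (auto intro!: derivative_eq_intros simp: field_simps)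

lemma logit_deriv2: "0 < a \<Longrightarrow> a < 1 \<Longrightarrow>
   ((\<lambda>a. 1 / (a * (1 - a))) has_real_derivative (2 * a - 1) / (a * (1 - a))\<^sup>2) (at a)"
  by (auto intro!: derivative_eq_intros simp: power2_eq_square)

lemma logit_sum_pos: "0 < a \<Longrightarrow> a < 1 \<Longrightarrow> 0 < b \<Longrightarrow> b < 1 \<Longrightarrow> 1 < a + b \<Longrightarrow> 0 < logit a + logit b"
proof -
  assume h: "0 < a" "a < 1" "0 < b" "b < 1" "1 < a + b"
  have "(1 - a) * (1 - b) < a * b" using h by (simp add: algebra_simps)
  moreover have "0 < (1 - a) * (1 - b)" using h by (intro mult_pos_pos) auto
  ultimately have "ln ((1 - a) * (1 - b)) < ln (a * b)" using h by (subst ln_less_cancel_iff) (auto intro: mult_pos_pos)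
  then show ?thesis using h by (simp add: logit_def ln_mult)
qed

lemma logit_sum_zero: "0 < a \<Longrightarrow> a < 1 \<Longrightarrow> logit a + logit (1 - a) = 0" by (simp add: logit_def)

text \<open>Logarithms split the barbell equation into one term for each side and one for the bar,
  the shape required by \<open>hess_form_implicit\<close>.\<close>

lemma logit_eq:
  assumes "0 < a" "a < 1" "0 < b" "b < 1" "logit a + logit b = 2 * t"
  shows "(1 - a) * (1 - b) = a * b * exp (- 2 * t)"
proof -
  have "ln ((1 - a) * (1 - b)) = ln (a * b) - 2 * t" using assms by (simp add: logit_def ln_mult)
  have "0 < (1 - a) * (1 - b)" "0 < a * b" using assms by (auto intro: mult_pos_pos)
  have "(1 - a) * (1 - b) = exp (ln ((1 - a) * (1 - b)))"
    using \<open>0 < (1 - a) * (1 - b)\<close> by (rule exp_ln[symmetric])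
  also have "\<dots> = exp (ln (a * b)) * exp (- 2 * t)" using \<open>ln ((1 - a) * (1 - b)) = ln (a * b) - 2 * t\<close>
    by (simp add: exp_add[symmetric])
  also have "exp (ln (a * b)) = a * b" using \<open>0 < a * b\<close> by (rule exp_ln)
  finally show ?thesis .
qed

text \<open>Coordinates on the unit entropy barbells: side weights \<open>w\<close> and, within each
  side, proportions \<open>\<theta>\<close> in an open simplex. The length of the bar is forced by
  the separated equation; it vanishes when the side weights sum to 1, and the barbell is then a
  rose.\<close>

definition blen :: "nat \<Rightarrow> (bool \<Rightarrow> real) \<Rightarrow> (nat \<Rightarrow> real) \<Rightarrow> nat \<Rightarrow> real" where
  "blen r w \<theta> i = (if i < r then ylen (w (i < 2) * \<theta> i) else (logit (w True) + logit (w False)) / 2)"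

definition dblen :: "nat \<Rightarrow> (bool \<Rightarrow> real) \<Rightarrow> (nat \<Rightarrow> real) \<Rightarrow> (bool \<Rightarrow> real) \<Rightarrow> (nat \<Rightarrow> real) \<Rightarrow> nat \<Rightarrow> real" where
  "dblen r w \<theta> dw d\<theta> i = (if i < r then
      - (dw (i < 2) * \<theta> i + w (i < 2) * d\<theta> i) / (w (i < 2) * \<theta> i * (1 - w (i < 2) * \<theta> i / 2))
    else (dw True / (w True * (1 - w True)) + dw False / (w False * (1 - w False))) / 2)"

text \<open>What one side contributes to the bound for the numerator of the Hessian: a radial part
  for the side weight and the Fisher metric of the simplex for the proportions.\<close>

definition bcost :: "nat \<Rightarrow> (bool \<Rightarrow> real) \<Rightarrow> (nat \<Rightarrow> real) \<Rightarrow> (bool \<Rightarrow> real) \<Rightarrow> (nat \<Rightarrow> real) \<Rightarrow> bool \<Rightarrow> real" where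
  "bcost r w \<theta> dw d\<theta> b = (dw b)\<^sup>2 / (w b * (1 - w b)\<^sup>2) + (\<Sum>i\<in>petals r b. (d\<theta> i)\<^sup>2 / \<theta> i) / (1 - w b)"

definition simplices :: "nat \<Rightarrow> (nat \<Rightarrow> real) \<Rightarrow> bool" where
  "simplices r \<theta> \<longleftrightarrow> (\<forall>i<r. 0 < \<theta> i) \<and> (\<forall>b. (\<Sum>i\<in>petals r b. \<theta> i) = 1)"

lemma petals_side: "i \<in> petals r b \<Longrightarrow> 4 \<le> r \<Longrightarrow> i < r \<and> (i < 2) = b"
  by (auto simp: petals_def split: if_splits)

lemma petals_mem: "i < r \<Longrightarrow> i \<in> petals r (i < 2)" by (auto simp: petals_def)

lemma simplices_le1:
  assumes "simplices r \<theta>" "4 \<le> r" "i < r" shows "\<theta> i \<le> 1"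
proof -
  have "\<theta> i \<le> (\<Sum>j\<in>petals r (i < 2). \<theta> j)"
  proof (rule member_le_sum[OF petals_mem[OF assms(3)]])
    fix j assume "j \<in> petals r (i < 2) - {i}"
    then have "j < r" using petals_side[OF _ assms(2), of j] by blast
    then show "0 \<le> \<theta> j" using assms(1) by (simp add: simplices_def less_imp_le)
  qed simp
  then show ?thesis using assms by (simp add: simplices_def)
qed

lemma sum_bool_option: "(\<Sum>k\<in>UNIV. F k) = F None + (\<Sum>b\<in>UNIV. F (Some b))" for F :: "bool option \<Rightarrow> real"
  by (simp add: UNIV_option_conv sum.reindex)

text \<open>Radial and simplicial velocities are orthogonal, since the cross term is a multiple of
  the sum of \<open>d\<theta>\<close>.\<close>

lemma sum_sq_div:
  fixes w dw :: real
  assumes w: "0 < w" and \<theta>: "\<And>i. i \<in> A \<Longrightarrow> 0 < \<theta> i" and s: "(\<Sum>i\<in>A. \<theta> i) = 1" "(\<Sum>i\<in>A. d\<theta> i) = 0"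
  shows "(\<Sum>i\<in>A. (dw * \<theta> i + w * d\<theta> i)\<^sup>2 / (w * \<theta> i)) = dw\<^sup>2 / w + w * (\<Sum>i\<in>A. (d\<theta> i)\<^sup>2 / \<theta> i)"
proof -
  have "(\<Sum>i\<in>A. (dw * \<theta> i + w * d\<theta> i)\<^sup>2 / (w * \<theta> i)) = (\<Sum>i\<in>A. dw\<^sup>2 / w * \<theta> i + 2 * dw * d\<theta> i + w * ((d\<theta> i)\<^sup>2 / \<theta> i))"
  proof (rule sum.cong[OF refl])
    fix i assume "i \<in> A"
    then show "(dw * \<theta> i + w * d\<theta> i)\<^sup>2 / (w * \<theta> i) = dw\<^sup>2 / w * \<theta> i + 2 * dw * d\<theta> i + w * ((d\<theta> i)\<^sup>2 / \<theta> i)"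
      using w \<theta>[of i] by (simp add: field_simps power2_eq_square)
  qed
  also have "\<dots> = dw\<^sup>2 / w * (\<Sum>i\<in>A. \<theta> i) + 2 * dw * (\<Sum>i\<in>A. d\<theta> i) + w * (\<Sum>i\<in>A. (d\<theta> i)\<^sup>2 / \<theta> i)"
    by (simp add: sum.distrib sum_distrib_left)
  finally show ?thesis using s by simp
qed

text \<open>A petal of weight at most 3/4 has length at least \<open>ln (5 / 3)\<close>, which
  exceeds 2/5, and 5/8 times 2/5 is 1/4.\<close>

lemma ylen_lower: assumes "0 < y" "y \<le> 3 / 4" shows "1 / 4 \<le> (1 - y / 2) * ylen y"
proof -
  have "5 / 3 \<le> 2 / y - 1" using assms by (simp add: field_simps)
  then have "ln (5 / 3) \<le> ylen y" unfolding ylen_def by simp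
  moreover have "2 / 5 \<le> ln (5 / 3 :: real)" using ln_one_minus_pos_upper_bound[of "2/5"] by (simp add: ln_div)
  ultimately have "2 / 5 \<le> ylen y" by linarith
  moreover have "5 / 8 \<le> 1 - y / 2" using assms by simp
  ultimately have "5 / 8 * (2 / 5) \<le> (1 - y / 2) * ylen y" by (intro mult_mono) auto
  then show ?thesis by simp
qed

text \<open>The left side is the second derivative of \<open>logit\<close> at the side weight plus
  its first derivative times the second order terms of the petals. Replacing \<open>1 - y\<close> by
  \<open>1 - y / 2\<close> makes the petal sum computable, after which the two coefficients of
  \<open>dw^2\<close> add up to \<open>1 / (w * (1 - w)^2)\<close>.\<close>

lemma side_second_order:
  fixes w dw :: real
  assumes w: "0 < w" "w < 1" and \<theta>: "\<And>i. i \<in> A \<Longrightarrow> 0 < \<theta> i \<and> \<theta> i \<le> 1"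
    and s: "(\<Sum>i\<in>A. \<theta> i) = 1" "(\<Sum>i\<in>A. d\<theta> i) = 0"
  shows "(2 * w - 1) / (w * (1 - w))\<^sup>2 * dw\<^sup>2 + 1 / (w * (1 - w)) *
     (\<Sum>i\<in>A. w * \<theta> i * (1 - w * \<theta> i / 2) * (1 - w * \<theta> i) * (- (dw * \<theta> i + w * d\<theta> i) / (w * \<theta> i * (1 - w * \<theta> i / 2)))\<^sup>2)
   \<le> dw\<^sup>2 / (w * (1 - w)\<^sup>2) + (\<Sum>i\<in>A. (d\<theta> i)\<^sup>2 / \<theta> i) / (1 - w)"
proof -
  define Q where "Q = (\<Sum>i\<in>A. (d\<theta> i)\<^sup>2 / \<theta> i)"
  have "(\<Sum>i\<in>A. w * \<theta> i * (1 - w * \<theta> i / 2) * (1 - w * \<theta> i) * (- (dw * \<theta> i + w * d\<theta> i) / (w * \<theta> i * (1 - w * \<theta> i / 2)))\<^sup>2)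
     \<le> (\<Sum>i\<in>A. (dw * \<theta> i + w * d\<theta> i)\<^sup>2 / (w * \<theta> i))"
  proof (rule sum_mono)
    fix i assume i: "i \<in> A"
    define y d where "y = w * \<theta> i" and "d = dw * \<theta> i + w * d\<theta> i"
    have "w * \<theta> i \<le> w" using \<theta>[OF i] w by (intro mult_left_le) auto
    moreover have "0 < w * \<theta> i" using w \<theta>[OF i] by (intro mult_pos_pos) auto
    ultimately have y: "0 < y" "y < 1" using w unfolding y_def by linarith+
    have alg: "y * q * p * (- d / (y * q))\<^sup>2 = d\<^sup>2 / y * (p / q)" if "q \<noteq> 0" for p q
      using that y(1) by (simp add: power2_eq_square)
    have "y * (1 - y / 2) * (1 - y) * (- d / (y * (1 - y / 2)))\<^sup>2 = d\<^sup>2 / y * ((1 - y) / (1 - y / 2))"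
      using y by (intro alg) auto
    also have "\<dots> \<le> d\<^sup>2 / y * 1" using y by (intro mult_left_mono) auto
    finally show "w * \<theta> i * (1 - w * \<theta> i / 2) * (1 - w * \<theta> i) * (- (dw * \<theta> i + w * d\<theta> i) / (w * \<theta> i * (1 - w * \<theta> i / 2)))\<^sup>2
      \<le> (dw * \<theta> i + w * d\<theta> i)\<^sup>2 / (w * \<theta> i)" unfolding y_def d_def by simp
  qed
  also have "\<dots> = dw\<^sup>2 / w + w * Q" unfolding Q_def using sum_sq_div[OF w(1) _ s, of dw] \<theta> by simp
  finally have "(2 * w - 1) / (w * (1 - w))\<^sup>2 * dw\<^sup>2 + 1 / (w * (1 - w)) *
     (\<Sum>i\<in>A. w * \<theta> i * (1 - w * \<theta> i / 2) * (1 - w * \<theta> i) * (- (dw * \<theta> i + w * d\<theta> i) / (w * \<theta> i * (1 - w * \<theta> i / 2)))\<^sup>2)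
    \<le> (2 * w - 1) / (w * (1 - w))\<^sup>2 * dw\<^sup>2 + 1 / (w * (1 - w)) * (dw\<^sup>2 / w + w * Q)"
    using w by (intro add_left_mono mult_left_mono) auto
  also have "\<dots> = dw\<^sup>2 / (w * (1 - w)\<^sup>2) + Q / (1 - w)"
  proof -
    have n: "w \<noteq> 0" "1 - w \<noteq> 0" using w by auto
    have "1 / (w * (1 - w)) / w = (1 - w) / (w * (1 - w))\<^sup>2" using n by (simp add: power2_eq_square)
    then have "(2 * w - 1) / (w * (1 - w))\<^sup>2 + 1 / (w * (1 - w)) / w = w / (w * (1 - w))\<^sup>2"
      by (simp add: add_divide_distrib[symmetric])
    also have "\<dots> = 1 / (w * (1 - w)\<^sup>2)" using n by (simp add: power2_eq_square)
    finally have 1: "(2 * w - 1) / (w * (1 - w))\<^sup>2 + 1 / (w * (1 - w)) / w = 1 / (w * (1 - w)\<^sup>2)" .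
    have "(2 * w - 1) / (w * (1 - w))\<^sup>2 * dw\<^sup>2 + 1 / (w * (1 - w)) * (dw\<^sup>2 / w + w * Q)
      = ((2 * w - 1) / (w * (1 - w))\<^sup>2 + 1 / (w * (1 - w)) / w) * dw\<^sup>2 + 1 / (w * (1 - w)) * (w * Q)"
      by (simp add: distrib_right distrib_left)
    also have "\<dots> = dw\<^sup>2 / (w * (1 - w)\<^sup>2) + Q / (1 - w)" unfolding 1 using w by simp
    finally show ?thesis .
  qed
  finally show ?thesis unfolding Q_def .
qed

text \<open>Every summand of the denominator is nonnegative, and a side whose petals have weight at
  most 3/4 alone contributes \<open>1 / (4 * (1 - w \<beta>))\<close>. This is the factor gained.
  Either side may serve as \<open>\<beta>\<close>, also one that does not move.\<close>

lemma barbell_hess: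
  assumes r: "4 \<le> r" and w: "\<And>b. 0 < w b \<and> w b < 1" "1 < w True + w False" and \<theta>: "simplices r \<theta>"
    and d\<theta>: "\<And>b. (\<Sum>i\<in>petals r b. d\<theta> i) = 0" and good: "\<And>i. i \<in> petals r \<beta> \<Longrightarrow> w \<beta> * \<theta> i \<le> 3 / 4"
  shows "hess_form (barbell r l') (blen r w \<theta>) (dblen r w \<theta> dw d\<theta>)
     \<le> 4 * (1 - w \<beta>) * (bcost r w \<theta> dw d\<theta> True + bcost r w \<theta> dw d\<theta> False)"
proof -
  \<comment> \<open>\<open>None\<close> stands for the bar, \<open>Some b\<close> for the petals of
    side \<open>b\<close>.\<close>
  define I where "I k = (case k of None \<Rightarrow> {r} | Some b \<Rightarrow> petals r b)" for k
  define U where "U k = (case k of None \<Rightarrow> UNIV | Some b \<Rightarrow> {0<..<1::real})" for k :: "bool option"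
  define f where "f k = (case k of None \<Rightarrow> (\<lambda>x::real. x) | Some b \<Rightarrow> yv)" for k :: "bool option"
  define f' where "f' k = (case k of None \<Rightarrow> (\<lambda>x::real. 1) | Some b \<Rightarrow> (\<lambda>x. - (yv x * (1 - yv x / 2))))" for k :: "bool option"
  define f'' where "f'' k = (case k of None \<Rightarrow> (\<lambda>x::real. 0) | Some b \<Rightarrow> (\<lambda>x. yv x * (1 - yv x / 2) * (1 - yv x)))" for k :: "bool option"
  define g where "g k = (case k of None \<Rightarrow> (\<lambda>x::real. - 2 * x) | Some b \<Rightarrow> logit)" for k :: "bool option"
  define g' where "g' k = (case k of None \<Rightarrow> (\<lambda>x::real. - 2) | Some b \<Rightarrow> (\<lambda>x. 1 / (x * (1 - x))))" for k :: "bool option"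
  define g'' where "g'' k = (case k of None \<Rightarrow> (\<lambda>x::real. 0) | Some b \<Rightarrow> (\<lambda>x. (2 * x - 1) / (x * (1 - x))\<^sup>2))" for k :: "bool option"
  note defs = I_def U_def f_def f'_def f''_def g_def g'_def g''_def
  define l v y where "l = blen r w \<theta>" and "v = dblen r w \<theta> dw d\<theta>" and "y i = w (i < 2) * \<theta> i" for i
  have y: "0 < y i" "y i < 1" if "i < r" for i
  proof -
    have "w (i < 2) * \<theta> i \<le> w (i < 2)"
      using w simplices_le1[OF \<theta> r that] by (intro mult_left_le) (auto simp: less_imp_le)
    then show "y i < 1" using w(1)[of "i < 2"] unfolding y_def by linarith
    show "0 < y i" using w \<theta> that by (simp add: y_def simplices_def)
  qed
  have ly: "l i = ylen (y i)" "yv (l i) = y i" if "i < r" for i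
    using that y[OF that] by (simp_all add: l_def blen_def y_def yv_ylen)
  have lr: "2 * l r = logit (w True) + logit (w False)" "0 < l r"
    using logit_sum_pos[of "w True" "w False"] w by (auto simp: l_def blen_def)
  have lpos: "0 < l i" if "i \<le> r" for i
    using that lr(2) ylen_pos[of "y i"] y[of i] ly[of i] by (cases "i = r") auto
  have vi: "v i = - (dw b * \<theta> i + w b * d\<theta> i) / (w b * \<theta> i * (1 - w b * \<theta> i / 2))" if "i \<in> petals r b" for i b
    using petals_side[OF that r] by (simp add: v_def dblen_def)
  have yi: "yv (l i) = w b * \<theta> i" "l i = ylen (w b * \<theta> i)" "0 < w b * \<theta> i" "w b * \<theta> i < 1" if "i \<in> petals r b" for i b
    using petals_side[OF that r] ly[of i] y[of i] by (simp_all add: y_def)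
  have S: "(\<Sum>i\<in>petals r b. yv (l i)) = w b" for b
  proof -
    have "(\<Sum>i\<in>petals r b. yv (l i)) = (\<Sum>i\<in>petals r b. w b * \<theta> i)" using yi by (intro sum.cong) auto
    then show ?thesis using \<theta> by (simp add: sum_distrib_left[symmetric] simplices_def)
  qed
  have dS: "(\<Sum>i\<in>petals r b. - (yv (l i) * (1 - yv (l i) / 2)) * v i) = dw b" for b
  proof -
    have "(\<Sum>i\<in>petals r b. - (yv (l i) * (1 - yv (l i) / 2)) * v i) = (\<Sum>i\<in>petals r b. dw b * \<theta> i + w b * d\<theta> i)"
    proof (rule sum.cong[OF refl])
      fix i assume i: "i \<in> petals r b"
      show "- (yv (l i) * (1 - yv (l i) / 2)) * v i = dw b * \<theta> i + w b * d\<theta> i"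
      proof -
        have c: "0 < w b * \<theta> i * (1 - w b * \<theta> i / 2)" using yi(4)[OF i] by (intro mult_pos_pos[OF yi(3)[OF i]]) linarith
        have "- c * (- D / c) = D" if "0 < c" for c D :: real using that by simp
        from this[OF c] show ?thesis unfolding yi(1)[OF i] vi[OF i] .
      qed
    qed
    then show ?thesis using \<theta> d\<theta> by (simp add: sum.distrib sum_distrib_left[symmetric] simplices_def)
  qed
  note dS' = dS[unfolded mult_minus_left]
  have vr: "2 * v r = dw True / (w True * (1 - w True)) + dw False / (w False * (1 - w False))"
    by (simp add: v_def dblen_def mult.commute)
  define N where "N b = (2 * w b - 1) / (w b * (1 - w b))\<^sup>2 * (dw b)\<^sup>2 + 1 / (w b * (1 - w b)) *
     (\<Sum>i\<in>petals r b. yv (l i) * (1 - yv (l i) / 2) * (1 - yv (l i)) * (v i)\<^sup>2)" for b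
  define D where "D b = 1 / (w b * (1 - w b)) * (\<Sum>i\<in>petals r b. yv (l i) * (1 - yv (l i) / 2) * l i)" for b
  have D0: "0 \<le> D b" for b
  proof -
    have "0 \<le> yv (l i) * (1 - yv (l i) / 2) * l i" if i: "i \<in> petals r b" for i
    proof -
      have "0 \<le> 1 - w b * \<theta> i / 2" using yi(4)[OF i] by linarith
      moreover have "0 \<le> l i" using lpos[of i] petals_side[OF i r] by simp
      ultimately show ?thesis unfolding yi(1)[OF i]
        by (intro mult_nonneg_nonneg[OF mult_nonneg_nonneg[OF less_imp_le[OF yi(3)[OF i]]]])
    qed
    then have "0 \<le> (\<Sum>i\<in>petals r b. yv (l i) * (1 - yv (l i) / 2) * l i)" by (rule sum_nonneg)
    then show ?thesis unfolding D_def using w(1)[of b] by simp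
  qed
  have N: "N b \<le> bcost r w \<theta> dw d\<theta> b" for b
  proof -
    have "N b = (2 * w b - 1) / (w b * (1 - w b))\<^sup>2 * (dw b)\<^sup>2 + 1 / (w b * (1 - w b)) *
       (\<Sum>i\<in>petals r b. w b * \<theta> i * (1 - w b * \<theta> i / 2) * (1 - w b * \<theta> i) *
         (- (dw b * \<theta> i + w b * d\<theta> i) / (w b * \<theta> i * (1 - w b * \<theta> i / 2)))\<^sup>2)"
      unfolding N_def using yi vi by (intro arg_cong2[where f = plus] arg_cong2[where f = times] refl sum.cong) auto
    also have "\<dots> \<le> bcost r w \<theta> dw d\<theta> b"
      unfolding bcost_def using w \<theta> d\<theta> simplices_le1[OF \<theta> r] petals_side[OF _ r]
      by (intro side_second_order) (auto simp: simplices_def)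
    finally show ?thesis .
  qed
  have D\<beta>: "1 / (4 * (1 - w \<beta>)) \<le> D \<beta>"
  proof -
    have "(\<Sum>i\<in>petals r \<beta>. w \<beta> * \<theta> i * (1 / 4)) \<le> (\<Sum>i\<in>petals r \<beta>. yv (l i) * (1 - yv (l i) / 2) * l i)"
    proof (rule sum_mono)
      fix i assume i: "i \<in> petals r \<beta>"
      have "w \<beta> * \<theta> i * (1 / 4) \<le> w \<beta> * \<theta> i * ((1 - w \<beta> * \<theta> i / 2) * ylen (w \<beta> * \<theta> i))"
        using ylen_lower[OF yi(3)[OF i] good[OF i]] yi(3)[OF i] by (intro mult_left_mono) auto
      then show "w \<beta> * \<theta> i * (1 / 4) \<le> yv (l i) * (1 - yv (l i) / 2) * l i"
        unfolding yi(1)[OF i] unfolding yi(2)[OF i] by (simp add: mult.assoc)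
    qed
    moreover have "(\<Sum>i\<in>petals r \<beta>. w \<beta> * \<theta> i * (1 / 4)) = w \<beta> / 4"
      using \<theta> by (simp add: sum_divide_distrib[symmetric] sum_distrib_left[symmetric] simplices_def)
    ultimately have "1 / (w \<beta> * (1 - w \<beta>)) * (w \<beta> / 4) \<le> D \<beta>"
      unfolding D_def using w(1)[of \<beta>] by (intro mult_left_mono) auto
    moreover have "1 / (w \<beta> * (1 - w \<beta>)) * (w \<beta> / 4) = 1 / (4 * (1 - w \<beta>))" using w(1)[of \<beta>] by simp
    ultimately show ?thesis by simp
  qed
  have den: "(\<Sum>k\<in>UNIV. g' k (\<Sum>i\<in>I k. f k (l i)) * (\<Sum>i\<in>I k. f' k (l i) * l i)) = - (2 * l r + D True + D False)"
    unfolding sum_bool_option by (simp add: defs S D_def UNIV_bool sum_negf)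
  have num: "(\<Sum>k\<in>UNIV. g'' k (\<Sum>i\<in>I k. f k (l i)) * (\<Sum>i\<in>I k. f' k (l i) * v i)\<^sup>2
     + g' k (\<Sum>i\<in>I k. f k (l i)) * (\<Sum>i\<in>I k. f'' k (l i) * (v i)\<^sup>2)) = N True + N False"
    unfolding sum_bool_option by (simp add: defs S dS' N_def UNIV_bool)
  have dpos: "0 < 2 * l r + D True + D False" using lr(2) D0[of True] D0[of False] by linarith
  have "hess_form (barbell r l') l v = - (\<Sum>k\<in>UNIV. g'' k (\<Sum>i\<in>I k. f k (l i)) * (\<Sum>i\<in>I k. f' k (l i) * v i)\<^sup>2
     + g' k (\<Sum>i\<in>I k. f k (l i)) * (\<Sum>i\<in>I k. f'' k (l i) * (v i)\<^sup>2))
       / (\<Sum>k\<in>UNIV. g' k (\<Sum>i\<in>I k. f k (l i)) * (\<Sum>i\<in>I k. f' k (l i) * l i))"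
  proof (rule hess_form_implicit[where U = U and g = g])
    show "finite (UNIV :: bool option set)" by simp
    show "finite (I k)" for k by (simp add: I_def split: option.split)
    show "open (U k) \<and> (\<Sum>i\<in>I k. f k (l i)) \<in> U k" for k using S w by (simp add: defs split: option.split)
    show "0 < l i" if "i \<in> I k" for k i using that lpos petals_side[OF _ r]
      by (auto simp: I_def split: option.splits intro: less_imp_le)
    show "(f k has_real_derivative f' k x) (at x)" for k x using yv_deriv by (auto simp: defs split: option.split)
    show "(f' k has_real_derivative f'' k x) (at x)" for k x using yv_deriv2 by (auto simp: defs split: option.split)
    show "(g k has_real_derivative g' k x) (at x)" if "x \<in> U k" for k x
      using that logit_deriv[of x] by (auto simp: defs split: option.splits intro!: derivative_eq_intros)
    show "(g' k has_real_derivative g'' k x) (at x)" if "x \<in> U k" for k x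
      using that logit_deriv2[of x] by (auto simp: defs split: option.splits intro!: derivative_eq_intros)
    show "(\<Sum>k\<in>UNIV. g k (\<Sum>i\<in>I k. f k (l i))) = 0"
      unfolding sum_bool_option using lr by (simp add: defs S UNIV_bool)
    show "(\<Sum>k\<in>UNIV. g' k (\<Sum>i\<in>I k. f k (l i)) * (\<Sum>i\<in>I k. f' k (l i) * l i)) < 0"
      unfolding den using dpos by simp
    show "(\<Sum>k\<in>UNIV. g' k (\<Sum>i\<in>I k. f k (l i)) * (\<Sum>i\<in>I k. f' k (l i) * v i)) = 0"
      unfolding sum_bool_option by (simp add: defs S dS' UNIV_bool vr)
    show "entropy (barbell r l') m = h" if h: "0 < h" and m: "\<And>k i. k \<in> UNIV \<Longrightarrow> i \<in> I k \<Longrightarrow> 0 < m i"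
      and mU: "\<And>k. k \<in> UNIV \<Longrightarrow> (\<Sum>i\<in>I k. f k (h * m i)) \<in> U k"
      and z: "(\<Sum>k\<in>UNIV. g k (\<Sum>i\<in>I k. f k (h * m i))) = 0" for h m
    proof (rule barbell_entropy[OF r _ h refl refl])
      show "0 < m i" if "i \<le> r" for i
      proof (cases "i = r")
        case True then show ?thesis using m[of None i] by (simp add: I_def)
      next
        case False then show ?thesis using m[of "Some (i < 2)" i] that petals_mem[of i r] by (simp add: I_def)
      qed
      let ?s = "\<lambda>b. \<Sum>i\<in>petals r b. yv (h * m i)"
      have u: "0 < ?s b" "?s b < 1" for b using mU[of "Some b"] by (auto simp: defs)
      show "?s True < 1" "?s False < 1" using u by auto
      have "logit (?s True) + logit (?s False) = 2 * (h * m r)"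
        using z unfolding sum_bool_option by (simp add: defs UNIV_bool)
      from logit_eq[OF u u this]
      show "(1 - ?s True) * (1 - ?s False) = ?s True * ?s False * exp (- 2 * h * m r)"
        by (simp add: mult.assoc)
    qed
  qed
  also have "\<dots> = (N True + N False) / (2 * l r + D True + D False)"
    unfolding den num by (rule minus_divide_divide)
  also have "\<dots> \<le> (bcost r w \<theta> dw d\<theta> True + bcost r w \<theta> dw d\<theta> False) / (2 * l r + D True + D False)"
    using N[of True] N[of False] dpos by (intro divide_right_mono) auto
  also have "\<dots> \<le> (bcost r w \<theta> dw d\<theta> True + bcost r w \<theta> dw d\<theta> False) / (1 / (4 * (1 - w \<beta>)))"
  proof (rule divide_left_mono)
    have "D \<beta> \<le> 2 * l r + D True + D False" using D0[of True] D0[of False] lr(2) by (cases \<beta>) auto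
    then show "1 / (4 * (1 - w \<beta>)) \<le> 2 * l r + D True + D False" using D\<beta> by linarith
    have "0 \<le> bcost r w \<theta> dw d\<theta> b" for b unfolding bcost_def
      using w(1)[of b] \<theta> petals_side[OF _ r]
      by (intro add_nonneg_nonneg divide_nonneg_nonneg mult_nonneg_nonneg sum_nonneg) (auto simp: simplices_def less_imp_le)
    then show "0 \<le> bcost r w \<theta> dw d\<theta> True + bcost r w \<theta> dw d\<theta> False" by (intro add_nonneg_nonneg)
    show "0 < (2 * l r + D True + D False) * (1 / (4 * (1 - w \<beta>)))"
      using dpos w(1)[of \<beta>] by (intro mult_pos_pos) auto
  qed
  finally show ?thesis unfolding l_def v_def by (simp add: mult.commute)
qed

section \<open>Paths through barbells\<close>

lemma collapse_rep_len:
  fixes G :: mgraph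
  assumes p: "point r (G\<lparr>len := l\<rparr>)"
  shows "collapse_rep r G l (G\<lparr>len := l\<rparr>)"
proof -
  have pos: "0 < l (e div 2)" if "e \<in> edges G" for e using p that by (auto simp: point_def edges_def)
  have b: "base G < nv G" "\<forall>i<r. is_path G (base G) (mark G i) (base G)"
    using p by (auto simp: point_def marking_ok_def)
  have m: "filter (\<lambda>e. 0 < l (e div 2)) (mark G i) = mark G i" if "i < r" for i
    using b(2) that is_path_edges[of G "base G" "mark G i" "base G"] pos by (auto simp: filter_id_conv)
  show ?thesis unfolding collapse_rep_def
  proof (intro conjI exI[of _ "\<lambda>v. v"] exI[of _ "\<lambda>e. e"] exI[of _ "[]"])
    show "\<forall>i<ne G. 0 \<le> l i" using p by (auto simp: point_def less_imp_le)
    show "bij_betw (\<lambda>e. e) {e \<in> edges G. 0 < l (e div 2)} (edges (G\<lparr>len := l\<rparr>))"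
      using pos by (intro bij_betwI[where g = "\<lambda>e. e"]) auto
    show "\<forall>e\<in>edges G. l (e div 2) = 0 \<longrightarrow> org G e = ter G e" using pos by force
    show "\<forall>u<nv G. \<forall>v<nv G. u = v \<longrightarrow> (\<exists>q. is_path G u q v \<and> (\<forall>e\<in>set q. l (e div 2) = 0))"
      by (auto intro!: exI[of _ "[]"])
    show "\<forall>q u. is_path G u q u \<and> reduced_by bar q \<and> q \<noteq> [] \<longrightarrow> (\<exists>e\<in>set q. 0 < l (e div 2))"
    proof (intro allI impI, elim conjE)
      fix q u assume "is_path G u q u" "q \<noteq> []"
      then have "hd q \<in> set q" "hd q \<in> edges G" using is_path_edges[of G u q u] hd_in_set by blast+
      then show "\<exists>e\<in>set q. 0 < l (e div 2)" using pos by blast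
    qed
  qed (use p b m in \<open>auto simp: rev_path_eq\<close>)
qed

text \<open>Reversal of the petals in \<open>F\<close>. With it one barbell path ends both at a rose
  and at its image under an inversion, which are the same point in two records.\<close>

definition eflip :: "nat set \<Rightarrow> nat \<Rightarrow> nat" where
  "eflip F e = (if e div 2 \<in> F then bar e else e)"

lemma eflip_simps [simp]: "eflip F (bar e) = bar (eflip F e)" "eflip F e div 2 = e div 2" "eflip F (eflip F e) = e"
  by (auto simp: eflip_def)

lemma collapse_barbell_rose:
  assumes r: "4 \<le> r" and l: "l r = 0" "\<And>i. i < r \<Longrightarrow> 0 < l i" and p: "point r x"
    and x: "nv x = 1" "ne x = r" "org x = (\<lambda>_. 0)" "base x = 0" "\<And>i. i < r \<Longrightarrow> len x i = l i"
      "\<And>i. i < r \<Longrightarrow> mark x i = [eflip F (2 * i)]"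
  shows "collapse_rep r (barbell r l') l x"
proof -
  have pos: "0 < l (e div 2) \<longleftrightarrow> e < 2 * r" if "e < 2 * r + 2" for e
  proof (cases "e < 2 * r")
    case True then show ?thesis using l(2)[of "e div 2"] by auto
  next
    case False
    then have "e div 2 = r" using that by auto
    then show ?thesis using False l(1) by simp
  qed
  have E: "{e \<in> edges (barbell r l'). 0 < l (e div 2)} = {..<2 * r}" using pos by (auto simp: barbell_edges)
  have ex: "edges x = {..<2 * r}" by (simp add: edges_def x)
  have fl: "eflip F e < 2 * r \<longleftrightarrow> e < 2 * r" for e
  proof -
    have "e' < 2 * r \<longleftrightarrow> e' div 2 < r" for e' by auto
    then show ?thesis by simp
  qed
  have nn: "\<forall>i<ne (barbell r l'). 0 \<le> l i" using l by (auto simp: less_Suc_eq less_imp_le)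
  show ?thesis unfolding collapse_rep_def
  proof (rule conjI[OF p conjI[OF nn]], rule exI[of _ "\<lambda>v. 0::nat"], rule exI[of _ "eflip F"],
      rule exI[of _ "[]"], intro conjI)
    show "(\<lambda>v. 0::nat) ` {..<nv (barbell r l')} = {..<nv x}"
      by (simp add: x image_constant_conv lessThan_empty_iff lessThan_Suc)
    show "bij_betw (eflip F) {e \<in> edges (barbell r l'). 0 < l (e div 2)} (edges x)"
      unfolding E ex by (rule bij_betw_byWitness[where f' = "eflip F"]) (auto simp: fl)
    show "\<forall>e\<in>edges (barbell r l'). 0 < l (e div 2) \<longrightarrow> eflip F (bar e) = bar (eflip F e) \<and>
       org x (eflip F e) = 0 \<and> len x (eflip F e div 2) = l (e div 2)"
    proof (intro ballI impI)
      fix e assume "e \<in> edges (barbell r l')" "0 < l (e div 2)"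
      then have "e div 2 < r" using pos by (auto simp: barbell_edges)
      then show "eflip F (bar e) = bar (eflip F e) \<and> org x (eflip F e) = 0 \<and> len x (eflip F e div 2) = l (e div 2)"
        using x by simp
    qed
    have p1: "is_path (barbell r l') 0 [2 * r] 1" "is_path (barbell r l') 1 [Suc (2 * r)] 0"
      by (auto simp: is_path_Cons[OF barbell_gwf] barbell_edges)
    show "\<forall>u<nv (barbell r l'). \<forall>v<nv (barbell r l'). (0::nat) = 0 \<longrightarrow>
        (\<exists>q. is_path (barbell r l') u q v \<and> (\<forall>e\<in>set q. l (e div 2) = 0))"
    proof (intro allI impI)
      fix u v assume "u < nv (barbell r l')" "v < nv (barbell r l')"
      then have "(u = 0 \<or> u = 1) \<and> (v = 0 \<or> v = 1)" by (simp add: less_2_cases_iff)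
      then consider "u = v" | "u = 0" "v = 1" | "u = 1" "v = 0" by blast
      then show "\<exists>q. is_path (barbell r l') u q v \<and> (\<forall>e\<in>set q. l (e div 2) = 0)"
      proof cases
        case 1
        then show ?thesis using \<open>u < nv (barbell r l')\<close> by (intro exI[of _ "[]"]) simp
      next
        case 2 then show ?thesis using p1 l(1) by (intro exI[of _ "[2 * r]"]) simp
      next
        case 3 then show ?thesis using p1 l(1) by (intro exI[of _ "[Suc (2 * r)]"]) simp
      qed
    qed
    \<comment> \<open>Only the bar has length zero, and a closed path inside a single edge with
      distinct ends must backtrack.\<close>
    show "\<forall>q u. is_path (barbell r l') u q u \<and> reduced_by bar q \<and> q \<noteq> [] \<longrightarrow> (\<exists>e\<in>set q. 0 < l (e div 2))"
    proof (intro allI impI, rule ccontr, elim conjE)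
      fix q u assume q: "is_path (barbell r l') u q u" "reduced_by bar q" "q \<noteq> []"
        and n: "\<not> (\<exists>e\<in>set q. 0 < l (e div 2))"
      have two: "e = 2 * r \<or> e = Suc (2 * r)" if "e \<in> set q" for e
      proof -
        have "e < 2 * r + 2" using is_path_edges[OF q(1)] that by (auto simp: barbell_edges)
        then show ?thesis using pos[of e] n that by auto
      qed
      obtain e q' where eq: "q = e # q'" using q(3) by (cases q) auto
      show False
      proof (cases q')
        case Nil
        then show False using q(1) eq two[of e] by (auto simp: is_path_Cons[OF barbell_gwf])
      next
        case (Cons f q'')
        then have "org (barbell r l') f = ter (barbell r l') e" "f \<noteq> bar e"
          using q eq by (auto simp: is_path_Cons[OF barbell_gwf] simp del: barbell_sel barbell_ter)
        then show False using two[of e] two[of f] eq Cons by auto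
      qed
    qed
    show "is_path x 0 [] (base x)" by (simp add: x)
    show "\<forall>i<r. freered bar (rev_path [] @ map (eflip F) (filter (\<lambda>e. 0 < l (e div 2)) (mark (barbell r l') i)) @ [])
        = freered bar (mark x i)"
    proof (intro allI impI)
      fix i assume i: "i < r"
      have "filter (\<lambda>e. 0 < l (e div 2)) (mark (barbell r l') i) = [2 * i]" using i l by auto
      then show "freered bar (rev_path [] @ map (eflip F) (filter (\<lambda>e. 0 < l (e div 2)) (mark (barbell r l') i)) @ [])
        = freered bar (mark x i)" using x(6)[OF i] by (simp add: rev_path_eq)
    qed
  qed simp
qed

lemma blen_props:
  assumes r: "4 \<le> r" and w: "\<And>b. 0 < w b \<and> w b < 1" and \<theta>: "simplices r \<theta>"
  shows "i < r \<Longrightarrow> 0 < w (i < 2) * \<theta> i \<and> w (i < 2) * \<theta> i < 1"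
    and "i < r \<Longrightarrow> 0 < blen r w \<theta> i \<and> yv (blen r w \<theta> i) = w (i < 2) * \<theta> i"
    and "(\<Sum>i\<in>petals r b. yv (blen r w \<theta> i)) = w b"
proof -
  show y: "0 < w (i < 2) * \<theta> i \<and> w (i < 2) * \<theta> i < 1" if "i < r" for i
  proof -
    have "w (i < 2) * \<theta> i \<le> w (i < 2)"
      using w simplices_le1[OF \<theta> r that] by (intro mult_left_le) (auto simp: less_imp_le)
    then have "w (i < 2) * \<theta> i < 1" using w[of "i < 2"] by linarith
    then show ?thesis using w \<theta> that by (simp add: simplices_def)
  qed
  show l: "0 < blen r w \<theta> i \<and> yv (blen r w \<theta> i) = w (i < 2) * \<theta> i" if "i < r" for i
    using y[OF that] that by (simp add: blen_def ylen_pos yv_ylen)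
  have "(\<Sum>i\<in>petals r b. yv (blen r w \<theta> i)) = (\<Sum>i\<in>petals r b. w b * \<theta> i)"
  proof (rule sum.cong[OF refl])
    fix i assume "i \<in> petals r b"
    then have "i < r" "(i < 2) = b" using petals_side[OF _ r] by blast+
    then show "yv (blen r w \<theta> i) = w b * \<theta> i" using l[of i] by simp
  qed
  then show "(\<Sum>i\<in>petals r b. yv (blen r w \<theta> i)) = w b"
    using \<theta> by (simp add: sum_distrib_left[symmetric] simplices_def)
qed

lemma blen_entropy:
  assumes r: "4 \<le> r" and w: "\<And>b. 0 < w b \<and> w b < 1" "1 < w True + w False" and \<theta>: "simplices r \<theta>"
  shows "(\<forall>i\<le>r. 0 < blen r w \<theta> i) \<and> entropy (barbell r l') (blen r w \<theta>) = 1"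
proof -
  note P = blen_props[where w = w and \<theta> = \<theta>, OF r w(1) \<theta>]
  have lr: "0 < blen r w \<theta> r" using logit_sum_pos[of "w True" "w False"] w by (simp add: blen_def)
  then have pos: "0 < blen r w \<theta> i" if "i \<le> r" for i using P(2)[of i] that by (cases "i = r") auto
  have "logit (w True) + logit (w False) = 2 * blen r w \<theta> r" by (simp add: blen_def)
  from logit_eq[OF _ _ _ _ this] w
  have e: "(1 - w True) * (1 - w False) = w True * w False * exp (- 2 * 1 * blen r w \<theta> r)" by simp
  have "entropy (barbell r l') (blen r w \<theta>) = 1"
    by (rule barbell_entropy[where a = "w True" and b = "w False" and h = 1]) (use r pos e P(3) w in auto)
  then show ?thesis using pos by auto
qed

lemma barbell_point:
  assumes "4 \<le> r" "\<And>b. 0 < w b \<and> w b < 1" "1 < w True + w False" "simplices r \<theta>"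
  shows "point r (barbell r (blen r w \<theta>))"
  using blen_entropy[OF assms] barbell_graph_ok[OF assms(1)] barbell_marking_ok[OF assms(1)]
  by (simp add: point_def less_Suc_eq_le)

lemma collapse_barbell_self:
  assumes "4 \<le> r" "\<And>b. 0 < w b \<and> w b < 1" "1 < w True + w False" "simplices r \<theta>"
  shows "collapse_rep r (barbell r l') (blen r w \<theta>) (barbell r (blen r w \<theta>))"
proof -
  have "barbell r (blen r w \<theta>) = (barbell r l')\<lparr>len := blen r w \<theta>\<rparr>" by (simp add: barbell_def)
  then show ?thesis using collapse_rep_len barbell_point[OF assms] by metis
qed

lemma petals_sum: "4 \<le> r \<Longrightarrow> (\<Sum>i<r. F i) = (\<Sum>i\<in>petals r True. F i) + (\<Sum>i\<in>petals r False. F i)"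
  for F :: "nat \<Rightarrow> real"
proof -
  assume r: "4 \<le> r"
  have "{..<r} = petals r True \<union> petals r False" using r by (auto simp: petals_def)
  moreover have "petals r True \<inter> petals r False = {}" by (auto simp: petals_def)
  ultimately show ?thesis by (simp add: sum.union_disjoint)
qed

lemma rose_blen_point:
  assumes r: "4 \<le> r" and w: "\<And>b. 0 < w b \<and> w b < 1" "w True + w False = 1" and \<theta>: "simplices r \<theta>"
  shows "point r (rose r (blen r w \<theta>))"
proof (rule rose_point)
  note P = blen_props[where w = w and \<theta> = \<theta>, OF r w(1) \<theta>]
  show "2 \<le> r" using r by simp
  show "0 < blen r w \<theta> i" if "i < r" for i using P(2)[OF that] by blast
  show "(\<Sum>i<r. yv (blen r w \<theta> i)) = 1" unfolding petals_sum[OF r] P(3) by (rule w(2))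
qed

lemma collapse_barbell_rose_blen:
  assumes r: "4 \<le> r" and w: "\<And>b. 0 < w b \<and> w b < 1" "w True + w False = 1" and \<theta>: "simplices r \<theta>"
    and j: "j < r"
  shows "collapse_rep r (barbell r l') (blen r w \<theta>) (rose r (blen r w \<theta>))"
    and "collapse_rep r (barbell r l') (blen r w \<theta>) (act (rose r (blen r w \<theta>)) (flip j))"
proof -
  have "w False = 1 - w True" using w(2) by simp
  then have l0: "blen r w \<theta> r = 0" using logit_sum_zero[of "w True"] w(1)[of True] by (simp add: blen_def)
  note P = blen_props[where w = w and \<theta> = \<theta>, OF r w(1) \<theta>]
  note pt = rose_blen_point[OF r w \<theta>]
  show "collapse_rep r (barbell r l') (blen r w \<theta>) (rose r (blen r w \<theta>))"
    by (rule collapse_barbell_rose[where l = "blen r w \<theta>" and F = "{}", OF r l0]) (use P pt in \<open>auto simp: eflip_def\<close>)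
  show "collapse_rep r (barbell r l') (blen r w \<theta>) (act (rose r (blen r w \<theta>)) (flip j))"
    by (rule collapse_barbell_rose[where l = "blen r w \<theta>" and F = "{j}", OF r l0])
      (use P point_act[OF pt is_aut_flip[OF j]] in
        \<open>auto simp: eflip_def flip_def lift_alt sgn_path_def rev_path_eq B.fr_Cons\<close>)
qed

lemma dblen_scale: "dblen r w \<theta> (\<lambda>b. k * dw b) (\<lambda>i. k * d\<theta> i) i = k * dblen r w \<theta> dw d\<theta> i"
  by (simp add: dblen_def algebra_simps add_divide_distrib diff_divide_distrib)

lemma bcost_scale: "bcost r w \<theta> (\<lambda>b. k * dw b) (\<lambda>i. k * d\<theta> i) b = k\<^sup>2 * bcost r w \<theta> dw d\<theta> b"
  by (simp add: bcost_def power_mult_distrib algebra_simps sum_distrib_left)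

section \<open>Straight segments in the coordinates of side weights and proportions\<close>

definition lin :: "real \<Rightarrow> real \<Rightarrow> real \<Rightarrow> real" where "lin s a b = (1 - s) * a + s * b"

lemma lin_deriv: "((\<lambda>s. lin s a b) has_real_derivative b - a) (at s)"
  unfolding lin_def by (auto intro!: derivative_eq_intros)

lemma lin_pos: "0 \<le> s \<Longrightarrow> s \<le> 1 \<Longrightarrow> 0 < a \<Longrightarrow> 0 < b \<Longrightarrow> 0 < lin s a b"
  unfolding lin_def by (cases "s = 0") (auto intro: add_nonneg_pos)

lemma lin_less1: "0 \<le> s \<Longrightarrow> s \<le> 1 \<Longrightarrow> a < 1 \<Longrightarrow> b < 1 \<Longrightarrow> lin s a b < 1"
  using lin_pos[of s "1 - a" "1 - b"] by (simp add: lin_def algebra_simps)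

lemma lin_simplices: "0 \<le> s \<Longrightarrow> s \<le> 1 \<Longrightarrow> simplices r \<theta>0 \<Longrightarrow> simplices r \<theta>1 \<Longrightarrow> simplices r (\<lambda>i. lin s (\<theta>0 i) (\<theta>1 i))"
  unfolding simplices_def by (auto simp: lin_pos) (simp add: lin_def sum.distrib sum_distrib_left[symmetric])

lemma lin_ends [simp]: "lin 0 a b = a" "lin 1 a b = b" "lin s a a = a" by (simp_all add: lin_def algebra_simps)

text \<open>Either endpoint may lie on the face where the bar is collapsed, but not both at once, so
  that all interior points are proper barbells. \<open>\<beta>\<close> is the side that supplies the
  Hessian factor. Multiples of the velocity are covered because \<open>dblen\<close> is linear and
  \<open>bcost\<close> quadratic in it.\<close>

lemma barbell_seg:
  assumes r: "4 \<le> r" and w: "\<And>b. 0 < w0 b \<and> w0 b < 1" "\<And>b. 0 < w1 b \<and> w1 b < 1"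
    and s1: "1 \<le> w0 True + w0 False" "1 \<le> w1 True + w1 False" "1 < w0 True + w0 False \<or> 1 < w1 True + w1 False"
    and \<theta>: "simplices r \<theta>0" "simplices r \<theta>1"
    and x: "collapse_rep r (barbell r l') (blen r w0 \<theta>0) x" and y: "collapse_rep r (barbell r l') (blen r w1 \<theta>1) y"
    and good: "\<And>s i. 0 < s \<Longrightarrow> s < 1 \<Longrightarrow> i \<in> petals r \<beta> \<Longrightarrow> lin s (w0 \<beta>) (w1 \<beta>) * lin s (\<theta>0 i) (\<theta>1 i) \<le> 3 / 4"
    and bound: "\<And>s. 0 < s \<Longrightarrow> s < 1 \<Longrightarrow> 4 * (1 - lin s (w0 \<beta>) (w1 \<beta>)) *
       (\<Sum>b\<in>UNIV. bcost r (\<lambda>b. lin s (w0 b) (w1 b)) (\<lambda>i. lin s (\<theta>0 i) (\<theta>1 i)) (\<lambda>b. w1 b - w0 b) (\<lambda>i. \<theta>1 i - \<theta>0 i) b)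
       \<le> K * (weight s)\<^sup>2"
    and K: "0 \<le> K"
  shows "cell_seg r x y K"
proof -
  define W where "W s b = lin s (w0 b) (w1 b)" for s b
  define \<Theta> where "\<Theta> s i = lin s (\<theta>0 i) (\<theta>1 i)" for s i
  define dw where "dw b = w1 b - w0 b" for b
  define d\<theta> where "d\<theta> i = \<theta>1 i - \<theta>0 i" for i
  have W: "0 < W s b \<and> W s b < 1" if "0 \<le> s" "s \<le> 1" for s b
    using lin_pos[OF that] lin_less1[OF that] w by (simp add: W_def)
  have \<Theta>: "simplices r (\<Theta> s)" if "0 \<le> s" "s \<le> 1" for s unfolding \<Theta>_def by (rule lin_simplices[OF that \<theta>])
  have WS: "1 < W s True + W s False" if "0 < s" "s < 1" for s
  proof -
    have "W s True + W s False - 1 = (1 - s) * (w0 True + w0 False - 1) + s * (w1 True + w1 False - 1)"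
      by (simp add: W_def lin_def algebra_simps)
    moreover have "0 < (1 - s) * (w0 True + w0 False - 1) + s * (w1 True + w1 False - 1)"
      using s1 that by (elim disjE) (auto intro: add_pos_nonneg add_nonneg_pos)
    ultimately show ?thesis by linarith
  qed
  have d\<theta>0: "(\<Sum>i\<in>petals r b. d\<theta> i) = 0" for b using \<theta> by (simp add: d\<theta>_def sum_subtractf simplices_def)
  define c where "c s = blen r (W s) (\<Theta> s)" for s
  define dc where "dc s = dblen r (W s) (\<Theta> s) dw d\<theta>" for s
  have dW: "((\<lambda>s. W s b) has_real_derivative dw b) (at s)" for s b unfolding W_def dw_def by (rule lin_deriv)
  have d\<Theta>: "((\<lambda>s. \<Theta> s i) has_real_derivative d\<theta> i) (at s)" for s i unfolding \<Theta>_def d\<theta>_def by (rule lin_deriv)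
  have y1: "0 < W s (i < 2) * \<Theta> s i \<and> W s (i < 2) * \<Theta> s i < 1" if "0 \<le> s" "s \<le> 1" "i < r" for s i
    by (rule blen_props(1)[OF r W[OF that(1,2)] \<Theta>[OF that(1,2)] that(3)])
  have dY: "((\<lambda>s. W s (i < 2) * \<Theta> s i) has_real_derivative dw (i < 2) * \<Theta> s i + W s (i < 2) * d\<theta> i) (at s)" for s i
    using DERIV_mult[OF dW d\<Theta>, of "i < 2" i s] by (simp add: add.commute mult.commute)
  have dc: "((\<lambda>s. c s i) has_real_derivative dc s i) (at s)" if s: "0 \<le> s" "s \<le> 1" for s i
  proof (cases "i < r")
    case True
    note q = y1[OF s True]
    have "((\<lambda>s. ylen (W s (i < 2) * \<Theta> s i)) has_real_derivative
       - 1 / (W s (i < 2) * \<Theta> s i * (1 - W s (i < 2) * \<Theta> s i / 2)) * (dw (i < 2) * \<Theta> s i + W s (i < 2) * d\<theta> i)) (at s)"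
      by (rule DERIV_chain2[OF ylen_deriv dY]) (use q in auto)
    moreover have "- 1 / B * A = - A / B" for A B :: real by simp
    ultimately have "((\<lambda>s. ylen (W s (i < 2) * \<Theta> s i)) has_real_derivative
       - (dw (i < 2) * \<Theta> s i + W s (i < 2) * d\<theta> i) / (W s (i < 2) * \<Theta> s i * (1 - W s (i < 2) * \<Theta> s i / 2))) (at s)"
      by (rule DERIV_cong)
    then show ?thesis using True by (simp add: c_def blen_def dc_def dblen_def)
  next
    case False
    have L: "((\<lambda>s. logit (W s b)) has_real_derivative 1 / (W s b * (1 - W s b)) * dw b) (at s)" for b
      by (rule DERIV_chain2[OF logit_deriv dW]) (use W[OF s] in auto)
    have "((\<lambda>s. (logit (W s True) + logit (W s False)) / 2) has_real_derivative
      (1 / (W s True * (1 - W s True)) * dw True + 1 / (W s False * (1 - W s False)) * dw False) / 2) (at s)"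
      by (intro DERIV_cdivide DERIV_add L)
    then show ?thesis using False by (simp add: c_def blen_def dc_def dblen_def)
  qed
  have cont: "continuous_on A (\<lambda>s. W s b)" "continuous_on A (\<lambda>s. \<Theta> s i)" for A b i
    using DERIV_isCont[OF dW] DERIV_isCont[OF d\<Theta>] by (auto intro: continuous_at_imp_continuous_on)
  have "cell_path r (barbell r l') c dc x y K"
    unfolding cell_path_def
  proof (intro conjI ballI allI impI)
    show "0 \<le> K" "graph_ok (barbell r l')" "marking_ok r (barbell r l')"
      using K barbell_graph_ok[OF r] barbell_marking_ok[OF r] by auto
    show "collapse_rep r (barbell r l') (c 0) x" "collapse_rep r (barbell r l') (c 1) y"
      using x y by (simp_all add: c_def W_def[abs_def] \<Theta>_def[abs_def])
    fix i assume i: "i < ne (barbell r l')"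
    show "continuous_on {0..1} (\<lambda>s. c s i)"
      by (rule continuous_at_imp_continuous_on) (use dc DERIV_isCont in force)
    show "continuous_on {0<..<1} (\<lambda>s. dc s i)"
    proof (cases "i < r")
      case True
      have "W s (i < 2) * \<Theta> s i * (1 - W s (i < 2) * \<Theta> s i / 2) \<noteq> 0" if "s \<in> {0<..<1}" for s
        using y1[of s i] that True by auto
      then show ?thesis unfolding dc_def dblen_def using True
        by (auto intro!: continuous_intros cont)
    next
      case False
      have "W s b * (1 - W s b) \<noteq> 0" if "s \<in> {0<..<1}" for s b using W[of s b] that by auto
      then show ?thesis unfolding dc_def dblen_def using False
        by (auto intro!: continuous_intros cont)
    qed
    fix s :: real assume s: "s \<in> {0<..<1}"
    show "((\<lambda>s. c s i) has_real_derivative dc s i) (at s)" using dc s by simp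
  next
    fix s :: real assume "s \<in> {0<..<1}"
    then have s: "0 < s" "s < 1" "0 \<le> s" "s \<le> 1" by auto
    note e = blen_entropy[OF r W[OF s(3,4)] WS[OF s(1,2)] \<Theta>[OF s(3,4)], of l']
    show "entropy (barbell r l') (c s) = 1" using e by (simp add: c_def)
    show "0 < c s i" if "i < ne (barbell r l')" for i using e that by (simp add: c_def)
    fix k :: real
    have "hess_form (barbell r l') (c s) (dblen r (W s) (\<Theta> s) (\<lambda>b. k * dw b) (\<lambda>i. k * d\<theta> i))
      \<le> 4 * (1 - W s \<beta>) * (bcost r (W s) (\<Theta> s) (\<lambda>b. k * dw b) (\<lambda>i. k * d\<theta> i) True
           + bcost r (W s) (\<Theta> s) (\<lambda>b. k * dw b) (\<lambda>i. k * d\<theta> i) False)"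
      unfolding c_def
      by (rule barbell_hess[OF r W[OF s(3,4)] WS[OF s(1,2)] \<Theta>[OF s(3,4)]])
        (use good[OF s(1,2)] d\<theta>0 in \<open>auto simp: sum_distrib_left[symmetric] W_def \<Theta>_def\<close>)
    also have "\<dots> = k\<^sup>2 * (4 * (1 - W s \<beta>) * (\<Sum>b\<in>UNIV. bcost r (W s) (\<Theta> s) dw d\<theta> b))"
      by (simp add: bcost_scale UNIV_bool algebra_simps)
    also have "\<dots> \<le> k\<^sup>2 * (K * (weight s)\<^sup>2)"
      using bound[OF s(1,2)] by (intro mult_left_mono) (simp_all add: W_def[abs_def] \<Theta>_def[abs_def] dw_def[abs_def] d\<theta>_def[abs_def])
    also have "dblen r (W s) (\<Theta> s) (\<lambda>b. k * dw b) (\<lambda>i. k * d\<theta> i) = (\<lambda>i. k * dc s i)"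
      by (simp add: fun_eq_iff dblen_scale dc_def)
    finally show "hess_form (barbell r l') (c s) (\<lambda>i. k * dc s i) \<le> k\<^sup>2 * (K * (weight s)\<^sup>2)" .
  qed
  then show ?thesis unfolding cell_seg_def by blast
qed

lemma weight_sq:
  assumes "0 < s" "s < 1" shows "(weight s)\<^sup>2 = 1 / ((s * (1 - s)) * sqrt (s * (1 - s)))"
proof -
  define \<omega> where "\<omega> = s * (1 - s)"
  have \<omega>: "0 < \<omega>" using assms by (simp add: \<omega>_def)
  have "(weight s)\<^sup>2 = \<omega> powr (- 3 / 4 * 2)" unfolding weight_def \<omega>_def[symmetric]
    using \<omega> by (simp add: powr_powr powr_realpow[symmetric])
  also have "\<dots> = \<omega> powr (- (1 + 1 / 2))" by simp
  also have "\<dots> = inverse (\<omega> powr 1 * \<omega> powr (1 / 2))" unfolding powr_minus powr_add ..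
  also have "\<omega> powr (1 / 2) = sqrt \<omega>" using \<omega> by (intro powr_half_sqrt) simp
  also have "\<omega> powr 1 = \<omega>" using \<omega> by simp
  also have "inverse (\<omega> * sqrt \<omega>) = 1 / (\<omega> * sqrt \<omega>)" by (rule inverse_eq_divide)
  finally show ?thesis by (simp add: \<omega>_def)
qed

lemma weight_ge:
  assumes "0 < s" "s < 1" shows "1 / (s * (1 - s)) \<le> (weight s)\<^sup>2" "1 \<le> (weight s)\<^sup>2"
proof -
  define \<omega> where "\<omega> = s * (1 - s)"
  have \<omega>: "0 < \<omega>" using assms by (simp add: \<omega>_def)
  have "s * (1 - s) \<le> 1 * 1" using assms by (intro mult_mono) auto
  then have \<omega>1: "\<omega> \<le> 1" by (simp add: \<omega>_def)
  have "\<omega> * sqrt \<omega> \<le> \<omega> * 1" using \<omega> \<omega>1 by (intro mult_left_mono) auto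
  then have "1 / \<omega> \<le> 1 / (\<omega> * sqrt \<omega>)" using \<omega> by (intro divide_left_mono) auto
  then show 1: "1 / (s * (1 - s)) \<le> (weight s)\<^sup>2" by (simp add: weight_sq[OF assms] \<omega>_def)
  have "1 \<le> 1 / \<omega>" using \<omega> \<omega>1 by simp
  then show "1 \<le> (weight s)\<^sup>2" using 1 by (simp add: \<omega>_def)
qed

text \<open>In each coordinate the interpolation is at least \<open>s\<close> times its end value
  and at least \<open>1 - s\<close> times its start value. Using the larger of the two bounds the
  quotient by that value over \<open>s\<close> or over \<open>1 - s\<close>, and both families of
  values sum to 1. No lower bound for the proportions enters, so the estimate is uniform over all
  roses.\<close>

lemma simplex_speed:
  assumes r: "4 \<le> r" and s: "0 < s" "s < 1" and \<theta>: "simplices r \<theta>0" "simplices r \<theta>1"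
  shows "(\<Sum>i\<in>petals r b. (\<theta>1 i - \<theta>0 i)\<^sup>2 / lin s (\<theta>0 i) (\<theta>1 i)) \<le> 1 / (s * (1 - s))"
proof -
  have "(\<Sum>i\<in>petals r b. (\<theta>1 i - \<theta>0 i)\<^sup>2 / lin s (\<theta>0 i) (\<theta>1 i)) \<le> (\<Sum>i\<in>petals r b. \<theta>1 i / s + \<theta>0 i / (1 - s))"
  proof (rule sum_mono)
    fix i assume "i \<in> petals r b"
    then have "i < r" using petals_side[OF _ r] by blast
    then have p: "0 < \<theta>0 i" "0 < \<theta>1 i" using \<theta> by (auto simp: simplices_def)
    define a c where "a = \<theta>0 i" and "c = \<theta>1 i"
    have ac: "0 < a" "0 < c" using p by (auto simp: a_def c_def)
    have l: "0 < lin s a c" using ac s by (intro lin_pos) auto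
    have "(c - a)\<^sup>2 / lin s a c \<le> c / s + a / (1 - s)"
    proof (cases "a \<le> c")
      case True
      have "(c - a)\<^sup>2 / lin s a c \<le> c\<^sup>2 / (s * c)"
      proof (rule frac_le)
        show "(c - a)\<^sup>2 \<le> c\<^sup>2" using True ac by (intro power_mono) auto
        show "s * c \<le> lin s a c" using ac s by (simp add: lin_def)
      qed (use ac s in auto)
      also have "\<dots> = c / s" using ac by (simp add: power2_eq_square)
      also have "\<dots> \<le> c / s + a / (1 - s)" using ac s by simp
      finally show ?thesis .
    next
      case False
      have "(c - a)\<^sup>2 / lin s a c \<le> a\<^sup>2 / ((1 - s) * a)"
      proof (rule frac_le)
        have "(c - a)\<^sup>2 = (a - c)\<^sup>2" by (simp add: power2_commute)
        also have "\<dots> \<le> a\<^sup>2" using False ac by (intro power_mono) auto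
        finally show "(c - a)\<^sup>2 \<le> a\<^sup>2" .
        show "(1 - s) * a \<le> lin s a c" using ac s by (simp add: lin_def)
      qed (use ac s in auto)
      also have "\<dots> = a / (1 - s)" using ac by (simp add: power2_eq_square)
      also have "\<dots> \<le> c / s + a / (1 - s)" using ac s by simp
      finally show ?thesis .
    qed
    then show "(\<theta>1 i - \<theta>0 i)\<^sup>2 / lin s (\<theta>0 i) (\<theta>1 i) \<le> \<theta>1 i / s + \<theta>0 i / (1 - s)" by (simp add: a_def c_def)
  qed
  also have "\<dots> = 1 / s + 1 / (1 - s)"
    using \<theta> by (simp add: sum.distrib sum_divide_distrib[symmetric] simplices_def)
  also have "\<dots> = 1 / (s * (1 - s))" using s by (simp add: field_simps)
  finally show ?thesis .
qed

section \<open>The three kinds of segments between roses, barbells and hub points\<close>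

definition unif :: "nat \<Rightarrow> nat \<Rightarrow> real" where "unif r i = (if i < 2 then 1 / 2 else 1 / (real r - 2))"

lemma unif_simplices: "4 \<le> r \<Longrightarrow> simplices r (unif r)"
proof -
  assume r: "4 \<le> r"
  have "(\<Sum>i\<in>petals r b. unif r i) = 1" for b
    using r by (cases b) (simp_all add: petals_def unif_def of_nat_diff)
  then show ?thesis using r by (auto simp: simplices_def unif_def)
qed

text \<open>Both sides have at least two petals because \<open>4 \<le> r\<close>. This keeps every
  petal of a hub point at weight below 1/2 and its length away from 0.\<close>

lemma unif_half: "4 \<le> r \<Longrightarrow> unif r i \<le> 1 / 2" by (simp add: unif_def field_simps)

text \<open>The completion point fixed by \<open>Out(F\<^sub>r)\<close> is the limit of these barbells as \<open>\<eta>\<close> tends to 0.\<close>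
definition hub_point :: "nat \<Rightarrow> real \<Rightarrow> mgraph" where
  "hub_point r \<eta> = barbell r (blen r (\<lambda>_. 1 - \<eta>) (unif r))"

lemma hub_point_point: "4 \<le> r \<Longrightarrow> 0 < \<eta> \<Longrightarrow> \<eta> < 1 / 2 \<Longrightarrow> point r (hub_point r \<eta>)"
  unfolding hub_point_def by (intro barbell_point unif_simplices) auto

lemma hub_point_rep: "4 \<le> r \<Longrightarrow> 0 < \<eta> \<Longrightarrow> \<eta> < 1 / 2 \<Longrightarrow>
   collapse_rep r (barbell r l') (blen r (\<lambda>_. 1 - \<eta>) (unif r)) (hub_point r \<eta>)"
  unfolding hub_point_def by (intro collapse_barbell_self unif_simplices) auto

lemma cancel_square: "V \<noteq> 0 \<Longrightarrow> 4 * V * (X / (W * V\<^sup>2) + Q / V) = 4 * (X / (W * V) + Q)" for V W X Q :: real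
  by (cases "W = 0") (simp_all add: power2_eq_square field_simps)

text \<open>A rose moves its lighter side \<open>\<beta>\<close> to weight \<open>1 - \<eta>\<close>
  while the other side stands still. The Hessian factor \<open>1 - W\<close> removes the worst
  singularity, and what is left is of order \<open>1 / (s * (1 - s))\<close>, independent of the
  rose and of \<open>\<eta>\<close>. Lightness gives \<open>W \<le> (1 + s) / 2\<close>, which keeps
  the petals below weight 3/4 while the proportions are still arbitrary.\<close>

lemma spread_seg:
  assumes r: "4 \<le> r" and w: "\<And>b. 0 < w b \<and> w b < 1" "w True + w False = 1" "w \<beta> \<le> 1 / 2"
    and \<theta>: "simplices r \<theta>" and \<eta>: "0 < \<eta>" "\<eta> < 1 / 2" "\<eta> < w (\<not> \<beta>)"
    and x: "collapse_rep r (barbell r l') (blen r w \<theta>) x"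
    and y: "collapse_rep r (barbell r l') (blen r (w(\<beta> := 1 - \<eta>)) (\<lambda>i. if i \<in> petals r \<beta> then unif r i else \<theta> i)) y"
  shows "cell_seg r x y 8"
proof (rule barbell_seg[OF r, where ?w0.0 = w and ?w1.0 = "w(\<beta> := 1 - \<eta>)" and ?\<theta>0.0 = \<theta>
      and ?\<theta>1.0 = "\<lambda>i. if i \<in> petals r \<beta> then unif r i else \<theta> i" and \<beta> = \<beta>])
  let ?\<theta>1 = "\<lambda>i. if i \<in> petals r \<beta> then unif r i else \<theta> i"
  let ?w1 = "w(\<beta> := 1 - \<eta>)"
  have sw: "w \<beta> + w (\<not> \<beta>) = 1" using w(2) by (cases \<beta>) auto
  show "0 < w b \<and> w b < 1" "0 < ?w1 b \<and> ?w1 b < 1" for b using w(1) \<eta> by auto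
  show "1 \<le> w True + w False" using w(2) by simp
  have s1: "1 < ?w1 True + ?w1 False" using \<eta>(3) by (cases \<beta>) auto
  then show "1 \<le> ?w1 True + ?w1 False" "1 < w True + w False \<or> 1 < ?w1 True + ?w1 False" by auto
  show t0: "simplices r \<theta>" by fact
  have disj: "petals r b \<inter> petals r \<beta> = {}" if "b \<noteq> \<beta>" for b using that by (auto simp: petals_def)
  show t1: "simplices r ?\<theta>1"
  proof -
    have "(\<Sum>i\<in>petals r b. ?\<theta>1 i) = 1" for b
    proof (cases "b = \<beta>")
      case True
      then have "(\<Sum>i\<in>petals r b. ?\<theta>1 i) = (\<Sum>i\<in>petals r b. unif r i)" by (intro sum.cong) auto
      then show ?thesis using unif_simplices[OF r] by (simp add: simplices_def)
    next
      case False
      then have "(\<Sum>i\<in>petals r b. ?\<theta>1 i) = (\<Sum>i\<in>petals r b. \<theta> i)" using disj[OF False] by (intro sum.cong) auto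
      then show ?thesis using \<theta> by (simp add: simplices_def)
    qed
    then show ?thesis using \<theta> unif_simplices[OF r] by (auto simp: simplices_def)
  qed
  show "collapse_rep r (barbell r l') (blen r w \<theta>) x"
    "collapse_rep r (barbell r l') (blen r ?w1 ?\<theta>1) y" by fact+
  fix s :: real assume s: "0 < s" "s < 1"
  define D where "D = 1 - \<eta> - w \<beta>"
  have D: "0 < D" using \<eta>(3) sw by (simp add: D_def)
  define W where "W = lin s (w \<beta>) (1 - \<eta>)"
  have W: "s * D \<le> W" "(1 - s) * D \<le> 1 - W" "W \<le> (1 + s) / 2"
  proof -
    have "W = w \<beta> + s * D" by (simp add: W_def D_def lin_def algebra_simps)
    then show "s * D \<le> W" using w(1)[of \<beta>] by simp
    have "1 - W = \<eta> + (1 - s) * D" by (simp add: W_def D_def lin_def algebra_simps)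
    then show "(1 - s) * D \<le> 1 - W" using \<eta> by simp
    have "(1 - s) * w \<beta> \<le> (1 - s) * (1 / 2)" "s * (1 - \<eta>) \<le> s * 1" using s w(3) \<eta> by (auto intro!: mult_left_mono)
    then show "W \<le> (1 + s) / 2" by (simp add: W_def lin_def)
  qed
  have W0: "0 < W" "0 < 1 - W" using W(1,2) D s mult_pos_pos[of s D] mult_pos_pos[of "1 - s" D] by linarith+
  show "lin s (w \<beta>) (?w1 \<beta>) * lin s (\<theta> i) (?\<theta>1 i) \<le> 3 / 4" if i: "i \<in> petals r \<beta>" for i
  proof -
    have "\<theta> i \<le> 1" using simplices_le1[OF \<theta> r] petals_side[OF i r] by blast
    then have "lin s (\<theta> i) (unif r i) \<le> (1 - s) * 1 + s * (1 / 2)"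
      unfolding lin_def using s unif_half[OF r, of i] by (intro add_mono mult_left_mono) auto
    moreover have "0 \<le> lin s (\<theta> i) (unif r i)"
      using lin_pos[of s "\<theta> i" "unif r i"] s petals_side[OF i r] \<theta> unif_simplices[OF r] by (simp add: simplices_def less_imp_le)
    ultimately have "W * lin s (\<theta> i) (unif r i) \<le> (1 + s) / 2 * ((1 - s) * 1 + s * (1 / 2))"
      using W(3) s by (intro mult_mono) auto
    also have "\<dots> \<le> 3 / 4"
    proof -
      have "3 / 4 - (1 + s) / 2 * ((1 - s) * 1 + s * (1 / 2)) = (1 - s) / 4 + s * s / 4" by (simp add: field_simps)
      moreover have "0 \<le> (1 - s) / 4 + s * s / 4" using s by simp
      ultimately show ?thesis by linarith
    qed
    finally show ?thesis using i by (simp add: W_def)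
  qed
  let ?B = "bcost r (\<lambda>b. lin s (w b) (?w1 b)) (\<lambda>i. lin s (\<theta> i) (?\<theta>1 i)) (\<lambda>b. ?w1 b - w b) (\<lambda>i. ?\<theta>1 i - \<theta> i)"
  have other: "?B (\<not> \<beta>) = 0"
  proof -
    have "(\<Sum>i\<in>petals r (\<not> \<beta>). (?\<theta>1 i - \<theta> i)\<^sup>2 / lin s (\<theta> i) (?\<theta>1 i)) = 0"
      using disj[of "\<not> \<beta>"] by (intro sum.neutral) auto
    then show ?thesis by (simp add: bcost_def)
  qed
  define Q where "Q = (\<Sum>i\<in>petals r \<beta>. (?\<theta>1 i - \<theta> i)\<^sup>2 / lin s (\<theta> i) (?\<theta>1 i))"
  have Q: "Q \<le> 1 / (s * (1 - s))" unfolding Q_def by (rule simplex_speed[OF r s t0 t1])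
  have "(\<Sum>b\<in>UNIV. ?B b) = ?B \<beta>" using other by (cases \<beta>) (simp_all add: UNIV_bool)
  also have "?B \<beta> = D\<^sup>2 / (W * (1 - W)\<^sup>2) + Q / (1 - W)" by (simp add: bcost_def D_def W_def Q_def)
  finally have "4 * (1 - W) * (\<Sum>b\<in>UNIV. ?B b) = 4 * (D\<^sup>2 / (W * (1 - W)) + Q)"
    using cancel_square[of "1 - W" "D\<^sup>2" W Q] W0 by simp
  \<comment> \<open>\<open>W\<close> and \<open>1 - W\<close> dominate \<open>s * D\<close> and
    \<open>(1 - s) * D\<close>, so the displacement \<open>D\<close> cancels.\<close>
  moreover have X: "D\<^sup>2 / (W * (1 - W)) \<le> 1 / (s * (1 - s))"
  proof -
    have "D\<^sup>2 / (W * (1 - W)) \<le> D\<^sup>2 / ((s * D) * ((1 - s) * D))"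
      using W D s W0 by (intro divide_left_mono mult_mono mult_pos_pos) auto
    also have "\<dots> = 1 / (s * (1 - s))" using D by (simp add: power2_eq_square)
    finally show ?thesis .
  qed
  moreover have "4 * (D\<^sup>2 / (W * (1 - W)) + Q) \<le> 4 * (1 / (s * (1 - s)) + 1 / (s * (1 - s)))"
    by (intro mult_left_mono add_mono X Q) simp
  ultimately have "4 * (1 - W) * (\<Sum>b\<in>UNIV. ?B b) \<le> 4 * (1 / (s * (1 - s)) + 1 / (s * (1 - s)))" by metis
  also have "\<dots> \<le> 8 * (weight s)\<^sup>2" using weight_ge(1)[OF s] by simp
  finally show "4 * (1 - lin s (w \<beta>) (?w1 \<beta>)) * (\<Sum>b\<in>UNIV. ?B b) \<le> 8 * (weight s)\<^sup>2" by (simp add: W_def)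
qed simp

text \<open>Side \<open>\<beta>\<close> rests at weight \<open>1 - \<eta>\<close> and supplies the
  factor \<open>4 * \<eta>\<close> while the other side rises from \<open>a\<close>. The defect
  \<open>V\<close> of the rising side stays above \<open>\<eta>\<close>, and half a power of it is
  traded: \<open>\<eta> / V^2\<close> is at most \<open>sqrt \<eta>\<close> over the power 3/2 of
  \<open>V\<close>. This power is the reason for the exponent in \<open>weight\<close>. For
  \<open>a = \<eta>\<close> the segment starts at a rose.\<close>

lemma refill_seg:
  assumes r: "4 \<le> r" and w: "\<And>b. 0 < w b \<and> w b < 1" and a: "w (\<not> \<beta>) = a" "\<eta> \<le> a" "a \<le> 1 - \<eta>" "w \<beta> = 1 - \<eta>"
    and \<theta>: "simplices r \<theta>" "\<And>i. i \<in> petals r \<beta> \<Longrightarrow> \<theta> i = unif r i" and \<eta>: "0 < \<eta>" "\<eta> < 1 / 2"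
    and x: "collapse_rep r (barbell r l') (blen r w \<theta>) x"
  shows "cell_seg r x (hub_point r \<eta>) (12 * sqrt \<eta> / ((1 - a) * sqrt (1 - a)))"
proof (rule barbell_seg[OF r, where ?w0.0 = w and ?w1.0 = "\<lambda>_. 1 - \<eta>" and ?\<theta>0.0 = \<theta>
      and ?\<theta>1.0 = "unif r" and \<beta> = \<beta>])
  let ?w1 = "\<lambda>_::bool. 1 - \<eta>"
  have sw: "w True + w False = 1 - \<eta> + a" using a by (cases \<beta>) auto
  show "0 < w b \<and> w b < 1" "0 < 1 - \<eta> \<and> 1 - \<eta> < 1" for b using w(1) \<eta> by auto
  show "1 \<le> w True + w False" using sw a by simp
  show "1 \<le> 1 - \<eta> + (1 - \<eta>)" "1 < w True + w False \<or> 1 < 1 - \<eta> + (1 - \<eta>)" using \<eta> by auto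
  show t0: "simplices r \<theta>" and t1: "simplices r (unif r)" using \<theta> unif_simplices[OF r] by auto
  show "collapse_rep r (barbell r l') (blen r w \<theta>) x" by fact
  show "collapse_rep r (barbell r l') (blen r (\<lambda>_. 1 - \<eta>) (unif r)) (hub_point r \<eta>)" by (rule hub_point_rep[OF r \<eta>])
  have a1: "0 < 1 - a" "0 < a" using w(1)[of "\<not> \<beta>"] a by auto
  then show "0 \<le> 12 * sqrt \<eta> / ((1 - a) * sqrt (1 - a))" using \<eta> by simp
  fix s :: real assume s: "0 < s" "s < 1"
  show "lin s (w \<beta>) (1 - \<eta>) * lin s (\<theta> i) (unif r i) \<le> 3 / 4" if i: "i \<in> petals r \<beta>" for i
  proof -
    have "(1 - \<eta>) * unif r i \<le> 1 * (1 / 2)" using \<eta> unif_half[OF r, of i] unif_simplices[OF r] petals_side[OF i r]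
      by (intro mult_mono) (auto simp: simplices_def less_imp_le)
    then show ?thesis using a \<theta>(2)[OF i] by simp
  qed
  define D where "D = 1 - \<eta> - a"
  have D: "0 \<le> D" "D \<le> 1" using a a1 \<eta> by (auto simp: D_def)
  define W where "W = lin s a (1 - \<eta>)"
  define V where "V = 1 - W"
  have V: "\<eta> \<le> V" "(1 - s) * (1 - a) \<le> V"
  proof -
    have "V = \<eta> + (1 - s) * D" by (simp add: V_def W_def D_def lin_def algebra_simps)
    then show "\<eta> \<le> V" using D s by simp
    have "V = (1 - s) * (1 - a) + s * \<eta>" by (simp add: V_def W_def lin_def algebra_simps)
    then show "(1 - s) * (1 - a) \<le> V" using s \<eta> by simp
  qed
  have W: "s / 2 \<le> W"
  proof -
    have "s * (1 / 2) \<le> s * (1 - \<eta>)" using s \<eta> by (intro mult_left_mono) auto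
    then show ?thesis using s a1 mult_nonneg_nonneg[of "1 - s" a] unfolding W_def lin_def by linarith
  qed
  define u where "u = (1 - s) * (1 - a)"
  have u: "0 < u" "u \<le> V" using s a1 V by (auto simp: u_def)
  have V0: "0 < V" using u by linarith
  let ?B = "bcost r (\<lambda>b. lin s (w b) (1 - \<eta>)) (\<lambda>i. lin s (\<theta> i) (unif r i)) (\<lambda>b. 1 - \<eta> - w b) (\<lambda>i. unif r i - \<theta> i)"
  have "(\<Sum>i\<in>petals r \<beta>. (unif r i - \<theta> i)\<^sup>2 / lin s (\<theta> i) (unif r i)) = 0" using \<theta>(2) by (intro sum.neutral) auto
  then have other: "?B \<beta> = 0" using a by (simp add: bcost_def)
  define Q where "Q = (\<Sum>i\<in>petals r (\<not> \<beta>). (unif r i - \<theta> i)\<^sup>2 / lin s (\<theta> i) (unif r i))"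
  have Q: "Q \<le> 1 / (s * (1 - s))" unfolding Q_def by (rule simplex_speed[OF r s t0 t1])
  define q where "q = sqrt \<eta>"
  have q: "0 < q" "q * q = \<eta>" "q \<le> sqrt V" using \<eta> V by (auto simp: q_def)
  have uv: "sqrt u \<le> sqrt V" "0 < sqrt u" "sqrt V * sqrt V = V" "0 < sqrt V" using u V0 by auto
  define \<omega> where "\<omega> = s * (1 - s)"
  have \<omega>: "0 < \<omega>" using s by (simp add: \<omega>_def)
  have "(\<Sum>b\<in>UNIV. ?B b) = ?B (\<not> \<beta>)" using other by (cases \<beta>) (simp_all add: UNIV_bool)
  also have "?B (\<not> \<beta>) = D\<^sup>2 / (W * V\<^sup>2) + Q / V" using a by (simp add: bcost_def D_def W_def V_def Q_def)
  finally have "4 * \<eta> * (\<Sum>b\<in>UNIV. ?B b) = 4 * (D\<^sup>2 / W * (\<eta> / V\<^sup>2)) + 4 * (\<eta> / V * Q)"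
    by (simp add: field_simps)
  moreover have X1: "D\<^sup>2 / W * (\<eta> / V\<^sup>2) \<le> 2 / s * (q / (u * sqrt u))"
  proof (rule mult_mono)
    have "D\<^sup>2 \<le> 1" using D by (simp add: power_le_one)
    then have "D\<^sup>2 / W \<le> 1 / (s / 2)" using W s by (intro frac_le) auto
    then show "D\<^sup>2 / W \<le> 2 / s" by simp
    have "\<eta> / V\<^sup>2 = q / sqrt V * (q / (V * sqrt V))" using q uv by (simp add: power2_eq_square field_simps)
    also have "\<dots> \<le> 1 * (q / (u * sqrt u))"
      using q uv u V0 by (intro mult_mono divide_left_mono mult_pos_pos) auto
    finally show "\<eta> / V\<^sup>2 \<le> q / (u * sqrt u)" by simp
  qed (use s \<eta> in auto)
  moreover have X2: "\<eta> / V * Q \<le> q / sqrt u * (1 / \<omega>)"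
  proof (rule mult_mono)
    have "\<eta> / V = q / sqrt V * (q / sqrt V)" using q uv by (simp add: field_simps)
    also have "\<dots> \<le> 1 * (q / sqrt u)" using q uv by (intro mult_mono divide_left_mono mult_pos_pos) auto
    finally show "\<eta> / V \<le> q / sqrt u" by simp
    show "Q \<le> 1 / \<omega>" using Q by (simp add: \<omega>_def)
    show "0 \<le> Q" unfolding Q_def using t0 t1 s petals_side[OF _ r]
      by (intro sum_nonneg divide_nonneg_nonneg less_imp_le[OF lin_pos]) (auto simp: simplices_def)
  qed (use q u in auto)
  moreover have "4 * (D\<^sup>2 / W * (\<eta> / V\<^sup>2)) + 4 * (\<eta> / V * Q) \<le> 4 * (2 / s * (q / (u * sqrt u))) + 4 * (q / sqrt u * (1 / \<omega>))"
    by (intro add_mono mult_left_mono X1 X2) simp_all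
  ultimately have "4 * \<eta> * (\<Sum>b\<in>UNIV. ?B b) \<le> 4 * (2 / s * (q / (u * sqrt u))) + 4 * (q / sqrt u * (1 / \<omega>))"
    by metis
  \<comment> \<open>The bounds \<open>sqrt s \<le> 1\<close> and \<open>1 - a \<le> 1\<close> bring
    both terms to the shape of the squared weight.\<close>
  also have "\<dots> \<le> 8 * (q / ((1 - a) * sqrt (1 - a)) * (1 / (\<omega> * sqrt \<omega>))) + 4 * (q / ((1 - a) * sqrt (1 - a)) * (1 / (\<omega> * sqrt \<omega>)))"
  proof (intro add_mono)
    have su: "sqrt u = sqrt (1 - s) * sqrt (1 - a)" by (simp add: u_def real_sqrt_mult)
    have so: "sqrt \<omega> = sqrt s * sqrt (1 - s)" by (simp add: \<omega>_def real_sqrt_mult)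
    have p: "0 < sqrt (1 - s)" "0 < sqrt (1 - a)" "0 < sqrt s" "sqrt s \<le> 1" "sqrt (1 - a) \<le> 1" "sqrt (1 - s) \<le> 1" using s a1 by auto
    have "2 / s * (q / (u * sqrt u)) = 2 * (q / ((1 - a) * sqrt (1 - a)) * (1 / (\<omega> * sqrt (1 - s))))"
      unfolding su unfolding u_def \<omega>_def by simp
    also have "\<dots> \<le> 2 * (q / ((1 - a) * sqrt (1 - a)) * (1 / (\<omega> * sqrt \<omega>)))"
    proof (intro mult_left_mono divide_left_mono)
      show "sqrt \<omega> \<le> sqrt (1 - s)" unfolding so using p mult_right_mono[of "sqrt s" 1 "sqrt (1 - s)"] by simp
    qed (use \<omega> p q a1 in auto)
    finally show "4 * (2 / s * (q / (u * sqrt u))) \<le> 8 * (q / ((1 - a) * sqrt (1 - a)) * (1 / (\<omega> * sqrt \<omega>)))" by simp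
    have "q / sqrt u * (1 / \<omega>) = q / sqrt (1 - a) * (1 / (\<omega> * sqrt (1 - s)))" unfolding su by simp
    also have "\<dots> \<le> q / ((1 - a) * sqrt (1 - a)) * (1 / (\<omega> * sqrt \<omega>))"
    proof (rule mult_mono)
      have "(1 - a) * sqrt (1 - a) \<le> 1 * sqrt (1 - a)" using a1 by (intro mult_right_mono) auto
      then show "q / sqrt (1 - a) \<le> q / ((1 - a) * sqrt (1 - a))" using q a1 by (intro divide_left_mono mult_pos_pos) auto
      have "sqrt \<omega> \<le> sqrt (1 - s)" unfolding so using p mult_right_mono[of "sqrt s" 1 "sqrt (1 - s)"] by simp
      then show "1 / (\<omega> * sqrt (1 - s)) \<le> 1 / (\<omega> * sqrt \<omega>)" using \<omega> p by (intro divide_left_mono mult_left_mono mult_pos_pos) auto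
    qed (use q a1 \<omega> p in auto)
    finally show "4 * (q / sqrt u * (1 / \<omega>)) \<le> 4 * (q / ((1 - a) * sqrt (1 - a)) * (1 / (\<omega> * sqrt \<omega>)))" by simp
  qed
  also have "\<dots> = 12 * sqrt \<eta> / ((1 - a) * sqrt (1 - a)) * (weight s)\<^sup>2"
    by (simp add: weight_sq[OF s] q_def \<omega>_def)
  finally show "4 * (1 - lin s (w \<beta>) (1 - \<eta>)) * (\<Sum>b\<in>UNIV. ?B b) \<le> 12 * sqrt \<eta> / ((1 - a) * sqrt (1 - a)) * (weight s)\<^sup>2"
    using a by simp
qed

text \<open>Both sides approach weight 1 together. With \<open>1 - W\<close> at least
  \<open>(1 - s) * \<eta>\<close>, the squared speed is of order \<open>\<eta> / (1 - s)\<close>, so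
  the hub points form a Cauchy family.\<close>

lemma hub_seg:
  assumes r: "4 \<le> r" and \<eta>: "0 < \<eta>'" "\<eta>' \<le> \<eta>" "\<eta> < 1 / 2"
  shows "cell_seg r (hub_point r \<eta>) (hub_point r \<eta>') (16 * \<eta>)"
proof (rule barbell_seg[OF r, where ?w0.0 = "\<lambda>_. 1 - \<eta>" and ?w1.0 = "\<lambda>_. 1 - \<eta>'" and ?\<theta>0.0 = "unif r"
      and ?\<theta>1.0 = "unif r" and \<beta> = True])
  show "collapse_rep r (barbell r (\<lambda>_. 0)) (blen r (\<lambda>_. 1 - \<eta>) (unif r)) (hub_point r \<eta>)"
    "collapse_rep r (barbell r (\<lambda>_. 0)) (blen r (\<lambda>_. 1 - \<eta>') (unif r)) (hub_point r \<eta>')"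
    using \<eta> by (auto intro!: hub_point_rep[OF r])
  fix s :: real assume s: "0 < s" "s < 1"
  define W where "W = lin s (1 - \<eta>) (1 - \<eta>')"
  have W: "1 / 2 \<le> W" "(1 - s) * \<eta> \<le> 1 - W" "W < 1"
  proof -
    have "W = 1 - \<eta> + s * (\<eta> - \<eta>')" by (simp add: W_def lin_def algebra_simps)
    then show "1 / 2 \<le> W" using \<eta> s mult_nonneg_nonneg[of s "\<eta> - \<eta>'"] by linarith
    have "1 - W = (1 - s) * \<eta> + s * \<eta>'" by (simp add: W_def lin_def algebra_simps)
    then show "(1 - s) * \<eta> \<le> 1 - W" using s \<eta> by simp
    then show "W < 1" using mult_pos_pos[of "1 - s" \<eta>] s \<eta> by linarith
  qed
  show "lin s (1 - \<eta>) (1 - \<eta>') * lin s (unif r i) (unif r i) \<le> 3 / 4" if i: "i \<in> petals r True" for i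
  proof -
    have "W * unif r i \<le> 1 * (1 / 2)" using W unif_half[OF r, of i] unif_simplices[OF r] petals_side[OF i r]
      by (intro mult_mono) (auto simp: simplices_def less_imp_le)
    then show ?thesis by (simp add: W_def)
  qed
  have "4 * (1 - W) * (2 * ((\<eta> - \<eta>')\<^sup>2 / (W * (1 - W)\<^sup>2))) = 8 * ((\<eta> - \<eta>')\<^sup>2 / (W * (1 - W)))"
    using cancel_square[of "1 - W" "(\<eta> - \<eta>')\<^sup>2" W 0] W by simp
  also have "\<dots> \<le> 8 * (\<eta>\<^sup>2 / (1 / 2 * ((1 - s) * \<eta>)))"
    using W \<eta> s by (intro mult_left_mono frac_le mult_mono power_mono mult_pos_pos) auto
  also have "\<dots> = 16 * \<eta> * (1 / (1 - s))" using \<eta> by (simp add: power2_eq_square)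
  also have "\<dots> \<le> 16 * \<eta> * (1 / (s * (1 - s)))"
  proof (intro mult_left_mono divide_left_mono)
    show "s * (1 - s) \<le> 1 - s" using s by (simp add: mult_left_le_one_le)
  qed (use s \<eta> in auto)
  also have "\<dots> \<le> 16 * \<eta> * (weight s)\<^sup>2" using weight_ge(1)[OF s] \<eta> by (intro mult_left_mono) auto
  finally show "4 * (1 - lin s (1 - \<eta>) (1 - \<eta>')) * (\<Sum>b\<in>UNIV. bcost r (\<lambda>b. lin s (1 - \<eta>) (1 - \<eta>'))
      (\<lambda>i. lin s (unif r i) (unif r i)) (\<lambda>b. 1 - \<eta>' - (1 - \<eta>)) (\<lambda>i. unif r i - unif r i) b) \<le> 16 * \<eta> * (weight s)\<^sup>2"
    by (simp add: bcost_def UNIV_bool W_def)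
qed (use \<eta> unif_simplices[OF r] in auto)

section \<open>Theta graphs with petals\<close>

text \<open>Edges \<open>r\<close> and \<open>j\<close> run from vertex 0 to vertex 1 and edge \<open>i\<close> from 1 to 0. Collapsing edge \<open>r\<close> gives
  the rose with the identity marking, collapsing edge \<open>j\<close> gives the rose marked by \<open>transv i j\<close>.\<close>
definition theta :: "nat \<Rightarrow> nat \<Rightarrow> nat \<Rightarrow> mgraph" where
  "theta r i j = \<lparr>nv = 2, ne = Suc r,
     org = (\<lambda>e. if e = Suc (2 * r) \<or> e = Suc (2 * j) \<or> e = 2 * i then 1 else 0),
     base = 0, mark = (\<lambda>k. if k = j then [2 * j, Suc (2 * r)] else if k = i then [2 * r, 2 * i] else [2 * k]),
     len = (\<lambda>_. 0)\<rparr>"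

lemma theta_sel [simp]: "nv (theta r i j) = 2" "ne (theta r i j) = Suc r"
  "org (theta r i j) e = (if e = Suc (2 * r) \<or> e = Suc (2 * j) \<or> e = 2 * i then 1 else 0)"
  "base (theta r i j) = 0"
  "mark (theta r i j) k = (if k = j then [2 * j, Suc (2 * r)] else if k = i then [2 * r, 2 * i] else [2 * k])"
  by (simp_all add: theta_def)

lemma theta_edges: "edges (theta r i j) = {..<2 * r + 2}" by (auto simp: edges_def)

lemma theta_gwf: "gwf (theta r i j)" by (auto simp: gwf_def)

lemma theta_ter [simp]: "ter (theta r i j) e = (if e = 2 * r \<or> e = 2 * j \<or> e = Suc (2 * i) then 1 else 0)"
  by (simp add: ter_def)

locale theta_graph =
  fixes r i j :: nat
  assumes r: "4 \<le> r" and ij: "i < r" "j < r" "i \<noteq> j"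
begin

text \<open>A petal that stays at vertex 0. It gives this vertex its valence and lets paths turn
  around there.\<close>

definition petal where "petal = (SOME k. k < r \<and> k \<noteq> i \<and> k \<noteq> j)"

lemma petal: "petal < r" "petal \<noteq> i" "petal \<noteq> j"
proof -
  have "card ({..<r} - {i, j}) = r - 2" using ij by (simp add: card_Diff_subset)
  then have "{..<r} - {i, j} \<noteq> {}" using r by (intro notI) simp
  then have "\<exists>k. k < r \<and> k \<noteq> i \<and> k \<noteq> j" by auto
  from someI_ex[OF this] show "petal < r" "petal \<noteq> i" "petal \<noteq> j" by (simp_all add: petal_def)
qed

lemma parity_neq [simp]: "Suc (2 * a) \<noteq> 2 * b" "2 * b \<noteq> Suc (2 * a)" by presburger+

lemma theta_graph_ok: "graph_ok (theta r i j)"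
proof -
  have "valence (theta r i j) 0 \<noteq> 1 \<and> valence (theta r i j) 0 \<noteq> 2"
    by (rule valence_ge3[of "2 * petal" "Suc (2 * petal)" "2 * r"]) (use petal ij in \<open>auto simp: theta_edges\<close>)
  moreover have "valence (theta r i j) 1 \<noteq> 1 \<and> valence (theta r i j) 1 \<noteq> 2"
    by (rule valence_ge3[of "Suc (2 * r)" "Suc (2 * j)" "2 * i"]) (use ij in \<open>auto simp: theta_edges\<close>)
  moreover have "is_path (theta r i j) 0 [2 * r] 1" "is_path (theta r i j) 1 [Suc (2 * r)] 0"
    using ij by (auto simp: is_path_Cons[OF theta_gwf] theta_edges)
  ultimately show ?thesis unfolding graph_ok_def
    using theta_gwf[of r i j]
    by (auto simp: gwf_def less_2_cases_iff simp del: theta_sel(3) intro: exI[of _ "[]"])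
qed

lemma theta_marking_ok: "marking_ok r (theta r i j)"
proof (rule marking_okI[where lb = "\<lambda>e. if e div 2 < r then [(e div 2, even e)] else []"
      and T = "\<lambda>v. if v = 0 then [] else [2 * r]"])
  show "\<forall>k<r. is_path (theta r i j) (base (theta r i j)) (mark (theta r i j) k) (base (theta r i j))"
    using ij by (auto simp: is_path_Cons[OF theta_gwf] theta_edges)
  show "(if bar e div 2 < r then [(bar e div 2, even (bar e))] else []) =
     W.winverse (if e div 2 < r then [(e div 2, even e)] else [])" for e
    by simp
  show "W.fr (concat (map (\<lambda>e. if e div 2 < r then [(e div 2, even e)] else []) (mark (theta r i j) k))) = [(k, True)]"
    if "k < r" for k using that ij by (simp add: W.fr_Cons)
  show "lift (mark (theta r i j)) (if e div 2 < r then [(e div 2, even e)] else []) =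
     B.fr ((if org (theta r i j) e = 0 then [] else [2 * r]) @
        e # rev_path (if ter (theta r i j) e = 0 then [] else [2 * r]))"
    if "e \<in> edges (theta r i j)" for e
  proof -
    define k where "k = e div 2"
    have k: "e = 2 * k \<or> e = Suc (2 * k)" unfolding k_def by presburger
    have "k \<le> r" using that k by (auto simp: theta_edges)
    show ?thesis
    proof (cases "k = r")
      case True
      have "B.fr [2 * r, Suc (2 * r)] = []" using B.fr_cancel[of "2 * r" "[]"] by simp
      then show ?thesis using k True ij by (elim disjE) (simp_all add: lift_alt rev_path_eq)
    next
      case False
      then have "k < r" using \<open>k \<le> r\<close> by simp
      from k show ?thesis
      proof
        assume e: "e = 2 * k"
        show ?thesis using \<open>k < r\<close> ij unfolding e
          by (cases "k = i"; cases "k = j") (simp_all add: lift_alt sgn_path_def rev_path_eq)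
      next
        assume e: "e = Suc (2 * k)"
        show ?thesis using \<open>k < r\<close> ij unfolding e
          by (cases "k = i"; cases "k = j") (simp_all add: lift_alt sgn_path_def rev_path_eq)
      qed
    qed
  qed
qed (use ij in \<open>auto simp: theta_gwf theta_edges split: if_splits\<close>)

text \<open>Edges \<open>r\<close> and \<open>j\<close> both run from vertex 0 to vertex 1, so
  collapsing either one gives a rose; both ends of the slide are treated at once.\<close>

lemma collapse_theta:
  assumes z: "z = r \<or> z = j" and l: "l z = 0" "\<And>n. n \<le> r \<Longrightarrow> n \<noteq> z \<Longrightarrow> 0 < l n" and p: "point r x"
    and x: "nv x = 1" "ne x = r" "org x = (\<lambda>_. 0)" "base x = 0"
    and b: "bij_betw \<beta> {e. e < 2 * r + 2 \<and> e div 2 \<noteq> z} {..<2 * r}"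
      "\<And>e. e < 2 * r + 2 \<Longrightarrow> e div 2 \<noteq> z \<Longrightarrow> \<beta> (bar e) = bar (\<beta> e) \<and> len x (\<beta> e div 2) = l (e div 2)"
    and m: "\<And>n. n < r \<Longrightarrow> B.fr (map \<beta> (filter (\<lambda>e. e div 2 \<noteq> z) (mark (theta r i j) n))) = B.fr (mark x n)"
  shows "collapse_rep r (theta r i j) l x"
proof -
  have pos: "0 < l (e div 2) \<longleftrightarrow> e div 2 \<noteq> z" "l (e div 2) = 0 \<longleftrightarrow> e div 2 = z" if "e < 2 * r + 2" for e
  proof -
    have "e div 2 \<le> r" using that by auto
    then show "0 < l (e div 2) \<longleftrightarrow> e div 2 \<noteq> z" "l (e div 2) = 0 \<longleftrightarrow> e div 2 = z"
      using l by (cases "e div 2 = z"; force)+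
  qed
  have zi: "z \<noteq> i" "z \<le> r" using z ij by auto
  have zo: "org (theta r i j) (2 * z) = 0" "org (theta r i j) (Suc (2 * z)) = 1"
     "ter (theta r i j) (2 * z) = 1" "ter (theta r i j) (Suc (2 * z)) = 0"
    using z zi ij by auto
  have nn: "\<forall>n<ne (theta r i j). 0 \<le> l n" using l by (metis less_Suc_eq_le less_imp_le order_refl theta_sel(2))
  have E: "{e \<in> edges (theta r i j). 0 < l (e div 2)} = {e. e < 2 * r + 2 \<and> e div 2 \<noteq> z}"
    using pos by (auto simp: theta_edges)
  have ex: "edges x = {..<2 * r}" by (simp add: edges_def x)
  show ?thesis unfolding collapse_rep_def
  proof (rule conjI[OF p conjI[OF nn]], rule exI[of _ "\<lambda>v. 0::nat"], rule exI[of _ \<beta>],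
      rule exI[of _ "[]"], intro conjI)
    show "(\<lambda>v. 0::nat) ` {..<nv (theta r i j)} = {..<nv x}"
      by (simp add: x image_constant_conv lessThan_empty_iff lessThan_Suc)
    show "bij_betw \<beta> {e \<in> edges (theta r i j). 0 < l (e div 2)} (edges x)" unfolding E ex by (rule b(1))
    show "\<forall>e\<in>edges (theta r i j). 0 < l (e div 2) \<longrightarrow> \<beta> (bar e) = bar (\<beta> e) \<and>
       org x (\<beta> e) = 0 \<and> len x (\<beta> e div 2) = l (e div 2)"
      using b(2) pos x by (simp add: theta_edges)
    have p1: "is_path (theta r i j) 0 [2 * z] 1" "is_path (theta r i j) 1 [Suc (2 * z)] 0"
      using zo zi by (auto simp: is_path_Cons[OF theta_gwf] theta_edges simp del: theta_sel(3) theta_ter)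
    show "\<forall>u<nv (theta r i j). \<forall>v<nv (theta r i j). (0::nat) = 0 \<longrightarrow>
        (\<exists>q. is_path (theta r i j) u q v \<and> (\<forall>e\<in>set q. l (e div 2) = 0))"
    proof (intro allI impI)
      fix u v assume "u < nv (theta r i j)" "v < nv (theta r i j)"
      then have "(u = 0 \<or> u = 1) \<and> (v = 0 \<or> v = 1)" by (simp add: less_2_cases_iff)
      then consider "u = v" | "u = 0" "v = 1" | "u = 1" "v = 0" by blast
      then show "\<exists>q. is_path (theta r i j) u q v \<and> (\<forall>e\<in>set q. l (e div 2) = 0)"
      proof cases
        case 1
        then show ?thesis using \<open>u < nv (theta r i j)\<close> by (intro exI[of _ "[]"]) simp
      next
        case 2 then show ?thesis using p1 l(1) by (intro exI[of _ "[2 * z]"]) simp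
      next
        case 3 then show ?thesis using p1 l(1) by (intro exI[of _ "[Suc (2 * z)]"]) simp
      qed
    qed
    show "\<forall>q u. is_path (theta r i j) u q u \<and> reduced_by bar q \<and> q \<noteq> [] \<longrightarrow> (\<exists>e\<in>set q. 0 < l (e div 2))"
    proof (intro allI impI, rule ccontr, elim conjE)
      fix q u assume q: "is_path (theta r i j) u q u" "reduced_by bar q" "q \<noteq> []"
        and n: "\<not> (\<exists>e\<in>set q. 0 < l (e div 2))"
      have two: "e = 2 * z \<or> e = Suc (2 * z)" if "e \<in> set q" for e
      proof -
        have "e < 2 * r + 2" using is_path_edges[OF q(1)] that by (auto simp: theta_edges)
        then have "e div 2 = z" using pos[of e] n that by auto
        then show ?thesis by presburger
      qed
      obtain e q' where eq: "q = e # q'" using q(3) by (cases q) auto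
      show False
      proof (cases q')
        case Nil
        then have "ter (theta r i j) e = org (theta r i j) e"
          using q(1) eq by (auto simp: is_path_Cons[OF theta_gwf] simp del: theta_sel(3) theta_ter)
        then show False using two[of e] eq zo by (auto simp del: theta_sel(3) theta_ter)
      next
        case (Cons f q'')
        then have "org (theta r i j) f = ter (theta r i j) e" "f \<noteq> bar e"
          using q eq by (auto simp: is_path_Cons[OF theta_gwf] simp del: theta_sel(3) theta_ter)
        then show False using two[of e] two[of f] eq Cons zo by (auto simp del: theta_sel(3) theta_ter)
      qed
    qed
    show "is_path x 0 [] (base x)" by (simp add: x)
    show "\<forall>n<r. freered bar (rev_path [] @ map \<beta> (filter (\<lambda>e. 0 < l (e div 2)) (mark (theta r i j) n)) @ [])
        = freered bar (mark x n)"
    proof (intro allI impI)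
      fix n assume n: "n < r"
      have "set (mark (theta r i j) n) \<subseteq> {..<2 * r + 2}" using n ij by auto
      then have "filter (\<lambda>e. 0 < l (e div 2)) (mark (theta r i j) n) = filter (\<lambda>e. e div 2 \<noteq> z) (mark (theta r i j) n)"
        using pos by (intro filter_cong) auto
      then show "freered bar (rev_path [] @ map \<beta> (filter (\<lambda>e. 0 < l (e div 2)) (mark (theta r i j) n)) @ [])
        = freered bar (mark x n)" using m[OF n] by (simp add: rev_path_eq)
    qed
  qed simp
qed

lemma collapse_theta_start:
  assumes "point r (rose r L)" "l r = 0" "\<And>n. n < r \<Longrightarrow> l n = L n"
  shows "collapse_rep r (theta r i j) l (rose r L)"
proof (rule collapse_theta[where z = r and \<beta> = "\<lambda>e. e"])
  have "{e. e < 2 * r + 2 \<and> e div 2 \<noteq> r} = {..<2 * r}" by auto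
  then show "bij_betw (\<lambda>e. e) {e. e < 2 * r + 2 \<and> e div 2 \<noteq> r} {..<2 * r}" by (simp add: bij_betw_def)
  show "0 < l n" if "n \<le> r" "n \<noteq> r" for n using assms that by (simp add: point_def)
  show "bar e = bar e \<and> len (rose r L) (e div 2) = l (e div 2)" if "e < 2 * r + 2" "e div 2 \<noteq> r" for e
  proof -
    have "e div 2 < r" using that by auto
    then show ?thesis using assms by simp
  qed
qed (use assms ij in auto)

text \<open>Once edge \<open>j\<close> is gone, edge \<open>r\<close> traversed backwards is the new
  petal \<open>j\<close>. The mark of \<open>j\<close> becomes this petal, and the mark of
  \<open>i\<close>, which begins along edge \<open>r\<close>, becomes the inverse of petal
  \<open>j\<close> followed by petal \<open>i\<close>.\<close>

lemma collapse_theta_end: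
  assumes pt: "point r (rose r L)" and l: "l j = 0" "l r = L j" "\<And>n. n < r \<Longrightarrow> n \<noteq> j \<Longrightarrow> l n = L n"
  shows "collapse_rep r (theta r i j) l (act (rose r L) (transv i j))"
proof (rule collapse_theta[where z = j and \<beta> = "\<lambda>e. if e = 2 * r then Suc (2 * j) else if e = Suc (2 * r) then 2 * j else e"])
  let ?\<beta> = "\<lambda>e. if e = 2 * r then Suc (2 * j) else if e = Suc (2 * r) then 2 * j else e"
  let ?\<gamma> = "\<lambda>e. if e = Suc (2 * j) then 2 * r else if e = 2 * j then Suc (2 * r) else e"
  have L: "0 < L n" if "n < r" for n using pt that by (simp add: point_def)
  have two: "e div 2 = k \<longleftrightarrow> e = 2 * k \<or> e = Suc (2 * k)" for e k :: nat by presburger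
  show "bij_betw ?\<beta> {e. e < 2 * r + 2 \<and> e div 2 \<noteq> j} {..<2 * r}"
    by (rule bij_betw_byWitness[where f' = ?\<gamma>]) (use ij in \<open>auto simp: two\<close>)
  show "0 < l n" if "n \<le> r" "n \<noteq> j" for n using l L[of n] L[of j] ij that by (cases "n = r") auto
  show "?\<beta> (bar e) = bar (?\<beta> e) \<and> len (act (rose r L) (transv i j)) (?\<beta> e div 2) = l (e div 2)"
    if "e < 2 * r + 2" "e div 2 \<noteq> j" for e
  proof -
    have "e < 2 * r \<or> e = 2 * r \<or> e = Suc (2 * r)" using that by auto
    then show ?thesis
    proof (elim disjE)
      assume "e < 2 * r"
      then have "e div 2 < r" "e \<noteq> 2 * r" "e \<noteq> Suc (2 * r)" by auto
      then show ?thesis using l that by simp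
    qed (use l in simp_all)
  qed
  show "B.fr (map ?\<beta> (filter (\<lambda>e. e div 2 \<noteq> j) (mark (theta r i j) n))) = B.fr (mark (act (rose r L) (transv i j)) n)"
    if "n < r" for n
    using that ij by (auto simp: transv_def lift_alt sgn_path_def rev_path_eq)
qed (use assms ij point_act[OF pt is_aut_transv[OF ij]] in auto)

lemma theta_split: "(\<Sum>k<Suc r. F k) = (\<Sum>k\<in>{..<r} - {i, j}. F k) + (F i + F j + F r)" for F :: "nat \<Rightarrow> real"
proof -
  have "{..<Suc r} = ({..<r} - {i, j}) \<union> {i, j, r}" using ij by auto
  moreover have "({..<r} - {i, j}) \<inter> {i, j, r} = {}" by auto
  ultimately have "(\<Sum>k<Suc r. F k) = (\<Sum>k\<in>{..<r} - {i, j}. F k) + (\<Sum>k\<in>{i, j, r}. F k)"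
    using sum.union_disjoint[of "{..<r} - {i, j}" "{i, j, r}" F] by (simp only: finite.intros finite_Diff finite_lessThan simp_thms)
  then show ?thesis using ij by simp
qed

end

section \<open>Entropy of theta graphs with petals\<close>

lemma theta_positive:
  assumes "0 < p" "p < 1" "0 < q" "q < 1" "0 < s" "s < (1::real)"
  shows "p * (1 + p\<^sup>2 / (1 - p\<^sup>2) + q\<^sup>2 / (1 - q\<^sup>2) + s\<^sup>2 / (1 - s\<^sup>2)) < p / (1 - p\<^sup>2) + q / (1 - q\<^sup>2) + s / (1 - s\<^sup>2)"
proof -
  have sq: "x\<^sup>2 < 1" if "0 < x" "x < 1" for x :: real using that by (simp add: power_less_one_iff)
  have 1: "p * (1 + p\<^sup>2 / (1 - p\<^sup>2)) = p / (1 - p\<^sup>2)"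
  proof -
    have "1 + p\<^sup>2 / (1 - p\<^sup>2) = 1 / (1 - p\<^sup>2)" using sq[of p] assms by (simp add: field_simps)
    then show ?thesis by simp
  qed
  have 2: "p * (x\<^sup>2 / (1 - x\<^sup>2)) < x / (1 - x\<^sup>2)" if x: "0 < x" "x < 1" for x
  proof -
    have "p * x < 1 * 1" using x assms by (intro mult_strict_mono) auto
    then have "(p * x) * x < 1 * x" using x by (intro mult_strict_right_mono) auto
    then have "p * x\<^sup>2 < x" by (simp add: power2_eq_square mult.assoc)
    then show ?thesis using sq[OF x] by (simp add: divide_strict_right_mono)
  qed
  have "p * (1 + p\<^sup>2 / (1 - p\<^sup>2) + q\<^sup>2 / (1 - q\<^sup>2) + s\<^sup>2 / (1 - s\<^sup>2))
    = p * (1 + p\<^sup>2 / (1 - p\<^sup>2)) + p * (q\<^sup>2 / (1 - q\<^sup>2)) + p * (s\<^sup>2 / (1 - s\<^sup>2))"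
    by (simp add: distrib_left)
  then show ?thesis using 1 2[of q] 2[of s] assms by linarith
qed

text \<open>With \<open>x = exp (- t)\<close> this is \<open>x / (1 - x)\<close>, while
  \<open>yv t / 2\<close> is \<open>x / (1 + x)\<close>. Together they diagonalise the pair of
  coefficients \<open>x / (1 - x^2)\<close> and \<open>x^2 / (1 - x^2)\<close> of an arc between two
  vertices.\<close>

definition qv :: "real \<Rightarrow> real" where "qv x = 1 / (exp x - 1)"

lemma arc_terms:
  assumes "0 < t"
  defines "x \<equiv> exp (- t)"
  shows "x / (1 - x\<^sup>2) = (yv t / 2 + qv t) / 2" "x\<^sup>2 / (1 - x\<^sup>2) = (qv t - yv t / 2) / 2" "0 < x" "x < 1"
proof -
  have x: "0 < x" "x < 1" using assms by auto
  then show "0 < x" "x < 1" .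
  have e: "exp t = 1 / x" by (simp add: x_def exp_minus inverse_eq_divide)
  have "2 / c / 2 = 1 / c" for c :: real by simp
  from this[of "1 + exp t"] have "yv t / 2 = 1 / (1 + exp t)" by (simp only: yv_def)
  then have y: "yv t / 2 = x / (1 + x)" "qv t = x / (1 - x)"
    using x by (simp_all add: e qv_def field_simps)
  have f: "1 - x\<^sup>2 = (1 + x) * (1 - x)" by (simp add: power2_eq_square algebra_simps)
  have n: "1 + x \<noteq> 0" "1 - x \<noteq> 0" using x by auto
  show "x / (1 - x\<^sup>2) = (yv t / 2 + qv t) / 2" unfolding y f using n by (simp add: divide_simps) algebra
  show "x\<^sup>2 / (1 - x\<^sup>2) = (qv t - yv t / 2) / 2" unfolding y f using n by (simp add: divide_simps) algebra
qed

context theta_graph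
begin

text \<open>Let \<open>\<beta>\<close> and \<open>\<gamma>\<close> be the potentials at vertices 0
  and 1. They are normalised so that \<open>U = \<beta> - \<gamma>\<close> and
  \<open>V = \<beta> + \<gamma>\<close> are separate sums over the three arcs, and the equation at
  vertex 1 then holds identically. The equation at vertex 0 becomes
  \<open>a * \<beta> = U * V\<close>, that is \<open>2 / a = 1 / U + 1 / V\<close>, again in
  separated form.\<close>

lemma theta_entropy:
  assumes l: "\<And>n. n \<le> r \<Longrightarrow> 0 < l n" and h: "0 < h"
    and U: "U = 1 - (yv (h * l i) + yv (h * l j) + yv (h * l r)) / 2" "0 < U"
    and V: "V = 1 + (qv (h * l i) + qv (h * l j) + qv (h * l r))"
    and eq: "2 / (\<Sum>k\<in>{..<r} - {i, j}. yv (h * l k)) = 1 / U + 1 / V"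
  shows "entropy (theta r i j) l = h"
proof (rule entropy_vertex[where P = "\<lambda>v. if v = 0 then (U + V) / 2 else (V - U) / 2" and hub = "2 * r"])
  define a where "a = (\<Sum>k\<in>{..<r} - {i, j}. yv (h * l k))"
  define \<beta> \<gamma> where "\<beta> = (U + V) / 2" and "\<gamma> = (V - U) / 2"
  define x where "x n = exp (- (h * l n))" for n
  have hl: "0 < h * l n" if "n \<le> r" for n using l[OF that] h by simp
  have x: "0 < x n" "x n < 1" if "n \<le> r" for n using hl[OF that] by (auto simp: x_def)
  have le: "i \<le> r" "j \<le> r" "r \<le> r" using ij by auto
  note at = arc_terms[OF hl[OF le(1)]] arc_terms[OF hl[OF le(2)]] arc_terms[OF hl[OF le(3)]]
  have g: "\<gamma> = x i / (1 - (x i)\<^sup>2) + x j / (1 - (x j)\<^sup>2) + x r / (1 - (x r)\<^sup>2)"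
    unfolding \<gamma>_def U V x_def at(1,5,9) by (simp add: field_simps)
  have b: "\<beta> = 1 + (x i)\<^sup>2 / (1 - (x i)\<^sup>2) + (x j)\<^sup>2 / (1 - (x j)\<^sup>2) + (x r)\<^sup>2 / (1 - (x r)\<^sup>2)"
    unfolding \<beta>_def U V x_def at(2,6,10) by (simp add: field_simps)
  have collect: "(A * (x i / (1 - (x i)\<^sup>2)) - C * ((x i)\<^sup>2 / (1 - (x i)\<^sup>2)))
      + (A * (x j / (1 - (x j)\<^sup>2)) - C * ((x j)\<^sup>2 / (1 - (x j)\<^sup>2)))
      + (A * (x r / (1 - (x r)\<^sup>2)) - C * ((x r)\<^sup>2 / (1 - (x r)\<^sup>2))) = A * \<gamma> - C * (\<beta> - 1)" for A C
    unfolding g b distrib_left right_diff_distrib by simp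
  have qpos: "0 < qv t" if "0 < t" for t using that by (simp add: qv_def)
  have V1: "1 < V" using qpos[OF hl[OF le(1)]] qpos[OF hl[OF le(2)]] qpos[OF hl[OF le(3)]] unfolding V by linarith
  have U1: "U < 1" unfolding U(1) by (simp add: add_pos_pos)
  have pos: "0 < \<gamma>" "\<gamma> < \<beta>" "0 < \<beta>" using V1 U1 U(2) by (auto simp: \<beta>_def \<gamma>_def)
  have a0: "0 < a" unfolding a_def using petal by (intro sum_pos) auto
  have ab: "a * \<beta> = \<beta>\<^sup>2 - \<gamma>\<^sup>2"
  proof -
    have "2 / a = (U + V) / (U * V)" using eq U(2) V1 by (simp add: a_def add_divide_distrib)
    then have "2 * (U * V) = a * (U + V)" using a0 U(2) V1 by (simp add: field_simps)
    then show ?thesis by (simp add: \<beta>_def \<gamma>_def power2_eq_square field_simps)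
  qed
  \<comment> \<open>Positivity of the eigenvector on the arcs: towards vertex 1 by
    \<open>theta_positive\<close>, towards vertex 0 because
    \<open>\<gamma> < \<beta>\<close>.\<close>
  have edge: "x n * \<beta> < \<gamma>" "x n * \<gamma> < \<beta>" if "n = i \<or> n = j \<or> n = r" for n
  proof -
    have n: "n \<le> r" using that le by auto
    have "x n * \<gamma> < 1 * \<gamma>" using x[OF n] pos by (intro mult_strict_right_mono) auto
    then show "x n * \<gamma> < \<beta>" using pos by linarith
    note tp = theta_positive[of "x i" "x j" "x r"] theta_positive[of "x j" "x i" "x r"] theta_positive[of "x r" "x i" "x j"]
    have "x i * \<beta> < \<gamma>" "x j * \<beta> < \<gamma>" "x r * \<beta> < \<gamma>"
      using tp x[OF le(1)] x[OF le(2)] x[OF le(3)] unfolding g b by (simp_all add: add_ac)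
    then show "x n * \<beta> < \<gamma>" using that by auto
  qed
  define P where "P v = (if v = 0 then (U + V) / 2 else (V - U) / 2)" for v :: nat
  have P: "P 0 = \<beta>" "P (Suc 0) = \<gamma>" by (simp_all add: P_def \<beta>_def \<gamma>_def)
  show "gwf (theta r i j)" by (rule theta_gwf)
  show "0 < l n" if "n < ne (theta r i j)" for n using that l by simp
  show "2 * r \<in> edges (theta r i j)" by (simp add: theta_edges)
  have arc: "e div 2 = i \<or> e div 2 = j \<or> e div 2 = r \<or> org (theta r i j) e = 0 \<and> ter (theta r i j) e = 0" for e
    by auto
  have "exp (- h * l (e div 2)) * P (org (theta r i j) e) < P (ter (theta r i j) e)"
    if e: "e \<in> edges (theta r i j)" for e
  proof -
    have n: "e div 2 \<le> r" using e by (auto simp: theta_edges)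
    have xe: "exp (- h * l (e div 2)) = x (e div 2)" by (simp add: x_def)
    show ?thesis
    proof (cases "e div 2 = i \<or> e div 2 = j \<or> e div 2 = r")
      case True
      have two: "e div 2 = k \<Longrightarrow> e = 2 * k \<or> e = Suc (2 * k)" for k by presburger
      have "e = 2 * i \<or> e = Suc (2 * i) \<or> e = 2 * j \<or> e = Suc (2 * j) \<or> e = 2 * r \<or> e = Suc (2 * r)"
        using True two by blast
      then have "(org (theta r i j) e = 0 \<and> ter (theta r i j) e = 1) \<or> (org (theta r i j) e = 1 \<and> ter (theta r i j) e = 0)"
        using ij by (elim disjE) simp_all
      then show ?thesis unfolding xe using edge[OF True] by (elim disjE conjE) (simp_all add: P del: theta_sel(3) theta_ter)
    next
      case False
      then have "org (theta r i j) e = 0" "ter (theta r i j) e = 0" using arc[of e] by blast+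
      then show ?thesis unfolding xe using x[OF n] pos by (simp add: P del: theta_sel(3) theta_ter)
    qed
  qed
  then show "exp (- h * l (e div 2)) * (if org (theta r i j) e = 0 then (U + V) / 2 else (V - U) / 2)
      < (if ter (theta r i j) e = 0 then (U + V) / 2 else (V - U) / 2)" if "e \<in> edges (theta r i j)" for e
    using that unfolding P_def by blast
  show "(\<Sum>f | f \<in> edges (theta r i j) \<and> org (theta r i j) f = v.
       exp (- h * l (f div 2)) * ((if ter (theta r i j) f = 0 then (U + V) / 2 else (V - U) / 2)
          - exp (- h * l (f div 2)) * (if v = 0 then (U + V) / 2 else (V - U) / 2)) /
       (1 - (exp (- h * l (f div 2)))\<^sup>2)) = (if v = 0 then (U + V) / 2 else (V - U) / 2)"
    if v: "v < nv (theta r i j)" for v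
  proof -
    define F where "F f = exp (- h * l (f div 2)) * (P (ter (theta r i j) f)
          - exp (- h * l (f div 2)) * P v) / (1 - (exp (- h * l (f div 2)))\<^sup>2)" for f
    let ?t = "\<lambda>k. (if org (theta r i j) (2 * k) = v then F (2 * k) else 0) +
        (if org (theta r i j) (Suc (2 * k)) = v then F (Suc (2 * k)) else 0)"
    have Fx: "F f = x (f div 2) * (P (ter (theta r i j) f) - x (f div 2) * P v) / (1 - (x (f div 2))\<^sup>2)" for f
      by (simp add: F_def x_def)
    have sum: "(\<Sum>f | f \<in> edges (theta r i j) \<and> org (theta r i j) f = v. F f)
        = (\<Sum>k\<in>{..<r} - {i, j}. ?t k) + (?t i + ?t j + ?t r)"
      unfolding sum_edges by (simp only: theta_sel(2) theta_split)
    have "v = 0 \<or> v = 1" using v by (simp add: less_2_cases_iff)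
    then have "(\<Sum>k\<in>{..<r} - {i, j}. ?t k) + (?t i + ?t j + ?t r) = P v"
    proof
      assume v0: "v = 0"
      have "(\<Sum>k\<in>{..<r} - {i, j}. ?t k) = (\<Sum>k\<in>{..<r} - {i, j}. \<beta> * yv (h * l k))"
      proof (rule sum.cong[OF refl])
        fix k assume k: "k \<in> {..<r} - {i, j}"
        have "F f = \<beta> * (yv (h * l k) / 2)" if "f = 2 * k \<or> f = Suc (2 * k)" for f
          using loop_term[of h "l k" \<beta>] hl[of k] that k v0 by (auto simp: F_def P)
        then have "F (2 * k) = \<beta> * (yv (h * l k) / 2)" "F (Suc (2 * k)) = \<beta> * (yv (h * l k) / 2)" by blast+
        moreover have "?t k = F (2 * k) + F (Suc (2 * k))" using k v0 by simp
        ultimately show "?t k = \<beta> * yv (h * l k)" by simp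
      qed
      then have 1: "(\<Sum>k\<in>{..<r} - {i, j}. ?t k) = \<beta> * a" by (simp add: a_def sum_distrib_left)
      have "?t i = F (Suc (2 * i))" "?t j = F (2 * j)" "?t r = F (2 * r)" using v0 ij by auto
      moreover have "F (Suc (2 * i)) = \<gamma> * (x i / (1 - (x i)\<^sup>2)) - \<beta> * ((x i)\<^sup>2 / (1 - (x i)\<^sup>2))"
        "F (2 * j) = \<gamma> * (x j / (1 - (x j)\<^sup>2)) - \<beta> * ((x j)\<^sup>2 / (1 - (x j)\<^sup>2))"
        "F (2 * r) = \<gamma> * (x r / (1 - (x r)\<^sup>2)) - \<beta> * ((x r)\<^sup>2 / (1 - (x r)\<^sup>2))"
        using v0 ij by (simp_all add: Fx P power2_eq_square diff_divide_distrib right_diff_distrib mult_ac)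
      ultimately have "?t i + ?t j + ?t r = \<gamma> * \<gamma> - \<beta> * (\<beta> - 1)"
        using collect[of \<gamma> \<beta>] by (simp only:)
      then show ?thesis using 1 ab v0 P by (simp add: power2_eq_square algebra_simps)
    next
      assume v1: "v = 1"
      have "(\<Sum>k\<in>{..<r} - {i, j}. ?t k) = 0" using v1 by (intro sum.neutral) auto
      moreover have "?t i = F (2 * i)" "?t j = F (Suc (2 * j))" "?t r = F (Suc (2 * r))" using v1 ij by auto
      moreover have "F (2 * i) = \<beta> * (x i / (1 - (x i)\<^sup>2)) - \<gamma> * ((x i)\<^sup>2 / (1 - (x i)\<^sup>2))"
        "F (Suc (2 * j)) = \<beta> * (x j / (1 - (x j)\<^sup>2)) - \<gamma> * ((x j)\<^sup>2 / (1 - (x j)\<^sup>2))"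
        "F (Suc (2 * r)) = \<beta> * (x r / (1 - (x r)\<^sup>2)) - \<gamma> * ((x r)\<^sup>2 / (1 - (x r)\<^sup>2))"
        using v1 ij by (simp_all add: Fx P power2_eq_square diff_divide_distrib right_diff_distrib mult_ac)
      ultimately have "(\<Sum>k\<in>{..<r} - {i, j}. ?t k) + (?t i + ?t j + ?t r) = \<beta> * \<gamma> - \<gamma> * (\<beta> - 1)"
        using collect[of \<beta> \<gamma>] by (simp only: add_0)
      then show ?thesis using v1 P by (simp add: algebra_simps)
    qed
    then have "(\<Sum>f | f \<in> edges (theta r i j) \<and> org (theta r i j) f = v. F f) = P v" using sum by simp
    then show ?thesis unfolding F_def P_def .
  qed
  fix e assume e: "e \<in> edges (theta r i j)"
  have S: "f \<in> succs (theta r i j) d \<longleftrightarrow> f < 2 * r + 2 \<and> org (theta r i j) f = ter (theta r i j) d \<and> f \<noteq> bar d" for d f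
    by (simp add: succs_def theta_edges)
  have s1: "2 * r \<in> succs (theta r i j) f" if "ter (theta r i j) f = 0" "f \<noteq> Suc (2 * r)" for f
  proof -
    have "2 * r \<noteq> bar f" using that(2) by (metis bar_eq_simps(1))
    then show ?thesis using that ij by (simp add: S del: theta_ter)
  qed
  have s2: "2 * petal \<in> succs (theta r i j) (Suc (2 * r))" using petal ij by (simp add: S)
  have s3: "2 * i \<in> succs (theta r i j) (2 * r)" "2 * i \<in> succs (theta r i j) (2 * j)"
    "Suc (2 * j) \<in> succs (theta r i j) (Suc (2 * i))" using ij by (simp_all add: S)
  have "ter (theta r i j) e = 0 \<or> e = 2 * r \<or> e = 2 * j \<or> e = Suc (2 * i)" by simp
  then consider "ter (theta r i j) e = 0" "e \<noteq> Suc (2 * r)" | "e = Suc (2 * r)" | "e = 2 * r" | "e = 2 * j" | "e = Suc (2 * i)"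
    by metis
  then show "\<exists>q. nb (theta r i j) e (q @ [2 * r])"
  proof cases
    case 1
    have "nb (theta r i j) e ([] @ [2 * r])" using s1[OF 1] by simp
    then show ?thesis by blast
  next
    case 2
    have "nb (theta r i j) e ([2 * petal] @ [2 * r])" using s2 s1[of "2 * petal"] 2 petal by simp
    then show ?thesis by blast
  next
    case 3
    have "nb (theta r i j) e ([2 * i] @ [2 * r])" using s3 s1[of "2 * i"] 3 ij by simp
    then show ?thesis by blast
  next
    case 4
    have "nb (theta r i j) e ([2 * i] @ [2 * r])" using s3 s1[of "2 * i"] 4 ij by simp
    then show ?thesis by blast
  next
    case 5
    have "nb (theta r i j) e ([Suc (2 * j)] @ [2 * r])" using s3 s1[of "Suc (2 * j)"] 5 ij by simp
    then show ?thesis by blast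
  qed
qed (fact h)

end

section \<open>Closed formulas along the slide of one petal end\<close>

lemma qv_deriv: "0 < x \<Longrightarrow> (qv has_real_derivative - (qv x * (1 + qv x))) (at x)"
proof -
  assume "0 < x"
  then have n: "exp x - 1 \<noteq> 0" by simp
  then have "(qv has_real_derivative - exp x / (exp x - 1)\<^sup>2) (at x)"
    unfolding qv_def by (auto intro!: derivative_eq_intros simp: power2_eq_square)
  moreover have "1 + qv x = exp x / (exp x - 1)" unfolding qv_def using n by (simp add: field_simps)
  then have "- exp x / (exp x - 1)\<^sup>2 = - (qv x * (1 + qv x))" by (simp add: qv_def power2_eq_square)
  ultimately show ?thesis by simp
qed

lemma qv_deriv2: "0 < x \<Longrightarrow> ((\<lambda>x. - (qv x * (1 + qv x))) has_real_derivative qv x * (1 + qv x) * (1 + 2 * qv x)) (at x)"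
proof -
  assume x: "0 < x"
  have "((\<lambda>y. - (y * (1 + y))) has_real_derivative - (1 + 2 * y)) (at y)" for y :: real
    by (auto intro!: derivative_eq_intros)
  from DERIV_chain2[OF this qv_deriv[OF x]]
  have "((\<lambda>x. - (qv x * (1 + qv x))) has_real_derivative - (1 + 2 * qv x) * - (qv x * (1 + qv x))) (at x)" .
  moreover have "- (1 + 2 * qv x) * - (qv x * (1 + qv x)) = qv x * (1 + qv x) * (1 + 2 * qv x)" by algebra
  ultimately show ?thesis by simp
qed

lemma qv_pos: "0 < x \<Longrightarrow> 0 < qv x" by (simp add: qv_def)

lemma recip_derivs:
  "z / 2 \<noteq> 1 \<Longrightarrow> ((\<lambda>z. 1 / (1 - z / 2)) has_real_derivative 1 / 2 / (1 - z / 2)\<^sup>2) (at z)"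
  "z / 2 \<noteq> 1 \<Longrightarrow> ((\<lambda>z. 1 / 2 / (1 - z / 2)\<^sup>2) has_real_derivative 1 / 2 / (1 - z / 2)^3) (at z)"
  "1 + z \<noteq> 0 \<Longrightarrow> ((\<lambda>z. 1 / (1 + z)) has_real_derivative - 1 / (1 + z)\<^sup>2) (at z)"
  "1 + z \<noteq> 0 \<Longrightarrow> ((\<lambda>z. - 1 / (1 + z)\<^sup>2) has_real_derivative 2 / (1 + z)^3) (at z)" for z :: real
proof -
  have i1: "((\<lambda>z. 1 / z) has_real_derivative - 1 / z\<^sup>2) (at z)" if "z \<noteq> 0" for z :: real
    using that by (auto intro!: derivative_eq_intros simp: power2_eq_square)
  have i2: "((\<lambda>z. k / z\<^sup>2) has_real_derivative - 2 * k / z^3) (at z)" if "z \<noteq> 0" for z k :: real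
    using that by (auto intro!: derivative_eq_intros simp: field_simps power2_eq_square power3_eq_cube)
  have m: "((\<lambda>z::real. 1 - z / 2) has_real_derivative - 1 / 2) (at z)" "((\<lambda>z::real. 1 + z) has_real_derivative 1) (at z)" for z
    by (auto intro!: derivative_eq_intros)
  show "((\<lambda>z. 1 / (1 - z / 2)) has_real_derivative 1 / 2 / (1 - z / 2)\<^sup>2) (at z)" if "z / 2 \<noteq> 1"
    using DERIV_chain2[OF i1 m(1), of z] that by (simp add: field_simps)
  show "((\<lambda>z. 1 / 2 / (1 - z / 2)\<^sup>2) has_real_derivative 1 / 2 / (1 - z / 2)^3) (at z)" if "z / 2 \<noteq> 1"
    using DERIV_chain2[OF i2 m(1), of z "1 / 2"] that by (simp add: field_simps)
  show "((\<lambda>z. 1 / (1 + z)) has_real_derivative - 1 / (1 + z)\<^sup>2) (at z)" if "1 + z \<noteq> 0"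
    using DERIV_chain2[OF i1 m(2), of z] that by simp
  show "((\<lambda>z. - 1 / (1 + z)\<^sup>2) has_real_derivative 2 / (1 + z)^3) (at z)" if "1 + z \<noteq> 0"
    using DERIV_chain2[OF i2 m(2), of z "- 1"] that by simp
qed

text \<open>Along the slide, edges \<open>r\<close> and \<open>j\<close> have lengths
  \<open>\<tau> * lam\<close> and \<open>(1 - \<tau>) * lam\<close>, and \<open>g\<close> is the
  length of the long petal. The thresholds 1/3 and 1/32 keep the denominators \<open>Xd\<close> and
  \<open>Yd\<close> above 1/2.\<close>

locale arc_path =
  fixes lam g :: real
  assumes lam: "0 < lam" and g: "0 < g" and x3: "exp (- lam) \<le> 1 / 3" and s32: "exp (- g) \<le> 1 / 32"
begin

definition "x = exp (- lam)"
definition "s = exp (- g)"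
definition "\<sigma> = yv g / 2"
definition "\<sigma>' = qv g"
definition "c = 1 - x"
definition "p \<tau> = exp (- (\<tau> * lam))"
definition "q \<tau> = exp (- ((1 - \<tau>) * lam))"
definition "t \<tau> = p \<tau> + q \<tau>"
definition "T \<tau> = 1 + x + t \<tau>"
definition "T' \<tau> = 1 + x - t \<tau>"
definition "Xd \<tau> = c - \<sigma> * T \<tau>"
definition "Yd \<tau> = c + \<sigma>' * T' \<tau>"
text \<open>Since \<open>U = Xd / T\<close> and \<open>V = Yd / T'\<close>, this is
  \<open>1 / U + 1 / V\<close>, in a form that stays smooth at the ends, where \<open>qv\<close> of
  the vanishing arc is infinite. If \<open>g\<close> were infinite, both denominators would equal
  \<open>c\<close>, and \<open>T + T'\<close> does not depend on \<open>\<tau>\<close>. So the slide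
  would be free, and all variation of \<open>Ab\<close> is of order \<open>s\<close>.\<close>

definition "Ab \<tau> = T \<tau> / Xd \<tau> + T' \<tau> / Yd \<tau>"
definition "phi \<tau> = c / (Xd \<tau>)\<^sup>2 - c / (Yd \<tau>)\<^sup>2"
definition "phi' \<tau> = 2 * c * \<sigma> / (Xd \<tau>)^3 - 2 * c * \<sigma>' / (Yd \<tau>)^3"
definition "t' \<tau> = lam * (q \<tau> - p \<tau>)"
definition "Ab1 \<tau> = phi \<tau> * t' \<tau>"
definition "Ab2 \<tau> = phi' \<tau> * (t' \<tau>)\<^sup>2 + phi \<tau> * (lam\<^sup>2 * t \<tau>)"

lemma xs: "0 < x" "x \<le> 1 / 3" "0 < s" "s \<le> 1 / 32" "2 / 3 \<le> c" "c \<le> 1" "c < 1"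
  using x3 s32 by (auto simp: x_def s_def c_def)

lemma sigma: "0 < \<sigma>" "\<sigma> \<le> s" "0 < \<sigma>'" "\<sigma>' \<le> 2 * s" "\<sigma> = s / (1 + s)" "\<sigma>' = s / (1 - s)"
proof -
  have e: "exp g = 1 / s" by (simp add: s_def exp_minus inverse_eq_divide)
  have "2 / d / 2 = 1 / d" for d :: real by simp
  from this[of "1 + exp g"] have "\<sigma> = 1 / (1 + exp g)" by (simp only: \<sigma>_def yv_def)
  then show s1: "\<sigma> = s / (1 + s)" and s2: "\<sigma>' = s / (1 - s)"
    using xs by (simp_all add: e \<sigma>'_def qv_def field_simps)
  show "0 < \<sigma>" "0 < \<sigma>'" using g by (auto simp: \<sigma>_def \<sigma>'_def qv_pos)
  have "s / (1 + s) \<le> s / 1" using xs by (intro divide_left_mono) auto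
  then show "\<sigma> \<le> s" by (simp add: s1)
  have "s / (1 - s) \<le> s / (1 / 2)" using xs by (intro divide_left_mono) auto
  then show "\<sigma>' \<le> 2 * s" by (simp add: s2)
qed

lemma pq: "0 < p \<tau>" "0 < q \<tau>" "p \<tau> * q \<tau> = x" "0 \<le> \<tau> \<Longrightarrow> p \<tau> \<le> 1" "\<tau> \<le> 1 \<Longrightarrow> q \<tau> \<le> 1"
  using lam by (auto simp: p_def q_def x_def exp_add[symmetric] algebra_simps)

lemma T_bounds:
  assumes "0 \<le> \<tau>" "\<tau> \<le> 1"
  shows "1 \<le> T \<tau>" "T \<tau> \<le> 8 / 3" "0 \<le> T' \<tau>" "T' \<tau> \<le> 4 / 3"
proof -
  have "0 \<le> (1 - p \<tau>) * (1 - q \<tau>)" using pq[of \<tau>] assms by (intro mult_nonneg_nonneg) auto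
  moreover have "(1 - p \<tau>) * (1 - q \<tau>) = T' \<tau>"
    using pq(3)[of \<tau>] by (simp add: T'_def t_def algebra_simps)
  ultimately show T': "0 \<le> T' \<tau>" by simp
  have tp: "0 < t \<tau>" using pq[of \<tau>] by (simp add: t_def)
  then show "1 \<le> T \<tau>" "T' \<tau> \<le> 4 / 3" using xs by (auto simp: T_def T'_def)
  show "T \<tau> \<le> 8 / 3" using T' xs by (simp add: T_def T'_def)
qed

lemma XY:
  assumes "0 \<le> \<tau>" "\<tau> \<le> 1"
  shows "1 / 2 \<le> Xd \<tau>" "1 / 2 \<le> Yd \<tau>" "Xd \<tau> \<le> 1" "Xd \<tau> \<le> Yd \<tau>" "Yd \<tau> - Xd \<tau> \<le> 16 / 3 * s" "Yd \<tau> + Xd \<tau> \<le> 3"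
proof -
  note b = T_bounds[OF assms]
  have "\<sigma> * T \<tau> \<le> s * (8 / 3)" using sigma b xs by (intro mult_mono) auto
  moreover have "0 \<le> \<sigma> * T \<tau>" using sigma b by simp
  moreover have "\<sigma>' * T' \<tau> \<le> (2 * s) * (4 / 3)" using sigma b xs by (intro mult_mono) auto
  moreover have "0 \<le> \<sigma>' * T' \<tau>" using sigma(3) b by (intro mult_nonneg_nonneg) auto
  ultimately show "1 / 2 \<le> Xd \<tau>" "1 / 2 \<le> Yd \<tau>" "Xd \<tau> \<le> 1" "Xd \<tau> \<le> Yd \<tau>" "Yd \<tau> - Xd \<tau> \<le> 16 / 3 * s" "Yd \<tau> + Xd \<tau> \<le> 3"
    using xs unfolding Xd_def Yd_def by linarith+
qed

text \<open>The difference of inverse squares factors through \<open>Yd - Xd\<close>, which is of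
  order \<open>s\<close>. The numerator is at most \<open>16 * s\<close> and the denominator at
  least 1/16.\<close>

lemma phi_bound: assumes "0 \<le> \<tau>" "\<tau> \<le> 1" shows "0 \<le> phi \<tau>" "phi \<tau> \<le> 256 * s"
proof -
  define X Y where "X = Xd \<tau>" and "Y = Yd \<tau>"
  note b = XY[OF assms, folded X_def Y_def]
  have pos: "0 < X" "0 < Y" using b by linarith+
  have e: "phi \<tau> = c * (Y - X) * (Y + X) / (X\<^sup>2 * Y\<^sup>2)"
    unfolding phi_def X_def[symmetric] Y_def[symmetric] using pos by (simp add: field_simps power2_eq_square)
  show "0 \<le> phi \<tau>" unfolding e using b pos xs by simp
  have "1 / 16 \<le> X\<^sup>2 * Y\<^sup>2"
  proof -
    have "(1 / 2)\<^sup>2 * (1 / 2)\<^sup>2 \<le> X\<^sup>2 * Y\<^sup>2" using b by (intro mult_mono power_mono) auto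
    then show ?thesis by (simp add: power2_eq_square)
  qed
  moreover have "c * (Y - X) * (Y + X) \<le> 1 * (16 / 3 * s) * 3"
    using b pos xs by (intro mult_mono) auto
  ultimately have "c * (Y - X) * (Y + X) / (X\<^sup>2 * Y\<^sup>2) \<le> (1 * (16 / 3 * s) * 3) / (1 / 16)"
    using b pos xs by (intro frac_le) auto
  then show "phi \<tau> \<le> 256 * s" unfolding e by simp
qed

lemma phi'_bound: assumes "0 \<le> \<tau>" "\<tau> \<le> 1" shows "phi' \<tau> \<le> 48 * s"
proof -
  define X Y where "X = Xd \<tau>" and "Y = Yd \<tau>"
  note b = XY[OF assms, folded X_def Y_def]
  have pos: "0 < X" "0 < Y" using b by linarith+
  have X3: "1 / 8 \<le> X^3" "1 / 8 \<le> Y^3" using b power_mono[of "1/2" X 3] power_mono[of "1/2" Y 3] by (auto simp: power3_eq_cube)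
  have "2 * c * \<sigma> / X^3 \<le> (2 * 1 * s) / (1 / 8)" using X3 xs sigma pos by (intro frac_le mult_mono) auto
  moreover have "0 \<le> 2 * c * \<sigma>' / Y^3" using xs sigma(3) pos by (intro divide_nonneg_nonneg mult_nonneg_nonneg) auto
  ultimately show "phi' \<tau> \<le> 48 * s" unfolding phi'_def X_def[symmetric] Y_def[symmetric] using xs(3) by simp
qed

lemma t'_bound: assumes "0 \<le> \<tau>" "\<tau> \<le> 1" shows "\<bar>t' \<tau>\<bar> \<le> lam" "0 \<le> t \<tau>" "t \<tau> \<le> 2"
proof -
  have "\<bar>q \<tau> - p \<tau>\<bar> \<le> 1" using pq[of \<tau>] assms by auto
  then have "lam * \<bar>q \<tau> - p \<tau>\<bar> \<le> lam * 1" using lam by (intro mult_left_mono) auto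
  then show "\<bar>t' \<tau>\<bar> \<le> lam" using lam by (simp add: t'_def abs_mult)
  show "0 \<le> t \<tau>" "t \<tau> \<le> 2" using pq[of \<tau>] assms by (auto simp: t_def)
qed

lemma Ab1_bound: assumes "0 \<le> \<tau>" "\<tau> \<le> 1" shows "\<bar>Ab1 \<tau>\<bar> \<le> 256 * s * lam"
proof -
  have "\<bar>phi \<tau>\<bar> * \<bar>t' \<tau>\<bar> \<le> (256 * s) * lam"
    using phi_bound[OF assms] t'_bound[OF assms] xs by (intro mult_mono) auto
  then show ?thesis by (simp add: Ab1_def abs_mult)
qed

lemma Ab2_bound: assumes "0 \<le> \<tau>" "\<tau> \<le> 1" shows "Ab2 \<tau> \<le> 560 * s * lam\<^sup>2"
proof -
  have "(t' \<tau>)\<^sup>2 \<le> lam\<^sup>2" using t'_bound(1)[OF assms] lam by (simp add: abs_le_square_iff[symmetric])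
  then have "(48 * s) * (t' \<tau>)\<^sup>2 \<le> (48 * s) * lam\<^sup>2" using xs by (intro mult_left_mono) auto
  moreover have "phi' \<tau> * (t' \<tau>)\<^sup>2 \<le> (48 * s) * (t' \<tau>)\<^sup>2"
    using phi'_bound[OF assms] by (intro mult_right_mono) auto
  moreover have "phi \<tau> * (lam\<^sup>2 * t \<tau>) \<le> (256 * s) * (lam\<^sup>2 * 2)"
    using phi_bound[OF assms] t'_bound[OF assms] xs by (intro mult_mono) auto
  ultimately show ?thesis by (simp add: Ab2_def)
qed

lemma Ab_ge1: assumes "0 \<le> \<tau>" "\<tau> \<le> 1" shows "1 \<le> Ab \<tau>"
proof -
  have "1 / 1 \<le> T \<tau> / Xd \<tau>" using T_bounds[OF assms] XY[OF assms] by (intro frac_le) auto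
  moreover have "0 \<le> T' \<tau> / Yd \<tau>" using T_bounds[OF assms] XY[OF assms] by simp
  ultimately show ?thesis by (simp add: Ab_def)
qed

lemma t_deriv: "(t has_real_derivative t' \<tau>) (at \<tau>)" "(t' has_real_derivative lam\<^sup>2 * t \<tau>) (at \<tau>)"
  unfolding t_def[abs_def] t'_def[abs_def] p_def[abs_def] q_def[abs_def]
  by (auto intro!: derivative_eq_intros simp: algebra_simps power2_eq_square)

lemma Ab_deriv:
  assumes "0 \<le> \<tau>" "\<tau> \<le> 1"
  shows "(Ab has_real_derivative Ab1 \<tau>) (at \<tau>)" "(Ab1 has_real_derivative Ab2 \<tau>) (at \<tau>)"
proof -
  have n: "Xd \<tau> \<noteq> 0" "Yd \<tau> \<noteq> 0" using XY[OF assms] by linarith+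
  have dT: "(T has_real_derivative t' \<tau>) (at \<tau>)" "(T' has_real_derivative - t' \<tau>) (at \<tau>)"
    unfolding T_def[abs_def] T'_def[abs_def] by (auto intro!: derivative_eq_intros t_deriv)
  have dX: "(Xd has_real_derivative - \<sigma> * t' \<tau>) (at \<tau>)" "(Yd has_real_derivative - \<sigma>' * t' \<tau>) (at \<tau>)"
    unfolding Xd_def[abs_def] Yd_def[abs_def] by (auto intro!: derivative_eq_intros dT)
  have "((\<lambda>\<tau>. T \<tau> / Xd \<tau>) has_real_derivative (t' \<tau> * Xd \<tau> - T \<tau> * (- \<sigma> * t' \<tau>)) / (Xd \<tau> * Xd \<tau>)) (at \<tau>)"
    by (rule DERIV_divide[OF dT(1) dX(1) n(1)])
  moreover have "t' \<tau> * Xd \<tau> - T \<tau> * (- \<sigma> * t' \<tau>) = c * t' \<tau>" by (simp add: Xd_def algebra_simps)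
  ultimately have 1: "((\<lambda>\<tau>. T \<tau> / Xd \<tau>) has_real_derivative c * t' \<tau> / (Xd \<tau>)\<^sup>2) (at \<tau>)" by (simp add: power2_eq_square)
  have "((\<lambda>\<tau>. T' \<tau> / Yd \<tau>) has_real_derivative (- t' \<tau> * Yd \<tau> - T' \<tau> * (- \<sigma>' * t' \<tau>)) / (Yd \<tau> * Yd \<tau>)) (at \<tau>)"
    by (rule DERIV_divide[OF dT(2) dX(2) n(2)])
  moreover have "- t' \<tau> * Yd \<tau> - T' \<tau> * (- \<sigma>' * t' \<tau>) = - (c * t' \<tau>)" by (simp add: Yd_def algebra_simps)
  ultimately have 2: "((\<lambda>\<tau>. T' \<tau> / Yd \<tau>) has_real_derivative - (c * t' \<tau>) / (Yd \<tau>)\<^sup>2) (at \<tau>)" by (simp add: power2_eq_square)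
  have "(Ab has_real_derivative c * t' \<tau> / (Xd \<tau>)\<^sup>2 + - (c * t' \<tau>) / (Yd \<tau>)\<^sup>2) (at \<tau>)"
    unfolding Ab_def[abs_def] by (rule DERIV_add[OF 1 2])
  moreover have "c * t' \<tau> / (Xd \<tau>)\<^sup>2 + - (c * t' \<tau>) / (Yd \<tau>)\<^sup>2 = Ab1 \<tau>" by (simp add: Ab1_def phi_def left_diff_distrib)
  ultimately show "(Ab has_real_derivative Ab1 \<tau>) (at \<tau>)" by simp
  have inv: "((\<lambda>z. c / z\<^sup>2) has_real_derivative - 2 * c / z^3) (at z)" if "z \<noteq> 0" for z
    using that by (auto intro!: derivative_eq_intros simp: field_simps power2_eq_square power3_eq_cube)
  have "(phi has_real_derivative - 2 * c / (Xd \<tau>)^3 * (- \<sigma> * t' \<tau>) - - 2 * c / (Yd \<tau>)^3 * (- \<sigma>' * t' \<tau>)) (at \<tau>)"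
    unfolding phi_def[abs_def] by (intro DERIV_diff DERIV_chain2[OF inv] dX n)
  moreover have "- 2 * c / (Xd \<tau>)^3 * (- \<sigma> * t' \<tau>) - - 2 * c / (Yd \<tau>)^3 * (- \<sigma>' * t' \<tau>) = phi' \<tau> * t' \<tau>"
    by (simp add: phi'_def algebra_simps)
  ultimately have "(phi has_real_derivative phi' \<tau> * t' \<tau>) (at \<tau>)" by simp
  from DERIV_mult[OF this t_deriv(2)]
  have "(Ab1 has_real_derivative phi' \<tau> * t' \<tau> * t' \<tau> + lam\<^sup>2 * t \<tau> * phi \<tau>) (at \<tau>)" unfolding Ab1_def[abs_def] .
  then show "(Ab1 has_real_derivative Ab2 \<tau>) (at \<tau>)" by (simp add: Ab2_def power2_eq_square mult_ac)
qed

definition "S0 \<tau> = yv g + yv ((1 - \<tau>) * lam) + yv (\<tau> * lam)"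
definition "S1 \<tau> = qv g + qv ((1 - \<tau>) * lam) + qv (\<tau> * lam)"

text \<open>Over the denominators \<open>(1 + P) * (1 + Q)\<close> and
  \<open>(1 - P) * (1 - Q)\<close> the two moving arcs leave the constant numerator
  \<open>c\<close>, because \<open>P * Q = x\<close> for every \<open>\<tau>\<close>.\<close>

lemma S_formula:
  assumes "0 < \<tau>" "\<tau> < 1"
  shows "1 - S0 \<tau> / 2 = Xd \<tau> / T \<tau>" "1 + S1 \<tau> = Yd \<tau> / T' \<tau>" "0 < T' \<tau>"
proof -
  define P Q where "P = p \<tau>" and "Q = q \<tau>"
  have l: "0 < \<tau> * lam" "0 < (1 - \<tau>) * lam" using assms lam by auto
  have P: "0 < P" "P < 1" "0 < Q" "Q < 1" using l by (auto simp: P_def Q_def p_def q_def)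
  have x: "x = P * Q" using pq(3)[of \<tau>] by (simp add: P_def Q_def)
  have e: "exp (\<tau> * lam) = 1 / P" "exp ((1 - \<tau>) * lam) = 1 / Q"
    by (simp_all only: P_def Q_def p_def q_def exp_minus inverse_eq_divide) simp_all
  have h: "2 / d / 2 = 1 / d" for d :: real by simp
  have y: "yv (\<tau> * lam) / 2 = P / (1 + P)" "yv ((1 - \<tau>) * lam) / 2 = Q / (1 + Q)"
    using P unfolding yv_def h e by (auto simp: field_simps)
  have v: "qv (\<tau> * lam) = P / (1 - P)" "qv ((1 - \<tau>) * lam) = Q / (1 - Q)"
    using P unfolding qv_def e by (auto simp: field_simps)
  have T: "T \<tau> = (1 + P) * (1 + Q)" "T' \<tau> = (1 - P) * (1 - Q)"
    by (simp_all add: T_def T'_def t_def x P_def[symmetric] Q_def[symmetric] algebra_simps)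
  show T': "0 < T' \<tau>" unfolding T using P by simp
  have T0: "0 < T \<tau>" unfolding T using P by simp
  have n: "1 + P \<noteq> 0" "1 + Q \<noteq> 0" "1 - P \<noteq> 0" "1 - Q \<noteq> 0" using P by auto
  have "1 - P / (1 + P) - Q / (1 + Q) = c / T \<tau>" unfolding T c_def x using n by (simp add: field_simps)
  moreover have "1 - S0 \<tau> / 2 = 1 - P / (1 + P) - Q / (1 + Q) - \<sigma>"
    unfolding S0_def add_divide_distrib y \<sigma>_def by simp
  ultimately show "1 - S0 \<tau> / 2 = Xd \<tau> / T \<tau>" using T0 by (simp add: Xd_def diff_divide_distrib)
  have "1 + P / (1 - P) + Q / (1 - Q) = c / T' \<tau>" unfolding T c_def x using n by (simp add: field_simps)
  moreover have "1 + S1 \<tau> = 1 + P / (1 - P) + Q / (1 - Q) + \<sigma>'" unfolding S1_def v \<sigma>'_def by simp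
  ultimately show "1 + S1 \<tau> = Yd \<tau> / T' \<tau>" using T' by (simp add: Yd_def add_divide_distrib)
qed

lemma S_pos:
  assumes "0 < \<tau>" "\<tau> < 1"
  shows "0 < 1 - S0 \<tau> / 2" "0 < 1 + S1 \<tau>" "1 / (1 - S0 \<tau> / 2) + 1 / (1 + S1 \<tau>) = Ab \<tau>"
  using S_formula[OF assms] T_bounds[of \<tau>] XY[of \<tau>] assms by (simp_all add: Ab_def)

text \<open>The first and second derivatives of \<open>S0\<close> and \<open>S1\<close>, written
  exactly as the implicit Hessian formula produces them.\<close>

definition "d0 \<tau> = - (yv (\<tau> * lam) * (1 - yv (\<tau> * lam) / 2)) * lam + - (yv ((1 - \<tau>) * lam) * (1 - yv ((1 - \<tau>) * lam) / 2)) * - lam"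
definition "d1 \<tau> = - (qv (\<tau> * lam) * (1 + qv (\<tau> * lam))) * lam + - (qv ((1 - \<tau>) * lam) * (1 + qv ((1 - \<tau>) * lam))) * - lam"
definition "e0 \<tau> = yv (\<tau> * lam) * (1 - yv (\<tau> * lam) / 2) * (1 - yv (\<tau> * lam)) * lam\<^sup>2
   + yv ((1 - \<tau>) * lam) * (1 - yv ((1 - \<tau>) * lam) / 2) * (1 - yv ((1 - \<tau>) * lam)) * lam\<^sup>2"
definition "e1 \<tau> = qv (\<tau> * lam) * (1 + qv (\<tau> * lam)) * (1 + 2 * qv (\<tau> * lam)) * lam\<^sup>2
   + qv ((1 - \<tau>) * lam) * (1 + qv ((1 - \<tau>) * lam)) * (1 + 2 * qv ((1 - \<tau>) * lam)) * lam\<^sup>2"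

text \<open>Both sides of each equation are derivatives of the same function, so uniqueness of
  derivatives replaces an algebraic comparison.\<close>

lemma Ab_jets:
  assumes "0 < \<tau>" "\<tau> < 1"
  shows "1 / 2 / (1 - S0 \<tau> / 2)\<^sup>2 * d0 \<tau> + - 1 / (1 + S1 \<tau>)\<^sup>2 * d1 \<tau> = Ab1 \<tau>" (is "?E1 \<tau> = _")
    and "1 / 2 / (1 - S0 \<tau> / 2)^3 * (d0 \<tau>)\<^sup>2 + 1 / 2 / (1 - S0 \<tau> / 2)\<^sup>2 * e0 \<tau>
      + (2 / (1 + S1 \<tau>)^3 * (d1 \<tau>)\<^sup>2 + - 1 / (1 + S1 \<tau>)\<^sup>2 * e1 \<tau>) = Ab2 \<tau>"
proof -
  have l: "0 < \<tau> * lam" "0 < (1 - \<tau>) * lam" if "0 < \<tau>" "\<tau> < 1" for \<tau> using that lam by auto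
  have m: "((\<lambda>\<tau>. \<tau> * lam) has_real_derivative lam) (at \<tau>)" "((\<lambda>\<tau>. (1 - \<tau>) * lam) has_real_derivative - lam) (at \<tau>)" for \<tau>
    by (auto intro!: derivative_eq_intros)
  have dS0: "(S0 has_real_derivative d0 \<tau>) (at \<tau>)" for \<tau>
    unfolding S0_def[abs_def] d0_def
    by (rule DERIV_cong[OF DERIV_add[OF DERIV_add[OF DERIV_const DERIV_chain2[OF yv_deriv m(2)]] DERIV_chain2[OF yv_deriv m(1)]]]) simp
  have dS1: "(S1 has_real_derivative d1 \<tau>) (at \<tau>)" if "0 < \<tau>" "\<tau> < 1" for \<tau>
    unfolding S1_def[abs_def] d1_def
    by (rule DERIV_cong[OF DERIV_add[OF DERIV_add[OF DERIV_const DERIV_chain2[OF qv_deriv m(2)]] DERIV_chain2[OF qv_deriv m(1)]]])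
      (use l[OF that] in simp_all)
  have dd0: "(d0 has_real_derivative e0 \<tau>) (at \<tau>)" for \<tau>
    unfolding d0_def[abs_def] e0_def
    by (rule DERIV_cong[OF DERIV_add[OF DERIV_cmult_right[OF DERIV_chain2[OF yv_deriv2 m(1)]] DERIV_cmult_right[OF DERIV_chain2[OF yv_deriv2 m(2)]]]])
      (simp add: power2_eq_square mult_ac)
  have dd1: "(d1 has_real_derivative e1 \<tau>) (at \<tau>)" if "0 < \<tau>" "\<tau> < 1" for \<tau>
    unfolding d1_def[abs_def] e1_def
    by (rule DERIV_cong[OF DERIV_add[OF DERIV_cmult_right[OF DERIV_chain2[OF qv_deriv2 m(1)]] DERIV_cmult_right[OF DERIV_chain2[OF qv_deriv2 m(2)]]]])
      (use l[OF that] in \<open>simp_all add: power2_eq_square mult_ac\<close>)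
  have n: "S0 \<tau> / 2 \<noteq> 1" "1 + S1 \<tau> \<noteq> 0" if "0 < \<tau>" "\<tau> < 1" for \<tau> using S_pos[OF that] by auto
  have E1: "?E1 \<tau> = Ab1 \<tau>" if t: "0 < \<tau>" "\<tau> < 1" for \<tau>
  proof -
    have "((\<lambda>\<tau>. 1 / (1 - S0 \<tau> / 2) + 1 / (1 + S1 \<tau>)) has_real_derivative ?E1 \<tau>) (at \<tau>)"
      by (intro DERIV_add DERIV_chain2[OF recip_derivs(1) dS0] DERIV_chain2[OF recip_derivs(3) dS1] n t)
    then have "(Ab has_real_derivative ?E1 \<tau>) (at \<tau>)"
      by (rule has_field_derivative_transform_within_open[of _ _ _ "{0<..<1}"]) (use t S_pos(3) in auto)
    then show ?thesis using Ab_deriv(1)[of \<tau>] t DERIV_unique by fastforce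
  qed
  then show "?E1 \<tau> = Ab1 \<tau>" using assms by blast
  let ?E2 = "(1 / 2 / (1 - S0 \<tau> / 2)^3 * d0 \<tau> * d0 \<tau> + e0 \<tau> * (1 / 2 / (1 - S0 \<tau> / 2)\<^sup>2))
      + (2 / (1 + S1 \<tau>)^3 * d1 \<tau> * d1 \<tau> + e1 \<tau> * (- 1 / (1 + S1 \<tau>)\<^sup>2))"
  have "(?E1 has_real_derivative ?E2) (at \<tau>)"
    by (intro DERIV_add DERIV_mult DERIV_chain2[OF recip_derivs(2) dS0] DERIV_chain2[OF recip_derivs(4) dS1] n assms dd0 dd1)
  then have "(Ab1 has_real_derivative ?E2) (at \<tau>)"
    by (rule has_field_derivative_transform_within_open[of _ _ _ "{0<..<1}"]) (use assms E1 in auto)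
  then have "?E2 = Ab2 \<tau>" using Ab_deriv(2)[of \<tau>] assms DERIV_unique by fastforce
  then show "1 / 2 / (1 - S0 \<tau> / 2)^3 * (d0 \<tau>)\<^sup>2 + 1 / 2 / (1 - S0 \<tau> / 2)\<^sup>2 * e0 \<tau>
      + (2 / (1 + S1 \<tau>)^3 * (d1 \<tau>)\<^sup>2 + - 1 / (1 + S1 \<tau>)\<^sup>2 * e1 \<tau>) = Ab2 \<tau>"
    by (simp add: power2_eq_square mult_ac)
qed

text \<open>At its ends the slide degenerates to roses, where \<open>2 / Ab\<close> is the weight
  left for the other petals. The agreement of the ends comes from the symmetry between
  \<open>\<tau>\<close> and \<open>1 - \<tau>\<close>, and it returns the compensating petal to its
  initial length.\<close>

lemma Ab_start: "2 / Ab 0 = 1 - yv lam - yv g" "Ab 1 = Ab 0"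
proof -
  have pq0: "p 0 = 1" "q 0 = x" "p 1 = x" "q 1 = 1" by (simp_all add: p_def q_def x_def)
  have t: "t 0 = 1 + x" "t 1 = 1 + x" by (simp_all add: t_def pq0)
  show "Ab 1 = Ab 0" by (simp add: Ab_def T_def T'_def Xd_def Yd_def t)
  have X: "1 / 2 \<le> Xd 0" using XY(1)[of 0] by simp
  have T0: "T 0 = 2 * (1 + x)" by (simp add: T_def t)
  have "Ab 0 = T 0 / Xd 0" by (simp add: Ab_def T'_def t)
  then have "2 / Ab 0 = 2 * Xd 0 / T 0" using X by simp
  also have "\<dots> = Xd 0 / (1 + x)" unfolding T0 by (rule mult_divide_mult_cancel_left) simp
  also have "\<dots> = (c - \<sigma> * (2 * (1 + x))) / (1 + x)" unfolding Xd_def T0 ..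
  also have "\<dots> = (1 - x) / (1 + x) - 2 * \<sigma>" using xs by (simp add: c_def field_simps)
  also have "(1 - x) / (1 + x) = 1 - 2 * x / (1 + x)" using xs by (simp add: field_simps)
  also have "2 * x / (1 + x) = yv lam"
  proof -
    have "exp lam = 1 / x" by (simp add: x_def exp_minus inverse_eq_divide)
    then show ?thesis using xs(1) by (simp only: yv_def) (simp add: field_simps)
  qed
  finally show "2 / Ab 0 = 1 - yv lam - yv g" by (simp add: \<sigma>_def)
qed

end

text \<open>With \<open>y = yv l / 2\<close> and \<open>q = qv l\<close>, both
  \<open>y / (1 - y)\<close> and \<open>q / (1 + q)\<close> equal \<open>exp (- l)\<close>; the
  bounds \<open>U \<le> 1 - y\<close> and \<open>1 + q \<le> V\<close> put the two terms on opposite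
  sides of this number. So no arc spoils the sign of the derivative in \<open>h\<close>.\<close>

lemma arc_sign:
  assumes l: "0 < l" and U: "0 < U" "U \<le> 1 - yv l / 2" and V: "1 + qv l \<le> V"
  shows "1 / 2 / U\<^sup>2 * (- (yv l * (1 - yv l / 2)) * l) + - 1 / V\<^sup>2 * (- (qv l * (1 + qv l)) * l) \<le> 0"
proof -
  define y q where "y = yv l / 2" and "q = qv l"
  have e: "1 < exp l" using l by simp
  have h: "2 / d / 2 = 1 / d" for d :: real by simp
  have y: "y = 1 / (1 + exp l)" unfolding y_def yv_def by (rule h)
  have q: "q = 1 / (exp l - 1)" by (simp add: q_def qv_def)
  have yq: "y / (1 - y) = exp (- l)" "q / (1 + q) = exp (- l)"
    using e add_pos_pos[OF zero_less_one exp_gt_zero[of l]] by (simp_all add: y q exp_minus field_simps)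
  have pos: "0 < y" "0 < q" using l by (simp_all add: y_def q_def qv_pos)
  have U': "U \<le> 1 - y" "0 < 1 - y" using U by (simp_all add: y_def)
  have V': "1 + q \<le> V" "0 < V" using V pos by (simp_all add: q_def)
  have "y / (1 - y) = y * (1 - y) / (1 - y)\<^sup>2" using U' by (simp add: power2_eq_square)
  also have "\<dots> \<le> y * (1 - y) / U\<^sup>2" using pos U U' by (intro divide_left_mono power_mono mult_pos_pos) auto
  finally have 1: "exp (- l) \<le> y * (1 - y) / U\<^sup>2" by (simp add: yq)
  have "q * (1 + q) / V\<^sup>2 \<le> q * (1 + q) / (1 + q)\<^sup>2" using pos V' by (intro divide_left_mono power_mono mult_pos_pos) auto
  also have "\<dots> = q / (1 + q)" using pos by (simp add: power2_eq_square)
  finally have 2: "q * (1 + q) / V\<^sup>2 \<le> exp (- l)" by (simp add: yq)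
  have "l * (q * (1 + q) / V\<^sup>2) \<le> l * (y * (1 - y) / U\<^sup>2)" using 1 2 l by (intro mult_left_mono) auto
  moreover have "1 / 2 / U\<^sup>2 * (- (yv l * (1 - yv l / 2)) * l) + - 1 / V\<^sup>2 * (- (qv l * (1 + qv l)) * l)
     = l * (q * (1 + q) / V\<^sup>2) - l * (y * (1 - y) / U\<^sup>2)"
    by (simp add: y_def q_def mult_ac)
  ultimately show ?thesis by simp
qed

section \<open>Hessian and cost of the slide\<close>

lemma recip_derivs':
  "0 < z \<Longrightarrow> ((\<lambda>z. - (2 / z)) has_real_derivative 2 / z\<^sup>2) (at z)"
  "0 < z \<Longrightarrow> ((\<lambda>z. 2 / z\<^sup>2) has_real_derivative - 4 / z^3) (at z)" for z :: real
  by (auto intro!: derivative_eq_intros simp: field_simps power2_eq_square power3_eq_cube)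

context theta_graph
begin

text \<open>While edges \<open>r\<close> and \<open>j\<close> exchange length, petal
  \<open>k\<close> takes the velocity that keeps the entropy at 1. The arcs only help the
  denominator, which is at least the contribution \<open>y / 8\<close> of petal \<open>k\<close>. In
  the numerator the arcs give at most \<open>A2\<close> and petal \<open>k\<close> adds at most
  \<open>2 * A1^2 / y\<close>, all up to the square of the multiplier
  \<open>\<kappa>\<close>.\<close>

lemma theta_hess:
  assumes k: "k < r" "k \<noteq> i" "k \<noteq> j" and l: "\<And>n. n \<le> r \<Longrightarrow> 0 < l n"
    and a: "a = (\<Sum>n\<in>{..<r} - {i, j}. yv (l n))" "a \<le> 2" and y: "yv (l k) \<le> 3 / 4"
    and U: "U = 1 - (yv (l i) + yv (l j) + yv (l r)) / 2" "0 < U"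
    and V: "V = 1 + (qv (l i) + qv (l j) + qv (l r))"
    and eq: "2 / a = 1 / U + 1 / V"
    and v: "\<And>n. n < r \<Longrightarrow> n \<noteq> j \<Longrightarrow> n \<noteq> k \<Longrightarrow> v n = 0" "v r = \<kappa> * lam" "v j = \<kappa> * - lam"
      "v k = \<kappa> * (A1 * a\<^sup>2 / 2 / (yv (l k) * (1 - yv (l k) / 2)))"
    and d0: "d0 = - (yv (l r) * (1 - yv (l r) / 2)) * lam + - (yv (l j) * (1 - yv (l j) / 2)) * - lam"
    and d1: "d1 = - (qv (l r) * (1 + qv (l r))) * lam + - (qv (l j) * (1 + qv (l j))) * - lam"
    and e0: "e0 = yv (l r) * (1 - yv (l r) / 2) * (1 - yv (l r)) * lam\<^sup>2 + yv (l j) * (1 - yv (l j) / 2) * (1 - yv (l j)) * lam\<^sup>2"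
    and e1: "e1 = qv (l r) * (1 + qv (l r)) * (1 + 2 * qv (l r)) * lam\<^sup>2 + qv (l j) * (1 + qv (l j)) * (1 + 2 * qv (l j)) * lam\<^sup>2"
    and A1: "1 / 2 / U\<^sup>2 * d0 + - 1 / V\<^sup>2 * d1 = A1"
    and A2: "1 / 2 / U^3 * d0\<^sup>2 + 1 / 2 / U\<^sup>2 * e0 + (2 / V^3 * d1\<^sup>2 + - 1 / V\<^sup>2 * e1) \<le> A2"
    and A2_0: "0 \<le> A2"
  shows "hess_form (theta r i j) l v \<le> \<kappa>\<^sup>2 * ((A2 + 2 * A1\<^sup>2 / yv (l k)) * 8 / yv (l k))"
proof -
  \<comment> \<open>\<open>None\<close> collects the petals at vertex 0; \<open>Some True\<close>
    and \<open>Some False\<close> both collect the arcs, measured by \<open>yv\<close> and by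
    \<open>qv\<close>.\<close>
  define I where "I b = (case b of None \<Rightarrow> {..<r} - {i, j} | Some _ \<Rightarrow> {i, j, r})" for b :: "bool option"
  define W where "W b = (case b of None \<Rightarrow> {0<..} | Some b \<Rightarrow> if b then {..<2} else {(- 1::real)<..})" for b :: "bool option"
  define f where "f b = (if b = Some False then qv else yv)" for b :: "bool option"
  define f' where "f' b = (if b = Some False then (\<lambda>x. - (qv x * (1 + qv x))) else (\<lambda>x. - (yv x * (1 - yv x / 2))))" for b :: "bool option"
  define f'' where "f'' b = (if b = Some False then (\<lambda>x. qv x * (1 + qv x) * (1 + 2 * qv x)) else (\<lambda>x. yv x * (1 - yv x / 2) * (1 - yv x)))" for b :: "bool option"
  define g where "g b = (case b of None \<Rightarrow> (\<lambda>z::real. - (2 / z)) | Some b \<Rightarrow> if b then (\<lambda>z. 1 / (1 - z / 2)) else (\<lambda>z. 1 / (1 + z)))" for b :: "bool option"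
  define g' where "g' b = (case b of None \<Rightarrow> (\<lambda>z::real. 2 / z\<^sup>2) | Some b \<Rightarrow> if b then (\<lambda>z. 1 / 2 / (1 - z / 2)\<^sup>2) else (\<lambda>z. - 1 / (1 + z)\<^sup>2))" for b :: "bool option"
  define g'' where "g'' b = (case b of None \<Rightarrow> (\<lambda>z::real. - 4 / z^3) | Some b \<Rightarrow> if b then (\<lambda>z. 1 / 2 / (1 - z / 2)^3) else (\<lambda>z. 2 / (1 + z)^3))" for b :: "bool option"
  note defs = I_def W_def f_def f'_def f''_def g_def g'_def g''_def
  define y where "y = yv (l k)"
  define N where "N = (\<Sum>n\<in>{..<r} - {i, j}. yv (l n) * (1 - yv (l n) / 2) * l n)"
  have le: "i \<le> r" "j \<le> r" "r \<le> r" "k \<le> r" using ij k by auto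
  have ne: "i \<noteq> r" "j \<noteq> r" "r \<noteq> i" "r \<noteq> j" using ij by auto
  have s3: "(\<Sum>n\<in>{i, j, r}. F n) = F i + F j + F r" for F :: "nat \<Rightarrow> real" using ij ne by simp
  have kI: "k \<in> {..<r} - {i, j}" using k by simp
  have y01: "0 < y" "y \<le> 3 / 4" using y by (simp_all add: y_def)
  have yy: "0 < y * (1 - y / 2)" using y01 by simp
  have half: "0 < 1 - yv (l n) / 2" if "n \<le> r" for n using yv_less1[OF l[OF that]] by linarith
  have "0 \<le> (\<Sum>n\<in>{..<r} - {i, j, k}. yv (l n))" by (intro sum_nonneg) (simp add: less_imp_le)
  moreover have s1: "(\<Sum>n\<in>{..<r} - {i, j}. F n) = F k + (\<Sum>n\<in>{..<r} - {i, j, k}. F n)" for F :: "nat \<Rightarrow> real"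
  proof -
    have "{..<r} - {i, j} - {k} = {..<r} - {i, j, k}" by auto
    then show ?thesis using sum.remove[OF _ kI, of F] by simp
  qed
  ultimately have "y \<le> a" unfolding a y_def by simp
  then have ya: "y \<le> a" "0 < a" using y01 by auto
  have vk: "(\<Sum>n\<in>{..<r} - {i, j}. F n * v n) = F k * v k" "(\<Sum>n\<in>{..<r} - {i, j}. F n * (v n)\<^sup>2) = F k * (v k)\<^sup>2" for F
    unfolding s1 by (simp_all add: v)
  have vi: "v i = 0" using v(1)[of i] ij k by simp
  have S: "(\<Sum>n\<in>{i, j, r}. yv (l n)) = 2 * (1 - U)" "(\<Sum>n\<in>{i, j, r}. qv (l n)) = V - 1"
    unfolding s3 U V by (simp_all add: field_simps)
  have D: "(\<Sum>n\<in>{i, j, r}. - (yv (l n) * (1 - yv (l n) / 2)) * v n) = \<kappa> * d0"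
    "(\<Sum>n\<in>{i, j, r}. - (qv (l n) * (1 + qv (l n))) * v n) = \<kappa> * d1"
    unfolding s3 vi v(2,3) d0 d1 by algebra+
  have sq: "c0 * 0\<^sup>2 + c1 * (\<kappa> * - lam)\<^sup>2 + c2 * (\<kappa> * lam)\<^sup>2 = \<kappa>\<^sup>2 * (c2 * lam\<^sup>2 + c1 * lam\<^sup>2)" for c0 c1 c2
    by (simp add: power_mult_distrib algebra_simps)
  have E: "(\<Sum>n\<in>{i, j, r}. yv (l n) * (1 - yv (l n) / 2) * (1 - yv (l n)) * (v n)\<^sup>2) = \<kappa>\<^sup>2 * e0"
    "(\<Sum>n\<in>{i, j, r}. qv (l n) * (1 + qv (l n)) * (1 + 2 * qv (l n)) * (v n)\<^sup>2) = \<kappa>\<^sup>2 * e1"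
    unfolding s3 vi v(2,3) e0 e1 by (rule sq)+
  have cancel: "- c * (\<kappa> * (z / c)) = - (\<kappa> * z)" if "0 < c" for c z \<kappa> :: real using that by simp
  have Dk: "(\<Sum>n\<in>{..<r} - {i, j}. - (yv (l n) * (1 - yv (l n) / 2)) * v n) = - (\<kappa> * (A1 * a\<^sup>2 / 2))"
    unfolding vk v(4) by (rule cancel) (use yy in \<open>simp add: y_def\<close>)
  have cancel2: "c * w * (\<kappa> * (z / c))\<^sup>2 = \<kappa>\<^sup>2 * z\<^sup>2 * (w / c)" if "0 < c" for c z w \<kappa> :: real
    using that by (simp add: field_simps power2_eq_square)
  have Ek: "(\<Sum>n\<in>{..<r} - {i, j}. yv (l n) * (1 - yv (l n) / 2) * (1 - yv (l n)) * (v n)\<^sup>2)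
      = \<kappa>\<^sup>2 * (A1 * a\<^sup>2 / 2)\<^sup>2 * ((1 - y) / (y * (1 - y / 2)))"
    unfolding vk v(4) y_def[symmetric] by (rule cancel2[OF yy])
  define num where "num = (- 4 / a^3 * (- (\<kappa> * (A1 * a\<^sup>2 / 2)))\<^sup>2 + 2 / a\<^sup>2 * (\<kappa>\<^sup>2 * (A1 * a\<^sup>2 / 2)\<^sup>2 * ((1 - y) / (y * (1 - y / 2)))))
     + ((1 / 2 / U^3 * (\<kappa> * d0)\<^sup>2 + 1 / 2 / U\<^sup>2 * (\<kappa>\<^sup>2 * e0)) + (2 / V^3 * (\<kappa> * d1)\<^sup>2 + - 1 / V\<^sup>2 * (\<kappa>\<^sup>2 * e1)))"
  define den where "den = 2 / a\<^sup>2 * (- N) + (1 / 2 / U\<^sup>2 * (\<Sum>n\<in>{i, j, r}. - (yv (l n) * (1 - yv (l n) / 2)) * l n)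
     + - 1 / V\<^sup>2 * (\<Sum>n\<in>{i, j, r}. - (qv (l n) * (1 + qv (l n))) * l n))"
  have UV: "1 - 2 * (1 - U) / 2 = U" "1 + (V - 1) = V" by (simp_all add: field_simps)
  have aS: "(\<Sum>n\<in>{..<r} - {i, j}. yv (l n)) = a" by (simp add: a)
  have sel: "(\<Sum>b\<in>UNIV. F b) = F None + (F (Some True) + F (Some False))" for F :: "bool option \<Rightarrow> real"
    unfolding sum_bool_option by (simp add: UNIV_bool)
  have NN: "(\<Sum>n\<in>{..<r} - {i, j}. - (yv (l n) * (1 - yv (l n) / 2)) * l n) = - N" by (simp add: N_def sum_negf)
  have den: "(\<Sum>b\<in>UNIV. g' b (\<Sum>n\<in>I b. f b (l n)) * (\<Sum>n\<in>I b. f' b (l n) * l n)) = den"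
    unfolding sel den_def by (simp only: defs option.case if_True if_False option.distinct option.inject bool.simps simp_thms S UV aS NN)
  have num: "(\<Sum>b\<in>UNIV. g'' b (\<Sum>n\<in>I b. f b (l n)) * (\<Sum>n\<in>I b. f' b (l n) * v n)\<^sup>2
     + g' b (\<Sum>n\<in>I b. f b (l n)) * (\<Sum>n\<in>I b. f'' b (l n) * (v n)\<^sup>2)) = num"
    unfolding sel num_def by (simp only: defs option.case if_True if_False option.distinct option.inject bool.simps simp_thms S UV aS D Dk E Ek)
  have qp: "0 < qv (l i)" "0 < qv (l j)" "0 < qv (l r)" using le by (auto intro!: qv_pos l)
  have V0: "1 \<le> V" using qp by (simp add: V)
  have arcs: "1 / 2 / U\<^sup>2 * (- (yv (l n) * (1 - yv (l n) / 2)) * l n) + - 1 / V\<^sup>2 * (- (qv (l n) * (1 + qv (l n))) * l n) \<le> 0"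
    if "n = i \<or> n = j \<or> n = r" for n
  proof (rule arc_sign)
    show "0 < l n" using that le l by auto
    show "0 < U" by (rule U(2))
    show "U \<le> 1 - yv (l n) / 2" unfolding U using that by (auto intro!: add_nonneg_nonneg simp: less_imp_le)
    show "1 + qv (l n) \<le> V" unfolding V using that qp by auto
  qed
  have "1 / 2 / U\<^sup>2 * (\<Sum>n\<in>{i, j, r}. - (yv (l n) * (1 - yv (l n) / 2)) * l n)
     + - 1 / V\<^sup>2 * (\<Sum>n\<in>{i, j, r}. - (qv (l n) * (1 + qv (l n))) * l n) \<le> 0"
    using arcs[of i] arcs[of j] arcs[of r] unfolding s3 distrib_left by linarith
  moreover have "y / 4 \<le> N"
  proof -
    have "0 \<le> (\<Sum>n\<in>{..<r} - {i, j, k}. yv (l n) * (1 - yv (l n) / 2) * l n)"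
    proof (rule sum_nonneg)
      fix n assume "n \<in> {..<r} - {i, j, k}"
      then have n: "n \<le> r" by simp
      show "0 \<le> yv (l n) * (1 - yv (l n) / 2) * l n"
        using half[OF n] l[OF n] by (intro mult_nonneg_nonneg) (auto intro: less_imp_le)
    qed
    then have "y * (1 - y / 2) * l k \<le> N" unfolding N_def s1 y_def by simp
    moreover have "y * (1 / 4) \<le> y * ((1 - y / 2) * ylen y)" using ylen_lower[OF y01] y01 by (intro mult_left_mono) auto
    moreover have "y * ((1 - y / 2) * ylen y) = y * (1 - y / 2) * l k" by (simp add: y_def ylen_yv)
    ultimately show ?thesis by linarith
  qed
  then have "1 / 2 * (y / 4) \<le> 2 / a\<^sup>2 * N"
  proof (rule mult_mono[rotated])
    have "a\<^sup>2 \<le> 2\<^sup>2" using ya a(2) by (intro power_mono) auto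
    then have "2 / 2\<^sup>2 \<le> 2 / a\<^sup>2" using ya by (intro divide_left_mono) auto
    then show "1 / 2 \<le> 2 / a\<^sup>2" by simp
  qed (use y01 ya in auto)
  ultimately have dn: "y / 8 \<le> - den" unfolding den_def mult_minus_right by linarith
  have nm: "num \<le> \<kappa>\<^sup>2 * (A2 + 2 * A1\<^sup>2 / y)"
  proof -
    \<comment> \<open>The second derivative of \<open>- (2 / a)\<close> is negative and only lowers
      the numerator.\<close>
    have "- 4 / a^3 * (- (\<kappa> * (A1 * a\<^sup>2 / 2)))\<^sup>2 \<le> 0" using ya by (intro mult_nonpos_nonneg) auto
    moreover have "2 / a\<^sup>2 * (\<kappa>\<^sup>2 * (A1 * a\<^sup>2 / 2)\<^sup>2 * ((1 - y) / (y * (1 - y / 2)))) \<le> \<kappa>\<^sup>2 * (2 * A1\<^sup>2 / y)"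
    proof -
      have "(1 - y) / (y * (1 - y / 2)) \<le> (1 - y / 2) / (y * (1 - y / 2))" using yy y01 by (intro divide_right_mono) auto
      also have "\<dots> = 1 / y" using y01 by simp
      finally have "2 / a\<^sup>2 * (\<kappa>\<^sup>2 * (A1 * a\<^sup>2 / 2)\<^sup>2 * ((1 - y) / (y * (1 - y / 2)))) \<le> 2 / a\<^sup>2 * (\<kappa>\<^sup>2 * (A1 * a\<^sup>2 / 2)\<^sup>2 * (1 / y))"
        by (intro mult_left_mono) auto
      also have "\<dots> = \<kappa>\<^sup>2 * (A1\<^sup>2 / (2 * y)) * a\<^sup>2" using ya y01 by (simp add: field_simps power2_eq_square)
      also have "\<dots> \<le> \<kappa>\<^sup>2 * (A1\<^sup>2 / (2 * y)) * 2\<^sup>2" using ya a(2) y01 by (intro mult_left_mono power_mono) auto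
      also have "\<dots> = \<kappa>\<^sup>2 * (2 * A1\<^sup>2 / y)" by simp
      finally show ?thesis .
    qed
    moreover have "(1 / 2 / U^3 * (\<kappa> * d0)\<^sup>2 + 1 / 2 / U\<^sup>2 * (\<kappa>\<^sup>2 * e0)) + (2 / V^3 * (\<kappa> * d1)\<^sup>2 + - 1 / V\<^sup>2 * (\<kappa>\<^sup>2 * e1))
      = \<kappa>\<^sup>2 * (1 / 2 / U^3 * d0\<^sup>2 + 1 / 2 / U\<^sup>2 * e0 + (2 / V^3 * d1\<^sup>2 + - 1 / V\<^sup>2 * e1))"
      by (simp add: power_mult_distrib algebra_simps)
    moreover have "\<dots> \<le> \<kappa>\<^sup>2 * A2" using A2 by (intro mult_left_mono) auto
    ultimately show ?thesis unfolding num_def distrib_left by linarith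
  qed
  have "hess_form (theta r i j) l v = - (\<Sum>b\<in>UNIV. g'' b (\<Sum>n\<in>I b. f b (l n)) * (\<Sum>n\<in>I b. f' b (l n) * v n)\<^sup>2
     + g' b (\<Sum>n\<in>I b. f b (l n)) * (\<Sum>n\<in>I b. f'' b (l n) * (v n)\<^sup>2))
       / (\<Sum>b\<in>UNIV. g' b (\<Sum>n\<in>I b. f b (l n)) * (\<Sum>n\<in>I b. f' b (l n) * l n))"
  proof (rule hess_form_implicit[where U = W and g = g])
    show "finite (UNIV :: bool option set)" by simp
    show "finite (I b)" for b by (simp add: I_def split: option.split)
    show "open (W b) \<and> (\<Sum>n\<in>I b. f b (l n)) \<in> W b" for b
    proof (cases b)
      case None then show ?thesis using ya by (simp add: defs aS)
    next
      case (Some t)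
      have "open (W b)" using Some by (simp add: W_def)
      moreover have "(\<Sum>n\<in>I b. f b (l n)) \<in> W b"
        using Some U(2) V0 S by (cases t) (simp_all add: I_def W_def f_def del: sum.insert)
      ultimately show ?thesis by simp
    qed
    show "0 < l n" if "n \<in> I b" for b n using that le by (intro l) (auto simp: I_def split: option.splits)
    show "(f b has_real_derivative f' b z) (at z)" if "0 < z" for b z using yv_deriv qv_deriv[OF that] by (simp add: f_def f'_def)
    show "(f' b has_real_derivative f'' b z) (at z)" if "0 < z" for b z using yv_deriv2 qv_deriv2[OF that] by (simp add: f'_def f''_def)
    show "(g b has_real_derivative g' b z) (at z)" if "z \<in> W b" for b z
      using that recip_derivs(1,3)[of z] recip_derivs'(1)[of z] by (simp add: g_def g'_def W_def split: option.splits if_splits)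
    show "(g' b has_real_derivative g'' b z) (at z)" if "z \<in> W b" for b z
      using that recip_derivs(2,4)[of z] recip_derivs'(2)[of z] by (simp add: g'_def g''_def W_def split: option.splits if_splits)
    have "- (2 / a) + (1 / U + 1 / V) = 0" using eq by simp
    then show "(\<Sum>b\<in>UNIV. g b (\<Sum>n\<in>I b. f b (l n))) = 0"
      unfolding sel by (simp only: defs option.case if_True if_False option.distinct option.inject bool.simps simp_thms S UV aS)
    show "(\<Sum>b\<in>UNIV. g' b (\<Sum>n\<in>I b. f b (l n)) * (\<Sum>n\<in>I b. f' b (l n) * l n)) < 0"
      unfolding den using dn y01 by linarith
    have "2 / a\<^sup>2 * - (\<kappa> * (A1 * a\<^sup>2 / 2)) + (1 / 2 / U\<^sup>2 * (\<kappa> * d0) + - 1 / V\<^sup>2 * (\<kappa> * d1)) = 0"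
    proof -
      have "2 / a\<^sup>2 * - (\<kappa> * (A1 * a\<^sup>2 / 2)) = - (\<kappa> * A1)" using ya by simp
      moreover have "1 / 2 / U\<^sup>2 * (\<kappa> * d0) + - 1 / V\<^sup>2 * (\<kappa> * d1) = \<kappa> * A1" unfolding A1[symmetric] by algebra
      ultimately show ?thesis by simp
    qed
    then show "(\<Sum>b\<in>UNIV. g' b (\<Sum>n\<in>I b. f b (l n)) * (\<Sum>n\<in>I b. f' b (l n) * v n)) = 0"
      unfolding sel by (simp only: defs option.case if_True if_False option.distinct option.inject bool.simps simp_thms S UV aS D Dk)
    show "entropy (theta r i j) m = h" if h: "0 < h" and m: "\<And>b n. b \<in> UNIV \<Longrightarrow> n \<in> I b \<Longrightarrow> 0 < m n"
      and mW: "\<And>b. b \<in> UNIV \<Longrightarrow> (\<Sum>n\<in>I b. f b (h * m n)) \<in> W b"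
      and z: "(\<Sum>b\<in>UNIV. g b (\<Sum>n\<in>I b. f b (h * m n))) = 0" for h m
    proof (rule theta_entropy[OF _ h refl _ refl])
      show "0 < m n" if "n \<le> r" for n
        using that m[of None n] m[of "Some True" n] by (auto simp: I_def le_less)
      show "0 < 1 - (yv (h * m i) + yv (h * m j) + yv (h * m r)) / 2"
        using mW[of "Some True"] by (simp add: I_def W_def f_def s3 del: sum.insert)
      show "2 / (\<Sum>k\<in>{..<r} - {i, j}. yv (h * m k)) = 1 / (1 - (yv (h * m i) + yv (h * m j) + yv (h * m r)) / 2)
         + 1 / (1 + (qv (h * m i) + qv (h * m j) + qv (h * m r)))"
        using z unfolding sel by (simp add: I_def g_def f_def s3 del: sum.insert)
    qed
  qed
  then have "hess_form (theta r i j) l v = num / (- den)" unfolding num den by simp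
  also have "\<dots> \<le> \<kappa>\<^sup>2 * (A2 + 2 * A1\<^sup>2 / y) / (- den)" using nm dn y01 by (intro divide_right_mono) auto
  also have "\<dots> \<le> \<kappa>\<^sup>2 * (A2 + 2 * A1\<^sup>2 / y) / (y / 8)" using dn y01 A2_0 by (intro divide_left_mono mult_pos_pos) auto
  also have "\<dots> = \<kappa>\<^sup>2 * ((A2 + 2 * A1\<^sup>2 / y) * 8 / y)" by simp
  finally show ?thesis by (simp add: y_def)
qed

end

context theta_graph
begin

text \<open>The number \<open>s\<close> measures how long petal \<open>i\<close> is. The first two
  derivatives of \<open>Ab\<close> are of order \<open>s * L j\<close> and
  \<open>s * (L j)^2\<close>, which gives the squared cost. Condition \<open>small\<close> keeps the
  weight of petal \<open>k\<close> within \<open>y0 / 2\<close> of its initial value, hence between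
  \<open>y0 / 2\<close> and 3/4.\<close>

lemma theta_seg:
  assumes k: "k < r" "k \<noteq> i" "k \<noteq> j" and pt: "point r (rose r L)"
    and ap: "arc_path (L j) (L i)" and s: "s = exp (- L i)"
    and y0: "0 < y0" "y0 \<le> yv (L k)" "yv (L k) \<le> 1 / 2" and small: "512 * (s * L j) \<le> y0 / 2"
  shows "cell_seg r (rose r L) (act (rose r L) (transv i j)) (16 / y0 * (560 + 8192 / y0) * (s * (L j)\<^sup>2))"
proof -
  interpret A: arc_path "L j" "L i" by (rule ap)
  have As: "A.s = s" by (simp add: A.s_def s)
  have L: "0 < L n" if "n < r" for n using rose_pointD[OF _ pt] r that by auto
  define \<rho> where "\<rho> = (\<Sum>n\<in>{..<r} - {i, j, k}. yv (L n))"
  define a where "a \<tau> = 2 / A.Ab \<tau>" for \<tau>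
  define a' where "a' \<tau> = - (A.Ab1 \<tau> * (a \<tau>)\<^sup>2 / 2)" for \<tau>
  \<comment> \<open>The weight left for petal \<open>k\<close> after the idle petals have taken
    \<open>\<rho>\<close>.\<close>
  define y where "y \<tau> = a \<tau> - \<rho>" for \<tau>
  define c where "c \<tau> n = (if n = r then \<tau> * L j else if n = j then (1 - \<tau>) * L j else if n = k then ylen (y \<tau>) else L n)" for \<tau> n
  define dc where "dc \<tau> n = (if n = r then L j else if n = j then - L j else if n = k then A.Ab1 \<tau> * (a \<tau>)\<^sup>2 / 2 / (y \<tau> * (1 - y \<tau> / 2)) else 0)" for \<tau> n
  have ne: "i \<noteq> r" "j \<noteq> r" "k \<noteq> r" using ij k by auto
  have sum1: "(\<Sum>n<r. yv (L n)) = 1" using rose_pointD[OF _ pt] r by auto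
  have kI: "k \<in> {..<r} - {i, j}" using k by simp
  have s1: "(\<Sum>n\<in>{..<r} - {i, j}. F n) = F k + (\<Sum>n\<in>{..<r} - {i, j, k}. F n)" for F :: "nat \<Rightarrow> real"
  proof -
    have "{..<r} - {i, j} - {k} = {..<r} - {i, j, k}" by auto
    then show ?thesis using sum.remove[OF _ kI, of F] by simp
  qed
  have "(\<Sum>n<r. yv (L n)) = yv (L i) + (yv (L j) + (\<Sum>n\<in>{..<r} - {i, j}. yv (L n)))"
  proof -
    have "{..<r} - {i} - {j} = {..<r} - {i, j}" by auto
    then show ?thesis
      using sum.remove[of "{..<r}" i "\<lambda>n. yv (L n)"] sum.remove[of "{..<r} - {i}" j "\<lambda>n. yv (L n)"] ij by simp
  qed
  then have y_0: "y 0 = yv (L k)" "y 1 = yv (L k)"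
    using sum1 s1[of "\<lambda>n. yv (L n)"] A.Ab_start by (simp_all add: y_def a_def \<rho>_def)
  have Ab1: "1 \<le> A.Ab \<tau>" if "0 \<le> \<tau>" "\<tau> \<le> 1" for \<tau> by (rule A.Ab_ge1[OF that])
  have a2: "0 < a \<tau>" "a \<tau> \<le> 2" if "0 \<le> \<tau>" "\<tau> \<le> 1" for \<tau>
  proof -
    show "0 < a \<tau>" using Ab1[OF that] by (simp add: a_def)
    have "2 / A.Ab \<tau> \<le> 2 / 1" using Ab1[OF that] by (intro divide_left_mono) auto
    then show "a \<tau> \<le> 2" by (simp add: a_def)
  qed
  have da: "(a has_real_derivative a' \<tau>) (at \<tau>)" if "0 \<le> \<tau>" "\<tau> \<le> 1" for \<tau>
  proof -
    have n: "A.Ab \<tau> \<noteq> 0" using Ab1[OF that] by auto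
    have "((\<lambda>\<tau>. 2 / A.Ab \<tau>) has_real_derivative (0 * A.Ab \<tau> - 2 * A.Ab1 \<tau>) / (A.Ab \<tau> * A.Ab \<tau>)) (at \<tau>)"
      by (intro DERIV_divide DERIV_const A.Ab_deriv(1)[OF that] n)
    moreover have "(0 * A.Ab \<tau> - 2 * A.Ab1 \<tau>) / (A.Ab \<tau> * A.Ab \<tau>) = a' \<tau>"
      using n by (simp add: a'_def a_def field_simps power2_eq_square)
    ultimately show ?thesis unfolding a_def[abs_def] by simp
  qed
  have dy: "(y has_real_derivative a' \<tau>) (at \<tau>)" if "0 \<le> \<tau>" "\<tau> \<le> 1" for \<tau>
    using DERIV_diff[OF da[OF that] DERIV_const] by (simp add: y_def[abs_def])
  have a'b: "\<bar>a' \<tau>\<bar> \<le> 512 * (s * L j)" if "0 \<le> \<tau>" "\<tau> \<le> 1" for \<tau>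
  proof -
    have "(a \<tau>)\<^sup>2 \<le> 2\<^sup>2" using a2[OF that] by (intro power_mono) auto
    then have "\<bar>A.Ab1 \<tau>\<bar> * (a \<tau>)\<^sup>2 \<le> (256 * A.s * L j) * 4"
      using A.Ab1_bound[OF that] A.xs(3) L[OF ij(2)] by (intro mult_mono) auto
    moreover have "\<bar>a' \<tau>\<bar> = \<bar>A.Ab1 \<tau>\<bar> * (a \<tau>)\<^sup>2 / 2" by (simp add: a'_def abs_mult)
    ultimately show ?thesis by (simp add: As)
  qed
  have yb: "y0 / 2 \<le> y \<tau>" "y \<tau> \<le> 3 / 4" if t: "0 \<le> \<tau>" "\<tau> \<le> 1" for \<tau>
  proof -
    have "\<bar>y \<tau> - y 0\<bar> \<le> y0 / 2"
    proof (cases "\<tau> = 0")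
      case False
      then have "0 < \<tau>" using t by simp
      from MVT2[OF this, of y a'] obtain z where z: "0 < z" "z < \<tau>" "y \<tau> - y 0 = (\<tau> - 0) * a' z" using dy t by force
      have "\<bar>\<tau> * a' z\<bar> \<le> 1 * (512 * (s * L j))" unfolding abs_mult using t z by (intro mult_mono a'b) auto
      then show ?thesis using z small by simp
    qed (use y0 in simp)
    then show "y0 / 2 \<le> y \<tau>" "y \<tau> \<le> 3 / 4" using y0 unfolding y_0 by linarith+
  qed
  have ypos: "0 < y \<tau>" "y \<tau> < 1" if "0 \<le> \<tau>" "\<tau> \<le> 1" for \<tau> using yb[OF that] y0 by linarith+
  have ck: "yv (c \<tau> k) = y \<tau>" if "0 \<le> \<tau>" "\<tau> \<le> 1" for \<tau> using k ne ypos[OF that] by (simp add: c_def yv_ylen)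
  have cs: "c \<tau> r = \<tau> * L j" "c \<tau> j = (1 - \<tau>) * L j" "c \<tau> i = L i" for \<tau> using ij k ne by (auto simp: c_def)
  have cpos: "0 < c \<tau> n" if t: "0 < \<tau>" "\<tau> < 1" and n: "n \<le> r" for \<tau> n
    using t n L[of j] L[of n] ij ylen_pos[of "y \<tau>"] ypos[of \<tau>] by (auto simp: c_def)
  have csum: "(\<Sum>n\<in>{..<r} - {i, j}. yv (c \<tau> n)) = a \<tau>" if "0 \<le> \<tau>" "\<tau> \<le> 1" for \<tau>
  proof -
    have "(\<Sum>n\<in>{..<r} - {i, j, k}. yv (c \<tau> n)) = \<rho>" unfolding \<rho>_def by (rule sum.cong) (auto simp: c_def)
    then show ?thesis unfolding s1 by (simp add: ck[OF that] y_def)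
  qed
  have S: "1 - (yv (c \<tau> i) + yv (c \<tau> j) + yv (c \<tau> r)) / 2 = 1 - A.S0 \<tau> / 2"
    "1 + (qv (c \<tau> i) + qv (c \<tau> j) + qv (c \<tau> r)) = 1 + A.S1 \<tau>" for \<tau>
    by (simp_all add: cs A.S0_def A.S1_def)
  have eq: "2 / a \<tau> = 1 / (1 - A.S0 \<tau> / 2) + 1 / (1 + A.S1 \<tau>)" if "0 < \<tau>" "\<tau> < 1" for \<tau>
    using A.S_pos(3)[OF that] by (simp add: a_def)
  let ?K = "16 / y0 * (560 + 8192 / y0) * (s * (L j)\<^sup>2)"
  have s0: "0 < s" "s \<le> 1 / 32" using A.xs(3,4) by (simp_all add: As)
  have K0: "0 \<le> ?K" using y0 s0 by simp
  have dcn: "((\<lambda>\<tau>. c \<tau> n) has_real_derivative dc \<tau> n) (at \<tau>)" if t: "0 \<le> \<tau>" "\<tau> \<le> 1" for \<tau> n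
  proof -
    have "((\<lambda>\<tau>. ylen (y \<tau>)) has_real_derivative - 1 / (y \<tau> * (1 - y \<tau> / 2)) * a' \<tau>) (at \<tau>)"
      by (rule DERIV_chain2[OF ylen_deriv dy[OF t]]) (use ypos[OF t] in auto)
    moreover have "- 1 / d * - e = e / d" for d e :: real by simp
    ultimately have "((\<lambda>\<tau>. ylen (y \<tau>)) has_real_derivative A.Ab1 \<tau> * (a \<tau>)\<^sup>2 / 2 / (y \<tau> * (1 - y \<tau> / 2))) (at \<tau>)"
      by (simp only: a'_def)
    moreover have "((\<lambda>\<tau>. \<tau> * L j) has_real_derivative L j) (at \<tau>)" "((\<lambda>\<tau>. (1 - \<tau>) * L j) has_real_derivative - L j) (at \<tau>)"
      by (auto intro!: derivative_eq_intros)
    ultimately show ?thesis unfolding c_def dc_def by (cases "n = r"; cases "n = j"; cases "n = k") simp_all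
  qed
  have "cell_path r (theta r i j) c dc (rose r L) (act (rose r L) (transv i j)) ?K"
    unfolding cell_path_def
  proof (intro conjI ballI allI impI)
    show "0 \<le> ?K" by (rule K0)
    show "graph_ok (theta r i j)" "marking_ok r (theta r i j)" by (rule theta_graph_ok theta_marking_ok)+
    show "collapse_rep r (theta r i j) (c 0) (rose r L)"
      by (rule collapse_theta_start[OF pt]) (auto simp: c_def y_0 ylen_yv)
    show "collapse_rep r (theta r i j) (c 1) (act (rose r L) (transv i j))"
      by (rule collapse_theta_end[OF pt]) (use ne in \<open>auto simp: c_def y_0 ylen_yv\<close>)
  next
    fix n assume "n < ne (theta r i j)"
    show "continuous_on {0..1} (\<lambda>\<tau>. c \<tau> n)"
      by (rule continuous_at_imp_continuous_on) (use dcn DERIV_isCont in force)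
    have cont: "continuous_on {0<..<1} A.Ab1" "continuous_on {0<..<1} a" "continuous_on {0<..<1} y"
      by (auto intro!: continuous_at_imp_continuous_on DERIV_isCont[OF A.Ab_deriv(2)] DERIV_isCont[OF da] DERIV_isCont[OF dy])
    have "y \<tau> * (1 - y \<tau> / 2) \<noteq> 0" if "0 < \<tau>" "\<tau> < 1" for \<tau> using ypos[of \<tau>] that by simp
    then show "continuous_on {0<..<1} (\<lambda>\<tau>. dc \<tau> n)" unfolding dc_def
      by (cases "n = r"; cases "n = j"; cases "n = k") (auto intro!: continuous_intros cont)
  next
    fix \<tau> :: real and n assume "\<tau> \<in> {0<..<1}"
    then show "((\<lambda>\<tau>. c \<tau> n) has_real_derivative dc \<tau> n) (at \<tau>)" by (intro dcn) auto
  next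
    fix \<tau> :: real and n assume t: "\<tau> \<in> {0<..<1}" and "n < ne (theta r i j)"
    then show "0 < c \<tau> n" by (intro cpos) auto
  next
    fix \<tau> :: real assume "\<tau> \<in> {0<..<1}"
    then have t: "0 < \<tau>" "\<tau> < 1" "0 \<le> \<tau>" "\<tau> \<le> 1" by auto
    show "entropy (theta r i j) (c \<tau>) = 1"
      by (rule theta_entropy[OF _ zero_less_one refl _ refl])
        (use cpos[OF t(1,2)] A.S_pos(1)[OF t(1,2)] eq[OF t(1,2)] csum[OF t(3,4)] in \<open>simp_all only: mult_1 S\<close>)
  next
    fix \<tau> \<kappa> :: real assume "\<tau> \<in> {0<..<1}"
    then have t: "0 < \<tau>" "\<tau> < 1" "0 \<le> \<tau>" "\<tau> \<le> 1" by auto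
    have A2: "A.Ab2 \<tau> \<le> 560 * (s * (L j)\<^sup>2)" using A.Ab2_bound[OF t(3,4)] by (simp add: As)
    have "hess_form (theta r i j) (c \<tau>) (\<lambda>i. \<kappa> * dc \<tau> i) \<le>
      \<kappa>\<^sup>2 * ((560 * (s * (L j)\<^sup>2) + 2 * (A.Ab1 \<tau>)\<^sup>2 / yv (c \<tau> k)) * 8 / yv (c \<tau> k))"
    proof (rule theta_hess[OF k _ csum[OF t(3,4), symmetric] a2(2)[OF t(3,4)] _ refl _ refl _ _ _ _ _ refl refl refl refl])
      show "0 < c \<tau> n" if "n \<le> r" for n by (rule cpos[OF t(1,2) that])
      show "yv (c \<tau> k) \<le> 3 / 4" using yb[OF t(3,4)] by (simp add: ck[OF t(3,4)])
      show "0 < 1 - (yv (c \<tau> i) + yv (c \<tau> j) + yv (c \<tau> r)) / 2" unfolding S by (rule A.S_pos(1)[OF t(1,2)])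
      show "2 / a \<tau> = 1 / (1 - (yv (c \<tau> i) + yv (c \<tau> j) + yv (c \<tau> r)) / 2) + 1 / (1 + (qv (c \<tau> i) + qv (c \<tau> j) + qv (c \<tau> r)))"
        unfolding S by (rule eq[OF t(1,2)])
      show "\<kappa> * dc \<tau> n = 0" if "n < r" "n \<noteq> j" "n \<noteq> k" for n using that by (simp add: dc_def)
      show "\<kappa> * dc \<tau> r = \<kappa> * L j" "\<kappa> * dc \<tau> j = \<kappa> * - L j" using ne by (simp_all add: dc_def)
      show "\<kappa> * dc \<tau> k = \<kappa> * (A.Ab1 \<tau> * (a \<tau>)\<^sup>2 / 2 / (yv (c \<tau> k) * (1 - yv (c \<tau> k) / 2)))"
        using ne k unfolding ck[OF t(3,4)] by (simp add: dc_def)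
      show "1 / 2 / (1 - (yv (c \<tau> i) + yv (c \<tau> j) + yv (c \<tau> r)) / 2)\<^sup>2 *
          (- (yv (c \<tau> r) * (1 - yv (c \<tau> r) / 2)) * L j + - (yv (c \<tau> j) * (1 - yv (c \<tau> j) / 2)) * - L j) +
        - 1 / (1 + (qv (c \<tau> i) + qv (c \<tau> j) + qv (c \<tau> r)))\<^sup>2 *
          (- (qv (c \<tau> r) * (1 + qv (c \<tau> r))) * L j + - (qv (c \<tau> j) * (1 + qv (c \<tau> j))) * - L j) = A.Ab1 \<tau>"
        unfolding S unfolding cs A.d0_def[symmetric] A.d1_def[symmetric] by (rule A.Ab_jets(1)[OF t(1,2)])
      show "1 / 2 / (1 - (yv (c \<tau> i) + yv (c \<tau> j) + yv (c \<tau> r)) / 2) ^ 3 *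
          (- (yv (c \<tau> r) * (1 - yv (c \<tau> r) / 2)) * L j + - (yv (c \<tau> j) * (1 - yv (c \<tau> j) / 2)) * - L j)\<^sup>2 +
        1 / 2 / (1 - (yv (c \<tau> i) + yv (c \<tau> j) + yv (c \<tau> r)) / 2)\<^sup>2 *
          (yv (c \<tau> r) * (1 - yv (c \<tau> r) / 2) * (1 - yv (c \<tau> r)) * (L j)\<^sup>2 + yv (c \<tau> j) * (1 - yv (c \<tau> j) / 2) * (1 - yv (c \<tau> j)) * (L j)\<^sup>2) +
        (2 / (1 + (qv (c \<tau> i) + qv (c \<tau> j) + qv (c \<tau> r))) ^ 3 *
          (- (qv (c \<tau> r) * (1 + qv (c \<tau> r))) * L j + - (qv (c \<tau> j) * (1 + qv (c \<tau> j))) * - L j)\<^sup>2 +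
         - 1 / (1 + (qv (c \<tau> i) + qv (c \<tau> j) + qv (c \<tau> r)))\<^sup>2 *
          (qv (c \<tau> r) * (1 + qv (c \<tau> r)) * (1 + 2 * qv (c \<tau> r)) * (L j)\<^sup>2 + qv (c \<tau> j) * (1 + qv (c \<tau> j)) * (1 + 2 * qv (c \<tau> j)) * (L j)\<^sup>2))
        \<le> 560 * (s * (L j)\<^sup>2)"
        unfolding S unfolding cs A.d0_def[symmetric] A.d1_def[symmetric] A.e0_def[symmetric] A.e1_def[symmetric]
        unfolding A.Ab_jets(2)[OF t(1,2)] by (rule A2)
      show "0 \<le> 560 * (s * (L j)\<^sup>2)" using s0 by simp
    qed
    also have "\<dots> \<le> \<kappa>\<^sup>2 * ((560 * (s * (L j)\<^sup>2) + 2 * (2048 * (s * (L j)\<^sup>2)) / (y0 / 2)) * 8 / (y0 / 2))"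
    proof -
      \<comment> \<open>One of the two factors \<open>s\<close> is traded for its bound 1/32, and
        256 squared over 32 is 2048; the square of \<open>Ab1\<close> is thereby brought to the
        order of \<open>Ab2\<close>.\<close>
      have "(A.Ab1 \<tau>)\<^sup>2 \<le> (256 * s * L j)\<^sup>2" using A.Ab1_bound[OF t(3,4)] by (intro power2_le_iff_abs_le[THEN iffD2]) (auto simp: As)
      also have "\<dots> = 65536 * s * (s * (L j)\<^sup>2)" by (simp add: power2_eq_square)
      also have "\<dots> \<le> 2048 * (s * (L j)\<^sup>2)" using s0 by (intro mult_right_mono) auto
      finally have 1: "(A.Ab1 \<tau>)\<^sup>2 \<le> 2048 * (s * (L j)\<^sup>2)" .
      have yt: "y0 / 2 \<le> yv (c \<tau> k)" using yb[OF t(3,4)] by (simp add: ck[OF t(3,4)])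
      show ?thesis
        by (intro mult_left_mono frac_le mult_right_mono add_left_mono)
          (use 1 yt y0 s0 in auto)
    qed
    also have "\<dots> = \<kappa>\<^sup>2 * ?K" using y0 by (simp add: field_simps)
    also have "\<dots> \<le> \<kappa>\<^sup>2 * (?K * (weight \<tau>)\<^sup>2)"
    proof (rule mult_left_mono)
      have "?K * 1 \<le> ?K * (weight \<tau>)\<^sup>2" using weight_ge[of \<tau>] t K0 by (intro mult_left_mono) auto
      then show "?K \<le> ?K * (weight \<tau>)\<^sup>2" by simp
    qed simp
    finally show "hess_form (theta r i j) (c \<tau>) (\<lambda>i. \<kappa> * dc \<tau> i) \<le> \<kappa>\<^sup>2 * (?K * (weight \<tau>)\<^sup>2)" .
  qed
  then show ?thesis unfolding cell_seg_def by blast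
qed

end

section \<open>The fixed point\<close>

lemma conn_cong:
  assumes "conn r x y D" "point r x'" "nv x' = nv x" "ne x' = ne x" "org x' = org x"
    "base x' = base x" "len x' = len x" "\<forall>i<r. freered bar (mark x' i) = freered bar (mark x i)"
  shows "conn r x' y D"
  using assms
proof (induction rule: conn.induct)
  case (conn_seg x y K)
  then obtain G c dc where P: "cell_path r G c dc x y K" unfolding cell_seg_def by blast
  then have "collapse_rep r G (c 0) x'" using collapse_rep_cong[OF _ conn_seg.prems] unfolding cell_path_def by blast
  with P have "cell_path r G c dc x' y K" unfolding cell_path_def by blast
  then show ?case using conn.conn_seg unfolding cell_seg_def by blast
next
  case (conn_trans x y C z D)
  then show ?case using conn.conn_trans by blast
qed

lemma conn_act_cong:
  assumes "conn r (act x \<sigma>) y D" "point r x" "is_aut r \<sigma>'" "\<forall>k<r. \<sigma>' k = \<sigma> k"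
  shows "conn r (act x \<sigma>') y D"
  by (rule conn_cong[OF assms(1) point_act[OF assms(2,3)]]) (use assms(4) in simp_all)

text \<open>Families whose distance tends to 0; Cauchy families so related have the same limit in
  the completion. Invariance of the limit point becomes a relation that can be composed and acted
  upon.\<close>

definition nearing :: "nat \<Rightarrow> (real \<Rightarrow> mgraph) \<Rightarrow> (real \<Rightarrow> mgraph) \<Rightarrow> bool" where
  "nearing r f g \<longleftrightarrow> (\<exists>D. (\<forall>\<^sub>F \<eta> in at_right 0. conn r (f \<eta>) (g \<eta>) (D \<eta>)) \<and> (D \<longlongrightarrow> 0) (at_right 0))"

lemma nearing_seg:
  assumes "\<forall>\<^sub>F \<eta> in at_right 0. cell_seg r (f \<eta>) (g \<eta>) (K \<eta>)" "(K \<longlongrightarrow> 0) (at_right 0)"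
  shows "nearing r f g"
  unfolding nearing_def
proof (intro exI conjI)
  show "\<forall>\<^sub>F \<eta> in at_right 0. conn r (f \<eta>) (g \<eta>) (sqrt (K \<eta>))"
    by (rule eventually_mono[OF assms(1)]) (rule conn_seg)
  show "((\<lambda>\<eta>. sqrt (K \<eta>)) \<longlongrightarrow> 0) (at_right 0)" using tendsto_real_sqrt[OF assms(2)] by simp
qed

lemma nearing_sym: "nearing r f g \<Longrightarrow> nearing r g f"
  unfolding nearing_def by (elim ex_forward conj_forward eventually_mono) (auto intro: conn_sym)

lemma nearing_act: "nearing r f g \<Longrightarrow> is_aut r \<sigma> \<Longrightarrow> nearing r (\<lambda>\<eta>. act (f \<eta>) \<sigma>) (\<lambda>\<eta>. act (g \<eta>) \<sigma>)"
  unfolding nearing_def by (elim ex_forward conj_forward eventually_mono) (auto intro: conn_act)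

lemma nearing_trans: assumes "nearing r f g" "nearing r g h" shows "nearing r f h"
proof -
  from assms obtain C D where C: "\<forall>\<^sub>F \<eta> in at_right 0. conn r (f \<eta>) (g \<eta>) (C \<eta>)" "(C \<longlongrightarrow> 0) (at_right 0)"
    and D: "\<forall>\<^sub>F \<eta> in at_right 0. conn r (g \<eta>) (h \<eta>) (D \<eta>)" "(D \<longlongrightarrow> 0) (at_right 0)" unfolding nearing_def by blast
  have "\<forall>\<^sub>F \<eta> in at_right 0. conn r (f \<eta>) (h \<eta>) (C \<eta> + D \<eta>)"
    using C(1) D(1) by eventually_elim (rule conn_trans)
  moreover have "((\<lambda>\<eta>. C \<eta> + D \<eta>) \<longlongrightarrow> 0) (at_right 0)" using tendsto_add[OF C(2) D(2)] by simp
  ultimately show ?thesis unfolding nearing_def by (intro exI conjI)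
qed

lemma eventually_small: "0 < c \<Longrightarrow> \<forall>\<^sub>F \<eta> in at_right 0. 0 < \<eta> \<and> \<eta> < c" for c :: real
  by (auto simp: eventually_at_right_field)

section \<open>Roses near the limit point and invariance under the generators\<close>

definition skew :: "bool \<Rightarrow> real \<Rightarrow> bool \<Rightarrow> real" where
  "skew \<beta> \<eta> b = (if b = \<beta> then 1 - \<eta> else \<eta>)"

lemma skew_simps: "0 < \<eta> \<Longrightarrow> \<eta> < 1 / 2 \<Longrightarrow> 0 < skew \<beta> \<eta> b \<and> skew \<beta> \<eta> b < 1"
  "skew \<beta> \<eta> True + skew \<beta> \<eta> False = 1" "skew \<beta> \<eta> \<beta> = 1 - \<eta>" "skew \<beta> \<eta> (\<not> \<beta>) = \<eta>"
  by (auto simp: skew_def)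

definition skew_rose :: "nat \<Rightarrow> bool \<Rightarrow> real \<Rightarrow> mgraph" where
  "skew_rose r \<beta> \<eta> = rose r (blen r (skew \<beta> \<eta>) (unif r))"

text \<open>Side \<open>\<beta>\<close> of this rose already has weight \<open>1 - \<eta>\<close>,
  so only the other side has to rise, from weight \<open>\<eta>\<close>. The same segment starts at
  the rose and at its image under an inversion.\<close>

lemma skew_rose_nearing:
  assumes r: "4 \<le> r" and j: "j < r"
  shows "nearing r (skew_rose r \<beta>) (hub_point r)" "nearing r (\<lambda>\<eta>. act (skew_rose r \<beta> \<eta>) (flip j)) (hub_point r)"
proof -
  let ?K = "\<lambda>\<eta>::real. 12 * sqrt \<eta> / ((1 - \<eta>) * sqrt (1 - \<eta>))"
  have "(?K \<longlongrightarrow> 12 * sqrt 0 / ((1 - 0) * sqrt (1 - 0))) (at_right 0)" by (intro tendsto_intros) auto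
  then have K: "(?K \<longlongrightarrow> 0) (at_right 0)" by simp
  have seg: "cell_seg r x (hub_point r \<eta>) (?K \<eta>)"
    if "0 < \<eta>" "\<eta> < 1 / 2" "collapse_rep r (barbell r (\<lambda>_. 0)) (blen r (skew \<beta> \<eta>) (unif r)) x" for \<eta> x
    by (rule refill_seg[OF r _ _ _ _ _ unif_simplices[OF r] _ _ _ that(3), where \<beta> = \<beta>])
      (use that skew_simps in auto)
  note rep = collapse_barbell_rose_blen[where w = "skew \<beta> \<eta>" for \<eta>, OF r skew_simps(1) skew_simps(2) unif_simplices[OF r] j, where l' = "\<lambda>_. 0"]
  show "nearing r (skew_rose r \<beta>) (hub_point r)"
    by (rule nearing_seg[OF _ K], rule eventually_mono[OF eventually_small[of "1 / 2"]])
      (use seg rep(1) in \<open>auto simp: skew_rose_def\<close>)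
  show "nearing r (\<lambda>\<eta>. act (skew_rose r \<beta> \<eta>) (flip j)) (hub_point r)"
    by (rule nearing_seg[OF _ K], rule eventually_mono[OF eventually_small[of "1 / 2"]])
      (use seg rep(2) in \<open>auto simp: skew_rose_def\<close>)
qed

lemma exp_minus_yv: "exp (- x) = yv x / (2 - yv x)"
proof -
  have e: "0 < exp x" "1 + exp x \<noteq> 0" using exp_gt_zero[of x] by linarith+
  have frac: "2 / d / (2 * b / d) = inverse b" if "d \<noteq> 0" for b d :: real using that by (simp add: inverse_eq_divide)
  have "2 - yv x = 2 * exp x / (1 + exp x)" using e by (simp add: yv_def field_simps)
  then have "yv x / (2 - yv x) = 2 / (1 + exp x) / (2 * exp x / (1 + exp x))" by (simp only: yv_def)
  also have "\<dots> = exp (- x)" unfolding exp_minus by (rule frac[OF e(2)])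
  finally show ?thesis ..
qed

lemma mult_ln_power_tendsto_0:
  assumes "0 < c" shows "((\<lambda>\<eta>::real. \<eta> * ln (c / \<eta>) ^ m) \<longlongrightarrow> 0) (at_right 0)"
proof -
  have "filterlim (\<lambda>\<eta>. c * inverse \<eta>) at_top (at_right 0)"
    by (rule filterlim_tendsto_pos_mult_at_top[OF tendsto_const assms filterlim_inverse_at_top_right])
  then have "filterlim (\<lambda>\<eta>. ln (c * inverse \<eta>)) at_top (at_right 0)" by (rule filterlim_compose[OF ln_at_top])
  then have "((\<lambda>\<eta>. ln (c * inverse \<eta>) ^ m / exp (ln (c * inverse \<eta>))) \<longlongrightarrow> 0) (at_right 0)"
    by (rule filterlim_compose[OF tendsto_power_div_exp_0])
  then have "((\<lambda>\<eta>. c * (ln (c * inverse \<eta>) ^ m / exp (ln (c * inverse \<eta>)))) \<longlongrightarrow> 0) (at_right 0)"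
    by (rule tendsto_mult_right_zero)
  moreover have "\<forall>\<^sub>F \<eta> in at_right 0. c * (ln (c * inverse \<eta>) ^ m / exp (ln (c * inverse \<eta>))) = \<eta> * ln (c / \<eta>) ^ m"
    by (rule eventually_mono[OF eventually_small[OF zero_less_one]]) (use assms in \<open>simp add: divide_inverse mult_ac\<close>)
  ultimately show ?thesis by (rule Lim_transform_eventually)
qed

text \<open>The side opposite to petal \<open>i\<close> is made heavy, so that \<open>exp\<close> of
  minus the length of \<open>i\<close> is at most \<open>\<eta>\<close>. Petal \<open>j\<close> may
  lie on either side, but its length is at most \<open>ln (2 * r / \<eta>)\<close>. The compensating
  petal \<open>k\<close> is chosen on the heavy side, where its weight is bounded below.\<close>

lemma skew_rose_transv:
  assumes r: "4 \<le> r" and ij: "i < r" "j < r" "i \<noteq> j"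
  shows "nearing r (skew_rose r (\<not> i < 2)) (\<lambda>\<eta>. act (skew_rose r (\<not> i < 2) \<eta>) (transv i j))"
proof -
  interpret theta_graph r i j by unfold_locales (use r ij in auto)
  define \<beta> where "\<beta> \<longleftrightarrow> \<not> i < 2"
  define k :: nat where "k = (if \<beta> then if j = 0 then 1 else 0 else if j = 2 then 3 else 2)"
  have k: "k < r" "k \<noteq> i" "k \<noteq> j" "(k < 2) = \<beta>" using r by (auto simp: k_def \<beta>_def)
  define L where "L \<eta> = blen r (skew \<beta> \<eta>) (unif r)" for \<eta>
  \<comment> \<open>The heavy side has weight at least 1/2, and each petal takes a proportion of at
    least \<open>1 / r\<close>.\<close>
  define y0 where "y0 = 1 / (2 * real r)"
  have y0: "0 < y0" using r by (simp add: y0_def)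
  have u: "1 / real r \<le> unif r n" "unif r n \<le> 1 / 2" "0 < unif r n" for n
    using r unif_half[OF r] by (auto simp: unif_def field_simps)
  define s where "s \<eta> = exp (- L \<eta> i)" for \<eta>
  define K where "K \<eta> = 16 / y0 * (560 + 8192 / y0) * (s \<eta> * (L \<eta> j)\<^sup>2)" for \<eta>
  have main: "yv (L \<eta> k) \<le> 1 / 2 \<and> y0 \<le> yv (L \<eta> k) \<and> 0 < L \<eta> j \<and> 0 < L \<eta> i \<and> exp (- L \<eta> j) \<le> 1 / 3 \<and> 0 < s \<eta> \<and> s \<eta> \<le> \<eta>
      \<and> L \<eta> j \<le> ln (2 * real r / \<eta>)"
    if \<eta>: "0 < \<eta>" "\<eta> < 1 / 2" for \<eta>
  proof -
    note P = blen_props(2)[where w = "skew \<beta> \<eta>", OF r skew_simps(1)[OF \<eta>] unif_simplices[OF r], folded L_def]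
    have sk: "\<eta> \<le> skew \<beta> \<eta> b" "skew \<beta> \<eta> b \<le> 1" "skew \<beta> \<eta> (k < 2) = 1 - \<eta>" "skew \<beta> \<eta> (i < 2) = \<eta>" for b
      using \<eta> k by (auto simp: skew_def \<beta>_def)
    have half: "skew \<beta> \<eta> b * unif r n \<le> 1 * (1 / 2)" for b n
      using u(2,3)[of n] sk(1,2)[of b] \<eta> by (intro mult_mono) (auto intro: less_imp_le)
    have Pk: "yv (L \<eta> k) = (1 - \<eta>) * unif r k" "yv (L \<eta> i) = \<eta> * unif r i" "yv (L \<eta> j) = skew \<beta> \<eta> (j < 2) * unif r j"
      using P[OF k(1)] P[OF ij(1)] P[OF ij(2)] sk by auto
    have "1 / 2 * (1 / real r) \<le> (1 - \<eta>) * unif r k" using \<eta> u by (intro mult_mono) auto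
    then have 1: "y0 \<le> yv (L \<eta> k)" "yv (L \<eta> k) \<le> 1 / 2" using half[of "k < 2" k] by (simp_all add: y0_def Pk sk)
    have yj: "yv (L \<eta> j) \<le> 1 / 2" using half[of "j < 2" j] by (simp add: Pk)
    then have "yv (L \<eta> j) / (2 - yv (L \<eta> j)) \<le> (1 / 2) / (3 / 2)" by (intro frac_le) (auto simp: less_imp_le)
    then have 2: "exp (- L \<eta> j) \<le> 1 / 3" by (simp add: exp_minus_yv)
    have yi: "yv (L \<eta> i) \<le> \<eta>" "yv (L \<eta> i) \<le> 1" using half[of "i < 2" i] u(2)[of i] \<eta> mult_left_mono[OF u(2)[of i], of \<eta>]
      by (simp_all add: Pk sk)
    then have "yv (L \<eta> i) / (2 - yv (L \<eta> i)) \<le> \<eta> / 1" using \<eta> by (intro frac_le) auto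
    then have 3: "s \<eta> \<le> \<eta>" by (simp add: s_def exp_minus_yv)
    have "\<eta> * (1 / real r) \<le> skew \<beta> \<eta> (j < 2) * unif r j" using \<eta> u sk(1)[of "j < 2"] by (intro mult_mono) auto
    then have yj': "\<eta> / real r \<le> yv (L \<eta> j)" by (simp add: Pk)
    have "2 / yv (L \<eta> j) \<le> 2 / (\<eta> / real r)" using \<eta> r yj' by (intro divide_left_mono mult_pos_pos) auto
    then have "2 / yv (L \<eta> j) - 1 \<le> 2 * real r / \<eta>" by simp
    moreover have "0 < 2 / yv (L \<eta> j) - 1" using yj by (simp add: field_simps)
    ultimately have "ylen (yv (L \<eta> j)) \<le> ln (2 * real r / \<eta>)" unfolding ylen_def by (intro ln_mono) auto
    then have 4: "L \<eta> j \<le> ln (2 * real r / \<eta>)" by (simp add: ylen_yv)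
    show ?thesis using 1 2 3 4 P ij by (auto simp: s_def)
  qed
  have c32: "0 < 1 / (32::real)" by simp
  have rr: "0 < 2 * real r" using r by simp
  have lim2: "((\<lambda>\<eta>. 512 * (\<eta> * ln (2 * real r / \<eta>))) \<longlongrightarrow> 0) (at_right 0)"
    using tendsto_mult_right_zero[OF mult_ln_power_tendsto_0[OF rr, of 1]] by simp
  have lim3: "((\<lambda>\<eta>. 16 / y0 * (560 + 8192 / y0) * (\<eta> * (ln (2 * real r / \<eta>))\<^sup>2)) \<longlongrightarrow> 0) (at_right 0)"
    by (rule tendsto_mult_right_zero[OF mult_ln_power_tendsto_0[OF rr]])
  have mono: "s \<eta> * L \<eta> j \<le> \<eta> * ln (2 * real r / \<eta>)" "s \<eta> * (L \<eta> j)\<^sup>2 \<le> \<eta> * (ln (2 * real r / \<eta>))\<^sup>2"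
    if \<eta>: "0 < \<eta>" "\<eta> < 1 / 2" for \<eta>
    using main[OF \<eta>] \<eta> by (auto intro!: mult_mono power_mono)
  have "\<forall>\<^sub>F \<eta> in at_right 0. cell_seg r (skew_rose r \<beta> \<eta>) (act (skew_rose r \<beta> \<eta>) (transv i j)) (K \<eta>)"
    using eventually_small[OF c32] order_tendstoD(2)[OF lim2 half_gt_zero[OF y0]]
  proof eventually_elim
    case (elim \<eta>)
    then have \<eta>: "0 < \<eta>" "\<eta> < 1 / 2" and sm: "512 * (\<eta> * ln (2 * real r / \<eta>)) < y0 / 2" using y0 by auto
    note m = main[OF \<eta>]
    show ?case unfolding skew_rose_def L_def[symmetric] K_def
    proof (rule theta_seg[where L = "L \<eta>", OF k(1,2,3) _ _ s_def[of \<eta>] y0])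
      show "point r (rose r (L \<eta>))" unfolding L_def
        by (rule rose_blen_point[OF r skew_simps(1)[OF \<eta>] skew_simps(2) unif_simplices[OF r]])
      show "arc_path (L \<eta> j) (L \<eta> i)" using m elim by unfold_locales (auto simp: s_def)
      show "y0 \<le> yv (L \<eta> k)" "yv (L \<eta> k) \<le> 1 / 2" using m by auto
      show "512 * (s \<eta> * L \<eta> j) \<le> y0 / 2" using mono(1)[OF \<eta>] sm by linarith
    qed
  qed
  moreover have "(K \<longlongrightarrow> 0) (at_right 0)"
  proof (rule tendsto_sandwich[OF _ _ tendsto_const lim3])
    show "\<forall>\<^sub>F \<eta> in at_right 0. 0 \<le> K \<eta>"
      by (rule eventually_mono[OF eventually_small[of "1 / 2"]]) (use main y0 in \<open>auto simp: K_def less_imp_le\<close>)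
    show "\<forall>\<^sub>F \<eta> in at_right 0. K \<eta> \<le> 16 / y0 * (560 + 8192 / y0) * (\<eta> * (ln (2 * real r / \<eta>))\<^sup>2)"
      unfolding K_def using eventually_small[OF half_gt_zero[OF zero_less_one]]
      by eventually_elim (intro mult_left_mono mono(2), use y0 in auto)
  qed
  ultimately show ?thesis unfolding \<beta>_def[symmetric] by (rule nearing_seg)
qed

text \<open>From the translated hub point pass to the translated rose. An inversion leaves this rose
  the same point, and for a transvection the slide leads back to the untranslated rose; from there
  return to the hub point.\<close>

lemma hub_nearing_gen:
  assumes r: "4 \<le> r"
  shows "i < r \<Longrightarrow> nearing r (\<lambda>\<eta>. act (hub_point r \<eta>) (flip i)) (hub_point r)"
    and "i < r \<Longrightarrow> j < r \<Longrightarrow> i \<noteq> j \<Longrightarrow> nearing r (\<lambda>\<eta>. act (hub_point r \<eta>) (transv i j)) (hub_point r)"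
proof -
  show "nearing r (\<lambda>\<eta>. act (hub_point r \<eta>) (flip i)) (hub_point r)" if "i < r"
    using nearing_act[OF nearing_sym[OF skew_rose_nearing(1)[OF r that]] is_aut_flip[OF that]] skew_rose_nearing(2)[OF r that]
    by (rule nearing_trans)
  show "nearing r (\<lambda>\<eta>. act (hub_point r \<eta>) (transv i j)) (hub_point r)" if "i < r" "j < r" "i \<noteq> j"
    using nearing_act[OF nearing_sym[OF skew_rose_nearing(1)[OF r that(1)]] is_aut_transv[OF that]]
      nearing_trans[OF nearing_sym[OF skew_rose_transv[OF r that]] skew_rose_nearing(1)[OF r that(1)]]
    by (rule nearing_trans)
qed

lemma nearing_hub_cong:
  assumes "4 \<le> r" "nearing r (\<lambda>\<eta>. act (hub_point r \<eta>) \<sigma>) g" "is_aut r \<sigma>'" "\<forall>k<r. \<sigma>' k = \<sigma> k"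
  shows "nearing r (\<lambda>\<eta>. act (hub_point r \<eta>) \<sigma>') g"
proof -
  from assms(2) obtain D where D: "\<forall>\<^sub>F \<eta> in at_right 0. conn r (act (hub_point r \<eta>) \<sigma>) (g \<eta>) (D \<eta>)" "(D \<longlongrightarrow> 0) (at_right 0)"
    unfolding nearing_def by blast
  have "\<forall>\<^sub>F \<eta> in at_right 0. conn r (act (hub_point r \<eta>) \<sigma>') (g \<eta>) (D \<eta>)"
    using D(1) eventually_small[OF half_gt_zero[OF zero_less_one]]
  proof eventually_elim
    case (elim \<eta>)
    then show ?case using assms by (intro conn_act_cong[OF elim(1)] hub_point_point) auto
  qed
  then show ?thesis using D(2) unfolding nearing_def by blast
qed

lemma niel_nearing:
  assumes r: "4 \<le> r" and "niel r u"
  shows "is_aut r u \<and> nearing r (\<lambda>\<eta>. act (hub_point r \<eta>) u) (hub_point r)"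
  using assms(2)
proof (induction rule: niel.induct)
  case (niel_id u)
  \<comment> \<open>A chain for \<open>conn\<close> has at least one segment, so the identity is
    reached as the square of an inversion.\<close>
  have a: "is_aut r u"
    by (rule is_aut_cong[of r "\<lambda>k. ext (flip 0) (flip 0 k)", OF is_aut_comp[OF is_aut_flip is_aut_flip]])
      (use r niel_id in \<open>auto simp: flip_def ext_def sgn_word_def W.fr_Cons\<close>)
  have "nearing r (\<lambda>\<eta>. act (act (hub_point r \<eta>) (flip 0)) (flip 0)) (hub_point r)"
    by (rule nearing_trans[OF nearing_act[OF hub_nearing_gen(1)[OF r] is_aut_flip] hub_nearing_gen(1)[OF r]]) (use r in auto)
  then have "nearing r (\<lambda>\<eta>. act (hub_point r \<eta>) (\<lambda>k. ext (flip 0) (flip 0 k))) (hub_point r)" by (simp add: act_act)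
  from nearing_hub_cong[OF r this a] show ?case
    using a niel_id by (auto simp: flip_def ext_def sgn_word_def W.fr_Cons)
next
  case (niel_transv u i j u')
  note g = is_aut_transv[OF niel_transv(2,3,4)]
  have a: "is_aut r u'" by (rule is_aut_cong[OF is_aut_comp[OF _ g]]) (use niel_transv in auto)
  have "nearing r (\<lambda>\<eta>. act (act (hub_point r \<eta>) u) (transv i j)) (hub_point r)"
    by (rule nearing_trans[OF nearing_act[OF conjunct2[OF niel_transv.IH] g] hub_nearing_gen(2)[OF r niel_transv(2,3,4)]])
  then show ?case using nearing_hub_cong[OF r _ a niel_transv(5)] a by (simp add: act_act)
next
  case (niel_flip u i u')
  note g = is_aut_flip[OF niel_flip(2)]
  have a: "is_aut r u'" by (rule is_aut_cong[OF is_aut_comp[OF _ g]]) (use niel_flip in auto)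
  have "nearing r (\<lambda>\<eta>. act (act (hub_point r \<eta>) u) (flip i)) (hub_point r)"
    by (rule nearing_trans[OF nearing_act[OF conjunct2[OF niel_flip.IH] g] hub_nearing_gen(1)[OF r niel_flip(2)]])
  then show ?case using nearing_hub_cong[OF r _ a niel_flip(3)] a by (simp add: act_act)
qed

lemma hub_nearing: "4 \<le> r \<Longrightarrow> is_aut r \<sigma> \<Longrightarrow> nearing r (\<lambda>\<eta>. act (hub_point r \<eta>) \<sigma>) (hub_point r)"
  by (rule conjunct2[OF niel_nearing[OF _ niel_of_aut]])

text \<open>Spreading the lighter side costs \<open>sqrt 8\<close>, which is below 3 for every rose,
  and refilling the other side costs less than 1 once \<open>\<eta>\<close> is small. How small
  depends on the rose, but the bound 4 does not.\<close>

lemma rose_near_hub: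
  assumes r: "4 \<le> r" and p: "point r (rose r l)"
  shows "\<forall>\<^sub>F \<eta> in at_right 0. \<exists>D\<le>4. conn r (rose r l) (hub_point r \<eta>) D"
proof -
  have l: "0 < l i" if "i < r" for i using rose_pointD[OF _ p] r that by auto
  have S: "(\<Sum>i<r. yv (l i)) = 1" using rose_pointD[OF _ p] r by auto
  define w where "w b = (\<Sum>i\<in>petals r b. yv (l i))" for b
  define \<theta> where "\<theta> i = yv (l i) / w (i < 2)" for i
  have w1: "w True + w False = 1" using S petals_sum[OF r, of "\<lambda>i. yv (l i)"] by (simp add: w_def)
  have w0: "0 < w b" for b unfolding w_def using petals_nonempty[OF r] by (intro sum_pos) auto
  have w: "0 < w b \<and> w b < 1" for b using w0[of b] w0[of True] w0[of False] w1 by (cases b) auto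
  have \<theta>: "simplices r \<theta>"
  proof -
    have "(\<Sum>i\<in>petals r b. \<theta> i) = (\<Sum>i\<in>petals r b. yv (l i) / w b)" for b
      using petals_side[OF _ r] by (intro sum.cong) (auto simp: \<theta>_def)
    then have "(\<Sum>i\<in>petals r b. \<theta> i) = 1" for b using w[of b] by (simp add: sum_divide_distrib[symmetric] w_def[symmetric])
    then show ?thesis using w by (auto simp: simplices_def \<theta>_def)
  qed
  have bl: "blen r w \<theta> i = l i" if "i < r" for i
    using that w0[of "i < 2"] by (simp add: blen_def \<theta>_def ylen_yv)
  have "w False = 1 - w True" using w1 by simp
  then have br: "blen r w \<theta> r = 0" using logit_sum_zero[of "w True"] w[of True] by (simp add: blen_def)
  have rep: "collapse_rep r (barbell r (\<lambda>_. 0)) (blen r w \<theta>) (rose r l)"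
    by (rule collapse_barbell_rose[where l = "blen r w \<theta>" and F = "{}", OF r br]) (use bl l p in \<open>auto simp: eflip_def\<close>)
  have "w True \<le> 1 / 2 \<or> w False \<le> 1 / 2" using w1 by linarith
  then obtain \<beta> where \<beta>: "w \<beta> \<le> 1 / 2" by blast
  define a where "a = w (\<not> \<beta>)"
  have a: "1 / 2 \<le> a" "a < 1" "w \<beta> = 1 - a" using \<beta> w1 w[of "\<not> \<beta>"] unfolding a_def by (cases \<beta>; auto)+
  let ?K = "\<lambda>\<eta>. sqrt (12 * sqrt \<eta> / ((1 - a) * sqrt (1 - a)))"
  have "(?K \<longlongrightarrow> sqrt (12 * sqrt 0 / ((1 - a) * sqrt (1 - a)))) (at_right 0)" using a by (intro tendsto_intros) auto
  then have "(?K \<longlongrightarrow> 0) (at_right 0)" by simp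
  then have "\<forall>\<^sub>F \<eta> in at_right 0. ?K \<eta> < 1" by (rule order_tendstoD) simp
  moreover have "\<forall>\<^sub>F \<eta> in at_right 0. 0 < \<eta> \<and> \<eta> < 1 - a" by (rule eventually_small) (use a in simp)
  ultimately show ?thesis
  proof eventually_elim
    case (elim \<eta>)
    then have \<eta>: "0 < \<eta>" "\<eta> < 1 / 2" "\<eta> < 1 - a" "\<eta> < a" using a by auto
    let ?w = "w(\<beta> := 1 - \<eta>)" and ?\<theta> = "\<lambda>i. if i \<in> petals r \<beta> then unif r i else \<theta> i"
    have w': "0 < ?w b \<and> ?w b < 1" for b using w \<eta> by simp
    have s': "1 < ?w True + ?w False" using \<eta> by (cases \<beta>) (auto simp: a_def)
    have \<theta>': "simplices r ?\<theta>"
    proof -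
      have "(\<Sum>i\<in>petals r b. ?\<theta> i) = 1" for b
      proof (cases "b = \<beta>")
        case True
        then have "(\<Sum>i\<in>petals r b. ?\<theta> i) = (\<Sum>i\<in>petals r b. unif r i)" by (intro sum.cong) auto
        then show ?thesis using unif_simplices[OF r] by (simp add: simplices_def)
      next
        case False
        have "i \<notin> petals r \<beta>" if "i \<in> petals r b" for i using petals_side[OF that r] petals_side[OF _ r] False by blast
        then have "(\<Sum>i\<in>petals r b. ?\<theta> i) = (\<Sum>i\<in>petals r b. \<theta> i)" by (intro sum.cong) auto
        then show ?thesis using \<theta> by (simp add: simplices_def)
      qed
      then show ?thesis using \<theta> unif_simplices[OF r] by (auto simp: simplices_def)
    qed
    define y where "y = barbell r (blen r ?w ?\<theta>)"
    have y: "collapse_rep r (barbell r (\<lambda>_. 0)) (blen r ?w ?\<theta>) y"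
      unfolding y_def by (rule collapse_barbell_self[OF r w' s' \<theta>'])
    have 1: "cell_seg r (rose r l) y 8"
      by (rule spread_seg[OF r w w1 \<beta> \<theta> \<eta>(1,2) _ rep y]) (use \<eta> in \<open>simp add: a_def\<close>)
    have 2: "cell_seg r y (hub_point r \<eta>) (12 * sqrt \<eta> / ((1 - a) * sqrt (1 - a)))"
      by (rule refill_seg[OF r w' _ _ _ _ \<theta>' _ \<eta>(1,2) y, where \<beta> = \<beta>]) (use \<eta> in \<open>auto simp: a_def\<close>)
    have "sqrt 8 \<le> sqrt (3\<^sup>2)" by (intro real_sqrt_le_mono) simp
    then have "sqrt 8 + ?K \<eta> \<le> 4" using elim(1) by (simp del: real_sqrt_lt_1_iff real_sqrt_divide real_sqrt_mult)
    then show ?case using conn_trans[OF conn_seg[OF 1] conn_seg[OF 2]] by blast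
  qed
qed

text \<open>Invariance of the limit point carries the bound 4 to all translates at an arbitrarily
  small extra cost, taken here as 1.\<close>

lemma rose_orbit_near_hub:
  assumes r: "4 \<le> r" and p: "point r (rose r l)" and \<sigma>: "is_aut r \<sigma>"
  shows "\<forall>\<^sub>F \<eta> in at_right 0. \<exists>D\<le>5. conn r (act (rose r l) \<sigma>) (hub_point r \<eta>) D"
proof -
  from hub_nearing[OF r \<sigma>] obtain D where D: "\<forall>\<^sub>F \<eta> in at_right 0. conn r (act (hub_point r \<eta>) \<sigma>) (hub_point r \<eta>) (D \<eta>)"
    "(D \<longlongrightarrow> 0) (at_right 0)" unfolding nearing_def by blast
  have "\<forall>\<^sub>F \<eta> in at_right 0. D \<eta> < 1" using D(2) by (rule order_tendstoD) simp
  with rose_near_hub[OF r p] D(1) show ?thesis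
  proof eventually_elim
    case (elim \<eta>)
    then obtain C where C: "C \<le> 4" "conn r (rose r l) (hub_point r \<eta>) C" by blast
    show ?case using conn_trans[OF conn_act[OF C(2) \<sigma>] elim(2)] C(1) elim(3) by (intro exI[of _ "C + D \<eta>"]) simp
  qed
qed

text \<open>Twice the distance bound 5 to a common hub point bounds the diameter. The fixed point of
  the completion is presented by a Cauchy sequence whose translate by each automorphism approaches
  it.\<close>

theorem theorem1p3:
  fixes r :: nat
  assumes "4 \<le> r"
  shows "(\<exists>D::real. \<forall>x\<in>{act (rose r l) \<sigma> | l \<sigma>. point r (rose r l) \<and> is_aut r \<sigma>}.
            \<forall>y\<in>{act (rose r l) \<sigma> | l \<sigma>. point r (rose r l) \<and> is_aut r \<sigma>}.
              dh r x y \<le> ennreal D)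
       \<and> (\<exists>xs::nat \<Rightarrow> mgraph. (\<forall>n. point r (xs n))
            \<and> (\<forall>\<epsilon>>0. \<exists>N. \<forall>m\<ge>N. \<forall>n\<ge>N. dh r (xs m) (xs n) < ennreal \<epsilon>)
            \<and> (\<forall>\<sigma>. is_aut r \<sigma> \<longrightarrow> ((\<lambda>n. dh r (act (xs n) \<sigma>) (xs n)) \<longlongrightarrow> 0) sequentially))"
proof
  have "dh r x y \<le> ennreal (10 * weight_integral)"
    if x: "x \<in> {act (rose r l) \<sigma> | l \<sigma>. point r (rose r l) \<and> is_aut r \<sigma>}"
      and y: "y \<in> {act (rose r l) \<sigma> | l \<sigma>. point r (rose r l) \<and> is_aut r \<sigma>}" for x y
  proof -
    have near: "\<forall>\<^sub>F \<eta> in at_right 0. \<exists>D\<le>5. conn r z (hub_point r \<eta>) D"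
      if "z \<in> {act (rose r l) \<sigma> | l \<sigma>. point r (rose r l) \<and> is_aut r \<sigma>}" for z
      using that rose_orbit_near_hub[OF assms] by auto
    \<comment> \<open>Both estimates hold for all sufficiently small \<open>\<eta>\<close>, so a
      single hub point serves \<open>x\<close> and \<open>y\<close>.\<close>
    from eventually_happens'[OF _ eventually_conj[OF near[OF x] near[OF y]]]
    obtain \<eta> C D where C: "C \<le> 5" "conn r x (hub_point r \<eta>) C" and D: "D \<le> 5" "conn r y (hub_point r \<eta>) D"
      by (auto simp: trivial_limit_at_right_real)
    have "dh r x y \<le> ennreal ((C + D) * weight_integral)"
      by (rule conn_dh[OF conn_trans[OF C(2) conn_sym[OF D(2)]]])
    also have "\<dots> \<le> ennreal (10 * weight_integral)" using C D by (intro ennreal_leI mult_right_mono) auto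
    finally show ?thesis .
  qed
  then show "\<exists>D::real. \<forall>x\<in>{act (rose r l) \<sigma> | l \<sigma>. point r (rose r l) \<and> is_aut r \<sigma>}.
            \<forall>y\<in>{act (rose r l) \<sigma> | l \<sigma>. point r (rose r l) \<and> is_aut r \<sigma>}. dh r x y \<le> ennreal D" by blast
next
  \<comment> \<open>The shift by 3 puts all parameters below 1/2, where the hub points are defined
    as unit entropy barbells.\<close>
  define h where "h n = 1 / (real n + 3)" for n
  have h: "0 < h n" "h n < 1 / 2" for n by (simp_all add: h_def field_simps)
  have hl: "filterlim h (at_right 0) sequentially"
    using LIMSEQ_ignore_initial_segment[OF lim_1_over_n[where 'a = real], of 3] h by (simp add: filterlim_at h_def[abs_def])
  show "\<exists>xs::nat \<Rightarrow> mgraph. (\<forall>n. point r (xs n))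
      \<and> (\<forall>\<epsilon>>0. \<exists>N. \<forall>m\<ge>N. \<forall>n\<ge>N. dh r (xs m) (xs n) < ennreal \<epsilon>)
      \<and> (\<forall>\<sigma>. is_aut r \<sigma> \<longrightarrow> ((\<lambda>n. dh r (act (xs n) \<sigma>) (xs n)) \<longlongrightarrow> 0) sequentially)"
  proof (intro exI[of _ "\<lambda>n. hub_point r (h n)"] conjI allI impI)
    show "point r (hub_point r (h n))" for n using h by (intro hub_point_point assms)
  next
    fix \<epsilon> :: real assume \<epsilon>: "0 < \<epsilon>"
    have "(\<lambda>N. sqrt (16 * h N) * weight_integral) \<longlonglongrightarrow> sqrt (16 * 0) * weight_integral"
      using hl by (intro tendsto_intros) (auto simp: filterlim_at)
    then have "\<forall>\<^sub>F N in sequentially. sqrt (16 * h N) * weight_integral < \<epsilon>"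
      using \<epsilon> by (intro order_tendstoD) auto
    then obtain N where N: "sqrt (16 * h N) * weight_integral < \<epsilon>" by (auto simp: eventually_sequentially)
    have le: "dh r x y < ennreal \<epsilon>" if "conn r x y (sqrt (16 * h k))" "N \<le> k" for x y k
    proof -
      have "h k \<le> h N" using that by (simp add: h_def frac_le)
      then have "sqrt (16 * h k) * weight_integral \<le> sqrt (16 * h N) * weight_integral"
        by (intro mult_right_mono real_sqrt_le_mono) auto
      then have "sqrt (16 * h k) * weight_integral < \<epsilon>" using N by linarith
      then have "ennreal (sqrt (16 * h k) * weight_integral) < ennreal \<epsilon>" using \<epsilon> by (intro ennreal_lessI)
      then show ?thesis using conn_dh[OF that(1)] by (rule le_less_trans[rotated])
    qed
    have cn: "conn r (hub_point r (h m)) (hub_point r (h n)) (sqrt (16 * h m))" if "m \<le> n" for m n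
      using that h by (intro conn_seg hub_seg assms) (auto simp: h_def frac_le)
    have "dh r (hub_point r (h m)) (hub_point r (h n)) < ennreal \<epsilon>" if "N \<le> m" "N \<le> n" for m n
    proof (cases "m \<le> n")
      case True then show ?thesis using le[OF cn] that by blast
    next
      case False
      then have "n \<le> m" by simp
      then show ?thesis using le[OF conn_sym[OF cn]] that by blast
    qed
    then show "\<exists>N. \<forall>m\<ge>N. \<forall>n\<ge>N. dh r (hub_point r (h m)) (hub_point r (h n)) < ennreal \<epsilon>" by blast
  next
    fix \<sigma> assume "is_aut r \<sigma>"
    from hub_nearing[OF assms this] obtain D where D: "\<forall>\<^sub>F \<eta> in at_right 0. conn r (act (hub_point r \<eta>) \<sigma>) (hub_point r \<eta>) (D \<eta>)"
      "(D \<longlongrightarrow> 0) (at_right 0)" unfolding nearing_def by blast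
    have "\<forall>\<^sub>F n in sequentially. dh r (act (hub_point r (h n)) \<sigma>) (hub_point r (h n)) \<le> ennreal (D (h n) * weight_integral)"
      by (rule eventually_mono[OF eventually_compose_filterlim[OF D(1) hl]]) (rule conn_dh)
    moreover have "(\<lambda>n. ennreal (D (h n) * weight_integral)) \<longlonglongrightarrow> ennreal (0 * weight_integral)"
      by (intro tendsto_ennrealI tendsto_mult_right filterlim_compose[OF D(2) hl])
    ultimately show "(\<lambda>n. dh r (act (hub_point r (h n)) \<sigma>) (hub_point r (h n))) \<longlonglongrightarrow> 0"
      by (intro tendsto_sandwich[OF _ _ tendsto_const, where g = "\<lambda>n. dh r (act (hub_point r (h n)) \<sigma>) (hub_point r (h n))"
        and h = "\<lambda>n. ennreal (D (h n) * weight_integral)"]) auto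
  qed
qed

end
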